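(* The only $4$-minimal triangulation of the disk in $\mathcal{F}^2(4)$ is the octahedron (the boundary of the octahedron with one face removed, a disk triangulation with six vertices all of degree $4$).
   Context: A triangulation of a compact connected surface $F^2$ is a simple graph $G$ embedded in $F^2$ such that every face is bounded by a 3-cycle and any two faces share at most one edge; $\partial G$ triangulates $\partial F^2$ (boundary vertices/edges; others inner). Contracting $e=uv$ identifies $u,v$ and deletes multiple edges; $e$ is contractible if $G/e$ is a triangulation of $F^2$. $\mathcal{F}^2(4)$: triangulations with all degrees $\ge4$. Octahedron component: $v_1v_2v_3$ a cycle with $\deg v_i=4$, $a_1,a_2,a_3$ the only vertices with $a_i$ adjacent to $v_j,v_k$, $H$ induced by $\{a_i,v_i\}$; octahedron component if the cycle $a_1a_2a_3$ exists and either no $v_i\in\partial G$, or exactly one $v_i\in\partial G$ and $\partial G=v_ia_ja_k$, or exactly $v_i,v_j\in\partial G$ and $\partial G=v_iv_ja_k$, or $\partial G=v_1v_2v_3$; external if two edges $a_ia_j,a_ja_k$ lie in $\partial G$. Quasi-octahedron component: either the cycle $a_1a_2a_3$ exists but bounds no face, exactly one $v_i\in\partial G$, and $a_ja_k\notin\partial G$; or exactly one edge $a_ia_j$ among $a_1a_2,a_2a_3,a_1a_3$ is missing, $v_k\in\partial G$, and all 3-cycles of $H$ are faces. Reductions (counted only if the result is a triangulation in $\mathcal{F}^2(4)$; these are 4-reductions): $R_1$ edge contraction; $R_2$ deleting $v_1,v_2,v_3$ of an octahedron component, or deleting $a_j,v_1,v_2,v_3$ of an external one with $a_ia_j,a_ja_k\in\partial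 G$; $R_3$ for an external octahedron with $\deg a_3=4$, $\deg a_i=6$ ($i=1$ or $2$), and face $a_1a_2v$: delete $a_3,v_1,v_2,v_3$ and insert an octahedron (three new mutually adjacent vertices of degree 4) into the face $a_1a_2v$; $R_4$ replace $G$ by $G-\{v_1,v_2,v_3\}$ or $(G-\{v_i,v_j\})/a_iv_k$ ($v_k\in\partial G$) for a quasi-octahedron component; $R_5$ for an octahedron component whose only boundary edge is $a_1a_2$ with $\deg a_2=5$ and $v$ the unique neighbour of $a_2$ outside it, delete the edge $a_1a_2$ (and its face) and contract $a_2v$; $R_6$ for two faces $xzy,xzv$ whose non-incident edges $xy,vz$ are contractible with at least one in $\partial G$, and such that both lie in $\partial G$ or some inner vertex of the configuration has degree $\ge5$, contract $xy$ and $vz$ simultaneously. A triangulation is $4$-minimal if it admits no 4-reduction. *)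

theory Defs
  imports "HOL-Analysis.Analysis"
begin

text \<open>
  A graph \<open>G\<close> triangulating a surface is represented by the set \<open>K\<close> of the vertex sets of its
  vertices, edges and faces, i.e. by an abstract simplicial complex. Faces are sets of three vertices,
  so each is bounded by a 3-cycle, \<open>G\<close> is simple, and two faces share at most one edge.
  The library's \<open>simplicial_complex\<close> consists of geometric simplices in a Euclidean space and does
  not lend itself to contractions.
\<close>

definition pure_2_complex :: "'v set set \<Rightarrow> bool" where
  "pure_2_complex K \<longleftrightarrow> finite K \<and> {} \<notin> K \<and>
     (\<forall>s\<in>K. \<forall>t. t \<noteq> {} \<and> t \<subseteq> s \<longrightarrow> t \<in> K) \<and>
     (\<forall>s\<in>K. \<exists>f\<in>K. card f = 3 \<and> s \<subseteq> f)"

definition vertices :: "'v set set \<Rightarrow> 'v set" where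
  "vertices K = {x. {x} \<in> K}"

definition adj :: "'v set set \<Rightarrow> 'v \<Rightarrow> 'v \<Rightarrow> bool" where
  "adj K x y \<longleftrightarrow> x \<noteq> y \<and> {x, y} \<in> K"

definition vdegree :: "'v set set \<Rightarrow> 'v \<Rightarrow> nat" where
  "vdegree K x = card {y. adj K x y}"

definition faces :: "'v set set \<Rightarrow> 'v set set" where
  "faces K = {f \<in> K. card f = 3}"

definition boundary_edges :: "'v set set \<Rightarrow> 'v set set" where
  "boundary_edges K = {e \<in> K. card e = 2 \<and> card {f \<in> faces K. e \<subseteq> f} = 1}"

definition boundary_vertices :: "'v set set \<Rightarrow> 'v set" where
  "boundary_vertices K = \<Union> (boundary_edges K)"

definition boundary_complex :: "'v set set \<Rightarrow> 'v set set" where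
  "boundary_complex K = {s. s \<noteq> {} \<and> (\<exists>e\<in>boundary_edges K. s \<subseteq> e)}"

text \<open>The polyhedron of \<open>K\<close>, in barycentric coordinates.\<close>

definition realization :: "'v set set \<Rightarrow> ('v \<Rightarrow> real) set" where
  "realization K = {x. (\<forall>v. 0 \<le> x v) \<and> {v. x v \<noteq> 0} \<in> K \<and> (\<Sum>v | x v \<noteq> 0. x v) = 1}"

text \<open>
  The surface is given by its point set \<open>F\<close> and its boundary curve set \<open>B\<close>. The map \<open>h\<close> embeds the
  graph in the surface and carries the open 2-simplices to the faces of the embedding.
\<close>

definition triangulates ::
    "'a::topological_space set \<Rightarrow> 'a set \<Rightarrow> 'v set set \<Rightarrow> bool" where
  "triangulates F B K \<longleftrightarrow> pure_2_complex K \<and>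
     (\<exists>h h'. homeomorphism (realization K) F h h' \<and> h ` realization (boundary_complex K) = B)"

definition F4 :: "'a::topological_space set \<Rightarrow> 'a set \<Rightarrow> 'v set set \<Rightarrow> bool" where
  "F4 F B K \<longleftrightarrow> triangulates F B K \<and> (\<forall>x\<in>vertices K. vdegree K x \<ge> 4)"

definition contract :: "'v \<Rightarrow> 'v \<Rightarrow> 'v set set \<Rightarrow> 'v set set" where
  "contract x y K = (\<lambda>s. (id(y := x)) ` s) ` K"

definition contractible ::
    "'a::topological_space set \<Rightarrow> 'a set \<Rightarrow> 'v set set \<Rightarrow> 'v \<Rightarrow> 'v \<Rightarrow> bool" where
  "contractible F B K x y \<longleftrightarrow> adj K x y \<and> triangulates F B (contract x y K)"

definition delete_vertices :: "'v set \<Rightarrow> 'v set set \<Rightarrow> 'v set set" where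
  "delete_vertices X K = {s \<in> K. s \<inter> X = {}}"

definition cycle3 :: "'v \<Rightarrow> 'v \<Rightarrow> 'v \<Rightarrow> 'v set set" where
  "cycle3 x y z = {{x, y}, {y, z}, {x, z}}"

text \<open>
  The octahedron with the three pairs of antipodal vertices \<open>v i\<close>, \<open>a i\<close>, without its face
  \<open>a 1\<close>, \<open>a 2\<close>, \<open>a 3\<close>: a face of the octahedron contains one vertex of each pair.
\<close>

definition octahedron_disk :: "(nat \<Rightarrow> 'v) \<Rightarrow> (nat \<Rightarrow> 'v) \<Rightarrow> 'v set set" where
  "octahedron_disk v a =
     {s. s \<noteq> {} \<and> (\<exists>x1\<in>{v 1, a 1}. \<exists>x2\<in>{v 2, a 2}. \<exists>x3\<in>{v 3, a 3}. s \<subseteq> {x1, x2, x3})}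
       - {{a 1, a 2, a 3}}"

definition is_octahedron_disk :: "'v set set \<Rightarrow> bool" where
  "is_octahedron_disk K \<longleftrightarrow> (\<exists>v a. inj_on v {1,2,3} \<and> inj_on a {1,2,3} \<and>
     v ` {1,2,3} \<inter> a ` {1,2,3} = {} \<and> K = octahedron_disk v a)"

text \<open>
  Throughout, only the values of \<open>v\<close> and \<open>a\<close> at 1, 2, 3 matter, and \<open>{i,j,k} = {1,2,3}\<close> says that
  \<open>i, j, k\<close> is a permutation of 1, 2, 3.
\<close>

definition octahedral_frame :: "'v set set \<Rightarrow> (nat \<Rightarrow> 'v) \<Rightarrow> (nat \<Rightarrow> 'v) \<Rightarrow> bool" where
  "octahedral_frame K v a \<longleftrightarrow> inj_on a {1,2,3} \<and>
     cycle3 (v 1) (v 2) (v 3) \<subseteq> K \<and> inj_on v {1,2,3} \<and>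
     (\<forall>i\<in>{1,2,3}. vdegree K (v i) = 4) \<and>
     (\<forall>i j k. {i,j,k} = {1,2,3} \<longrightarrow>
        {w. w \<notin> v ` {1,2,3} \<and> adj K w (v j) \<and> adj K w (v k)} = {a i})"

definition octahedron_component :: "'v set set \<Rightarrow> (nat \<Rightarrow> 'v) \<Rightarrow> (nat \<Rightarrow> 'v) \<Rightarrow> bool" where
  "octahedron_component K v a \<longleftrightarrow> octahedral_frame K v a \<and>
     cycle3 (a 1) (a 2) (a 3) \<subseteq> K \<and>
     (v ` {1,2,3} \<inter> boundary_vertices K = {}
      \<or> (\<exists>i j k. {i,j,k} = {1,2,3} \<and> v ` {1,2,3} \<inter> boundary_vertices K = {v i} \<and>
           boundary_edges K = cycle3 (v i) (a j) (a k))
      \<or> (\<exists>i j k. {i,j,k} = {1,2,3} \<and> v ` {1,2,3} \<inter> boundary_vertices K = {v i, v j} \<and>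
           boundary_edges K = cycle3 (v i) (v j) (a k))
      \<or> boundary_edges K = cycle3 (v 1) (v 2) (v 3))"

definition quasi_octahedron_component ::
    "'v set set \<Rightarrow> (nat \<Rightarrow> 'v) \<Rightarrow> (nat \<Rightarrow> 'v) \<Rightarrow> bool" where
  "quasi_octahedron_component K v a \<longleftrightarrow> octahedral_frame K v a \<and>
     ((cycle3 (a 1) (a 2) (a 3) \<subseteq> K \<and> {a 1, a 2, a 3} \<notin> faces K \<and>
       (\<exists>i j k. {i,j,k} = {1,2,3} \<and> v ` {1,2,3} \<inter> boundary_vertices K = {v i} \<and>
          {a j, a k} \<notin> boundary_edges K))
      \<or>
      ((\<exists>i j k. {i,j,k} = {1,2,3} \<and>
          {a i, a j} \<notin> K \<and> {a i, a k} \<in> K \<and> {a j, a k} \<in> K \<and> v k \<in> boundary_vertices K) \<and>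
       (\<forall>x\<in>v ` {1,2,3} \<union> a ` {1,2,3}. \<forall>y\<in>v ` {1,2,3} \<union> a ` {1,2,3}.
        \<forall>z\<in>v ` {1,2,3} \<union> a ` {1,2,3}.
          adj K x y \<and> adj K y z \<and> adj K x z \<longrightarrow> {x, y, z} \<in> faces K)))"

text \<open>
  The relation \<open>reduction\<close> describes only the combinatorial operation; that the result must again
  be in \<open>F4\<close> is required in \<open>four_reduction\<close>.

  Case \<open>R2\<close>: if no \<open>v i\<close> is on the boundary, then deleting the \<open>v i\<close> leaves a region that becomes
  the face bounded by the cycle of the \<open>a i\<close>. Otherwise that region contains the hole of the
  surface, and the cycle becomes the new boundary.

  Case \<open>R4_contract\<close>: deleting \<open>v i\<close> and \<open>v j\<close> leaves a quadrilateral region with corners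
  \<open>v k\<close>, \<open>a i\<close>, \<open>a k\<close>, \<open>a j\<close>, which contracting the edge \<open>a i\<close> -- \<open>v k\<close> turns into the
  face \<open>{a 1, a 2, a 3}\<close>.

  Case \<open>R3\<close>: the vertices \<open>w i\<close> only have to differ from those that remain, so they may reuse the
  deleted ones.
\<close>

inductive reduction ::
    "'a::topological_space set \<Rightarrow> 'a set \<Rightarrow> 'v set set \<Rightarrow> 'v set set \<Rightarrow> bool"
  for F :: "'a set" and B :: "'a set" and K :: "'v set set" where
  R1: "adj K x y \<Longrightarrow> reduction F B K (contract x y K)"
| R2: "octahedron_component K v a \<Longrightarrow>
    reduction F B K
      (delete_vertices (v ` {1,2,3}) K \<union>
       (if v ` {1,2,3} \<inter> boundary_vertices K = {} then {{a 1, a 2, a 3}} else {}))"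
| R2_external: "octahedron_component K v a \<Longrightarrow> {i,j,k} = {1,2,3} \<Longrightarrow>
    {a i, a j} \<in> boundary_edges K \<Longrightarrow> {a j, a k} \<in> boundary_edges K \<Longrightarrow>
    reduction F B K (delete_vertices ({a j} \<union> v ` {1,2,3}) K)"
| R3: "octahedron_component K v a \<Longrightarrow>
    {a 1, a 3} \<in> boundary_edges K \<Longrightarrow> {a 3, a 2} \<in> boundary_edges K \<Longrightarrow>
    vdegree K (a 3) = 4 \<Longrightarrow> vdegree K (a 1) = 6 \<or> vdegree K (a 2) = 6 \<Longrightarrow>
    {a 1, a 2, x} \<in> faces K \<Longrightarrow> x \<notin> {a 3} \<union> v ` {1,2,3} \<Longrightarrow>
    inj_on w {1,2,3} \<Longrightarrow>
    w ` {1,2,3} \<inter> (vertices K - ({a 3} \<union> v ` {1,2,3})) = {} \<Longrightarrow>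
    reduction F B K
      ((delete_vertices ({a 3} \<union> v ` {1,2,3}) K - {{a 1, a 2, x}}) \<union>
       octahedron_disk w (a(3 := x)))"
| R4_delete: "quasi_octahedron_component K v a \<Longrightarrow>
    reduction F B K (delete_vertices (v ` {1,2,3}) K)"
| R4_contract: "quasi_octahedron_component K v a \<Longrightarrow> {i,j,k} = {1,2,3} \<Longrightarrow>
    v k \<in> boundary_vertices K \<Longrightarrow>
    reduction F B K
      (contract (a i) (v k) (delete_vertices {v i, v j} K) \<union> {{a 1, a 2, a 3}})"
| R5: "octahedron_component K v a \<Longrightarrow>
    {e \<in> boundary_edges K. e \<subseteq> v ` {1,2,3} \<union> a ` {1,2,3}} = {{a 1, a 2}} \<Longrightarrow>
    vdegree K (a 2) = 5 \<Longrightarrow>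
    {y. adj K (a 2) y} - (v ` {1,2,3} \<union> a ` {1,2,3}) = {x} \<Longrightarrow>
    reduction F B K (contract x (a 2) {s \<in> K. \<not> {a 1, a 2} \<subseteq> s})"
| R6: "{x, z, y} \<in> faces K \<Longrightarrow> {x, z, u} \<in> faces K \<Longrightarrow> y \<noteq> u \<Longrightarrow>
    contractible F B K x y \<Longrightarrow> contractible F B K z u \<Longrightarrow>
    {x, y} \<in> boundary_edges K \<or> {z, u} \<in> boundary_edges K \<Longrightarrow>
    ({x, y} \<in> boundary_edges K \<and> {z, u} \<in> boundary_edges K) \<or>
      (\<exists>t\<in>{x, y, z, u} - boundary_vertices K. vdegree K t \<ge> 5) \<Longrightarrow>
    reduction F B K (contract x y (contract z u K))"

definition four_reduction ::
    "'a::topological_space set \<Rightarrow> 'a set \<Rightarrow> 'v set set \<Rightarrow> 'v set set \<Rightarrow> bool" where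
  "four_reduction F B K K' \<longleftrightarrow> reduction F B K K' \<and> F4 F B K'"

definition four_minimal :: "'a::topological_space set \<Rightarrow> 'a set \<Rightarrow> 'v set set \<Rightarrow> bool" where
  "four_minimal F B K \<longleftrightarrow> \<not> (\<exists>K'. four_reduction F B K K')"

end

theory Submission
  imports Defs
begin

text \<open>
  Complexes are compared up to homeomorphisms of their polyhedra that respect the boundary. Flips,
  stellar subdivisions and renamings of vertices are such homeomorphisms, given by explicit
  piecewise linear formulas in barycentric coordinates, and the result of each reduction that is
  used arises from \<open>K\<close> by a sequence of these moves; hence it triangulates the disk again.
  On the other hand, topology yields combinatorial facts about \<open>K\<close>: links are connected, since a
  point does not separate the disk locally, and by the Jordan curve theorem every 3-cycle is the
  boundary modulo 2 of a set of faces, as is every chord together with an arc of the boundary circle.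

  Let \<open>K\<close> be 4-minimal. An edge that lies in no non-facial 3-cycle, and is on the boundary or has an
  inner end, is contractible, so one of the vertices opposite to it has degree 4. If all 3-cycles are
  faces, this principle, applied in an innermost region cut off by a chord, leads to a
  quasi-octahedron component that can be reduced by \<open>R4\<close>. Otherwise a non-facial 3-cycle
  \<open>a1\<close>, \<open>a2\<close>, \<open>a3\<close> with the least number of faces inside bounds an octahedron. If all \<open>ai\<close> have degree
  at least 6, then \<open>R2\<close> applies; if the least of these degrees is 5, then \<open>R5\<close> or \<open>R1\<close> does. If \<open>a3\<close> has
  degree 4, then \<open>a1 a3\<close> and \<open>a2 a3\<close> are boundary edges; either \<open>a1 a2\<close> is a boundary edge too and \<open>K\<close> is
  the octahedron, or one of \<open>R1\<close>, \<open>R3\<close> and the external case of \<open>R2\<close> applies, according to the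
  degrees of \<open>a1\<close> and \<open>a2\<close>.

  For the octahedron itself, every applicable reduction leaves at most four vertices, except for a
  contraction, after which some vertex still has an antipode and thus degree at most 3.
\<close>

definition complex_of :: "'v set set \<Rightarrow> 'v set set" where
  "complex_of F = {s. s \<noteq> {} \<and> (\<exists>f\<in>F. s \<subseteq> f)}"

definition triples :: "'v set set \<Rightarrow> bool" where
  "triples F \<longleftrightarrow> finite F \<and> (\<forall>f\<in>F. card f = 3)"

lemma complex_ofI: "f \<in> F \<Longrightarrow> s \<subseteq> f \<Longrightarrow> s \<noteq> {} \<Longrightarrow> s \<in> complex_of F"
  by (auto simp: complex_of_def)

lemma triples_finite: "triples F \<Longrightarrow> f \<in> F \<Longrightarrow> finite f"
  unfolding triples_def using card.infinite by force

lemma pure_complex_of: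
  assumes "triples F" shows "pure_2_complex (complex_of F)"
proof -
  have fin: "finite (complex_of F)"
  proof (rule finite_subset)
    show "complex_of F \<subseteq> Pow (\<Union>F)" by (auto simp: complex_of_def)
    show "finite (Pow (\<Union>F))" using assms triples_finite[OF assms] by (auto simp: triples_def)
  qed
  have "f \<in> complex_of F" if "f \<in> F" for f
    using that assms by (intro complex_ofI[of f]) (auto simp: triples_def)
  then have "\<exists>f\<in>complex_of F. card f = 3 \<and> s \<subseteq> f" if "s \<in> complex_of F" for s
    using that assms unfolding complex_of_def triples_def by blast
  moreover have "t \<in> complex_of F" if "s \<in> complex_of F" "t \<noteq> {}" "t \<subseteq> s" for s t
    using that unfolding complex_of_def by blast
  moreover have "{} \<notin> complex_of F" by (simp add: complex_of_def)
  ultimately show ?thesis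
    using fin unfolding pure_2_complex_def by blast
qed

lemma faces_complex_of:
  assumes "triples F" shows "faces (complex_of F) = F"
proof -
  have "s = f" if "card s = 3" "s \<subseteq> f" "f \<in> F" for s f
    using that assms card_subset_eq[of f s] triples_finite[OF assms] by (auto simp: triples_def)
  moreover have "f \<noteq> {}" if "f \<in> F" for f using that assms by (auto simp: triples_def)
  ultimately show ?thesis
    using assms by (auto simp: faces_def complex_of_def triples_def)
qed

lemma triples_faces: "pure_2_complex K \<Longrightarrow> triples (faces K)"
  by (auto simp: pure_2_complex_def triples_def faces_def)

lemma complex_of_faces:
  assumes "pure_2_complex K" shows "complex_of (faces K) = K"
proof -
  have "\<exists>f\<in>faces K. s \<subseteq> f" if "s \<in> K" for s
    using that assms unfolding pure_2_complex_def faces_def by blast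
  moreover have "s \<in> K" if "f \<in> faces K" "s \<subseteq> f" "s \<noteq> {}" for s f
    using that assms unfolding pure_2_complex_def faces_def by blast
  moreover have "{} \<notin> K" using assms unfolding pure_2_complex_def by blast
  ultimately show ?thesis
    unfolding complex_of_def by blast
qed

lemma boundary_complex_eq: "boundary_complex K = complex_of (boundary_edges K)"
  by (auto simp: boundary_complex_def complex_of_def)

lemma mem_realization_complex_of:
  assumes "finite V" "\<Union>F \<subseteq> V"
  shows "t \<in> realization (complex_of F) \<longleftrightarrow>
    (\<forall>v. 0 \<le> t v) \<and> (\<exists>f\<in>F. \<forall>v. t v \<noteq> 0 \<longrightarrow> v \<in> f) \<and> (\<Sum>v\<in>V. t v) = 1"
proof -
  have "(\<Sum>v | t v \<noteq> 0. t v) = (\<Sum>v\<in>V. t v)" if "f \<in> F" "\<forall>v. t v \<noteq> 0 \<longrightarrow> v \<in> f" for f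
    using that assms by (intro sum.mono_neutral_left) auto
  moreover have "{v. t v \<noteq> 0} \<noteq> {}" if "(\<Sum>v\<in>V. t v) = 1"
    using that by (intro notI) simp
  ultimately show ?thesis
    unfolding realization_def complex_of_def by (auto; force)
qed

definition same_surface :: "'v set set \<Rightarrow> 'v set set \<Rightarrow> bool" where
  "same_surface K L \<longleftrightarrow> (\<exists>h h'. homeomorphism (realization K) (realization L) h h' \<and>
      h ` realization (boundary_complex K) = realization (boundary_complex L))"

lemma realization_boundary_subset:
  assumes "pure_2_complex K"
  shows "realization (boundary_complex K) \<subseteq> realization K"
proof -
  have "s \<in> K" if "s \<in> boundary_complex K" for s
    using that assms unfolding boundary_complex_def boundary_edges_def pure_2_complex_def by blast
  then show ?thesis by (auto simp: realization_def)
qed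

lemma same_surface_sym:
  assumes "pure_2_complex K" "same_surface K L" shows "same_surface L K"
proof -
  obtain h h' where h: "homeomorphism (realization K) (realization L) h h'"
      "h ` realization (boundary_complex K) = realization (boundary_complex L)"
    using assms(2) unfolding same_surface_def by blast
  have "h' ` realization (boundary_complex L) = realization (boundary_complex K)"
    unfolding h(2)[symmetric] image_image
    using h(1) realization_boundary_subset[OF assms(1)]
    by (auto simp: homeomorphism_def subset_iff image_iff)
  then show ?thesis
    unfolding same_surface_def using homeomorphism_sym[of "realization K"] h(1) by blast
qed

lemma same_surface_trans:
  assumes "same_surface K L" "same_surface L M" shows "same_surface K M"
proof -
  obtain h h' g g' where h: "homeomorphism (realization K) (realization L) h h'"
      "h ` realization (boundary_complex K) = realization (boundary_complex L)"
      and g: "homeomorphism (realization L) (realization M) g g'"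
      "g ` realization (boundary_complex L) = realization (boundary_complex M)"
    using assms unfolding same_surface_def by blast
  then have "(g \<circ> h) ` realization (boundary_complex K) = realization (boundary_complex M)"
    by (metis image_comp)
  then show ?thesis
    unfolding same_surface_def using homeomorphism_compose[OF h(1) g(1)] by blast
qed

lemma triangulates_same_surface:
  assumes "triangulates F B L" "pure_2_complex K" "same_surface K L"
  shows "triangulates F B K"
proof -
  obtain h h' where h: "homeomorphism (realization K) (realization L) h h'"
      "h ` realization (boundary_complex K) = realization (boundary_complex L)"
    using assms(3) unfolding same_surface_def by blast
  obtain g g' where g: "homeomorphism (realization L) F g g'" "g ` realization (boundary_complex L) = B"
    using assms(1) unfolding triangulates_def by blast
  have "(g \<circ> h) ` realization (boundary_complex K) = B"
    using g h by (metis image_comp)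
  then show ?thesis
    unfolding triangulates_def using homeomorphism_compose[OF h(1) g(1)] assms(2) by blast
qed

lemma same_surfaceI:
  assumes "continuous_on UNIV \<phi>" "continuous_on UNIV \<psi>"
    and "\<And>t. t \<in> realization K \<Longrightarrow> \<phi> t \<in> realization L \<and> \<psi> (\<phi> t) = t"
    and "\<And>t. t \<in> realization L \<Longrightarrow> \<psi> t \<in> realization K \<and> \<phi> (\<psi> t) = t"
    and "\<And>t. t \<in> realization (boundary_complex K) \<Longrightarrow> \<phi> t \<in> realization (boundary_complex L)"
    and "\<And>t. t \<in> realization (boundary_complex L) \<Longrightarrow> \<psi> t \<in> realization (boundary_complex K)"
    and "pure_2_complex L"
  shows "same_surface K L"
proof -
  have "homeomorphism (realization K) (realization L) \<phi> \<psi>"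
  proof (rule homeomorphismI)
    show "continuous_on (realization K) \<phi>" "continuous_on (realization L) \<psi>"
      using assms(1,2) by (auto intro: continuous_on_subset)
  qed (use assms(3,4) in auto)
  moreover have "\<phi> ` realization (boundary_complex K) = realization (boundary_complex L)"
  proof
    show "realization (boundary_complex L) \<subseteq> \<phi> ` realization (boundary_complex K)"
    proof
      fix t assume t: "t \<in> realization (boundary_complex L)"
      then have "\<phi> (\<psi> t) = t" using realization_boundary_subset[OF assms(7)] assms(4) by blast
      then show "t \<in> \<phi> ` realization (boundary_complex K)" using assms(6)[OF t] by (metis imageI)
    qed
  qed (use assms(5) in blast)
  ultimately show ?thesis unfolding same_surface_def by blast
qed

subsection \<open>Flips and stellar subdivisions\<close>

text \<open>A point of the square \<open>a c b d\<close> has the coordinates \<open>P\<close>, \<open>Q\<close> along the two diagonals; the map rewrites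
  its barycentric coordinates from the triangulation with the diagonal \<open>a b\<close> to the one with \<open>c d\<close>.\<close>

definition flip_map :: "'v \<Rightarrow> 'v \<Rightarrow> 'v \<Rightarrow> 'v \<Rightarrow> ('v \<Rightarrow> real) \<Rightarrow> 'v \<Rightarrow> real" where
  "flip_map a b c d t =
    (let P = t a - t b; Q = t c - t d; M = t a + t b + t c + t d in
     t(a := max P 0, b := max (- P) 0, c := (M - \<bar>P\<bar> + Q) / 2, d := (M - \<bar>P\<bar> - Q) / 2))"

lemma continuous_flip_map:
  fixes a b c d :: 'v
  shows "continuous_on UNIV (flip_map a b c d)"
  unfolding flip_map_def Let_def fun_upd_def
proof (rule continuous_on_coordinatewise_then_product)
  fix i
  show "continuous_on UNIV (\<lambda>t :: 'v \<Rightarrow> real. if i = d then (t a + t b + t c + t d - \<bar>t a - t b\<bar> - (t c - t d)) / 2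
       else if i = c then (t a + t b + t c + t d - \<bar>t a - t b\<bar> + (t c - t d)) / 2
       else if i = b then max (- (t a - t b)) 0 else if i = a then max (t a - t b) 0 else t i)"
    by (cases "i = d"; cases "i = c"; cases "i = b"; cases "i = a"; simp only: if_True if_False refl)
       (intro continuous_intros continuous_on_product_coordinates; simp)+
qed

lemma sum_flip_map:
  assumes "finite V" "{a,b,c,d} \<subseteq> V" "distinct [a,b,c,d]"
  shows "(\<Sum>v\<in>V. flip_map a b c d t v) = (\<Sum>v\<in>V. t v)"
proof -
  have V: "V = {a,b,c,d} \<union> (V - {a,b,c,d})" using assms by auto
  have s: "sum g V = g a + g b + g c + g d + sum g (V - {a,b,c,d})" for g :: "'a \<Rightarrow> real"
    using assms by (subst V, subst sum.union_disjoint) auto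
  have "sum (flip_map a b c d t) (V - {a,b,c,d}) = sum t (V - {a,b,c,d})"
    by (intro sum.cong) (auto simp: flip_map_def Let_def)
  moreover have "flip_map a b c d t a + flip_map a b c d t b + flip_map a b c d t c + flip_map a b c d t d
      = t a + t b + t c + t d"
    using assms(3) by (simp add: flip_map_def Let_def field_simps) (simp add: max_def abs_if)
  ultimately show ?thesis
    unfolding s by linarith
qed

definition flip_config :: "'v set set \<Rightarrow> 'v \<Rightarrow> 'v \<Rightarrow> 'v \<Rightarrow> 'v \<Rightarrow> bool" where
  "flip_config F a b c d \<longleftrightarrow> distinct [a,b,c,d] \<and> {a,b,c} \<in> F \<and> {a,b,d} \<in> F \<and>
     (\<forall>f\<in>F. {a,b} \<subseteq> f \<longrightarrow> f = {a,b,c} \<or> f = {a,b,d}) \<and> (\<forall>f\<in>F. \<not> {c,d} \<subseteq> f)"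

definition flip :: "'v set set \<Rightarrow> 'v \<Rightarrow> 'v \<Rightarrow> 'v \<Rightarrow> 'v \<Rightarrow> 'v set set" where
  "flip F a b c d = F - {{a,b,c},{a,b,d}} \<union> {{c,d,a},{c,d,b}}"

lemma flip_config_flip:
  assumes "flip_config F a b c d"
  shows "flip_config (flip F a b c d) c d a b" "flip (flip F a b c d) c d a b = F"
proof -
  have dist: "distinct [a,b,c,d]" and ab: "\<And>f. f \<in> F \<Longrightarrow> {a,b} \<subseteq> f \<Longrightarrow> f = {a,b,c} \<or> f = {a,b,d}"
    and cd: "\<And>f. f \<in> F \<Longrightarrow> \<not> {c,d} \<subseteq> f" and inF: "{a,b,c} \<in> F" "{a,b,d} \<in> F"
    using assms unfolding flip_config_def by blast+
  have "{c,d,a} \<notin> F" "{c,d,b} \<notin> F" using cd by blast+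
  then show "flip (flip F a b c d) c d a b = F"
    using inF unfolding flip_def by blast
  have "\<not> {a,b} \<subseteq> {c,d,a}" "\<not> {a,b} \<subseteq> {c,d,b}" "distinct [c,d,a,b]" using dist by auto
  then show "flip_config (flip F a b c d) c d a b"
    unfolding flip_config_def flip_def using ab cd by blast
qed

lemma flip_map_mem:
  assumes c: "flip_config F a b c d" and V: "finite (\<Union>F)" and t: "t \<in> realization (complex_of F)"
  shows "flip_map a b c d t \<in> realization (complex_of (flip F a b c d))"
    and "flip_map c d a b (flip_map a b c d t) = t"
    and "t a = 0 \<or> t b = 0 \<Longrightarrow> flip_map a b c d t = t"
proof -
  have dist: "distinct [a,b,c,d]" and ab: "\<And>f. f \<in> F \<Longrightarrow> {a,b} \<subseteq> f \<Longrightarrow> f = {a,b,c} \<or> f = {a,b,d}"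
    and cd: "\<And>f. f \<in> F \<Longrightarrow> \<not> {c,d} \<subseteq> f"
    and inF: "{a,b,c} \<in> F" "{a,b,d} \<in> F"
    using c unfolding flip_config_def by blast+
  have 1: "{a,b,c,d} \<subseteq> \<Union>F" using inF by blast
  have 2: "\<Union>(flip F a b c d) \<subseteq> \<Union>F"
  proof (rule Union_least)
    fix f assume "f \<in> flip F a b c d"
    then have "f \<in> F \<or> f \<subseteq> {a,b,c,d}" by (auto simp: flip_def)
    then show "f \<subseteq> \<Union>F" using 1 by (metis Sup_upper order_trans)
  qed
  from t have nn: "\<And>v. 0 \<le> t v" and s: "(\<Sum>v\<in>\<Union>F. t v) = 1"
    using mem_realization_complex_of[OF V] by blast+
  from t obtain f where f: "f \<in> F" "\<And>v. t v \<noteq> 0 \<Longrightarrow> v \<in> f"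
    using mem_realization_complex_of[OF V] by blast
  have cd0: "t c = 0 \<or> t d = 0" using cd[OF f(1)] f(2) by auto
  show id: "flip_map a b c d t = t" if "t a = 0 \<or> t b = 0"
    using that cd0 nn[of a] nn[of b] nn[of c] nn[of d] dist
    by (auto simp: flip_map_def Let_def fun_eq_iff)
  show "flip_map c d a b (flip_map a b c d t) = t"
    using cd0 nn[of a] nn[of b] nn[of c] nn[of d] dist
    by (auto simp: flip_map_def Let_def fun_eq_iff max_def abs_if field_simps)
  have "\<exists>g\<in>flip F a b c d. \<forall>v. flip_map a b c d t v \<noteq> 0 \<longrightarrow> v \<in> g"
  proof (cases "{a,b} \<subseteq> f")
    case True
    then have fs: "f = {a,b,c} \<or> f = {a,b,d}" using ab f(1) by blast
    show ?thesis
    proof (cases "t b \<le> t a")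
      case True
      have "\<forall>v. flip_map a b c d t v \<noteq> 0 \<longrightarrow> v \<in> {c,d,a}"
        using fs f(2) True dist by (auto simp: flip_map_def Let_def split: if_splits)
      then show ?thesis by (force simp: flip_def)
    next
      case False
      have "\<forall>v. flip_map a b c d t v \<noteq> 0 \<longrightarrow> v \<in> {c,d,b}"
        using fs f(2) False dist by (auto simp: flip_map_def Let_def split: if_splits)
      then show ?thesis by (force simp: flip_def)
    qed
  next
    case False
    then have "t a = 0 \<or> t b = 0" using f(2) by auto
    moreover have "f \<in> flip F a b c d" using False f(1) by (auto simp: flip_def)
    ultimately show ?thesis using id f(2) by metis
  qed
  moreover have "\<forall>v. 0 \<le> flip_map a b c d t v"
    using nn cd0 nn[of a] nn[of b] nn[of c] nn[of d] by (auto simp: flip_map_def Let_def max_def abs_if)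
  ultimately show "flip_map a b c d t \<in> realization (complex_of (flip F a b c d))"
    using mem_realization_complex_of[OF V 2] sum_flip_map[OF V 1 dist] s by metis
qed

lemma triples_flip:
  assumes "triples F" "flip_config F a b c d" shows "triples (flip F a b c d)"
  using assms by (auto simp: triples_def flip_def flip_config_def)

lemma boundary_edges_complex_of:
  assumes "triples F"
  shows "boundary_edges (complex_of F) = {e. card e = 2 \<and> card {f\<in>F. e \<subseteq> f} = 1}"
proof -
  have "e \<in> complex_of F" if "card e = 2" "card {f\<in>F. e \<subseteq> f} = 1" for e
  proof -
    have "{f\<in>F. e \<subseteq> f} \<noteq> {}" using that(2) by (metis card.empty zero_neq_one)
    then show ?thesis using that(1) by (auto simp: complex_of_def)
  qed
  then show ?thesis
    unfolding boundary_edges_def faces_complex_of[OF assms] by auto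
qed

lemma card_star_flip:
  assumes F: "triples F" and c: "flip_config F a b c d" and e: "card e = 2" "e \<noteq> {a,b}" "e \<noteq> {c,d}"
  shows "card {f\<in>flip F a b c d. e \<subseteq> f} = card {f\<in>F. e \<subseteq> f}"
proof -
  define G where "G = {f \<in> F - {{a,b,c},{a,b,d}}. e \<subseteq> f}"
  have fin: "finite G" using F by (auto simp: G_def triples_def)
  have dist: "distinct [a,b,c,d]" and inF: "{a,b,c} \<in> F" "{a,b,d} \<in> F"
    using c unfolding flip_config_def by blast+
  have nc: "\<And>f. f \<in> F \<Longrightarrow> \<not> {c,d} \<subseteq> f"
    using c unfolding flip_config_def by blast
  have cd: "{c,d,a} \<notin> F" "{c,d,b} \<notin> F"
    using nc by (metis empty_subsetI insert_mono)+
  obtain x y where xy: "e = {x,y}" "x \<noteq> y" using e(1) card_2_iff by metis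
  have 1: "{f\<in>F. e \<subseteq> f} = G \<union> {f\<in>{{a,b,c},{a,b,d}}. e \<subseteq> f}"
    using inF unfolding G_def by blast
  have 2: "{f\<in>flip F a b c d. e \<subseteq> f} = G \<union> {f\<in>{{c,d,a},{c,d,b}}. e \<subseteq> f}"
    unfolding G_def flip_def by blast
  have 3: "card {f\<in>F. e \<subseteq> f} = card G + card {f\<in>{{a,b,c},{a,b,d}}. e \<subseteq> f}"
    unfolding 1 by (rule card_Un_disjoint) (simp_all add: fin, unfold G_def, blast)
  have 4: "card {f\<in>flip F a b c d. e \<subseteq> f} = card G + card {f\<in>{{c,d,a},{c,d,b}}. e \<subseteq> f}"
    unfolding 2 by (rule card_Un_disjoint) (simp_all add: fin, use cd in \<open>unfold G_def, blast\<close>)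
  have ne: "{a,b,c} \<noteq> {a,b,d}" "{c,d,a} \<noteq> {c,d,b}" using dist by auto
  have *: "card {f\<in>{p,q}. e \<subseteq> f} = (if e \<subseteq> p then 1 else 0) + (if e \<subseteq> q then 1 else 0)" if "p \<noteq> q" for p q :: "'a set"
  proof -
    have "{f\<in>{p,q}. e \<subseteq> f} = (if e \<subseteq> p then {p} else {}) \<union> (if e \<subseteq> q then {q} else {})" by auto
    then show ?thesis using that by auto
  qed
  show ?thesis
    unfolding 3 4 *[OF ne(1)] *[OF ne(2)] using xy e dist by auto
qed

lemma boundary_edges_flip:
  assumes F: "triples F" and c: "flip_config F a b c d"
  shows "boundary_edges (complex_of (flip F a b c d)) = boundary_edges (complex_of F)"
    and "{a,b} \<notin> boundary_edges (complex_of F)"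
proof -
  have dist: "distinct [a,b,c,d]" using c unfolding flip_config_def by blast
  have ab: "{f\<in>F. {a,b} \<subseteq> f} = {{a,b,c},{a,b,d}}" "{f\<in>F. {c,d} \<subseteq> f} = {}"
    using c unfolding flip_config_def by blast+
  have c': "flip_config (flip F a b c d) c d a b" by (rule flip_config_flip[OF c])
  have cd: "{f\<in>flip F a b c d. {c,d} \<subseteq> f} = {{c,d,a},{c,d,b}}" "{f\<in>flip F a b c d. {a,b} \<subseteq> f} = {}"
    using c' unfolding flip_config_def by blast+
  have "{a,b,c} \<noteq> {a,b,d}" "{c,d,a} \<noteq> {c,d,b}" using dist by auto
  then have n: "card {f\<in>F. {a,b} \<subseteq> f} \<noteq> 1" "card {f\<in>F. {c,d} \<subseteq> f} \<noteq> 1"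
      "card {f\<in>flip F a b c d. {a,b} \<subseteq> f} \<noteq> 1" "card {f\<in>flip F a b c d. {c,d} \<subseteq> f} \<noteq> 1"
    unfolding ab cd by auto
  show "boundary_edges (complex_of (flip F a b c d)) = boundary_edges (complex_of F)"
    unfolding boundary_edges_complex_of[OF F] boundary_edges_complex_of[OF triples_flip[OF F c]]
  proof (rule Collect_cong)
    fix e
    show "card e = 2 \<and> card {f \<in> flip F a b c d. e \<subseteq> f} = 1 \<longleftrightarrow> card e = 2 \<and> card {f \<in> F. e \<subseteq> f} = 1"
    proof (cases "e = {a,b} \<or> e = {c,d}")
      case True
      then show ?thesis using n by (elim disjE) (simp_all only: simp_thms)
    next
      case False
      then show ?thesis using card_star_flip[OF F c, of e] by (metis (no_types, lifting))
    qed
  qed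
  show "{a,b} \<notin> boundary_edges (complex_of F)"
    unfolding boundary_edges_complex_of[OF F] using n by simp
qed

lemma same_surface_flip:
  assumes F: "triples F" and c: "flip_config F a b c d"
  shows "same_surface (complex_of F) (complex_of (flip F a b c d))"
proof -
  have c': "flip_config (flip F a b c d) c d a b" and ff: "flip (flip F a b c d) c d a b = F"
    by (rule flip_config_flip[OF c])+
  have F': "triples (flip F a b c d)" by (rule triples_flip[OF F c])
  have fin: "finite (\<Union>G)" if "triples G" for G :: "'a set set"
    using that triples_finite[OF that] by (auto simp: triples_def)
  have bd: "flip_map a b c d t = t" if F: "triples F" and c: "flip_config F a b c d"
    and t: "t \<in> realization (boundary_complex (complex_of F))" for F a b c d and t :: "'a \<Rightarrow> real"
  proof -
    obtain e where e: "e \<in> boundary_edges (complex_of F)" "{v. t v \<noteq> 0} \<subseteq> e"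
      using t by (auto simp: realization_def boundary_complex_def)
    have "t a = 0 \<or> t b = 0"
    proof (rule ccontr)
      assume "\<not> ?thesis"
      then have "{a,b} \<subseteq> e" using e(2) by auto
      moreover have "card e = 2" using e(1) by (simp add: boundary_edges_def)
      moreover have "a \<noteq> b" using c by (auto simp: flip_config_def)
      ultimately have "e = {a,b}" by (metis card_2_iff card_subset_eq card_eq_0_iff zero_neq_numeral)
      then show False using boundary_edges_flip(2)[OF F c] e(1) by simp
    qed
    moreover have "t \<in> realization (complex_of F)"
      using t realization_boundary_subset[OF pure_complex_of[OF F]] by blast
    ultimately show ?thesis using flip_map_mem(3)[OF c fin[OF F]] by blast
  qed
  have be: "boundary_complex (complex_of (flip F a b c d)) = boundary_complex (complex_of F)"
    using boundary_edges_flip(1)[OF F c] by (simp add: boundary_complex_def)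
  show ?thesis
  proof (rule same_surfaceI[where \<phi> = "flip_map a b c d" and \<psi> = "flip_map c d a b"])
    show "flip_map a b c d t \<in> realization (boundary_complex (complex_of (flip F a b c d)))"
      if "t \<in> realization (boundary_complex (complex_of F))" for t
      unfolding be bd[OF F c that] by (rule that)
    show "flip_map c d a b t \<in> realization (boundary_complex (complex_of F))"
      if "t \<in> realization (boundary_complex (complex_of (flip F a b c d)))" for t
      unfolding bd[OF F' c' that] using that be by simp
    show "flip_map a b c d t \<in> realization (complex_of (flip F a b c d)) \<and>
          flip_map c d a b (flip_map a b c d t) = t" if "t \<in> realization (complex_of F)" for t
      using flip_map_mem(1,2)[OF c fin[OF F] that] by blast
    show "flip_map c d a b t \<in> realization (complex_of F) \<and>
          flip_map a b c d (flip_map c d a b t) = t" if "t \<in> realization (complex_of (flip F a b c d))" for t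
      using flip_map_mem(1,2)[OF c' fin[OF F'] that, unfolded ff] by blast
  qed (rule continuous_flip_map pure_complex_of[OF F'])+
qed

definition pl_equiv :: "'v set set \<Rightarrow> 'v set set \<Rightarrow> bool" where
  "pl_equiv F G \<longleftrightarrow> triples F \<and> triples G \<and> same_surface (complex_of F) (complex_of G)"

lemma pl_equiv_sym: "pl_equiv F G \<Longrightarrow> pl_equiv G F"
  using same_surface_sym pure_complex_of unfolding pl_equiv_def by blast

lemma pl_equiv_trans [trans]: "pl_equiv F G \<Longrightarrow> pl_equiv G H \<Longrightarrow> pl_equiv F H"
  using same_surface_trans unfolding pl_equiv_def by blast

lemma triangulates_pl_equiv:
  assumes "pl_equiv F G" shows "triangulates X Y (complex_of F) \<longleftrightarrow> triangulates X Y (complex_of G)"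
  using assms pl_equiv_sym[OF assms] triangulates_same_surface pure_complex_of
  unfolding pl_equiv_def by metis

lemma pl_equiv_flip:
  assumes "triples (G \<union> {{a,b,c},{a,b,d}})" "distinct [a,b,c,d]"
    and "\<And>f. f \<in> G \<Longrightarrow> \<not> {a,b} \<subseteq> f" "\<And>f. f \<in> G \<Longrightarrow> \<not> {c,d} \<subseteq> f"
  shows "pl_equiv (G \<union> {{a,b,c},{a,b,d}}) (G \<union> {{c,d,a},{c,d,b}})"
proof -
  let ?F = "G \<union> {{a,b,c},{a,b,d}}"
  have nin: "\<not> {c,d} \<subseteq> {a,b,c}" "\<not> {c,d} \<subseteq> {a,b,d}" using assms(2) by auto
  have c: "flip_config ?F a b c d"
    unfolding flip_config_def using assms(2-) nin by blast
  have "flip ?F a b c d = G \<union> {{c,d,a},{c,d,b}}"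
    using assms(3) unfolding flip_def by blast
  then show ?thesis
    using same_surface_flip[OF assms(1) c] triples_flip[OF assms(1) c] assms(1)
    unfolding pl_equiv_def by simp
qed

definition stellar :: "'v set set \<Rightarrow> 'v set \<Rightarrow> 'v \<Rightarrow> 'v set set" where
  "stellar F \<sigma> x = {f\<in>F. \<not> \<sigma> \<subseteq> f} \<union> {insert x (f - {v}) | f v. f \<in> F \<and> \<sigma> \<subseteq> f \<and> v \<in> \<sigma>}"

definition merge_map :: "'v set \<Rightarrow> 'v \<Rightarrow> ('v \<Rightarrow> real) \<Rightarrow> 'v \<Rightarrow> real" where
  "merge_map \<sigma> x t v = (if v = x then 0 else if v \<in> \<sigma> then t v + t x / card \<sigma> else t v)"

definition split_map :: "'v set \<Rightarrow> 'v \<Rightarrow> ('v \<Rightarrow> real) \<Rightarrow> 'v \<Rightarrow> real" where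
  "split_map \<sigma> x t v = (if v = x then real (card \<sigma>) * Min (t ` \<sigma>) else if v \<in> \<sigma> then t v - Min (t ` \<sigma>) else t v)"

lemma continuous_on_Min_image:
  assumes "finite \<sigma>" "\<sigma> \<noteq> {}"
  shows "continuous_on UNIV (\<lambda>t :: 'v \<Rightarrow> real. Min (t ` \<sigma>))"
  using assms
proof (induction rule: finite_ne_induct)
  case (insert v \<sigma>)
  then have "(\<lambda>t :: 'v \<Rightarrow> real. Min (t ` insert v \<sigma>)) = (\<lambda>t. min (t v) (Min (t ` \<sigma>)))"
    by (simp add: fun_eq_iff)
  then show ?case using insert by (auto intro!: continuous_intros continuous_on_product_coordinates)
qed (auto intro!: continuous_on_product_coordinates)

lemma continuous_merge_map: "continuous_on UNIV (merge_map \<sigma> x)"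
proof (rule continuous_on_coordinatewise_then_product)
  fix v
  show "continuous_on UNIV (\<lambda>t. merge_map \<sigma> x t v)"
    unfolding merge_map_def divide_inverse
    by (cases "v = x"; cases "v \<in> \<sigma>"; simp)
       (intro continuous_intros continuous_on_product_coordinates; simp)+
qed

lemma continuous_split_map:
  assumes "finite \<sigma>" "\<sigma> \<noteq> {}" shows "continuous_on UNIV (split_map \<sigma> x)"
proof (rule continuous_on_coordinatewise_then_product)
  fix v
  show "continuous_on UNIV (\<lambda>t. split_map \<sigma> x t v)"
    unfolding split_map_def
    by (cases "v = x"; cases "v \<in> \<sigma>"; simp)
       (intro continuous_intros continuous_on_product_coordinates continuous_on_Min_image assms; simp)+
qed

lemma stellar_subset: "x \<in> V \<Longrightarrow> \<Union>F \<subseteq> V \<Longrightarrow> \<Union>(stellar F \<sigma> x) \<subseteq> V"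
  by (auto simp: stellar_def)

lemma sum_merge_map:
  fixes t :: "'v \<Rightarrow> real"
  assumes "finite V" "x \<in> V" "\<sigma> \<subseteq> V" "x \<notin> \<sigma>" "\<sigma> \<noteq> {}"
  shows "sum (merge_map \<sigma> x t) V = sum t V"
proof -
  have fin: "finite \<sigma>" using assms finite_subset by blast
  have V: "V = insert x (\<sigma> \<union> (V - insert x \<sigma>))" using assms by auto
  have s: "sum g V = g x + (sum g \<sigma> + sum g (V - insert x \<sigma>))" for g :: "'v \<Rightarrow> real"
    using assms fin by (subst V, subst sum.insert, simp_all, subst sum.union_disjoint) auto
  have "sum (merge_map \<sigma> x t) \<sigma> = (\<Sum>v\<in>\<sigma>. t v + t x / card \<sigma>)"
    using assms by (intro sum.cong) (auto simp: merge_map_def)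
  also have "\<dots> = sum t \<sigma> + t x"
    using assms fin by (simp add: sum.distrib)
  moreover have "sum (merge_map \<sigma> x t) (V - insert x \<sigma>) = sum t (V - insert x \<sigma>)"
    by (intro sum.cong) (auto simp: merge_map_def)
  ultimately show ?thesis
    unfolding s by (simp add: merge_map_def)
qed

lemma merge_map_mem:
  assumes V: "finite V" "x \<in> V" "\<Union>F \<subseteq> V" "\<sigma> \<subseteq> V" and x: "x \<notin> \<Union>F" "x \<notin> \<sigma>" "\<sigma> \<noteq> {}"
    and t: "t \<in> realization (complex_of (stellar F \<sigma> x))"
  shows "merge_map \<sigma> x t \<in> realization (complex_of F) \<and> split_map \<sigma> x (merge_map \<sigma> x t) = t"
proof -
  have fin: "finite \<sigma>" by (rule finite_subset[OF V(4,1)])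
  note mem = mem_realization_complex_of[OF V(1) stellar_subset[OF V(2,3)]]
  have nn: "\<And>v. 0 \<le> t v" and s: "sum t V = 1" using t mem by blast+
  from t mem obtain g where g: "g \<in> stellar F \<sigma> x" "\<And>v. t v \<noteq> 0 \<Longrightarrow> v \<in> g" by blast
  have nn': "\<forall>v. 0 \<le> merge_map \<sigma> x t v" using nn by (simp add: merge_map_def)
  have s': "sum (merge_map \<sigma> x t) V = 1" using sum_merge_map V x s by metis
  obtain v where v: "v \<in> \<sigma>" "t v = 0" and "\<exists>f\<in>F. \<forall>v. merge_map \<sigma> x t v \<noteq> 0 \<longrightarrow> v \<in> f"
  proof (cases "g \<in> F \<and> \<not> \<sigma> \<subseteq> g")
    case True
    then obtain v where v: "v \<in> \<sigma>" "t v = 0" using g(2) by blast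
    have "t x = 0" using True g(2) x by blast
    then have "\<forall>v. merge_map \<sigma> x t v \<noteq> 0 \<longrightarrow> v \<in> g" using g(2) by (auto simp: merge_map_def split: if_splits)
    then show thesis using that[OF v] True by blast
  next
    case False
    then obtain f v where f: "f \<in> F" "\<sigma> \<subseteq> f" "v \<in> \<sigma>" "g = insert x (f - {v})"
      using g(1) by (auto simp: stellar_def)
    have "v \<notin> g" using f x by blast
    then have tv: "t v = 0" using g(2) by blast
    have "\<forall>v. merge_map \<sigma> x t v \<noteq> 0 \<longrightarrow> v \<in> f"
      using g(2) f by (auto simp: merge_map_def split: if_splits)
    then show thesis using that[OF f(3) tv] f(1) by blast
  qed
  then have 1: "merge_map \<sigma> x t \<in> realization (complex_of F)"
    using mem_realization_complex_of[OF V(1,3)] nn' s' by blast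
  have m: "Min (merge_map \<sigma> x t ` \<sigma>) = t x / card \<sigma>"
  proof (rule Min_eqI)
    show "t x / card \<sigma> \<in> merge_map \<sigma> x t ` \<sigma>"
      using v x by (intro image_eqI[of _ _ v]) (auto simp: merge_map_def)
  qed (use fin nn x in \<open>auto simp: merge_map_def\<close>)
  have "split_map \<sigma> x (merge_map \<sigma> x t) = t"
    using x fin by (auto simp: fun_eq_iff split_map_def m) (auto simp: merge_map_def)
  with 1 show ?thesis by blast
qed

lemma split_map_mem:
  assumes V: "finite V" "x \<in> V" "\<Union>F \<subseteq> V" "\<sigma> \<subseteq> V" and x: "x \<notin> \<Union>F" "x \<notin> \<sigma>" "\<sigma> \<noteq> {}"
    and t: "t \<in> realization (complex_of F)"
  shows "split_map \<sigma> x t \<in> realization (complex_of (stellar F \<sigma> x)) \<and> merge_map \<sigma> x (split_map \<sigma> x t) = t"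
proof -
  have fin: "finite \<sigma>" by (rule finite_subset[OF V(4,1)])
  note mem = mem_realization_complex_of[OF V(1,3)]
  have nn: "\<And>v. 0 \<le> t v" and s: "sum t V = 1" using t mem by blast+
  from t mem obtain f where f: "f \<in> F" "\<And>v. t v \<noteq> 0 \<Longrightarrow> v \<in> f" by blast
  have tx: "t x = 0" using f x by blast
  define m where "m = Min (t ` \<sigma>)"
  have m: "\<And>v. v \<in> \<sigma> \<Longrightarrow> m \<le> t v" "0 \<le> m" using fin x nn by (auto simp: m_def)
  have "m \<in> t ` \<sigma>" unfolding m_def by (rule Min_in) (use fin x in auto)
  then obtain v where v: "v \<in> \<sigma>" "t v = m" by auto
  have sm: "split_map \<sigma> x t v = (if v = x then card \<sigma> * m else if v \<in> \<sigma> then t v - m else t v)" for v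
    by (simp add: split_map_def m_def)
  have inv: "merge_map \<sigma> x (split_map \<sigma> x t) = t"
    using x fin tx by (auto simp: fun_eq_iff merge_map_def sm)
  have "sum (split_map \<sigma> x t) V = 1"
    using sum_merge_map[OF V(1,2,4) x(2,3), of "split_map \<sigma> x t"] inv s by simp
  moreover have "\<forall>v. 0 \<le> split_map \<sigma> x t v" using m nn by (simp add: sm)
  moreover have "\<exists>g\<in>stellar F \<sigma> x. \<forall>v. split_map \<sigma> x t v \<noteq> 0 \<longrightarrow> v \<in> g"
  proof (cases "\<sigma> \<subseteq> f")
    case True
    have "\<forall>w. split_map \<sigma> x t w \<noteq> 0 \<longrightarrow> w \<in> insert x (f - {v})"
      using f(2) v True by (auto simp: sm split: if_splits)
    moreover have "insert x (f - {v}) \<in> stellar F \<sigma> x" using f(1) True v(1) by (auto simp: stellar_def)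
    ultimately show ?thesis by blast
  next
    case False
    then obtain u where "u \<in> \<sigma>" "t u = 0" using f(2) by blast
    then have "m = 0" using m by (metis order_antisym)
    then have "\<forall>w. split_map \<sigma> x t w \<noteq> 0 \<longrightarrow> w \<in> f" using f(2) by (auto simp: sm split: if_splits)
    moreover have "f \<in> stellar F \<sigma> x" using f(1) False by (auto simp: stellar_def)
    ultimately show ?thesis by blast
  qed
  ultimately show ?thesis
    using mem_realization_complex_of[OF V(1) stellar_subset[OF V(2,3)]] inv by blast
qed

lemma boundary_edges_subset: "triples F \<Longrightarrow> \<Union>(boundary_edges (complex_of F)) \<subseteq> \<Union>F"
  unfolding boundary_edges_def complex_of_def by blast

lemma pl_equiv_stellar:
  assumes F: "triples F" "triples (stellar F \<sigma> x)" and x: "x \<notin> \<Union>F" "\<sigma> \<noteq> {}" "\<sigma> \<subseteq> \<Union>F"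
    and b: "boundary_edges (complex_of (stellar F \<sigma> x)) = stellar (boundary_edges (complex_of F)) \<sigma> x"
  shows "pl_equiv F (stellar F \<sigma> x)"
proof -
  let ?V = "insert x (\<Union>F)" and ?B = "boundary_edges (complex_of F)"
  have V: "finite ?V" "x \<in> ?V" "\<Union>F \<subseteq> ?V" "\<sigma> \<subseteq> ?V"
    using F(1) triples_finite[OF F(1)] x by (auto simp: triples_def)
  have x2: "x \<notin> \<sigma>" using x by blast
  have B: "\<Union>?B \<subseteq> ?V" "x \<notin> \<Union>?B" using boundary_edges_subset[OF F(1)] x by blast+
  have fin: "finite \<sigma>" by (rule finite_subset[OF V(4,1)])
  have "same_surface (complex_of (stellar F \<sigma> x)) (complex_of F)"
  proof (rule same_surfaceI[where \<phi> = "merge_map \<sigma> x" and \<psi> = "split_map \<sigma> x"])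
    show "merge_map \<sigma> x t \<in> realization (boundary_complex (complex_of F))"
      if "t \<in> realization (boundary_complex (complex_of (stellar F \<sigma> x)))" for t
      using merge_map_mem[OF V(1,2) B(1) V(4) B(2) x2 x(2)] that
      unfolding boundary_complex_eq b by blast
    show "split_map \<sigma> x t \<in> realization (boundary_complex (complex_of (stellar F \<sigma> x)))"
      if "t \<in> realization (boundary_complex (complex_of F))" for t
      using split_map_mem[OF V(1,2) B(1) V(4) B(2) x2 x(2)] that
      unfolding boundary_complex_eq b by blast
    show "continuous_on UNIV (split_map \<sigma> x)" by (rule continuous_split_map[OF fin x(2)])
  qed (auto intro: continuous_merge_map pure_complex_of[OF F(1)]
        dest!: merge_map_mem[OF V x(1) x2 x(2)] split_map_mem[OF V x(1) x2 x(2)])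
  then show ?thesis
    using F same_surface_sym[OF pure_complex_of[OF F(2)]] unfolding pl_equiv_def by blast
qed

lemma card_star_Un:
  assumes "finite G" "distinct fs" "set fs \<inter> G = {}"
  shows "card {f \<in> G \<union> set fs. e \<subseteq> f} = card {f\<in>G. e \<subseteq> f} + length (filter (\<lambda>f. e \<subseteq> f) fs)"
proof -
  have "{f \<in> G \<union> set fs. e \<subseteq> f} = {f\<in>G. e \<subseteq> f} \<union> set (filter (\<lambda>f. e \<subseteq> f) fs)" by auto
  moreover have "card \<dots> = card {f\<in>G. e \<subseteq> f} + card (set (filter (\<lambda>f. e \<subseteq> f) fs))"
    using assms by (intro card_Un_disjoint) auto
  moreover have "card (set (filter (\<lambda>f. e \<subseteq> f) fs)) = length (filter (\<lambda>f. e \<subseteq> f) fs)"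
    using assms(2) by (intro distinct_card) simp
  ultimately show ?thesis by (simp only:)
qed

lemma card_2_cases:
  assumes "card e = 2" obtains (mem) v where "e = {x, v}" "v \<noteq> x" | (not_mem) "x \<notin> e"
  using assms by (metis card_2_iff doubleton_eq_iff insertE singletonD insert_commute)

lemma pl_equiv_subdivide_face:
  assumes F: "triples (insert {a,b,c} G)" and T: "{a,b,c} \<notin> G" and x: "x \<notin> \<Union>(insert {a,b,c} G)"
  shows "pl_equiv (insert {a,b,c} G) (G \<union> {{x,b,c},{x,a,c},{x,a,b}})"
proof -
  let ?F = "insert {a,b,c} G" and ?F' = "G \<union> {{x,b,c},{x,a,c},{x,a,b}}"
  have d: "distinct [a,b,c]" using F by (auto simp: triples_def card_insert_if split: if_splits)
  have dx: "x \<notin> {a,b,c}" "\<And>f. f \<in> G \<Longrightarrow> x \<notin> f" using x by auto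
  have eq: "f = {a,b,c}" if "f \<in> ?F" "{a,b,c} \<subseteq> f" for f
    using that F triples_finite[OF F] card_subset_eq[of f "{a,b,c}"] by (auto simp: triples_def)
  have F': "triples ?F'" using F d dx(1) by (auto simp: triples_def)
  have st: "stellar ?F {a,b,c} x = ?F'"
  proof -
    have "{f \<in> ?F. \<not> {a,b,c} \<subseteq> f} = G" using eq T by blast
    moreover have "{insert x (f - {v}) | f v. f \<in> ?F \<and> {a,b,c} \<subseteq> f \<and> v \<in> {a,b,c}}
        = {insert x ({a,b,c} - {v}) | v. v \<in> {a,b,c}}" using eq by blast
    moreover have "{a,b,c} - {a} = {b,c}" "{a,b,c} - {b} = {a,c}" "{a,b,c} - {c} = {a,b}" using d by auto
    then have "{insert x ({a,b,c} - {v}) | v. v \<in> {a,b,c}} = {{x,b,c},{x,a,c},{x,a,b}}"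
      unfolding Setcompr_eq_image by (simp only: image_insert image_empty)
    ultimately show ?thesis unfolding stellar_def by simp
  qed
  have fin: "finite G" using F by (simp add: triples_def)
  have ds: "distinct [{x,b,c},{x,a,c},{x,a,b}]"
    using d dx(1) by (auto simp: insert_ident doubleton_eq_iff)
  have disj: "set [{x,b,c},{x,a,c},{x,a,b}] \<inter> G = {}" using dx(2) by fastforce
  have c1: "card {f\<in>?F'. e \<subseteq> f} = card {f\<in>G. e \<subseteq> f} + length (filter (\<lambda>f. e \<subseteq> f) [{x,b,c},{x,a,c},{x,a,b}])" for e
    using card_star_Un[OF fin ds disj, of e] by simp
  have c2: "card {f\<in>?F. e \<subseteq> f} = card {f\<in>G. e \<subseteq> f} + length (filter (\<lambda>f. e \<subseteq> f) [{a,b,c}])" for e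
    using card_star_Un[OF fin, of "[{a,b,c}]" e] T by simp
  have bx: "{x,v} \<notin> boundary_edges (complex_of ?F')" if "v \<noteq> x" for v
  proof -
    have "{f\<in>G. {x,v} \<subseteq> f} = {}" using dx by blast
    then have g0: "card {f\<in>G. {x,v} \<subseteq> f} = 0" by (simp only: card.empty)
    have "card {f\<in>?F'. {x,v} \<subseteq> f} \<noteq> 1"
      unfolding c1 g0 using that dx d by auto
    then show ?thesis unfolding boundary_edges_complex_of[OF F'] by simp
  qed
  have bn: "e \<in> boundary_edges (complex_of ?F') \<longleftrightarrow> e \<in> boundary_edges (complex_of ?F)" if "x \<notin> e" for e
  proof -
    have "card {f\<in>?F'. e \<subseteq> f} = card {f\<in>?F. e \<subseteq> f}" if "card e = 2"
    proof -
      obtain p q where "e = {p,q}" "p \<noteq> q" using \<open>card e = 2\<close> card_2_iff by metis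
      then show ?thesis unfolding c1 c2 using \<open>x \<notin> e\<close> d by auto
    qed
    then show ?thesis unfolding boundary_edges_complex_of[OF F'] boundary_edges_complex_of[OF F] by auto
  qed
  have sub: "\<not> {a,b,c} \<subseteq> e" if "e \<in> boundary_edges (complex_of ?F)" for e
  proof
    assume "{a,b,c} \<subseteq> e"
    moreover have "card e = 2" using that by (simp add: boundary_edges_def)
    moreover have "card {a,b,c} = 3" using d by simp
    ultimately show False using card_mono[of e "{a,b,c}"] card.infinite[of e] by auto
  qed
  have "boundary_edges (complex_of ?F') = boundary_edges (complex_of ?F)"
  proof (rule set_eqI)
    fix e
    show "e \<in> boundary_edges (complex_of ?F') \<longleftrightarrow> e \<in> boundary_edges (complex_of ?F)"
    proof (cases "x \<in> e")
      case True
      then have "e \<notin> boundary_edges (complex_of ?F)" using boundary_edges_subset[OF F] x by blast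
      moreover have "e \<notin> boundary_edges (complex_of ?F')"
      proof
        assume e: "e \<in> boundary_edges (complex_of ?F')"
        then have "card e = 2" by (simp add: boundary_edges_def)
        then show False using True bx e by (cases rule: card_2_cases[of e x]) auto
      qed
      ultimately show ?thesis by blast
    qed (use bn in blast)
  qed
  also have "\<dots> = stellar (boundary_edges (complex_of ?F)) {a,b,c} x"
    using sub unfolding stellar_def by blast
  finally show ?thesis
    using pl_equiv_stellar[of ?F "{a,b,c}" x] F F' x unfolding st by blast
qed

lemma pl_equiv_subdivide_boundary:
  assumes F: "triples (insert {a,b,c} G)" and ab: "\<And>f. f \<in> G \<Longrightarrow> \<not> {a,b} \<subseteq> f"
    and x: "x \<notin> \<Union>(insert {a,b,c} G)"
  shows "pl_equiv (insert {a,b,c} G) (G \<union> {{x,a,c},{x,b,c}})"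
proof -
  let ?F = "insert {a,b,c} G" and ?F' = "G \<union> {{x,a,c},{x,b,c}}"
  let ?B = "boundary_edges (complex_of ?F)" and ?B' = "boundary_edges (complex_of ?F')"
  have d: "distinct [a,b,c]" using F by (auto simp: triples_def card_insert_if split: if_splits)
  have dx: "x \<notin> {a,b,c}" "\<And>f. f \<in> G \<Longrightarrow> x \<notin> f" using x by auto
  have eq: "f = {a,b,c}" if "f \<in> ?F" "{a,b} \<subseteq> f" for f using that ab by blast
  have T: "{a,b,c} \<notin> G" using ab by blast
  have F': "triples ?F'" using F d dx(1) by (auto simp: triples_def)
  have st: "stellar ?F {a,b} x = ?F'"
  proof -
    have "{f \<in> ?F. \<not> {a,b} \<subseteq> f} = G" using eq T ab by blast
    moreover have "{insert x (f - {v}) | f v. f \<in> ?F \<and> {a,b} \<subseteq> f \<and> v \<in> {a,b}}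
        = {insert x ({a,b,c} - {v}) | v. v \<in> {a,b}}" using eq by blast
    moreover have "{a,b,c} - {a} = {b,c}" "{a,b,c} - {b} = {a,c}" using d by auto
    then have "{insert x ({a,b,c} - {v}) | v. v \<in> {a,b}} = {{x,b,c},{x,a,c}}"
      unfolding Setcompr_eq_image by (simp only: image_insert image_empty)
    ultimately show ?thesis unfolding stellar_def by (simp add: insert_commute)
  qed
  have fin: "finite G" using F by (simp add: triples_def)
  have ds: "distinct [{x,a,c},{x,b,c}]"
    using d dx(1) by (auto simp: insert_ident doubleton_eq_iff)
  have disj: "set [{x,a,c},{x,b,c}] \<inter> G = {}" using dx(2) by fastforce
  have c1: "card {f\<in>?F'. e \<subseteq> f} = card {f\<in>G. e \<subseteq> f} + length (filter (\<lambda>f. e \<subseteq> f) [{x,a,c},{x,b,c}])" for e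
    using card_star_Un[OF fin ds disj, of e] by simp
  have c2: "card {f\<in>?F. e \<subseteq> f} = card {f\<in>G. e \<subseteq> f} + length (filter (\<lambda>f. e \<subseteq> f) [{a,b,c}])" for e
    using card_star_Un[OF fin, of "[{a,b,c}]" e] T by simp
  have bx: "{x,v} \<in> ?B' \<longleftrightarrow> v = a \<or> v = b" if "v \<noteq> x" for v
  proof -
    have "{f\<in>G. {x,v} \<subseteq> f} = {}" using dx by blast
    then have g0: "card {f\<in>G. {x,v} \<subseteq> f} = 0" by (simp only: card.empty)
    have "card {f\<in>?F'. {x,v} \<subseteq> f} = 1 \<longleftrightarrow> v = a \<or> v = b"
      unfolding c1 g0 using that dx d by auto
    then show ?thesis unfolding boundary_edges_complex_of[OF F'] using that by simp
  qed
  have bn: "e \<in> ?B' \<longleftrightarrow> e \<in> ?B \<and> e \<noteq> {a,b}" if "x \<notin> e" for e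
  proof (cases "e = {a,b}")
    case True
    have "{f\<in>G. {a,b} \<subseteq> f} = {}" using ab by blast
    then have g0: "card {f\<in>G. {a,b} \<subseteq> f} = 0" by (simp only: card.empty)
    have "card {f\<in>?F'. e \<subseteq> f} \<noteq> 1" unfolding c1 True g0 using dx d by auto
    then show ?thesis unfolding boundary_edges_complex_of[OF F'] True by simp
  next
    case False
    have "card {f\<in>?F'. e \<subseteq> f} = card {f\<in>?F. e \<subseteq> f}" if "card e = 2"
    proof -
      obtain p q where "e = {p,q}" "p \<noteq> q" using \<open>card e = 2\<close> card_2_iff by metis
      then show ?thesis unfolding c1 c2 using \<open>x \<notin> e\<close> d False by auto
    qed
    then show ?thesis unfolding boundary_edges_complex_of[OF F'] boundary_edges_complex_of[OF F]
      using False by auto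
  qed
  have abB: "{a,b} \<in> ?B"
  proof -
    have "{f\<in>G. {a,b} \<subseteq> f} = {}" using ab by blast
    then have g0: "card {f\<in>G. {a,b} \<subseteq> f} = 0" by (simp only: card.empty)
    have "card {f\<in>?F. {a,b} \<subseteq> f} = 1" unfolding c2 g0 by simp
    then show ?thesis unfolding boundary_edges_complex_of[OF F] using d by simp
  qed
  have c2B: "card e = 2" if "e \<in> ?B \<or> e \<in> ?B'" for e using that by (auto simp: boundary_edges_def)
  have eqB: "e = {a,b}" if "e \<in> ?B" "{a,b} \<subseteq> e" for e
    using c2B[of e] that d card_subset_eq[of e "{a,b}"] card.infinite[of e] by auto
  have xB: "x \<notin> e" if "e \<in> ?B" for e using boundary_edges_subset[OF F] x that by blast
  have st2: "stellar ?B {a,b} x = {e\<in>?B. e \<noteq> {a,b}} \<union> {{x,a},{x,b}}"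
  proof -
    have "{f \<in> ?B. \<not> {a,b} \<subseteq> f} = {e\<in>?B. e \<noteq> {a,b}}" using eqB by blast
    moreover have "{insert x (f - {v}) | f v. f \<in> ?B \<and> {a,b} \<subseteq> f \<and> v \<in> {a,b}}
        = {insert x ({a,b} - {v}) | v. v \<in> {a,b}}" using eqB abB by blast
    moreover have "{a,b} - {a} = {b}" "{a,b} - {b} = {a}" using d by auto
    then have "{insert x ({a,b} - {v}) | v. v \<in> {a,b}} = {{x,b},{x,a}}"
      unfolding Setcompr_eq_image by (simp only: image_insert image_empty)
    ultimately show ?thesis unfolding stellar_def by (simp add: insert_commute)
  qed
  have "?B' = stellar ?B {a,b} x"
  proof (rule set_eqI)
    fix e
    show "e \<in> ?B' \<longleftrightarrow> e \<in> stellar ?B {a,b} x"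
    proof (cases "x \<in> e")
      case True
      have "e \<in> ?B' \<longleftrightarrow> e = {x,a} \<or> e = {x,b}"
      proof
        assume e: "e \<in> ?B'"
        then have "card e = 2" using c2B by blast
        then obtain v where "e = {x,v}" "v \<noteq> x" using True by (cases rule: card_2_cases[of e x]) auto
        then show "e = {x,a} \<or> e = {x,b}" using bx e by auto
      qed (use bx dx in auto)
      then show ?thesis unfolding st2 using xB True by blast
    next
      case False
      then have "e \<noteq> {x,a}" "e \<noteq> {x,b}" by auto
      then show ?thesis unfolding st2 using bn[OF False] by (simp only: Un_iff mem_Collect_eq insert_iff empty_iff simp_thms)
    qed
  qed
  then show ?thesis
    using pl_equiv_stellar[of ?F "{a,b}" x] F F' x unfolding st by blast
qed

subsection \<open>Renaming vertices\<close>

lemma complex_of_image: "(`) g ` complex_of F = complex_of ((`) g ` F)"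
proof -
  have "s \<in> (`) g ` complex_of F" if "s \<noteq> {}" "f \<in> F" "s \<subseteq> g ` f" for s f
  proof -
    have "s = g ` {v\<in>f. g v \<in> s}" using that(3) by auto
    moreover from this that(1) have "{v\<in>f. g v \<in> s} \<noteq> {}" by auto
    then have "{v\<in>f. g v \<in> s} \<in> complex_of F" using that(2) by (auto simp: complex_of_def)
    ultimately show ?thesis by blast
  qed
  moreover have "g ` s \<in> complex_of ((`) g ` F)" if "s \<in> complex_of F" for s
    using that by (auto simp: complex_of_def)
  moreover have "\<exists>f\<in>F. s \<subseteq> g ` f \<and> s \<noteq> {}" if "s \<in> complex_of ((`) g ` F)" for s
    using that by (auto simp: complex_of_def)
  ultimately show ?thesis by (meson image_subsetI subsetI subset_antisym)
qed

lemma same_surface_rename: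
  fixes K :: "'v set set" and \<pi> :: "'v \<Rightarrow> 'v"
  assumes K: "pure_2_complex K" "pure_2_complex ((`) \<pi> ` K)" and inv: "\<And>v. \<pi> (\<pi> v) = v"
  shows "same_surface K ((`) \<pi> ` K)"
proof -
  have bij: "bij \<pi>" using inv by (metis bij_betw_def inj_on_def surj_def)
  have inj: "inj \<pi>" using bij bij_is_inj by blast
  have im: "\<pi> ` \<pi> ` s = s" for s by (simp add: image_image inv)
  have iK: "s \<in> (`) \<pi> ` L \<longleftrightarrow> \<pi> ` s \<in> L" for s L using im by (metis imageE imageI)
  have sub: "\<pi> ` s \<subseteq> t \<longleftrightarrow> s \<subseteq> \<pi> ` t" for s t using im by (metis image_mono)
  have c: "card (\<pi> ` s) = card s" for s using inj by (simp add: card_image inj_on_subset)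
  have supp: "{v. (t \<circ> \<pi>) v \<noteq> 0} = \<pi> ` {v. t v \<noteq> 0}" for t :: "'v \<Rightarrow> real"
    using inv by (auto simp: image_iff) metis
  have R: "t \<circ> \<pi> \<in> realization ((`) \<pi> ` L)" if "t \<in> realization L" for t and L :: "'v set set"
  proof -
    have "(\<Sum>v\<in>\<pi> ` {v. t v \<noteq> 0}. (t \<circ> \<pi>) v) = (\<Sum>v | t v \<noteq> 0. t v)"
      by (subst sum.reindex) (auto simp: inv inj_on_subset[OF inj])
    then show ?thesis using that unfolding realization_def mem_Collect_eq supp by (simp only: iK im comp_def) blast
  qed
  have R': "t \<circ> \<pi> \<in> realization L" if "t \<in> realization ((`) \<pi> ` L)" for t and L :: "'v set set"
  proof -
    have "(`) \<pi> ` (`) \<pi> ` L = L" by (auto simp: im) (metis im imageI)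
    then show ?thesis using R[OF that] by simp
  qed
  have bd: "boundary_edges ((`) \<pi> ` K) = (`) \<pi> ` boundary_edges K"
  proof -
    have "faces ((`) \<pi> ` K) = (`) \<pi> ` faces K"
      by (auto simp: faces_def c)
    moreover have "card {f \<in> (`) \<pi> ` faces K. e \<subseteq> f} = card {f \<in> faces K. \<pi> ` e \<subseteq> f}" for e
    proof -
      have "{f \<in> (`) \<pi> ` faces K. e \<subseteq> f} = (`) \<pi> ` {f \<in> faces K. \<pi> ` e \<subseteq> f}"
        using sub by auto
      moreover have "inj ((`) \<pi>)" using inj by (simp add: inj_on_def[of "(`) \<pi>"] inj_image_eq_iff)
      ultimately show ?thesis by (simp add: card_image inj_on_subset)
    qed
    ultimately show ?thesis
      unfolding boundary_edges_def by (auto simp: c im image_iff)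
  qed
  have bd2: "boundary_complex ((`) \<pi> ` K) = (`) \<pi> ` boundary_complex K"
    unfolding boundary_complex_eq bd complex_of_image ..
  have cont: "continuous_on UNIV (\<lambda>t :: 'v \<Rightarrow> real. t \<circ> \<pi>)"
    by (rule continuous_on_coordinatewise_then_product) (simp add: continuous_on_product_coordinates)
  show ?thesis
    by (rule same_surfaceI[where \<phi> = "\<lambda>t. t \<circ> \<pi>" and \<psi> = "\<lambda>t. t \<circ> \<pi>"])
       (use cont R R' K(2) inv bd2 in \<open>auto simp: comp_assoc comp_def\<close>)
qed

lemma pl_equiv_rename:
  assumes "triples F" "\<And>v. \<pi> (\<pi> v) = v" shows "pl_equiv F ((`) \<pi> ` F)"
proof -
  have inj: "inj \<pi>" using assms(2) by (metis inj_on_def)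
  then have t: "triples ((`) \<pi> ` F)"
    using assms(1) by (auto simp: triples_def card_image inj_on_subset)
  show ?thesis
    using same_surface_rename[of "complex_of F" \<pi>] t assms pure_complex_of
    unfolding pl_equiv_def complex_of_image by metis
qed

lemma complex_of_cong:
  assumes "\<And>f. f \<in> F \<Longrightarrow> \<exists>g\<in>G. f \<subseteq> g" "\<And>g. g \<in> G \<Longrightarrow> \<exists>f\<in>F. g \<subseteq> f"
  shows "complex_of F = complex_of G"
  using assms unfolding complex_of_def by (metis (no_types, opaque_lifting) order_trans)

lemma contract_complex_of: "contract x y (complex_of F) = complex_of ((`) (id(y := x)) ` F)"
  unfolding contract_def by (rule complex_of_image)

lemma delete_vertices_complex_of:
  "delete_vertices X (complex_of F) = complex_of ((\<lambda>f. f - X) ` F)"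
proof (rule set_eqI)
  fix s
  have "(\<exists>f\<in>F. s \<subseteq> f) \<and> s \<inter> X = {} \<longleftrightarrow> (\<exists>f\<in>F. s \<subseteq> f - X)" by blast
  then show "s \<in> delete_vertices X (complex_of F) \<longleftrightarrow> s \<in> complex_of ((\<lambda>f. f - X) ` F)"
    unfolding delete_vertices_def complex_of_def by simp
qed

subsection \<open>Contractions\<close>

fun fan :: "'v \<Rightarrow> 'v list \<Rightarrow> 'v set set" where
  "fan x (u # v # ws) = insert {x,u,v} (fan x (v # ws))"
| "fan x _ = {}"

lemma fan_mem: "f \<in> fan x ws \<Longrightarrow> \<exists>u v. f = {x,u,v} \<and> u \<in> set ws \<and> v \<in> set ws"
proof (induction x ws rule: fan.induct)
  case (1 x u v ws)
  then consider "f = {x,u,v}" | "f \<in> fan x (v # ws)" by auto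
  then show ?case
  proof cases
    case 2
    then show ?thesis using 1(1) by (metis list.set_intros(2))
  qed (metis list.set_intros)
qed simp_all

lemma fan_covers: "length ws \<ge> 2 \<Longrightarrow> w \<in> set ws \<Longrightarrow> \<exists>f\<in>fan x ws. {x,w} \<subseteq> f"
proof (induction x ws rule: fan.induct)
  case (1 x u v ws)
  show ?case
  proof (cases "w \<in> {u,v}")
    case False
    then have "length (v # ws) \<ge> 2" "w \<in> set (v # ws)" using 1 by (cases ws; auto)+
    then show ?thesis using 1 by auto
  qed auto
qed auto

lemma fan_Cons: "length ws \<ge> 1 \<Longrightarrow> fan x (u # ws) = insert {x,u,hd ws} (fan x ws)"
  by (cases ws) auto

lemma flip_fan:
  assumes F: "triples F" and d: "distinct (x # y # u # v # ws)"
    and st: "{f\<in>F. x \<in> f} = fan x (y # u # v # ws) \<union> C" and C: "\<And>f. f \<in> C \<Longrightarrow> x \<in> f \<and> u \<notin> f"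
    and na: "\<And>f. f \<in> F \<Longrightarrow> \<not> {y,v} \<subseteq> f"
  obtains F' where "pl_equiv F F'" "{f\<in>F'. x \<in> f} = fan x (y # v # ws) \<union> C"
    "{f\<in>F'. x \<notin> f} = insert {y,u,v} {f\<in>F. x \<notin> f}"
    "\<And>f w. f \<in> F' \<Longrightarrow> {y,w} \<subseteq> f \<Longrightarrow> w \<noteq> y \<Longrightarrow> w \<in> {x,u,v} \<or> f \<in> F"
proof -
  define G where "G = {f\<in>F. x \<notin> f} \<union> (fan x (v # ws) \<union> C)"
  have fm: "f \<in> fan x (v # ws) \<Longrightarrow> u \<notin> f \<and> y \<notin> f \<and> x \<in> f" for f
    using fan_mem[of f x "v # ws"] d by auto
  have yu: "{x,y,u} = {x,u,y}" and vy: "{y,v,x} = {x,y,v}" by auto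
  have FG: "F = G \<union> {{x,u,y},{x,u,v}}"
  proof -
    have "F = {f\<in>F. x \<notin> f} \<union> {f\<in>F. x \<in> f}" by blast
    also have "\<dots> = G \<union> {{x,u,y},{x,u,v}}"
      unfolding st G_def fan.simps yu by blast
    finally show ?thesis .
  qed
  have nG: "\<not> {x,u} \<subseteq> f" if "f \<in> G" for f using that fm C unfolding G_def by blast
  have nG2: "\<not> {y,v} \<subseteq> f" if "f \<in> G" for f using that na FG by blast
  let ?F' = "G \<union> {{y,v,x},{y,v,u}}"
  have e: "pl_equiv F ?F'"
    unfolding FG by (rule pl_equiv_flip) (use F FG d nG nG2 in auto)
  have x1: "{f\<in>?F'. x \<in> f} = fan x (y # v # ws) \<union> C"
  proof -
    have "{f\<in>G. x \<in> f} = fan x (v # ws) \<union> C" using fm C unfolding G_def by blast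
    moreover have "{f\<in>{{x,y,v},{y,v,u}}. x \<in> f} = {{x,y,v}}" using d by auto
    moreover have "{f\<in>?F'. x \<in> f} = {f\<in>G. x \<in> f} \<union> {f\<in>{{x,y,v},{y,v,u}}. x \<in> f}"
      unfolding vy by blast
    ultimately show ?thesis unfolding fan.simps by simp
  qed
  have x2: "{f\<in>?F'. x \<notin> f} = insert {y,u,v} {f\<in>F. x \<notin> f}"
  proof -
    have "{f\<in>G. x \<notin> f} = {f\<in>F. x \<notin> f}"
      using fm C unfolding G_def by (intro set_eqI) (simp only: Un_iff mem_Collect_eq; metis)
    moreover have "{f\<in>{{x,y,v},{y,v,u}}. x \<notin> f} = {{y,u,v}}" using d by auto
    moreover have "{f\<in>?F'. x \<notin> f} = {f\<in>G. x \<notin> f} \<union> {f\<in>{{x,y,v},{y,v,u}}. x \<notin> f}"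
      unfolding vy by blast
    ultimately show ?thesis by simp
  qed
  have "w \<in> {x,u,v} \<or> f \<in> F" if f: "f \<in> ?F'" and w: "{y,w} \<subseteq> f" "w \<noteq> y" for f w
  proof -
    have "f \<in> F \<or> f = {y,v,x} \<or> f = {y,v,u}" using f FG by blast
    then show ?thesis using w by (elim disjE) auto
  qed
  then show thesis using that[OF e x1 x2] by blast
qed

lemma pl_equiv_contract_interior:
  assumes "triples F" "distinct (x # y # ws)" "length ws \<ge> 2"
    and "{f\<in>F. x \<in> f} = fan x (y # ws) \<union> {{x,y,last ws}}"
    and "\<And>w f. w \<in> set (butlast (tl ws)) \<Longrightarrow> f \<in> F \<Longrightarrow> \<not> {y,w} \<subseteq> f"
    and "length ws = 2 \<Longrightarrow> {y,hd ws,last ws} \<notin> F"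
  shows "pl_equiv F ({f\<in>F. x \<notin> f} \<union> fan y ws)"
  using assms
proof (induction "length ws" arbitrary: F ws rule: less_induct)
  case less
  then obtain u v ws' where ws: "ws = u # v # ws'" by (metis Suc_le_length_iff numeral_2_eq_2)
  note F = less(2) and d = less(3)[unfolded ws] and st = less(5)[unfolded ws] and na = less(6)[unfolded ws]
  show ?case
  proof (cases "ws' = []")
    case True
    define G where "G = {f\<in>F. x \<notin> f}"
    have FG: "F = G \<union> {{x,u,v},{x,y,v},{x,y,u}}"
    proof -
      have "F = {f\<in>F. x \<notin> f} \<union> {f\<in>F. x \<in> f}" by blast
      then show ?thesis unfolding st G_def True by (simp add: insert_commute Un_commute Un_left_commute)
    qed
    have T: "{y,u,v} \<notin> G" using less(7) unfolding ws True G_def by simp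
    have "x \<notin> \<Union>(insert {y,u,v} G)" using d by (auto simp: G_def)
    moreover have tr: "triples (insert {y,u,v} G)" using F d by (auto simp: triples_def G_def)
    ultimately have "pl_equiv (insert {y,u,v} G) F"
      unfolding FG using pl_equiv_subdivide_face T by metis
    then show ?thesis using pl_equiv_sym unfolding G_def ws True by simp
  next
    case False
    have v: "v \<in> set (butlast (v # ws'))" using False by simp
    have "set ws' \<inter> {x,u,v,y} = {}" using d by auto
    then have ln: "last ws' \<notin> {x,u,v,y}" using last_in_set[OF False] by blast
    then have lu: "last ws' \<noteq> u" by simp
    obtain F' where F': "pl_equiv F F'" "{f\<in>F'. x \<in> f} = fan x (y # v # ws') \<union> {{x,y,last ws'}}"
      "{f\<in>F'. x \<notin> f} = insert {y,u,v} {f\<in>F. x \<notin> f}"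
      "\<And>f w. f \<in> F' \<Longrightarrow> {y,w} \<subseteq> f \<Longrightarrow> w \<noteq> y \<Longrightarrow> w \<in> {x,u,v} \<or> f \<in> F"
      using flip_fan[OF F d, of "{{x,y,last ws'}}"] st na v lu False d by (auto simp del: fan.simps)
    have "pl_equiv F' ({f\<in>F'. x \<notin> f} \<union> fan y (v # ws'))"
    proof (rule less(1))
      show "triples F'" using F'(1) by (simp add: pl_equiv_def)
      show "2 \<le> length (v # ws')" using False by (cases ws') auto
      show "{f\<in>F'. x \<in> f} = fan x (y # v # ws') \<union> {{x,y,last (v # ws')}}" using F'(2) False by simp
      show "\<not> {y,w} \<subseteq> f" if "w \<in> set (butlast (tl (v # ws')))" "f \<in> F'" for w f
      proof
        assume "{y,w} \<subseteq> f"
        moreover have "w \<in> set ws'" using that(1) by (simp add: in_set_butlastD)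
        then have "w \<notin> {x,u,v}" "w \<noteq> y" using d by auto
        ultimately have "f \<in> F" using F'(4) that(2) by blast
        moreover have "w \<in> set (butlast (v # ws'))" using that(1) False by simp
        ultimately show False using na[of w f] \<open>{y,w} \<subseteq> f\<close> by simp
      qed
      show "{y, hd (v # ws'), last (v # ws')} \<notin> F'" if "length (v # ws') = 2"
      proof
        assume a: "{y, hd (v # ws'), last (v # ws')} \<in> F'"
        then have "last ws' \<in> {x,u,v} \<or> {y, hd (v # ws'), last (v # ws')} \<in> F"
          using F'(4)[OF a, of "last ws'"] False ln by simp
        moreover have "last ws' \<notin> {x,u,v}" using ln by simp
        ultimately show False using na[of v "{y, hd (v # ws'), last (v # ws')}"] v by simp
      qed
    qed (use d ws in auto)
    then show ?thesis
      using pl_equiv_trans[OF F'(1)] F'(3) unfolding ws by (simp add: Un_commute Un_left_commute)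
  qed
qed

lemma pl_equiv_contract_boundary:
  assumes "triples F" "distinct (x # y # ws)" "length ws \<ge> 2"
    and "{f\<in>F. x \<in> f} = fan x (y # ws)"
    and "\<And>w f. w \<in> set (tl ws) \<Longrightarrow> f \<in> F \<Longrightarrow> \<not> {y,w} \<subseteq> f"
  shows "pl_equiv F ({f\<in>F. x \<notin> f} \<union> fan y ws)"
  using assms
proof (induction "length ws" arbitrary: F ws rule: less_induct)
  case less
  then obtain u v ws' where ws: "ws = u # v # ws'" by (metis Suc_le_length_iff numeral_2_eq_2)
  note F = less(2) and d = less(3)[unfolded ws] and st = less(5)[unfolded ws] and na = less(6)[unfolded ws]
  show ?case
  proof (cases "ws' = []")
    case True
    define G where "G = {f\<in>F. x \<notin> f}"
    have FG: "F = G \<union> {{x,y,u},{x,v,u}}"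
    proof -
      have "F = {f\<in>F. x \<notin> f} \<union> {f\<in>F. x \<in> f}" by blast
      then show ?thesis unfolding st G_def True by (simp add: insert_commute Un_commute Un_left_commute)
    qed
    have T: "\<not> {y,v} \<subseteq> f" if "f \<in> G" for f using na[of v f] that True unfolding G_def by simp
    have "x \<notin> \<Union>(insert {y,v,u} G)" using d by (auto simp: G_def)
    moreover have tr: "triples (insert {y,v,u} G)" using F d by (auto simp: triples_def G_def)
    ultimately have "pl_equiv (insert {y,v,u} G) F"
      unfolding FG using pl_equiv_subdivide_boundary T by metis
    moreover have "{f \<in> F. x \<notin> f} \<union> fan y ws = insert {y,v,u} G"
      unfolding G_def ws True by (simp add: insert_commute)
    ultimately show ?thesis using pl_equiv_sym by metis
  next
    case False
    obtain F' where F': "pl_equiv F F'" "{f\<in>F'. x \<in> f} = fan x (y # v # ws')"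
      "{f\<in>F'. x \<notin> f} = insert {y,u,v} {f\<in>F. x \<notin> f}"
      "\<And>f w. f \<in> F' \<Longrightarrow> {y,w} \<subseteq> f \<Longrightarrow> w \<noteq> y \<Longrightarrow> w \<in> {x,u,v} \<or> f \<in> F"
      using flip_fan[OF F d, of "{}"] st na by (auto simp del: fan.simps)
    have "pl_equiv F' ({f\<in>F'. x \<notin> f} \<union> fan y (v # ws'))"
    proof (rule less(1))
      show "triples F'" using F'(1) by (simp add: pl_equiv_def)
      show "2 \<le> length (v # ws')" using False by (cases ws') auto
      show "{f\<in>F'. x \<in> f} = fan x (y # v # ws')" by (rule F'(2))
      show "\<not> {y,w} \<subseteq> f" if "w \<in> set (tl (v # ws'))" "f \<in> F'" for w f
      proof
        assume "{y,w} \<subseteq> f"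
        moreover have "w \<in> set ws'" using that(1) by simp
        then have "w \<notin> {x,u,v}" "w \<noteq> y" using d by auto
        ultimately have "f \<in> F" using F'(4) that(2) by blast
        then show False using na[of w f] \<open>{y,w} \<subseteq> f\<close> \<open>w \<in> set ws'\<close> by simp
      qed
    qed (use d ws in auto)
    then show ?thesis
      using pl_equiv_trans[OF F'(1)] F'(3) unfolding ws by (simp add: Un_commute Un_left_commute)
  qed
qed

lemma contract_fan:
  assumes st: "{f\<in>F. x \<in> f} = fan x (y # ws) \<union> C" and C: "C \<subseteq> {{x,y,last ws}}"
    and d: "distinct (x # y # ws)" "length ws \<ge> 2"
  shows "contract y x (complex_of F) = complex_of ({f\<in>F. x \<notin> f} \<union> fan y ws)"
proof -
  let ?g = "id(x := y)"
  have id: "?g ` f = f" if "x \<notin> f" for f using that by auto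
  have fanx: "(`) ?g ` fan x vs = fan y vs" if "x \<notin> set vs" for vs
    using that by (induction x vs rule: fan.induct) auto
  have ne: "ws \<noteq> []" using d by auto
  have F: "F = {f\<in>F. x \<notin> f} \<union> (insert {x,y,hd ws} (fan x ws) \<union> C)"
    using st fan_Cons[of ws x y] ne by (cases ws) auto
  have "(`) ?g ` F = (`) ?g ` {f\<in>F. x \<notin> f} \<union> ((`) ?g ` {{x,y,hd ws}} \<union> (`) ?g ` fan x ws \<union> (`) ?g ` C)"
    by (subst F) (simp only: image_Un image_insert insert_is_Un[of _ "fan x ws"] image_empty)
  also have "(`) ?g ` {f\<in>F. x \<notin> f} = {f\<in>F. x \<notin> f}" using id by force
  also have "(`) ?g ` fan x ws = fan y ws" using fanx d by auto
  finally have im: "(`) ?g ` F = {f\<in>F. x \<notin> f} \<union> ((`) ?g ` {{x,y,hd ws}} \<union> fan y ws \<union> (`) ?g ` C)" .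
  show ?thesis
    unfolding contract_complex_of im
  proof (rule complex_of_cong)
    fix f assume f: "f \<in> {f\<in>F. x \<notin> f} \<union> ((`) ?g ` {{x,y,hd ws}} \<union> fan y ws \<union> (`) ?g ` C)"
    have "\<exists>h\<in>fan y ws. {y,w} \<subseteq> h" if "w \<in> set ws" for w using fan_covers[OF d(2) that] .
    moreover have "hd ws \<in> set ws" "last ws \<in> set ws" using ne by auto
    moreover have "f \<subseteq> {y,hd ws} \<or> f \<subseteq> {y, last ws} \<or> f \<in> {f\<in>F. x \<notin> f} \<union> fan y ws"
      using f C by auto
    ultimately show "\<exists>g\<in>{f \<in> F. x \<notin> f} \<union> fan y ws. f \<subseteq> g"
      by (meson UnCI order_refl order_trans)
  qed auto
qed

subsection \<open>Attaching a triangle and inserting an octahedron\<close>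

lemma pl_equiv_attach_triangle:
  assumes F: "triples (insert {a,b,c} G)" and ab: "\<And>f. f \<in> G \<Longrightarrow> \<not> {a,b} \<subseteq> f"
    and x: "x \<notin> \<Union>(insert {a,b,c} G)"
  shows "pl_equiv (insert {a,b,c} G) (G \<union> {{a,b,c},{a,b,x}})"
proof -
  have d: "distinct [a,b,c]" using F by (auto simp: triples_def card_insert_if split: if_splits)
  have dx: "distinct [a,b,c,x]" "\<And>f. f \<in> G \<Longrightarrow> x \<notin> f" using d x by auto
  have t: "triples (G \<union> {{a,b,c},{a,b,x}})" using F dx by (auto simp: triples_def)
  have "pl_equiv (G \<union> {{a,b,c},{a,b,x}}) (G \<union> {{c,x,a},{c,x,b}})"
    by (rule pl_equiv_flip) (use t dx ab in auto)
  also have "G \<union> {{c,x,a},{c,x,b}} = G \<union> {{x,a,c},{x,b,c}}" by (simp add: insert_commute)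
  also have "pl_equiv \<dots> (insert {a,b,c} G)"
    by (rule pl_equiv_sym, rule pl_equiv_subdivide_boundary[OF F ab x])
  finally show ?thesis by (rule pl_equiv_sym)
qed

definition octahedron_faces :: "'v \<Rightarrow> 'v \<Rightarrow> 'v \<Rightarrow> 'v \<Rightarrow> 'v \<Rightarrow> 'v \<Rightarrow> 'v set set" where
  "octahedron_faces v1 v2 v3 a1 a2 a3 =
    {{v1,v2,v3}, {v1,v2,a3}, {v1,a2,v3}, {a1,v2,v3}, {v1,a2,a3}, {a1,v2,a3}, {a1,a2,v3}}"

lemma pl_equiv_insert_octahedron:
  assumes F: "triples (insert {a1,a2,a3} G)" and T: "{a1,a2,a3} \<notin> G"
    and v: "{v1,v2,v3} \<inter> \<Union>(insert {a1,a2,a3} G) = {}" "distinct [v1,v2,v3]"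
  shows "pl_equiv (insert {a1,a2,a3} G) (G \<union> octahedron_faces v1 v2 v3 a1 a2 a3)"
proof -
  have "distinct [a1,a2,a3]" using F by (auto simp: triples_def card_insert_if split: if_splits)
  then have d: "distinct [a1,a2,a3,v1,v2,v3]" using v by auto
  have n1: "v1 \<notin> f" and n2: "v2 \<notin> f" and n3: "v3 \<notin> f" if "f \<in> G" for f using v that by blast+
  have nG: "f \<notin> G" if "v1 \<in> f \<or> v2 \<in> f \<or> v3 \<in> f" for f using that n1 n2 n3 by blast
  have tG: "triples G" using F by (simp add: triples_def)
  have tU: "triples (insert f H)" if "card f = 3" "triples H" for f :: "'a set" and H using that by (simp add: triples_def)
  have "pl_equiv (insert {a1,a2,a3} G) (G \<union> {{v2,a2,a3},{v2,a1,a3},{v2,a1,a2}})"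
    by (rule pl_equiv_subdivide_face[OF F T]) (use v in blast)
  also have "\<dots> = insert {a1,a2,v2} (G \<union> {{v2,a2,a3},{v2,a1,a3}})" by (simp add: insert_commute)
  also have "pl_equiv \<dots> ((G \<union> {{v2,a2,a3},{v2,a1,a3}}) \<union> {{v3,a2,v2},{v3,a1,v2},{v3,a1,a2}})"
  proof (rule pl_equiv_subdivide_face)
    show "triples (insert {a1,a2,v2} (G \<union> {{v2,a2,a3},{v2,a1,a3}}))" using tG d by (auto intro!: tU)
    have "a3 \<notin> {a1,a2,v2}" using d by auto
    then show "{a1,a2,v2} \<notin> G \<union> {{v2,a2,a3},{v2,a1,a3}}" using nG[of "{a1,a2,v2}"] by blast
    show "v3 \<notin> \<Union>(insert {a1,a2,v2} (G \<union> {{v2,a2,a3},{v2,a1,a3}}))" using n3 d by auto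
  qed
  also have "\<dots> = insert {a2,v2,v3} (G \<union> {{v2,a2,a3},{v2,a1,a3},{v3,a1,v2},{v3,a1,a2}})"
    by (simp add: insert_commute)
  also have "pl_equiv \<dots> ((G \<union> {{v2,a2,a3},{v2,a1,a3},{v3,a1,v2},{v3,a1,a2}}) \<union> {{v1,v2,v3},{v1,a2,v3},{v1,a2,v2}})"
  proof (rule pl_equiv_subdivide_face)
    show "triples (insert {a2,v2,v3} (G \<union> {{v2,a2,a3},{v2,a1,a3},{v3,a1,v2},{v3,a1,a2}}))" using tG d by (auto intro!: tU)
    have "a3 \<notin> {a2,v2,v3}" "a1 \<notin> {a2,v2,v3}" using d by auto
    then show "{a2,v2,v3} \<notin> G \<union> {{v2,a2,a3},{v2,a1,a3},{v3,a1,v2},{v3,a1,a2}}" using nG[of "{a2,v2,v3}"] by blast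
    show "v1 \<notin> \<Union>(insert {a2,v2,v3} (G \<union> {{v2,a2,a3},{v2,a1,a3},{v3,a1,v2},{v3,a1,a2}}))" using n1 d by auto
  qed
  also have "\<dots> = (G \<union> {{v2,a1,a3},{v3,a1,v2},{v3,a1,a2},{v1,v2,v3},{v1,a2,v3}}) \<union> {{a2,v2,v1},{a2,v2,a3}}"
    by (simp add: insert_commute)
  also have "pl_equiv \<dots> ((G \<union> {{v2,a1,a3},{v3,a1,v2},{v3,a1,a2},{v1,v2,v3},{v1,a2,v3}}) \<union> {{v1,a3,a2},{v1,a3,v2}})"
  proof (rule pl_equiv_flip)
    show "triples ((G \<union> {{v2,a1,a3},{v3,a1,v2},{v3,a1,a2},{v1,v2,v3},{v1,a2,v3}}) \<union> {{a2,v2,v1},{a2,v2,a3}})"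
      using tG d by (auto intro!: tU)
  qed (use d n1 n2 in auto)
  also have "\<dots> = G \<union> octahedron_faces v1 v2 v3 a1 a2 a3"
    unfolding octahedron_faces_def by (simp add: insert_commute)
  finally show ?thesis .
qed

subsection \<open>Triangulated disks\<close>

lemma continuous_on_const_if:
  "continuous_on S f \<Longrightarrow> continuous_on S g \<Longrightarrow> continuous_on S (\<lambda>z. if P then f z else g z)"
  by (cases P) simp_all

lemma ray_outside:
  fixes q :: complex
  assumes G: "G \<subseteq> cball 0 1" and q: "1 \<le> norm q" "q \<notin> G"
  shows "q \<in> outside G"
proof -
  let ?R = "(\<lambda>s. of_real s * q) ` {1..}"
  have "s *\<^sub>R q \<notin> G" if "s \<ge> 1" for s
  proof (cases "s = 1")
    case False
    then have "1 * 1 < s * norm q" using that q(1) by (intro mult_less_le_imp_less) auto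
    then show ?thesis using G that by (auto simp: subset_iff)
  qed (use q in simp)
  then have R: "?R \<subseteq> - G" by (auto simp: scaleR_conv_of_real)
  have con: "connected ?R" by (intro connected_continuous_image continuous_intros) auto
  have "q \<in> ?R" by (intro image_eqI[of _ _ 1]) auto
  then have sub: "?R \<subseteq> connected_component_set (- G) q"
    by (intro connected_component_maximal con R)
  have "\<not> bounded ?R"
  proof
    assume "bounded ?R"
    then obtain B where B: "\<And>z. z \<in> ?R \<Longrightarrow> norm z \<le> B" by (auto simp: bounded_iff)
    have "\<bar>B\<bar> + 2 \<le> norm (of_real (\<bar>B\<bar> + 2) * q)"
      using q(1) mult_left_mono[of 1 "norm q" "\<bar>B\<bar> + 2"] by (simp add: norm_mult)
    moreover have "of_real (\<bar>B\<bar> + 2) * q \<in> ?R" by (intro image_eqI[of _ _ "\<bar>B\<bar> + 2"]) auto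
    ultimately show False using B by fastforce
  qed
  then show ?thesis
    unfolding outside using bounded_subset[OF _ sub] by blast
qed

lemma inside_subset_cball:
  fixes G :: "complex set"
  assumes "G \<subseteq> cball 0 1" shows "inside G \<subseteq> cball 0 1"
proof
  fix q assume q: "q \<in> inside G"
  show "q \<in> cball 0 1"
  proof (rule ccontr)
    assume "q \<notin> cball 0 1"
    moreover from this have "q \<notin> G" using assms by blast
    ultimately have "q \<in> outside G" using assms ray_outside[of G q] by auto
    then show False using q inside_Int_outside by blast
  qed
qed

definition point_on_edge :: "'v \<Rightarrow> 'v \<Rightarrow> real \<Rightarrow> 'v \<Rightarrow> real" where
  "point_on_edge a b s = (\<lambda>v. if v = a then 1 - s else if v = b then s else 0)"

lemma continuous_point_on_edge: "continuous_on S (point_on_edge a b)"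
  unfolding point_on_edge_def
proof (rule continuous_on_coordinatewise_then_product)
  fix v show "continuous_on S (\<lambda>s. if v = a then 1 - s else if v = b then s else 0)"
    by (intro continuous_on_const_if continuous_intros)
qed

lemma mem_realizationI:
  assumes "finite V" "\<And>v. 0 \<le> t v" "{v. t v \<noteq> 0} \<subseteq> V" "sum t V = 1" "{v. t v \<noteq> 0} \<in> K"
  shows "t \<in> realization K"
proof -
  have "(\<Sum>v | t v \<noteq> 0. t v) = sum t V"
    using assms(1,3) by (intro sum.mono_neutral_left) auto
  then show ?thesis using assms by (simp add: realization_def)
qed

locale disk_triangulation =
  fixes K :: "'v set set" and h :: "('v \<Rightarrow> real) \<Rightarrow> complex" and h' :: "complex \<Rightarrow> 'v \<Rightarrow> real"
  assumes pure: "pure_2_complex K"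
    and homeo: "homeomorphism (realization K) (cball 0 1) h h'"
    and boundary: "h ` realization (boundary_complex K) = sphere 0 1"
begin

lemma finite_K: "finite K" and sub_K: "s \<in> K \<Longrightarrow> t \<subseteq> s \<Longrightarrow> t \<noteq> {} \<Longrightarrow> t \<in> K"
  and K_face: "s \<in> K \<Longrightarrow> \<exists>f\<in>K. card f = 3 \<and> s \<subseteq> f" and empty_K: "{} \<notin> K"
  using pure unfolding pure_2_complex_def by blast+

lemma finite_simplex: "s \<in> K \<Longrightarrow> finite s"
  using K_face by (metis card.infinite finite_subset zero_neq_numeral)

lemma finite_vertices: "finite (vertices K)"
proof -
  have "vertices K \<subseteq> \<Union>K" by (auto simp: vertices_def)
  moreover have "finite (\<Union>K)" using finite_K finite_simplex by blast
  ultimately show ?thesis by (rule finite_subset)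
qed

lemma inj_h: "inj_on h (realization K)" and im_h: "h ` realization K = cball 0 1"
  and cont_h: "continuous_on (realization K) h"
  using homeo by (auto simp: homeomorphism_def inj_on_def) metis

lemma open_map:
  assumes "open U" obtains W where "open W" "h ` (realization K \<inter> U) = cball 0 1 \<inter> W"
proof -
  have "openin (top_of_set (realization K)) (realization K \<inter> U)" using assms by blast
  then have "openin (top_of_set (cball 0 1)) (h ` (realization K \<inter> U))"
    by (rule homeomorphism_imp_open_map[OF homeo])
  then show thesis using that by (auto simp: openin_open)
qed

definition cell :: "'v set \<Rightarrow> ('v \<Rightarrow> real) set" where
  "cell s = {t \<in> realization K. {v. t v \<noteq> 0} = s}"

lemma cell_subset: "cell s \<subseteq> realization K" by (auto simp: cell_def)

lemma point_on_edge_cell: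
  assumes "adj K a b" "0 < s" "s < 1" shows "point_on_edge a b s \<in> cell {a,b}"
proof -
  have ab: "a \<noteq> b" "{a,b} \<in> K" using assms(1) by (auto simp: adj_def)
  have s: "{v. point_on_edge a b s v \<noteq> 0} = {a,b}"
    using assms ab by (auto simp: point_on_edge_def)
  have "point_on_edge a b s \<in> realization K"
    by (rule mem_realizationI[of "{a,b}"]) (use s ab assms in \<open>auto simp: point_on_edge_def\<close>)
  then show ?thesis using s by (simp add: cell_def)
qed

lemma point_on_edge_mem:
  assumes "adj K a b" "0 \<le> s" "s \<le> 1" shows "point_on_edge a b s \<in> realization K"
proof -
  have ab: "a \<noteq> b" "{a,b} \<in> K" using assms(1) by (auto simp: adj_def)
  have "{v. point_on_edge a b s v \<noteq> 0} \<subseteq> {a,b}" by (auto simp: point_on_edge_def)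
  moreover have "{v. point_on_edge a b s v \<noteq> 0} \<noteq> {}"
    using assms ab by (cases "s = 0") (auto simp: point_on_edge_def)
  ultimately show ?thesis
    by (intro mem_realizationI[of "{a,b}"]) (use sub_K ab assms in \<open>auto simp: point_on_edge_def\<close>)
qed

lemma connected_cell: "connected (cell s)"
proof -
  have "connected_component (cell s) t u" if "t \<in> cell s" "u \<in> cell s" for t u
  proof -
    define g where "g = (\<lambda>r. \<lambda>v. (1 - r) * t v + r * u v)"
    have tu: "\<And>v. 0 \<le> t v" "\<And>v. 0 \<le> u v" "{v. t v \<noteq> 0} = s" "{v. u v \<noteq> 0} = s" "s \<in> K"
      "sum t s = 1" "sum u s = 1"
      using that by (auto simp: cell_def realization_def)
    have "continuous_on {0..1} g"
      unfolding g_def by (intro continuous_on_coordinatewise_then_product continuous_intros)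
    then have "connected (g ` {0..1})" by (intro connected_continuous_image) auto
    moreover have "g r \<in> cell s" if r: "r \<in> {0..1}" for r
    proof -
      have nn: "0 \<le> g r v" for v using r tu(1,2)[of v] by (simp add: g_def)
      have supp: "{v. g r v \<noteq> 0} = s"
      proof -
        have "g r v \<noteq> 0 \<longleftrightarrow> v \<in> s" for v
        proof (cases "v \<in> s")
          case True
          then have "t v \<noteq> 0" "u v \<noteq> 0" using tu(3,4) by blast+
          then have "0 < t v" "0 < u v" using tu(1,2)[of v] by simp_all
          then have "0 < g r v" using r unfolding g_def
            by (cases "r = 0") (auto intro!: add_nonneg_pos mult_pos_pos)
          then show ?thesis using True by simp
        next
          case False
          then have "t v = 0" "u v = 0" using tu by blast+
          then show ?thesis using False by (simp add: g_def)
        qed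
        then show ?thesis by blast
      qed
      have "sum (g r) s = (1 - r) * sum t s + r * sum u s"
        by (simp add: g_def sum.distrib sum_distrib_left)
      then have "sum (g r) s = 1" using tu by simp
      then have "g r \<in> realization K"
        by (intro mem_realizationI[of s]) (use nn supp tu finite_simplex in auto)
      then show ?thesis using supp by (simp add: cell_def)
    qed
    moreover have "t = g 0" "u = g 1" by (simp_all add: g_def)
    then have "t \<in> g ` {0..1}" "u \<in> g ` {0..1}" by auto
    ultimately show ?thesis by (intro connected_componentI[of "g ` {0..1}"]) auto
  qed
  then show ?thesis by (simp add: connected_iff_connected_component)
qed

text \<open>The chart from the square \<open>\<bar>Re z\<bar> + \<bar>Im z\<bar> < 1\<close> to the union of two adjacent open faces; the
  common edge corresponds to the real axis.\<close>

definition diamond :: "'v \<Rightarrow> 'v \<Rightarrow> 'v \<Rightarrow> 'v \<Rightarrow> complex \<Rightarrow> 'v \<Rightarrow> real" where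
  "diamond a b c d z = (\<lambda>v. if v = a then (1 - \<bar>Im z\<bar> + Re z) / 2 else if v = b then (1 - \<bar>Im z\<bar> - Re z) / 2
     else if v = c then max (Im z) 0 else if v = d then max (- Im z) 0 else 0)"

lemma open_diamond:
  assumes abc: "{a,b,c} \<in> K" "{a,b,d} \<in> K" and d: "distinct [a,b,c,d]"
  shows "open (h ` (cell {a,b} \<union> cell {a,b,c} \<union> cell {a,b,d}))"
    and "connected (cell {a,b} \<union> cell {a,b,c} \<union> cell {a,b,d})"
proof -
  let ?D = "cell {a,b} \<union> cell {a,b,c} \<union> cell {a,b,d}"
  let ?O = "{z. \<bar>Im z\<bar> + \<bar>Re z\<bar> < 1}"
  have ab: "{a,b} \<in> K" using sub_K[OF abc(1)] by auto
  have cont: "continuous_on UNIV (diamond a b c d)"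
    unfolding diamond_def
  proof (rule continuous_on_coordinatewise_then_product)
    fix v
    show "continuous_on UNIV (\<lambda>z. if v = a then (1 - \<bar>Im z\<bar> + Re z) / 2 else if v = b then (1 - \<bar>Im z\<bar> - Re z) / 2
     else if v = c then max (Im z) 0 else if v = d then max (- Im z) 0 else (0::real))"
      by (intro continuous_on_const_if continuous_intros) auto
  qed
  have 1: "diamond a b c d z \<in> ?D" if z: "z \<in> ?O" for z
  proof -
    let ?t = "diamond a b c d z"
    define s where "s = {a,b} \<union> (if Im z > 0 then {c} else {}) \<union> (if Im z < 0 then {d} else {})"
    have nn: "0 \<le> ?t v" for v using z by (auto simp: diamond_def abs_if split: if_splits)
    have supp: "{v. ?t v \<noteq> 0} = s"
      using z d by (auto simp: s_def diamond_def max_def abs_if split: if_splits)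
    have sK: "s \<in> K" using ab abc by (auto simp: s_def insert_commute)
    have "sum ?t {a,b,c,d} = ?t a + ?t b + ?t c + ?t d" using d by simp
    also have "\<dots> = 1" using d by (auto simp: diamond_def max_def abs_if field_simps)
    finally have "sum ?t {a,b,c,d} = 1" .
    then have "?t \<in> realization K"
      by (intro mem_realizationI[of "{a,b,c,d}"]) (use nn supp sK in \<open>auto simp: s_def\<close>)
    then have "?t \<in> cell s" using supp by (simp add: cell_def)
    moreover have "s = {a,b} \<or> s = {a,b,c} \<or> s = {a,b,d}" by (auto simp: s_def)
    ultimately show ?thesis by blast
  qed
  have 2: "t \<in> diamond a b c d ` ?O" if t: "t \<in> ?D" for t
  proof -
    have nn: "0 \<le> t v" for v using t by (auto simp: cell_def realization_def)
    obtain s where s: "{v. t v \<noteq> 0} = s" "s = {a,b} \<or> s = {a,b,c} \<or> s = {a,b,d}" "sum t s = 1"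
      using t by (auto simp: cell_def realization_def)
    have pos: "0 < t a" "0 < t b" using s(1,2) nn[of a] nn[of b] by (auto simp: less_le)
    have sum1: "t a + t b + t c + t d = 1"
    proof -
      have "sum t {a,b,c,d} = sum t s"
        using s(1,2) by (intro sum.mono_neutral_right) auto
      then show ?thesis using s(3) d by simp
    qed
    have cd: "t c = 0 \<or> t d = 0" using s(1,2) d by auto
    have z0: "t v = 0" if "v \<notin> {a,b,c,d}" for v using that s(1,2) by auto
    let ?z = "Complex (t a - t b) (t c - t d)"
    have ab: "\<bar>t c - t d\<bar> = t c + t d" "max (t c - t d) 0 = t c" "max (t d - t c) 0 = t d"
      using cd nn[of c] nn[of d] by auto
    have e: "diamond a b c d ?z = t"
    proof
      fix v
      consider "v = a" | "v = b" | "v = c" | "v = d" | "v \<notin> {a,b,c,d}" by blast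
      then show "diamond a b c d ?z v = t v"
      proof cases
        case 5
        then show ?thesis using z0[OF 5] by (simp add: diamond_def)
      qed (use d ab sum1 in \<open>auto simp: diamond_def\<close>)
    qed
    have "\<bar>t a - t b\<bar> < t a + t b" using pos by linarith
    then have "?z \<in> ?O" using ab(1) sum1 by simp
    then show ?thesis using e by (metis imageI)
  qed
  have D: "diamond a b c d ` ?O = ?D" using 1 2 by blast
  have inj: "inj_on (diamond a b c d) ?O"
  proof (rule inj_onI)
    fix z w assume "diamond a b c d z = diamond a b c d w"
    then have e: "diamond a b c d z v = diamond a b c d w v" for v by simp
    have "max (Im z) 0 = max (Im w) 0" "max (- Im z) 0 = max (- Im w) 0"
      using e[of c] e[of d] d by (auto simp: diamond_def)
    then have "Im z = Im w" by (auto simp: max_def split: if_splits)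
    moreover from this have "Re z = Re w" using e[of a] by (simp add: diamond_def)
    ultimately show "z = w" by (rule complex_eqI[rotated])
  qed
  have sub: "?D \<subseteq> realization K" using cell_subset by blast
  have op: "open ?O" by (intro open_Collect_less continuous_intros)
  have "open ((h \<circ> diamond a b c d) ` ?O)"
  proof (rule invariance_of_domain[OF _ op])
    show "continuous_on ?O (h \<circ> diamond a b c d)"
      using cont cont_h sub D by (intro continuous_on_compose) (auto intro: continuous_on_subset)
    show "inj_on (h \<circ> diamond a b c d) ?O"
      using inj inj_h sub D by (intro comp_inj_on) (auto intro: inj_on_subset)
  qed
  then show "open (h ` ?D)" unfolding image_comp[symmetric] D .
  have "convex ?O"
  proof -
    have "?O = {z. \<bar>Im z\<bar> + \<bar>Re z\<bar> < 1}" ..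
    have "\<bar>Im ((1-u) *\<^sub>R x + u *\<^sub>R y)\<bar> + \<bar>Re ((1-u) *\<^sub>R x + u *\<^sub>R y)\<bar> < 1"
      if "x \<in> ?O" "y \<in> ?O" "0 \<le> u" "u \<le> 1" for x y :: complex and u
    proof -
      have "\<bar>Im ((1-u) *\<^sub>R x + u *\<^sub>R y)\<bar> \<le> (1-u) * \<bar>Im x\<bar> + u * \<bar>Im y\<bar>"
        "\<bar>Re ((1-u) *\<^sub>R x + u *\<^sub>R y)\<bar> \<le> (1-u) * \<bar>Re x\<bar> + u * \<bar>Re y\<bar>"
        using that abs_triangle_ineq[of "(1-u) * Im x" "u * Im y"] abs_triangle_ineq[of "(1-u) * Re x" "u * Re y"]
        by (simp_all add: abs_mult)
      moreover have "(1-u) * (\<bar>Im x\<bar> + \<bar>Re x\<bar>) + u * (\<bar>Im y\<bar> + \<bar>Re y\<bar>) < 1"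
        using that by (intro convex_bound_lt) auto
      ultimately show ?thesis by (simp add: algebra_simps)
    qed
    then show ?thesis by (auto simp: convex_alt)
  qed
  then show "connected ?D"
    unfolding D[symmetric] using cont
    by (intro connected_continuous_image convex_connected) (auto intro: continuous_on_subset)
qed

lemma near_start:
  fixes g :: "real \<Rightarrow> 'v \<Rightarrow> real"
  assumes g: "continuous_on {0..1} g" "g ` {0..1} \<subseteq> realization K" and W: "open W" "h (g 0) \<in> W"
  obtains s where "0 < s" "s < 1" "h (g s) \<in> W"
proof -
  have "continuous_on {0..1} (h \<circ> g)"
    using g cont_h by (intro continuous_on_compose) (auto intro: continuous_on_subset)
  then obtain U where U: "open U" "U \<inter> {0..1} = (h \<circ> g) -` W \<inter> {0..1::real}"
    using W(1) unfolding continuous_on_open_invariant by metis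
  have "0 \<in> U" using U(2) W(2) by force
  then obtain e where e: "e > 0" "ball 0 e \<subseteq> U" using U(1) open_contains_ball by blast
  let ?s = "min (e / 2) (1 / 2)"
  have "?s \<in> U \<inter> {0..1}" using e by (auto simp: subset_iff dist_real_def)
  then have "h (g ?s) \<in> W" using U(2) by auto
  then show thesis using that[of ?s] e(1) by auto
qed

definition edge_to_face :: "'v \<Rightarrow> 'v \<Rightarrow> 'v \<Rightarrow> real \<Rightarrow> 'v \<Rightarrow> real" where
  "edge_to_face a b c s = (\<lambda>v. if v = c then s else if v = a \<or> v = b then (1 - s) / 2 else 0)"

lemma edge_to_face:
  assumes abc: "{a,b,c} \<in> K" "distinct [a,b,c]"
  shows "continuous_on {0..1} (edge_to_face a b c)" "edge_to_face a b c ` {0..1} \<subseteq> realization K"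
    and "edge_to_face a b c 0 = point_on_edge a b (1/2)"
    and "0 < s \<Longrightarrow> s < 1 \<Longrightarrow> edge_to_face a b c s \<in> cell {a,b,c}"
proof -
  show "continuous_on {0..1} (edge_to_face a b c)"
    unfolding edge_to_face_def
  proof (rule continuous_on_coordinatewise_then_product)
    fix v
    show "continuous_on {0..1} (\<lambda>s::real. if v = c then s else if v = a \<or> v = b then (1 - s) / 2 else 0)"
      by (intro continuous_on_const_if continuous_intros) auto
  qed
  have mem: "edge_to_face a b c s \<in> realization K" if "0 \<le> s" "s \<le> 1" for s
  proof (rule mem_realizationI[of "{a,b,c}"])
    have "{v. edge_to_face a b c s v \<noteq> 0} \<subseteq> {a,b,c}" by (auto simp: edge_to_face_def)
    moreover have "{v. edge_to_face a b c s v \<noteq> 0} \<noteq> {}"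
      using abc by (cases "s = 0") (auto simp: edge_to_face_def)
    ultimately show "{v. edge_to_face a b c s v \<noteq> 0} \<in> K" using sub_K[OF abc(1)] by blast
  qed (use that abc(2) in \<open>auto simp: edge_to_face_def\<close>)
  then show "edge_to_face a b c ` {0..1} \<subseteq> realization K" by auto
  show "edge_to_face a b c 0 = point_on_edge a b (1/2)"
    using abc(2) by (auto simp: edge_to_face_def point_on_edge_def fun_eq_iff)
  show "edge_to_face a b c s \<in> cell {a,b,c}" if "0 < s" "s < 1"
    using mem[of s] that abc(2) by (auto simp: cell_def edge_to_face_def)
qed

lemma adjI: "{a,b,c} \<in> K \<Longrightarrow> a \<noteq> b \<Longrightarrow> adj K a b"
  unfolding adj_def using sub_K[of "{a,b,c}" "{a,b}"] by blast

lemma face_cases: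
  assumes "f \<in> faces K" "{a,b} \<subseteq> f" "a \<noteq> b" obtains c where "f = {a,b,c}" "distinct [a,b,c]"
proof -
  have f: "card f = 3" "finite f" using assms finite_simplex by (auto simp: faces_def)
  then have "card (f - {a,b}) = 1" using assms by (simp add: card_Diff_subset)
  then obtain c where "f - {a,b} = {c}" by (auto simp: card_1_singleton_iff)
  then have "f = {a,b,c}" "distinct [a,b,c]" using assms by auto
  then show thesis by (rule that)
qed

lemma faceI: "{a,b,c} \<in> K \<Longrightarrow> distinct [a,b,c] \<Longrightarrow> {a,b,c} \<in> faces K"
  by (simp add: faces_def)

lemma edge_in_face:
  assumes "adj K a b" obtains c where "{a,b,c} \<in> K" "distinct [a,b,c]"
proof -
  obtain f where "f \<in> K" "card f = 3" "{a,b} \<subseteq> f" using K_face[of "{a,b}"] assms by (auto simp: adj_def)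
  moreover from this have "f \<in> faces K" by (simp add: faces_def)
  ultimately show thesis using that face_cases assms unfolding adj_def by metis
qed

lemma edge_in_two_faces:
  assumes "{a,b,c} \<in> K" "{a,b,d} \<in> K" "{a,b,e} \<in> K" "distinct [a,b,c]" "distinct [a,b,d]" "distinct [a,b,e]"
  shows "c = d \<or> c = e \<or> d = e"
proof (rule ccontr)
  assume "\<not> ?thesis"
  then have n: "c \<noteq> d" "c \<noteq> e" "d \<noteq> e" by auto
  let ?D = "cell {a,b} \<union> cell {a,b,c} \<union> cell {a,b,d}"
  have ab: "adj K a b" using assms adjI by auto
  have o: "open (h ` ?D)" using open_diamond(1)[OF assms(1,2)] n assms by auto
  have "point_on_edge a b (1/2) \<in> ?D" using point_on_edge_cell[OF ab] by simp
  then have "h (edge_to_face a b e 0) \<in> h ` ?D" using edge_to_face(3)[OF assms(3,6)] by simp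
  then obtain s where s: "0 < s" "s < 1" "h (edge_to_face a b e s) \<in> h ` ?D"
    using near_start[OF edge_to_face(1,2)[OF assms(3,6)] o] by blast
  have c: "edge_to_face a b e s \<in> cell {a,b,e}" by (rule edge_to_face(4)[OF assms(3,6) s(1,2)])
  then have "edge_to_face a b e s \<in> ?D"
    using s(3) inj_on_image_mem_iff[OF inj_h, of _ ?D] cell_subset by blast
  then have "{a,b,e} = {a,b} \<or> {a,b,e} = {a,b,c} \<or> {a,b,e} = {a,b,d}" using c by (auto simp: cell_def)
  then show False using n assms(4-6) by auto
qed

lemma edge_star:
  assumes "adj K a b"
  obtains (boundary) c where "{a,b} \<in> boundary_edges K" "distinct [a,b,c]" "{f\<in>faces K. {a,b} \<subseteq> f} = {{a,b,c}}"
  | (inner) c d where "{a,b} \<notin> boundary_edges K" "distinct [a,b,c,d]"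
      "{f\<in>faces K. {a,b} \<subseteq> f} = {{a,b,c},{a,b,d}}"
proof -
  obtain c where c: "{a,b,c} \<in> K" "distinct [a,b,c]" using edge_in_face[OF assms] .
  have ab: "a \<noteq> b" "{a,b} \<in> K" using assms by (auto simp: adj_def)
  show thesis
  proof (cases "\<exists>d. {a,b,d} \<in> K \<and> distinct [a,b,d] \<and> d \<noteq> c")
    case True
    then obtain d where d: "{a,b,d} \<in> K" "distinct [a,b,d]" "d \<noteq> c" by blast
    have s: "{f\<in>faces K. {a,b} \<subseteq> f} = {{a,b,c},{a,b,d}}"
    proof -
      have "f = {a,b,c} \<or> f = {a,b,d}" if f: "f \<in> faces K" "{a,b} \<subseteq> f" for f
      proof -
        obtain e where e: "f = {a,b,e}" "distinct [a,b,e]" using face_cases[OF f ab(1)] .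
        then have "{a,b,e} \<in> K" using f by (simp add: faces_def)
        then show ?thesis using edge_in_two_faces[OF c(1) d(1) _ c(2) d(2) e(2)] d(3) e(1) by blast
      qed
      then show ?thesis using faceI[OF c] faceI[OF d(1,2)] by blast
    qed
    have "{a,b,c} \<noteq> {a,b,d}" using c(2) d by auto
    then have "card {f\<in>faces K. {a,b} \<subseteq> f} \<noteq> 1" unfolding s by simp
    then have "{a,b} \<notin> boundary_edges K" by (simp only: boundary_edges_def mem_Collect_eq simp_thms)
    then show thesis using inner[of c d] s c(2) d by auto
  next
    case False
    have s: "{f\<in>faces K. {a,b} \<subseteq> f} = {{a,b,c}}"
    proof -
      have "f = {a,b,c}" if f: "f \<in> faces K" "{a,b} \<subseteq> f" for f
      proof -
        obtain e where e: "f = {a,b,e}" "distinct [a,b,e]" using face_cases[OF f ab(1)] .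
        then show ?thesis using False f by (auto simp: faces_def)
      qed
      then show ?thesis using faceI[OF c] by blast
    qed
    then have "{a,b} \<in> boundary_edges K" using ab by (simp add: boundary_edges_def)
    then show thesis using boundary s c(2) by blast
  qed
qed

lemma link_connected:
  assumes A: "A \<subseteq> {y. adj K x y}" "A \<noteq> {}"
    and cl: "\<And>y z. y \<in> A \<Longrightarrow> {x,y,z} \<in> K \<Longrightarrow> distinct [x,y,z] \<Longrightarrow> z \<in> A"
  shows "A = {y. adj K x y}"
proof (rule ccontr)
  assume neq: "A \<noteq> {y. adj K x y}"
  define B where "B = {y. adj K x y} - A"
  have B: "B \<noteq> {}" "B \<subseteq> {y. adj K x y}" "A \<inter> B = {}" using neq A by (auto simp: B_def)
  have "{y. adj K x y} \<subseteq> vertices K"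
  proof
    fix y assume "y \<in> {y. adj K x y}"
    then show "y \<in> vertices K" using sub_K[of "{x,y}" "{y}"] by (simp add: adj_def vertices_def)
  qed
  then have fin: "finite A" "finite B" using finite_vertices A(1) B(2) by (meson finite_subset order_trans)+
  let ?X = "realization K"
  have pos: "0 < sum t C \<longleftrightarrow> (\<exists>y\<in>C. t y \<noteq> 0)" if "t \<in> ?X" "finite C" for t C
    using that sum_nonneg_eq_0_iff[of C t] sum_nonneg[of C t] by (auto simp: realization_def less_le)
  have op: "open {t :: 'v \<Rightarrow> real. 0 < t x \<and> 0 < sum t C}" for C
    by (intro open_Collect_conj open_Collect_less continuous_intros continuous_on_product_coordinates)
  obtain WA where WA: "open WA" "h ` (?X \<inter> {t. 0 < t x \<and> 0 < sum t A}) = cball 0 1 \<inter> WA"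
    using open_map[OF op] .
  obtain WB where WB: "open WB" "h ` (?X \<inter> {t. 0 < t x \<and> 0 < sum t B}) = cball 0 1 \<inter> WB"
    using open_map[OF op] .
  have "open {t :: 'v \<Rightarrow> real. 0 < t x}"
    by (intro open_Collect_less continuous_intros continuous_on_product_coordinates)
  then obtain W where W: "open W" "h ` (?X \<inter> {t. 0 < t x}) = cball 0 1 \<inter> W"
    using open_map by blast
  define pt where "pt = (\<lambda>v. if v = x then 1 else 0 :: real)"
  have ptE: "point_on_edge x y 0 = pt" for y by (auto simp: point_on_edge_def pt_def)
  obtain y0 where y0: "y0 \<in> A" using A by blast
  then have pt: "pt \<in> ?X" using point_on_edge_mem[of x y0 0] A ptE by auto
  define p where "p = h pt"
  have "p \<in> cball 0 1 \<inter> W" unfolding p_def W(2)[symmetric] using pt by (simp add: pt_def)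
  then obtain e where e: "0 < e" "ball p e \<subseteq> W" and p1: "p \<in> cball 0 1" using W(1) open_contains_ball by blast
  let ?C = "ball p e \<inter> cball 0 1"
  have "p \<in> closure (ball 0 1)" using p1 by simp
  then have "ball p e \<inter> ball 0 1 \<noteq> {}"
    using e(1) by (metis Int_commute centre_in_ball closure_iff_nhds_not_empty open_ball order_refl)
  moreover have "ball p e \<inter> ball 0 1 \<subseteq> interior ?C" by (intro interior_maximal) auto
  ultimately have "interior ?C \<noteq> {}" by blast
  then have "aff_dim ?C = 2" using aff_dim_nonempty_interior[of ?C] by simp
  then have con: "connected (?C - {p})"
    by (intro connected_punctured_convex convex_Int) auto
  have sub: "?C - {p} \<subseteq> WA \<union> WB"
  proof
    fix q assume q: "q \<in> ?C - {p}"
    then have "q \<in> h ` (?X \<inter> {t. 0 < t x})" using e(2) W(2) by blast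
    then obtain t where t: "t \<in> ?X" "0 < t x" "q = h t" by blast
    then have sK: "{v. t v \<noteq> 0} \<in> K" "(\<Sum>v | t v \<noteq> 0. t v) = 1" by (auto simp: realization_def)
    have "\<exists>y. y \<noteq> x \<and> t y \<noteq> 0"
    proof (rule ccontr)
      assume n: "\<not> ?thesis"
      then have "{v. t v \<noteq> 0} = {x}" using t(2) by auto
      then have "t x = 1" using sK by simp
      then have "t = pt" using n by (auto simp: pt_def fun_eq_iff)
      then show False using q t(3) by (simp add: p_def)
    qed
    then obtain y where y: "y \<noteq> x" "t y \<noteq> 0" by blast
    then have "{x,y} \<in> K" using t(2) sub_K[OF sK(1), of "{x,y}"] by auto
    then have "adj K x y" using y by (auto simp: adj_def)
    then have "y \<in> A \<or> y \<in> B" by (auto simp: B_def)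
    then have "0 < sum t A \<or> 0 < sum t B"
      using pos[OF t(1) fin(1)] pos[OF t(1) fin(2)] y(2) by blast
    then have "q \<in> cball 0 1 \<inter> WA \<or> q \<in> cball 0 1 \<inter> WB"
      unfolding WA(2)[symmetric] WB(2)[symmetric] using t by blast
    then show "q \<in> WA \<union> WB" by blast
  qed
  have disj: "WA \<inter> WB \<inter> (?C - {p}) = {}"
  proof (rule ccontr)
    assume "WA \<inter> WB \<inter> (?C - {p}) \<noteq> {}"
    then obtain q where "q \<in> cball 0 1 \<inter> WA" "q \<in> cball 0 1 \<inter> WB" by blast
    then obtain t u where t: "t \<in> ?X" "u \<in> ?X" "h t = h u" "0 < t x" "0 < sum t A" "0 < sum u B"
      unfolding WA(2)[symmetric] WB(2)[symmetric] by (auto simp: image_iff)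
    then have "t = u" using inj_h by (simp add: inj_on_def)
    then have "\<exists>y\<in>A. t y \<noteq> 0" "\<exists>z\<in>B. t z \<noteq> 0"
      using pos[OF t(1) fin(1)] pos[OF t(1) fin(2)] t(5,6) by simp_all
    then obtain y z where y: "y \<in> A" "t y \<noteq> 0" and z: "z \<in> B" "t z \<noteq> 0" by blast
    have "{x,y,z} \<in> K"
      using sub_K[of "{v. t v \<noteq> 0}" "{x,y,z}"] t(1,4) y z by (auto simp: realization_def)
    moreover have "distinct [x,y,z]" using y(1) z(1) A B by (auto simp: adj_def)
    ultimately show False using cl y(1) z(1) B(3) by blast
  qed
  have meet: "WC \<inter> (?C - {p}) \<noteq> {}" if C: "C \<subseteq> {y. adj K x y}" "C \<noteq> {}" "finite C"
    and WC: "h ` (?X \<inter> {t. 0 < t x \<and> 0 < sum t C}) = cball 0 1 \<inter> WC" for C WC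
  proof -
    obtain y where y: "y \<in> C" "adj K x y" using C by blast
    let ?g = "point_on_edge x y"
    have g: "?g ` {0..1} \<subseteq> ?X" using point_on_edge_mem[OF y(2)] by auto
    obtain s where s: "0 < s" "s < 1" "h (?g s) \<in> ball p e"
      using near_start[OF continuous_point_on_edge g, of "ball p e"] e(1) ptE by (auto simp: p_def)
    have gX: "?g s \<in> ?X" using s g by auto
    have xy: "x \<noteq> y" using y by (auto simp: adj_def)
    have "?g s y \<noteq> 0" "0 < ?g s x" using s xy by (auto simp: point_on_edge_def)
    then have "0 < sum (?g s) C" using pos[OF gX C(3)] y(1) by blast
    then have "h (?g s) \<in> cball 0 1 \<inter> WC" unfolding WC[symmetric] using gX \<open>0 < ?g s x\<close> by blast
    moreover have "?g s \<noteq> pt" using s xy by (auto simp: pt_def point_on_edge_def fun_eq_iff)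
    then have "h (?g s) \<noteq> p" using inj_h gX pt unfolding p_def by (auto simp: inj_on_def)
    ultimately show ?thesis using s(3) by blast
  qed
  show False
    using connectedD[OF con WA(1) WB(1) disj sub] meet[OF A(1,2) fin(1) WA(2)] meet[OF B(2,1) fin(2) WB(2)]
    by blast
qed

lemma complex_connected:
  assumes A: "A \<subseteq> vertices K" "A \<noteq> {}" and cl: "\<And>x y. x \<in> A \<Longrightarrow> adj K x y \<Longrightarrow> y \<in> A"
  shows "A = vertices K"
proof (rule ccontr)
  assume neq: "A \<noteq> vertices K"
  define B where "B = vertices K - A"
  have fin: "finite A" "finite B" using finite_vertices A(1) by (auto simp: B_def intro: finite_subset)
  let ?X = "realization K"
  have pos: "0 < sum t C \<longleftrightarrow> (\<exists>y\<in>C. t y \<noteq> 0)" if "t \<in> ?X" "finite C" for t C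
    using that sum_nonneg_eq_0_iff[of C t] sum_nonneg[of C t] by (auto simp: realization_def less_le)
  have op: "open {t :: 'v \<Rightarrow> real. 0 < sum t C}" for C
    by (intro open_Collect_less continuous_intros continuous_on_product_coordinates)
  have con: "connected ?X"
  proof -
    have "h' ` cball 0 1 = ?X" "continuous_on (cball 0 1) h'" using homeo by (auto simp: homeomorphism_def)
    then show ?thesis using connected_continuous_image[of "cball 0 1" h'] convex_connected[OF convex_cball] by metis
  qed
  have ptX: "(\<lambda>v. if v = x then 1 else 0) \<in> ?X" if "x \<in> vertices K" for x
    by (rule mem_realizationI[of "{x}"]) (use that in \<open>auto simp: vertices_def\<close>)
  have meet: "{t. 0 < sum t C} \<inter> ?X \<noteq> {}" if C: "C \<subseteq> vertices K" "C \<noteq> {}" "finite C" for C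
  proof -
    obtain x where x: "x \<in> C" using C by blast
    have "0 < (\<Sum>v\<in>C. if v = x then 1 else 0 :: real)" using x C(3) by simp
    then show ?thesis using ptX[of x] x C(1) by blast
  qed
  have "?X \<subseteq> {t. 0 < sum t A} \<union> {t. 0 < sum t B}"
  proof
    fix t assume t: "t \<in> ?X"
    then have "{v. t v \<noteq> 0} \<noteq> {}" using empty_K unfolding realization_def by (metis (mono_tags, lifting) mem_Collect_eq)
    then obtain v where v: "t v \<noteq> 0" by blast
    then have "{v} \<in> K" using t sub_K[of "{v. t v \<noteq> 0}" "{v}"] by (auto simp: realization_def)
    then have "v \<in> A \<or> v \<in> B" by (auto simp: B_def vertices_def)
    then have "0 < sum t A \<or> 0 < sum t B"
      using pos[OF t fin(1)] pos[OF t fin(2)] v by blast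
    then show "t \<in> {t. 0 < sum t A} \<union> {t. 0 < sum t B}" by simp
  qed
  moreover have "{t. 0 < sum t A} \<inter> {t. 0 < sum t B} \<inter> ?X = {}"
  proof (rule ccontr)
    assume "\<not> ?thesis"
    then obtain t where t: "t \<in> ?X" "0 < sum t A" "0 < sum t B" by blast
    then have "\<exists>y\<in>A. t y \<noteq> 0" "\<exists>z\<in>B. t z \<noteq> 0"
      using pos[OF t(1) fin(1)] pos[OF t(1) fin(2)] by simp_all
    then obtain y z where y: "y \<in> A" "t y \<noteq> 0" and z: "z \<in> B" "t z \<noteq> 0" by blast
    have "{y,z} \<in> K" using sub_K[of "{v. t v \<noteq> 0}" "{y,z}"] t(1) y z by (auto simp: realization_def)
    then have "adj K y z" using y z by (auto simp: adj_def B_def)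
    then show False using cl y z by (auto simp: B_def)
  qed
  ultimately have "{t. 0 < sum t A} \<inter> ?X = {} \<or> {t. 0 < sum t B} \<inter> ?X = {}"
    using connectedD[OF con op op] by blast
  then show False using meet[of A] meet[of B] A fin neq by (auto simp: B_def)
qed

lemma boundary_edges_nonempty: "boundary_edges K \<noteq> {}"
proof
  assume "boundary_edges K = {}"
  then have "realization (boundary_complex K) = {}" by (auto simp: realization_def boundary_complex_def)
  then have "sphere 0 1 = ({} :: complex set)" using boundary by simp
  then show False by (metis empty_iff mem_sphere_0 norm_one)
qed

lemma cell_on_sphere:
  assumes "t \<in> realization K" "{v. t v \<noteq> 0} = s"
  shows "h t \<in> sphere 0 1 \<longleftrightarrow> s \<in> boundary_complex K"
proof
  assume "h t \<in> sphere 0 1"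
  then obtain u where u: "u \<in> realization (boundary_complex K)" "h t = h u" using boundary by (metis imageE)
  then have "t = u"
    using inj_h assms(1) realization_boundary_subset[OF pure] by (auto simp: inj_on_def)
  then show "s \<in> boundary_complex K" using u assms by (auto simp: realization_def)
next
  assume "s \<in> boundary_complex K"
  then have "t \<in> realization (boundary_complex K)" using assms by (auto simp: realization_def)
  then show "h t \<in> sphere 0 1" using boundary by blast
qed

lemma midpoint_cell:
  assumes "adj K a b" shows "point_on_edge a b (1/2) \<in> cell {a,b}"
  using point_on_edge_cell[OF assms] by simp

definition filling :: "complex set \<Rightarrow> 'v set set" where
  "filling G = {f \<in> faces K. h ` cell f \<subseteq> inside G}"

lemma filling_parity:
  assumes c: "simple_path c" "pathfinish c = pathstart c" and G: "G = path_image c"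
    and Gsub: "G \<subseteq> cball 0 1" and Gf: "\<And>f. f \<in> faces K \<Longrightarrow> G \<inter> h ` cell f = {}"
    and ab: "adj K a b" and e: "G \<inter> h ` cell {a,b} = {} \<or> h ` cell {a,b} \<subseteq> G"
  shows "odd (card {f \<in> filling G. {a,b} \<subseteq> f}) \<longleftrightarrow> h ` cell {a,b} \<subseteq> G"
proof -
  note J = Jordan_inside_outside[OF c, folded G]
  have op: "open (inside G)" "open (outside G)"
    and fr: "frontier (inside G) = G" "frontier (outside G) = G" using J by blast+
  have dich: "A \<subseteq> inside G \<or> A \<subseteq> outside G" if "connected A" "G \<inter> A = {}" for A
  proof -
    have A: "A \<subseteq> inside G \<union> outside G" unfolding inside_Un_outside using that(2) by blast
    have "inside G \<inter> outside G \<inter> A = {}" by simp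
    then have "inside G \<inter> A = {} \<or> outside G \<inter> A = {}"
      using connectedD[OF that(1) op] A by blast
    then show ?thesis using A by blast
  qed
  have conn: "connected (h ` D)" if "connected D" "D \<subseteq> realization K" for D
    using that cont_h by (intro connected_continuous_image) (auto intro: continuous_on_subset)
  have cellc: "connected (h ` cell f)" for f by (rule conn[OF connected_cell cell_subset])
  have face_ne: "cell {a,b,c} \<noteq> {}" if "{a,b,c} \<in> K" "distinct [a,b,c]" for c
    using edge_to_face(4)[OF that, of "1/2"] by auto
  let ?m = "point_on_edge a b (1/2)"
  have m: "?m \<in> cell {a,b}" by (rule midpoint_cell[OF ab])
  have star: "{f \<in> filling G. {a,b} \<subseteq> f} = {f \<in> {f\<in>faces K. {a,b} \<subseteq> f}. h ` cell f \<subseteq> inside G}"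
    by (auto simp: filling_def)
  from ab show ?thesis
  proof (cases rule: edge_star)
    case (boundary c)
    have abc: "{a,b,c} \<in> faces K" using boundary(3) by blast
    then have abcK: "{a,b,c} \<in> K" by (simp add: faces_def)
    have crd: "odd (card {f \<in> filling G. {a,b} \<subseteq> f}) \<longleftrightarrow> h ` cell {a,b,c} \<subseteq> inside G"
    proof -
      have "{f \<in> filling G. {a,b} \<subseteq> f} = (if h ` cell {a,b,c} \<subseteq> inside G then {{a,b,c}} else {})"
        unfolding star boundary(3) by auto
      then show ?thesis by simp
    qed
    show ?thesis
    proof (cases "h ` cell {a,b} \<subseteq> G")
      case False
      then have mG: "h ?m \<notin> G" using e m by blast
      have "{a,b} \<in> boundary_complex K" using boundary(1) by (auto simp: boundary_complex_def)
      then have "h ?m \<in> sphere 0 1" using cell_on_sphere[of ?m "{a,b}"] m by (auto simp: cell_def)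
      then have "h ?m \<in> outside G" using ray_outside[OF Gsub _ mG] by simp
      then have "h (edge_to_face a b c 0) \<in> outside G" unfolding edge_to_face(3)[OF abcK boundary(2)] .
      then obtain s where s: "0 < s" "s < 1" "h (edge_to_face a b c s) \<in> outside G"
        by (rule near_start[OF edge_to_face(1,2)[OF abcK boundary(2)] op(2)])
      then have "\<not> h ` cell {a,b,c} \<subseteq> inside G"
        using edge_to_face(4)[OF abcK boundary(2) s(1,2)] inside_Int_outside[of G] by blast
      then show ?thesis using crd False by blast
    next
      case True
      have "open {t :: 'v \<Rightarrow> real. 0 < t a \<and> 0 < t b}"
        by (intro open_Collect_conj open_Collect_less continuous_intros continuous_on_product_coordinates)
      then obtain W where W: "open W" "h ` (realization K \<inter> {t. 0 < t a \<and> 0 < t b}) = cball 0 1 \<inter> W"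
        using open_map by blast
      have "?m \<in> realization K \<inter> {t. 0 < t a \<and> 0 < t b}"
        using m ab by (auto simp: cell_def point_on_edge_def adj_def)
      then have "h ?m \<in> W" using W(2) by blast
      moreover have "h ?m \<in> frontier (inside G)" unfolding fr using True m by blast
      then have "h ?m \<in> closure (inside G)" by (simp add: frontier_def)
      ultimately have "W \<inter> inside G \<noteq> {}" using W(1) closure_iff_nhds_not_empty by blast
      then obtain q where q: "q \<in> W" "q \<in> inside G" by blast
      then have "q \<in> cball 0 1 \<inter> W" using inside_subset_cball[OF Gsub] by blast
      then obtain t where t: "t \<in> realization K" "0 < t a" "0 < t b" "q = h t" using W(2) by blast
      let ?s = "{v. t v \<noteq> 0}"
      have ts: "t \<in> cell ?s" and sK: "?s \<in> K" using t(1) by (auto simp: cell_def realization_def)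
      have abs: "{a,b} \<subseteq> ?s" using t by auto
      obtain f where f: "f \<in> K" "card f = 3" "?s \<subseteq> f" using K_face[OF sK] by blast
      then have "f \<in> {f\<in>faces K. {a,b} \<subseteq> f}" using abs by (auto simp: faces_def)
      then have "f = {a,b,c}" unfolding boundary(3) by simp
      then have sub: "?s \<subseteq> {a,b,c}" using f(3) by simp
      have "?s \<noteq> {a,b}"
      proof
        assume "?s = {a,b}"
        then have "q \<in> G" using True ts t(4) by auto
        then show False using q(2) inside_no_overlap[of G] by blast
      qed
      then have "?s = {a,b,c}" using sub abs by blast
      then have "q \<in> h ` cell {a,b,c}" using ts t(4) by (metis imageI)
      then have "\<not> h ` cell {a,b,c} \<subseteq> outside G" using q(2) inside_Int_outside[of G] by blast
      then have "h ` cell {a,b,c} \<subseteq> inside G" using dich[OF cellc] Gf[OF abc] by blast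
      then show ?thesis using crd True by blast
    qed
  next
    case (inner c d)
    have abc: "{a,b,c} \<in> faces K" "{a,b,d} \<in> faces K" using inner(3) by blast+
    then have abcK: "{a,b,c} \<in> K" "{a,b,d} \<in> K" by (simp_all add: faces_def)
    have d3: "distinct [a,b,c]" "distinct [a,b,d]" using inner(2) by auto
    let ?D = "cell {a,b} \<union> cell {a,b,c} \<union> cell {a,b,d}"
    have oD: "open (h ` ?D)" and cD: "connected (h ` ?D)"
      using open_diamond[OF abcK inner(2)] conn[of ?D] cell_subset by blast+
    have mD: "h ?m \<in> h ` ?D" using m by blast
    have ne: "{a,b,c} \<noteq> {a,b,d}" using inner(2) by auto
    have crd: "odd (card {f \<in> filling G. {a,b} \<subseteq> f}) \<longleftrightarrow>
       (h ` cell {a,b,c} \<subseteq> inside G) \<noteq> (h ` cell {a,b,d} \<subseteq> inside G)"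
    proof -
      have "{f \<in> filling G. {a,b} \<subseteq> f} = (if h ` cell {a,b,c} \<subseteq> inside G then {{a,b,c}} else {})
         \<union> (if h ` cell {a,b,d} \<subseteq> inside G then {{a,b,d}} else {})"
        unfolding star inner(3) by auto
      then show ?thesis using ne by simp
    qed
    show ?thesis
    proof (cases "h ` cell {a,b} \<subseteq> G")
      case False
      then have "G \<inter> h ` ?D = {}" using e Gf abc by blast
      then have "h ` ?D \<subseteq> inside G \<or> h ` ?D \<subseteq> outside G" by (rule dich[OF cD])
      then have "(h ` cell {a,b,c} \<subseteq> inside G) = (h ` cell {a,b,d} \<subseteq> inside G)"
        using face_ne[OF abcK(1) d3(1)] face_ne[OF abcK(2) d3(2)] inside_Int_outside[of G] by blast
      then show ?thesis using crd False by blast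
    next
      case True
      have "h ?m \<in> G" using True m by blast
      then have "h ?m \<in> frontier (inside G)" "h ?m \<in> frontier (outside G)" unfolding fr by blast+
      then have "h ?m \<in> closure (inside G)" "h ?m \<in> closure (outside G)" by (simp_all add: frontier_def)
      then have "h ` ?D \<inter> inside G \<noteq> {}" "h ` ?D \<inter> outside G \<noteq> {}"
        using oD mD closure_iff_nhds_not_empty by blast+
      moreover have "h ` cell {a,b} \<inter> inside G = {}" "h ` cell {a,b} \<inter> outside G = {}"
        using True inside_no_overlap[of G] outside_no_overlap[of G] by blast+
      ultimately have "h ` cell {a,b,c} \<inter> inside G \<noteq> {} \<or> h ` cell {a,b,d} \<inter> inside G \<noteq> {}"
        "h ` cell {a,b,c} \<inter> outside G \<noteq> {} \<or> h ` cell {a,b,d} \<inter> outside G \<noteq> {}" by blast+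
      moreover have "h ` cell {a,b,c} \<subseteq> inside G \<or> h ` cell {a,b,c} \<subseteq> outside G"
        "h ` cell {a,b,d} \<subseteq> inside G \<or> h ` cell {a,b,d} \<subseteq> outside G"
        using dich[OF cellc] Gf abc by blast+
      ultimately have "(h ` cell {a,b,c} \<subseteq> inside G) \<noteq> (h ` cell {a,b,d} \<subseteq> inside G)"
        using inside_Int_outside[of G] by blast
      then show ?thesis using crd True by blast
    qed
  qed
qed

definition edge_arc :: "'v \<Rightarrow> 'v \<Rightarrow> real \<Rightarrow> complex" where
  "edge_arc a b = h \<circ> point_on_edge a b"

lemma point_on_edge_inj: "a \<noteq> b \<Longrightarrow> inj_on (point_on_edge a b) S"
  by (rule inj_onI) (auto simp: point_on_edge_def fun_eq_iff split: if_splits)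

lemma edge_arc:
  assumes "adj K a b"
  shows "arc (edge_arc a b)" "pathstart (edge_arc a b) = h (point_on_edge a b 0)"
    "pathfinish (edge_arc a b) = h (point_on_edge a b 1)"
    "path_image (edge_arc a b) = h ` point_on_edge a b ` {0..1}"
    "path_image (edge_arc a b) \<subseteq> cball 0 1"
proof -
  have sub: "point_on_edge a b ` {0..1} \<subseteq> realization K" using point_on_edge_mem[OF assms] by auto
  have "a \<noteq> b" using assms by (auto simp: adj_def)
  then show "arc (edge_arc a b)"
    unfolding arc_def path_def edge_arc_def
    using sub cont_h inj_h point_on_edge_inj
    by (intro conjI continuous_on_compose continuous_point_on_edge comp_inj_on)
       (auto intro: continuous_on_subset inj_on_subset)
  show im: "path_image (edge_arc a b) = h ` point_on_edge a b ` {0..1}"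
    by (simp add: path_image_def edge_arc_def image_comp)
  show "path_image (edge_arc a b) \<subseteq> cball 0 1" unfolding im using sub im_h by blast
qed (simp_all add: pathstart_def pathfinish_def edge_arc_def)

lemma edge_image_cells:
  assumes "adj K a b" "t \<in> point_on_edge a b ` {0..1}"
  shows "t \<in> cell {a,b} \<or> t \<in> cell {a} \<or> t \<in> cell {b}"
proof -
  obtain s where s: "t = point_on_edge a b s" "0 \<le> s" "s \<le> 1" using assms(2) by auto
  have "t \<in> realization K" unfolding s(1) using point_on_edge_mem[OF assms(1)] s by blast
  moreover have "{v. t v \<noteq> 0} = {a,b} \<or> {v. t v \<noteq> 0} = {a} \<or> {v. t v \<noteq> 0} = {b}"
    using assms(1) s by (auto simp: point_on_edge_def adj_def split: if_splits)
  ultimately show ?thesis by (auto simp: cell_def)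
qed

lemma cell_edge_image:
  assumes "adj K a b" shows "cell {a,b} \<subseteq> point_on_edge a b ` {0..1}"
proof
  fix t assume t: "t \<in> cell {a,b}"
  have ab: "a \<noteq> b" using assms by (auto simp: adj_def)
  have s: "{v. t v \<noteq> 0} = {a,b}" "t a + t b = 1" "\<And>v. 0 \<le> t v"
    using t ab by (auto simp: cell_def realization_def)
  have "t v = 0" if "v \<notin> {a,b}" for v using s(1) that by blast
  then have "t = point_on_edge a b (t b)" using s(2) by (auto simp: point_on_edge_def fun_eq_iff)
  moreover have "t b \<in> {0..1}" using s(2) s(3)[of a] s(3)[of b] by auto
  ultimately show "t \<in> point_on_edge a b ` {0..1}" by blast
qed

lemma cell_disjoint: "s \<noteq> s' \<Longrightarrow> cell s \<inter> cell s' = {}"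
  by (auto simp: cell_def)

lemma cell_vertex: "t \<in> cell {a} \<Longrightarrow> t = point_on_edge a b 0"
  and cell_vertex': "t \<in> cell {b} \<Longrightarrow> a \<noteq> b \<Longrightarrow> t = point_on_edge a b 1"
  by (auto simp: cell_def realization_def point_on_edge_def fun_eq_iff)

lemma path_images_Int:
  assumes "adj K a b" "adj K c d" "q \<in> path_image (edge_arc a b)" "q \<in> path_image (edge_arc c d)"
  obtains t where "t \<in> realization K" "q = h t" "{v. t v \<noteq> 0} \<subseteq> {a,b} \<inter> {c,d}"
    "t \<in> point_on_edge a b ` {0..1}"
proof -
  obtain t u where t: "t \<in> point_on_edge a b ` {0..1}" "q = h t" and u: "u \<in> point_on_edge c d ` {0..1}" "q = h u"
    using assms(3,4) unfolding edge_arc(4)[OF assms(1)] edge_arc(4)[OF assms(2)] by blast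
  have tX: "t \<in> realization K" "u \<in> realization K"
    using edge_image_cells[OF assms(1) t(1)] edge_image_cells[OF assms(2) u(1)] cell_subset by blast+
  then have "t = u" using inj_h t(2) u(2) by (simp add: inj_on_def)
  have "{v. t v \<noteq> 0} \<subseteq> {a,b}" using edge_image_cells[OF assms(1) t(1)] by (auto simp: cell_def)
  moreover have "{v. u v \<noteq> 0} \<subseteq> {c,d}" using edge_image_cells[OF assms(2) u(1)] by (auto simp: cell_def)
  ultimately show thesis using that tX t \<open>t = u\<close> by blast
qed

lemma consecutive_edges_Int:
  assumes "adj K a b" "adj K b d" "a \<noteq> d"
  shows "path_image (edge_arc a b) \<inter> path_image (edge_arc b d) \<subseteq> {pathstart (edge_arc b d)}"
proof
  fix q assume q: "q \<in> path_image (edge_arc a b) \<inter> path_image (edge_arc b d)"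
  obtain t where t: "t \<in> realization K" "q = h t" "{v. t v \<noteq> 0} \<subseteq> {a,b} \<inter> {b,d}"
    using path_images_Int[OF assms(1,2)] q by (metis IntE)
  have "{a,b} \<inter> {b,d} \<subseteq> {b}" using assms by (auto simp: adj_def)
  moreover have "{v. t v \<noteq> 0} \<noteq> {}" using t(1) empty_K unfolding realization_def by (metis (mono_tags, lifting) mem_Collect_eq)
  ultimately have "{v. t v \<noteq> 0} = {b}" using t(3) by blast
  then have "t \<in> cell {b}" using t(1) by (simp add: cell_def)
  then have "t = point_on_edge b d 0" by (rule cell_vertex)
  then show "q \<in> {pathstart (edge_arc b d)}" using t(2) edge_arc(2)[OF assms(2)] by simp
qed

lemma path_start_finish: "adj K a b \<Longrightarrow> adj K b d \<Longrightarrow> pathfinish (edge_arc a b) = pathstart (edge_arc b d)"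
  by (auto simp: edge_arc adj_def point_on_edge_def fun_eq_iff intro!: arg_cong[of _ _ h])

lemma cell_image_disjoint:
  assumes "A \<subseteq> \<Union>(cell ` \<C>)" "s \<notin> \<C>" shows "h ` A \<inter> h ` cell s = {}"
proof (rule ccontr)
  assume "\<not> ?thesis"
  then obtain t u where t: "t \<in> A" "u \<in> cell s" "h t = h u" by auto
  then obtain s' where s': "s' \<in> \<C>" "t \<in> cell s'" using assms(1) by blast
  then have "t = u" using t inj_h cell_subset[of s'] cell_subset[of s] by (auto simp: inj_on_def)
  then show False using cell_disjoint[of s s'] s' t(2) assms(2) by blast
qed

lemma edge_subset_cells: "adj K a b \<Longrightarrow> point_on_edge a b ` {0..1} \<subseteq> \<Union>(cell ` {{a,b},{a},{b}})"
  using edge_image_cells by auto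

lemma triangle_filling:
  assumes "adj K x y" "adj K y z" "adj K x z"
  obtains S where "S \<subseteq> faces K"
    "\<And>a b. adj K a b \<Longrightarrow> odd (card {f\<in>S. {a,b} \<subseteq> f}) \<longleftrightarrow> {a,b} \<in> cycle3 x y z"
proof -
  have zx: "adj K z x" using assms(3) by (auto simp: adj_def insert_commute)
  have ne: "x \<noteq> y" "y \<noteq> z" "x \<noteq> z" using assms by (auto simp: adj_def)
  let ?g2 = "edge_arc y z +++ edge_arc z x"
  let ?c = "edge_arc x y +++ ?g2"
  have a2: "arc ?g2"
    using consecutive_edges_Int[OF assms(2) zx] ne path_start_finish[OF assms(2) zx]
    by (intro arc_join edge_arc assms zx) auto
  have im2: "path_image ?g2 = path_image (edge_arc y z) \<union> path_image (edge_arc z x)"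
    using path_start_finish[OF assms(2) zx] by (rule path_image_join)
  have pf: "pathfinish (edge_arc x y) = pathstart ?g2" "pathfinish ?g2 = pathstart (edge_arc x y)"
    using path_start_finish[OF assms(1,2)] path_start_finish[OF zx assms(1)] by simp_all
  have c: "simple_path ?c"
  proof (rule simple_path_join_loop[OF edge_arc(1)[OF assms(1)] a2 pf])
    have "path_image (edge_arc x y) \<inter> path_image (edge_arc y z) \<subseteq> {pathstart ?g2}"
      using consecutive_edges_Int[OF assms(1,2)] ne by simp
    moreover have "path_image (edge_arc x y) \<inter> path_image (edge_arc z x) \<subseteq> {pathstart (edge_arc x y)}"
      using consecutive_edges_Int[OF zx assms(1)] ne by auto
    ultimately show "path_image (edge_arc x y) \<inter> path_image ?g2 \<subseteq> {pathstart (edge_arc x y), pathstart ?g2}"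
      unfolding im2 by blast
  qed
  have cc: "pathfinish ?c = pathstart ?c" using pf(2) by simp
  define A where "A = point_on_edge x y ` {0..1} \<union> point_on_edge y z ` {0..1} \<union> point_on_edge z x ` {0..1}"
  define G where "G = path_image ?c"
  have G: "G = h ` A"
    unfolding G_def path_image_join[OF pf(1)] im2 edge_arc(4)[OF assms(1)] edge_arc(4)[OF assms(2)]
      edge_arc(4)[OF zx] A_def by blast
  have AC: "A \<subseteq> \<Union>(cell ` {{x,y},{y,z},{z,x},{x},{y},{z}})"
    using edge_subset_cells[OF assms(1)] edge_subset_cells[OF assms(2)] edge_subset_cells[OF zx]
    unfolding A_def by auto
  have "G \<subseteq> cball 0 1"
    unfolding G_def path_image_join[OF pf(1)] im2
    using edge_arc(5)[OF assms(1)] edge_arc(5)[OF assms(2)] edge_arc(5)[OF zx] by blast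
  moreover have "G \<inter> h ` cell f = {}" if f: "f \<in> faces K" for f
    unfolding G
  proof (rule cell_image_disjoint[OF AC])
    have "card f = 3" using f by (simp add: faces_def)
    then show "f \<notin> {{x,y},{y,z},{z,x},{x},{y},{z}}" using ne by auto
  qed
  moreover have "odd (card {f \<in> filling G. {a,b} \<subseteq> f}) \<longleftrightarrow> {a,b} \<in> cycle3 x y z" if ab: "adj K a b" for a b
  proof (cases "{a,b} \<in> cycle3 x y z")
    case True
    have "cell {x,y} \<subseteq> A" "cell {y,z} \<subseteq> A" "cell {z,x} \<subseteq> A"
      using cell_edge_image[OF assms(1)] cell_edge_image[OF assms(2)] cell_edge_image[OF zx] unfolding A_def by blast+
    then have "cell {a,b} \<subseteq> A" using True by (auto simp: cycle3_def insert_commute)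
    then have sub: "h ` cell {a,b} \<subseteq> G" unfolding G by blast
    show ?thesis
      using filling_parity[OF c cc G_def calculation ab] sub True by blast
  next
    case False
    have "a \<noteq> b" using ab by (auto simp: adj_def)
    then have nA: "{a,b} \<notin> {{x,y},{y,z},{z,x},{x},{y},{z}}"
      using False by (auto simp: cycle3_def insert_commute)
    have disj: "G \<inter> h ` cell {a,b} = {}" unfolding G by (rule cell_image_disjoint[OF AC nA])
    have "cell {a,b} \<noteq> {}" using midpoint_cell[OF ab] by blast
    then have "\<not> h ` cell {a,b} \<subseteq> G" using disj by blast
    then show ?thesis
      using filling_parity[OF c cc G_def calculation ab] disj False by blast
  qed
  moreover have "filling G \<subseteq> faces K" by (auto simp: filling_def)
  ultimately show thesis using that by blast
qed

lemma boundary_vertex_complex: "x \<in> boundary_vertices K \<Longrightarrow> {x} \<in> boundary_complex K"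
  by (auto simp: boundary_vertices_def boundary_complex_def)

lemma chord_filling:
  assumes cd: "adj K c d" "{c,d} \<notin> boundary_edges K" "c \<in> boundary_vertices K" "d \<in> boundary_vertices K"
  obtains S where "S \<subseteq> faces K"
    "\<And>a b. adj K a b \<Longrightarrow> {a,b} \<notin> boundary_edges K \<Longrightarrow> odd (card {f\<in>S. {a,b} \<subseteq> f}) \<longleftrightarrow> {a,b} = {c,d}"
proof -
  have ne: "c \<noteq> d" using cd by (auto simp: adj_def)
  have bc2: "{a,b} \<notin> boundary_complex K" if "adj K a b" "{a,b} \<notin> boundary_edges K" for a b
  proof
    assume "{a,b} \<in> boundary_complex K"
    then obtain e where e: "e \<in> boundary_edges K" "{a,b} \<subseteq> e" by (auto simp: boundary_complex_def)
    then have "card e = 2" by (simp add: boundary_edges_def)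
    then have "e = {a,b}" using e(2) that(1) card_subset_eq[of e "{a,b}"] card.infinite[of e] by (auto simp: adj_def)
    then show False using that(2) e(1) by simp
  qed
  have bc3: "f \<notin> boundary_complex K" if "f \<in> faces K" for f
  proof
    assume "f \<in> boundary_complex K"
    then obtain e where e: "e \<in> boundary_edges K" "f \<subseteq> e" by (auto simp: boundary_complex_def)
    then have "card e = 2" by (simp add: boundary_edges_def)
    then show False using that card_mono[OF _ e(2)] card.infinite[of e] by (force simp: faces_def)
  qed
  let ?P = "h (point_on_edge c d 0)" and ?Q = "h (point_on_edge c d 1)"
  have supp: "{v. point_on_edge c d 0 v \<noteq> 0} = {c}" "{v. point_on_edge c d 1 v \<noteq> 0} = {d}"
    using ne by (auto simp: point_on_edge_def)
  have PQ: "?P \<in> sphere 0 1" "?Q \<in> sphere 0 1"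
    using cell_on_sphere[OF _ supp(1)] cell_on_sphere[OF _ supp(2)] point_on_edge_mem[OF cd(1)]
      boundary_vertex_complex cd by auto
  have PneQ: "?P \<noteq> ?Q"
    using arc_distinct_ends[OF edge_arc(1)[OF cd(1)]] by (simp add: edge_arc(2,3)[OF cd(1)])
  have "path_connected (sphere (0::complex) 1)" by (rule path_connected_sphere) simp
  then obtain p where p: "path p" "path_image p \<subseteq> sphere 0 1" "pathstart p = ?Q" "pathfinish p = ?P"
    using PQ unfolding path_connected_def by blast
  then obtain g where g: "arc g" "path_image g \<subseteq> sphere 0 1" "pathstart g = ?Q" "pathfinish g = ?P"
    using path_contains_arc[OF p(1,3,4)] PneQ by (metis order_trans)
  let ?c = "edge_arc c d +++ g"
  have pf: "pathfinish (edge_arc c d) = pathstart g" "pathfinish g = pathstart (edge_arc c d)"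
    using g by (simp_all add: edge_arc(2,3)[OF cd(1)])
  have sph: "h ` cell s \<inter> sphere 0 1 = {}" if "s \<notin> boundary_complex K" for s
    using cell_on_sphere that by (auto simp: cell_def)
  let ?E = "point_on_edge c d ` {0..1}"
  have Eim: "path_image (edge_arc c d) = h ` ?E" by (rule edge_arc(4)[OF cd(1)])
  have c: "simple_path ?c"
  proof (rule simple_path_join_loop[OF edge_arc(1)[OF cd(1)] g(1) pf])
    show "path_image (edge_arc c d) \<inter> path_image g \<subseteq> {pathstart (edge_arc c d), pathstart g}"
    proof
      fix q assume q: "q \<in> path_image (edge_arc c d) \<inter> path_image g"
      then obtain t where t: "t \<in> ?E" "q = h t" unfolding Eim by blast
      have "q \<in> sphere 0 1" using q g(2) by blast
      then have "t \<notin> cell {c,d}" using sph[OF bc2[OF cd(1,2)]] t(2) by blast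
      then have "t \<in> cell {c} \<or> t \<in> cell {d}" using edge_image_cells[OF cd(1) t(1)] by blast
      then have "t = point_on_edge c d 0 \<or> t = point_on_edge c d 1" using cell_vertex cell_vertex' ne by blast
      then show "q \<in> {pathstart (edge_arc c d), pathstart g}"
        using t(2) g(3) by (auto simp: edge_arc(2,3)[OF cd(1)])
    qed
  qed
  have cc: "pathfinish ?c = pathstart ?c" using pf(2) by simp
  define G where "G = path_image ?c"
  have G: "G = h ` ?E \<union> path_image g" unfolding G_def path_image_join[OF pf(1)] Eim ..
  have Gsub: "G \<subseteq> cball 0 1"
    using edge_arc(5)[OF cd(1)] g(2) sphere_cball unfolding G Eim by blast
  have Gdisj: "G \<inter> h ` cell s = {}" if "s \<notin> boundary_complex K" "s \<notin> {{c,d},{c},{d}}" for s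
  proof -
    have "h ` ?E \<inter> h ` cell s = {}" by (rule cell_image_disjoint[OF edge_subset_cells[OF cd(1)] that(2)])
    moreover have "path_image g \<inter> h ` cell s = {}" using sph[OF that(1)] g(2) by blast
    ultimately show ?thesis unfolding G by blast
  qed
  have Gf: "G \<inter> h ` cell f = {}" if f: "f \<in> faces K" for f
  proof (rule Gdisj[OF bc3[OF f]])
    have "card f = 3" using f by (simp add: faces_def)
    then show "f \<notin> {{c,d},{c},{d}}" using ne by auto
  qed
  have "odd (card {f \<in> filling G. {a,b} \<subseteq> f}) \<longleftrightarrow> {a,b} = {c,d}" if ab: "adj K a b" "{a,b} \<notin> boundary_edges K" for a b
  proof (cases "{a,b} = {c,d}")
    case True
    have sub: "h ` cell {a,b} \<subseteq> G" unfolding True G using cell_edge_image[OF cd(1)] by blast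
    then show ?thesis using filling_parity[OF c cc G_def Gsub Gf ab(1)] True by blast
  next
    case False
    have "a \<noteq> b" using ab by (auto simp: adj_def)
    then have nA: "{a,b} \<notin> {{c,d},{c},{d}}" using False by auto
    have disj: "G \<inter> h ` cell {a,b} = {}" by (rule Gdisj[OF bc2[OF ab] nA])
    have "cell {a,b} \<noteq> {}" using midpoint_cell[OF ab(1)] by blast
    then have "\<not> h ` cell {a,b} \<subseteq> G" using disj by blast
    then show ?thesis using filling_parity[OF c cc G_def Gsub Gf ab(1)] disj False by blast
  qed
  moreover have "filling G \<subseteq> faces K" by (auto simp: filling_def)
  ultimately show thesis using that by blast
qed

end

subsection \<open>Vertex links and contractible edges\<close>

lemma fan_nth: "f \<in> fan x vs \<longleftrightarrow> (\<exists>i. Suc i < length vs \<and> f = {x, vs ! i, vs ! Suc i})"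
proof (induction x vs rule: fan.induct)
  case (1 x u v ws)
  show ?case (is "_ \<longleftrightarrow> (\<exists>i. ?P i)")
  proof
    assume "f \<in> fan x (u # v # ws)"
    then consider "f = {x,u,v}" | "f \<in> fan x (v # ws)" by auto
    then show "\<exists>i. ?P i"
    proof cases
      case 1
      then show ?thesis by (intro exI[of _ 0]) simp
    next
      case 2
      then obtain i where "Suc i < length (v # ws)" "f = {x, (v # ws) ! i, (v # ws) ! Suc i}"
        using \<open>(f \<in> fan x (v # ws)) = _\<close> by blast
      then show ?thesis by (intro exI[of _ "Suc i"]) simp
    qed
  next
    assume "\<exists>i. ?P i"
    then obtain i where i: "?P i" by blast
    show "f \<in> fan x (u # v # ws)"
    proof (cases i)
      case 0
      then show ?thesis using i by simp
    next
      case (Suc j)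
      then have "Suc j < length (v # ws) \<and> f = {x, (v # ws) ! j, (v # ws) ! Suc j}" using i by simp
      then have "f \<in> fan x (v # ws)" using \<open>(f \<in> fan x (v # ws)) = _\<close> by blast
      then show ?thesis by simp
    qed
  qed
qed simp_all

text \<open>A connected graph of maximal degree two is a cycle (case \<open>C\<close>) or a path that starts at \<open>y\<close>.\<close>

lemma traverse_graph:
  fixes R :: "'v \<Rightarrow> 'v \<Rightarrow> bool"
  assumes fin: "finite N" and R: "\<And>u v. R u v \<Longrightarrow> u \<in> N \<and> v \<in> N \<and> u \<noteq> v \<and> R v u"
    and two: "\<And>u a b c. R u a \<Longrightarrow> R u b \<Longrightarrow> R u c \<Longrightarrow> a = b \<or> a = c \<or> b = c"
    and con: "\<And>A. A \<subseteq> N \<Longrightarrow> A \<noteq> {} \<Longrightarrow> (\<And>u v. u \<in> A \<Longrightarrow> R u v \<Longrightarrow> v \<in> A) \<Longrightarrow> A = N"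
    and y: "R y a"
    and ends: "(\<forall>u\<in>N. \<forall>b. R u b \<longrightarrow> (\<exists>c. R u c \<and> c \<noteq> b)) \<and> C \<or> (\<forall>b. R y b \<longrightarrow> b = a) \<and> \<not> C"
  obtains vs where "vs \<noteq> []" "distinct (y # vs)" "set (y # vs) = N"
      "\<And>u v. R u v \<longleftrightarrow> (\<exists>i. Suc i < length (y # vs) \<and> {u,v} = {(y # vs) ! i, (y # vs) ! Suc i})
          \<or> (C \<and> {u,v} = {y, last vs})"
proof -
  define P where "P = (\<lambda>vs. distinct (y # vs) \<and> (\<forall>i. Suc i < length (y # vs) \<longrightarrow> R ((y # vs) ! i) ((y # vs) ! Suc i)) \<and> set (y # vs) \<subseteq> N)"
  have P0: "P [a]" using y R[OF y] by (auto simp: P_def)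
  have "length vs \<le> card N" if "P vs" for vs
    using that fin card_mono[of N "set (y # vs)"] distinct_card[of "y # vs"] by (auto simp: P_def)
  then obtain ws where ws: "P ws" "\<And>us. P us \<Longrightarrow> length us \<le> length ws"
    using P0 by (metis (mono_tags, lifting) arg_max_nat_lemma[of P "[a]" length "Suc (card N)"] less_Suc_eq_le)
  let ?vs = "y # ws"
  let ?n = "length ws"
  have n: "?n \<ge> 1" using ws(2)[OF P0] by simp
  have d: "distinct ?vs" and sub: "set ?vs \<subseteq> N" and succ: "\<And>i. i < ?n \<Longrightarrow> R (?vs ! i) (?vs ! Suc i)"
    using ws(1) by (auto simp: P_def)
  have eqi: "?vs ! i = ?vs ! j \<longleftrightarrow> i = j" if "i \<le> ?n" "j \<le> ?n" for i j
    using nth_eq_iff_index_eq[OF d, of i j] that by simp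
  have mid: "v = ?vs ! (i - 1) \<or> v = ?vs ! Suc i" if i: "0 < i" "i < ?n" and v: "R (?vs ! i) v" for i v
  proof -
    have "R (?vs ! i) (?vs ! (i - 1))" using succ[of "i - 1"] R i by simp
    moreover have "?vs ! (i - 1) \<noteq> ?vs ! Suc i" using eqi[of "i - 1" "Suc i"] i by simp
    ultimately show ?thesis using two[OF v _ succ[OF i(2)]] by blast
  qed
  have last_in: "v \<in> set ?vs" if v: "R (?vs ! ?n) v" for v
  proof (rule ccontr)
    assume "v \<notin> set ?vs"
    have "P (ws @ [v])"
      unfolding P_def
    proof (intro conjI allI impI)
      show "distinct (y # ws @ [v])" using d \<open>v \<notin> set ?vs\<close> by auto
      show "set (y # ws @ [v]) \<subseteq> N" using sub R[OF v] by auto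
      fix i assume i: "Suc i < length (y # ws @ [v])"
      have nth: "(y # ws @ [v]) ! j = (if j \<le> ?n then ?vs ! j else v)" if "j \<le> Suc ?n" for j
        using that by (cases j) (auto simp: nth_append)
      show "R ((y # ws @ [v]) ! i) ((y # ws @ [v]) ! Suc i)"
      proof (cases "i = ?n")
        case True
        then show ?thesis using nth[of i] nth[of "Suc i"] v by (simp del: nth_Cons_Suc)
      next
        case False
        then have "i < ?n" using i by simp
        then show ?thesis using nth[of i] nth[of "Suc i"] succ[of i] by (simp del: nth_Cons_Suc)
      qed
    qed
    then show False using ws(2) by fastforce
  qed
  have last_nb: "v = ?vs ! (?n - 1) \<or> v = y" if v: "R (?vs ! ?n) v" for v
  proof -
    obtain j where j: "j \<le> ?n" "v = ?vs ! j" using last_in[OF v] by (metis in_set_conv_nth length_Cons less_Suc_eq_le)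
    have "j \<noteq> ?n" using R[OF v] j by auto
    show ?thesis
    proof (cases "j = 0")
      case False
      then have "?vs ! ?n = ?vs ! (j - 1) \<or> ?vs ! ?n = ?vs ! Suc j"
        using mid[of j "?vs ! ?n"] R[OF v] j \<open>j \<noteq> ?n\<close> by auto
      then have "?n = j - 1 \<or> ?n = Suc j" using eqi[of ?n "j - 1"] eqi[of ?n "Suc j"] j \<open>j \<noteq> ?n\<close> by auto
      then show ?thesis using j \<open>j \<noteq> ?n\<close> by auto
    qed (use j in simp)
  qed
  have "ws \<noteq> []" using n by auto
  then have lastE: "last ws = ?vs ! ?n" by (simp add: last_conv_nth nth_Cons')
  have cyc: "R y (last ws)" "?n \<ge> 2" if C
  proof -
    obtain m where m: "?n = Suc m" using n by (cases ?n) auto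
    have "R (?vs ! (?n - 1)) (?vs ! ?n)" unfolding m using succ[of m] m by simp
    then have "R (?vs ! ?n) (?vs ! (?n - 1))" using R by blast
    moreover have "?vs ! ?n \<in> N" using sub by (metis length_Cons lessI nth_mem subsetD)
    moreover have "\<forall>u\<in>N. \<forall>b. R u b \<longrightarrow> (\<exists>c. R u c \<and> c \<noteq> b)" using ends that by blast
    ultimately obtain c where c: "R (?vs ! ?n) c" "c \<noteq> ?vs ! (?n - 1)" by blast
    then have "c = y" using last_nb by blast
    then show "R y (last ws)" using R[OF c(1)] lastE by simp
    show "?n \<ge> 2" using c(2) \<open>c = y\<close> n by (cases "?n = 1") auto
  qed
  have y_nb: "v = ?vs ! 1 \<or> (C \<and> v = last ws)" if v: "R y v" for v
  proof (cases C)
    case True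
    have "?vs ! 1 \<noteq> ?vs ! ?n" using eqi[of 1 ?n] n cyc(2)[OF True] by simp
    moreover have "R y (?vs ! 1)" using succ[of 0] \<open>ws \<noteq> []\<close> by simp
    ultimately show ?thesis using two[OF v _ cyc(1)[OF True]] True lastE by metis
  next
    case False
    then have "\<forall>b. R y b \<longrightarrow> b = a" using ends by blast
    moreover have "R y (?vs ! 1)" using succ[of 0] \<open>ws \<noteq> []\<close> by simp
    ultimately show ?thesis using v by blast
  qed
  have nb: "v \<in> set ?vs \<and> ((\<exists>i. Suc i < length ?vs \<and> {?vs ! k,v} = {?vs ! i, ?vs ! Suc i}) \<or> (C \<and> {?vs ! k,v} = {y, last ws}))"
    if k: "k \<le> ?n" and v: "R (?vs ! k) v" for k v
  proof -
    consider "k = 0" | "0 < k" "k < ?n" | "k = ?n" using k by linarith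
    then show ?thesis
    proof cases
      case 1
      then consider "v = ?vs ! 1" | "C" "v = last ws" using y_nb v by auto
      then show ?thesis
      proof cases
        case 1
        then show ?thesis using n \<open>k = 0\<close>
          by (intro conjI disjI1 exI[of _ 0]) (auto simp: in_set_conv_nth intro!: exI[of _ 0])
      next
        case 2
        then show ?thesis using n \<open>k = 0\<close> \<open>ws \<noteq> []\<close> last_in_set[of ws] by auto
      qed
    next
      case 2
      then consider "v = ?vs ! (k - 1)" | "v = ?vs ! Suc k" using mid v by blast
      then show ?thesis
      proof cases
        case 1
        have "v \<in> set ?vs" unfolding 1 using 2 by (intro nth_mem) simp
        moreover have "Suc (k - 1) < length ?vs" "{?vs ! k, v} = {?vs ! (k - 1), ?vs ! Suc (k - 1)}"
          unfolding 1 using 2 by (simp_all add: insert_commute)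
        ultimately show ?thesis by blast
      next
        case 2
        have "v \<in> set ?vs" unfolding 2 using \<open>k < ?n\<close> by (intro nth_mem) simp
        moreover have "Suc k < length ?vs" using \<open>k < ?n\<close> by simp
        ultimately show ?thesis unfolding 2 by blast
      qed
    next
      case 3
      then consider "v = ?vs ! (?n - 1)" | "v = y" using last_nb v by blast
      then show ?thesis
      proof cases
        case 1
        have "v \<in> set ?vs" unfolding 1 using n by (intro nth_mem) simp
        moreover have "Suc (?n - 1) = ?n" using n by simp
        then have "Suc (?n - 1) < length ?vs" "{?vs ! k, v} = {?vs ! (?n - 1), ?vs ! Suc (?n - 1)}"
          unfolding 1 3 by (simp_all only: insert_commute length_Cons lessI)
        ultimately show ?thesis by blast
      next
        case 2
        have "R y (last ws)" using v R 3 2 lastE by simp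
        then consider "last ws = ?vs ! 1" | "C" using y_nb by blast
        then show ?thesis
        proof cases
          case 1
          then have "?n = 1" using eqi[of 1 ?n] n lastE by simp
          then show ?thesis using 2 3 by (intro conjI disjI1 exI[of _ 0]) (auto simp: insert_commute)
        next
          assume C
          then show ?thesis using 2 3 lastE by (auto simp: insert_commute)
        qed
      qed
    qed
  qed
  have N: "set ?vs = N"
  proof (rule con[OF sub])
    fix u v assume "u \<in> set ?vs" "R u v"
    then obtain k where "k \<le> ?n" "u = ?vs ! k" by (metis in_set_conv_nth length_Cons less_Suc_eq_le)
    then show "v \<in> set ?vs" using nb \<open>R u v\<close> by blast
  qed simp
  have "R u v \<longleftrightarrow> (\<exists>i. Suc i < length ?vs \<and> {u,v} = {?vs ! i, ?vs ! Suc i}) \<or> (C \<and> {u,v} = {y, last ws})" for u v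
  proof
    assume uv: "R u v"
    then have "u \<in> set ?vs" using N R by blast
    then obtain k where k: "k \<le> ?n" "u = ?vs ! k" by (metis in_set_conv_nth length_Cons less_Suc_eq_le)
    then show "(\<exists>i. Suc i < length ?vs \<and> {u,v} = {?vs ! i, ?vs ! Suc i}) \<or> (C \<and> {u,v} = {y, last ws})"
      using nb[OF k(1)] uv by blast
  next
    assume "(\<exists>i. Suc i < length ?vs \<and> {u,v} = {?vs ! i, ?vs ! Suc i}) \<or> (C \<and> {u,v} = {y, last ws})"
    then obtain p q where "R p q" "{u,v} = {p,q}" using succ cyc by (metis Suc_less_eq length_Cons)
    then show "R u v" using R by (auto simp: doubleton_eq_iff)
  qed
  then show thesis using that[of ws] n d N by force
qed

lemma adj_complex_of: "adj (complex_of F) u v \<longleftrightarrow> u \<noteq> v \<and> (\<exists>f\<in>F. {u,v} \<subseteq> f)"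
  by (auto simp: adj_def complex_of_def)

context disk_triangulation
begin

definition tri :: "'v \<Rightarrow> 'v \<Rightarrow> 'v \<Rightarrow> bool" where
  "tri x y z \<longleftrightarrow> {x,y,z} \<in> K \<and> x \<noteq> y \<and> y \<noteq> z \<and> x \<noteq> z"

abbreviation nbrs :: "'v \<Rightarrow> 'v set" where "nbrs x \<equiv> {y. adj K x y}"

definition bd :: "'v \<Rightarrow> 'v \<Rightarrow> bool" where "bd x y \<longleftrightarrow> {x,y} \<in> boundary_edges K"

abbreviation inner_vertex :: "'v \<Rightarrow> bool" where "inner_vertex x \<equiv> x \<notin> boundary_vertices K"

lemma adj_sym: "adj K x y \<Longrightarrow> adj K y x" by (auto simp: adj_def insert_commute)

lemma adj_irrefl: "\<not> adj K x x" by (simp add: adj_def)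

lemma bd_sym: "bd x y \<Longrightarrow> bd y x" by (simp add: bd_def insert_commute)

lemma tri_swap: "tri x y z \<Longrightarrow> tri y x z" "tri x y z \<Longrightarrow> tri x z y"
  by (auto simp: tri_def insert_commute)

lemma tri_perm: assumes "tri x y z" shows "tri y x z" "tri x z y" "tri z y x" "tri y z x" "tri z x y"
  using assms tri_swap by blast+

lemma tri_adj: assumes "tri x y z" shows "adj K x y" "adj K y z" "adj K x z" "adj K y x" "adj K z y" "adj K z x"
proof -
  have "adj K a b" if "tri a b c" for a b c using that unfolding tri_def by (blast intro: adjI)
  then show "adj K x y" "adj K y z" "adj K x z" "adj K y x" "adj K z y" "adj K z x"
    using tri_perm[OF assms] assms by blast+
qed

lemma tri_neq: assumes "tri x y z" shows "x \<noteq> y" "y \<noteq> z" "x \<noteq> z" "y \<noteq> x" "z \<noteq> y" "z \<noteq> x"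
  using assms by (auto simp: tri_def)

lemma tri_face: "tri x y z \<Longrightarrow> {x,y,z} \<in> faces K" by (simp add: tri_def faceI)

lemma face_tri: "{x,y,z} \<in> faces K \<Longrightarrow> x \<noteq> y \<Longrightarrow> y \<noteq> z \<Longrightarrow> x \<noteq> z \<Longrightarrow> tri x y z" by (simp add: tri_def faces_def)

lemma tri_ex: "adj K x y \<Longrightarrow> \<exists>z. tri x y z"
  using edge_in_face[of x y] unfolding tri_def by (metis distinct_length_2_or_more)

lemma tri_two: "tri x y a \<Longrightarrow> tri x y b \<Longrightarrow> tri x y c \<Longrightarrow> a = b \<or> a = c \<or> b = c"
  using edge_in_two_faces[of x y a b c] by (simp add: tri_def)

lemma face_star: "adj K x y \<Longrightarrow> {f\<in>faces K. {x,y} \<subseteq> f} = {{x,y,z} | z. tri x y z}"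
proof -
  assume xy: "adj K x y"
  then have ne: "x \<noteq> y" by (auto simp: adj_def)
  have "\<exists>z. f = {x,y,z} \<and> tri x y z" if f: "f \<in> faces K" "{x,y} \<subseteq> f" for f
    using face_cases[OF f ne] f(1) face_tri by (metis distinct_length_2_or_more)
  then show ?thesis using tri_face by blast
qed

lemma bd_iff: "bd x y \<longleftrightarrow> adj K x y \<and> (\<forall>a b. tri x y a \<longrightarrow> tri x y b \<longrightarrow> a = b)"
proof
  assume b: "bd x y"
  then have "card {x,y} = 2" by (simp add: bd_def boundary_edges_def)
  then have "x \<noteq> y" by auto
  then have xy: "adj K x y" using b by (auto simp: bd_def boundary_edges_def adj_def)
  have "card {{x,y,z} | z. tri x y z} = 1"
    using b face_star[OF xy] by (simp add: bd_def boundary_edges_def)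
  then obtain f where f: "{{x,y,z} | z. tri x y z} = {f}" by (auto simp: card_1_singleton_iff)
  have "a = b" if "tri x y a" "tri x y b" for a b
  proof -
    have "{x,y,a} \<in> {{x,y,z} | z. tri x y z}" "{x,y,b} \<in> {{x,y,z} | z. tri x y z}" using that by blast+
    then have "{x,y,a} = {x,y,b}" unfolding f by simp
    then show ?thesis using tri_neq[OF that(1)] tri_neq[OF that(2)] by auto
  qed
  then show "adj K x y \<and> (\<forall>a b. tri x y a \<longrightarrow> tri x y b \<longrightarrow> a = b)" using xy by blast
next
  assume a: "adj K x y \<and> (\<forall>a b. tri x y a \<longrightarrow> tri x y b \<longrightarrow> a = b)"
  then obtain z where z: "tri x y z" using tri_ex by blast
  then have "{{x,y,z} | z. tri x y z} = {{x,y,z}}" using a by blast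
  then show "bd x y" using a face_star[of x y] by (auto simp: bd_def boundary_edges_def adj_def)
qed

lemma bd_adj: "bd x y \<Longrightarrow> adj K x y" by (simp add: bd_iff)

lemma bd_unique: "bd x y \<Longrightarrow> tri x y a \<Longrightarrow> tri x y b \<Longrightarrow> a = b" by (simp add: bd_iff)

lemma tri_other: "adj K x y \<Longrightarrow> \<not> bd x y \<Longrightarrow> \<exists>b. tri x y b \<and> b \<noteq> a" by (metis bd_iff)

lemma bd_boundary: "bd x y \<Longrightarrow> x \<in> boundary_vertices K \<and> y \<in> boundary_vertices K"
  by (auto simp: bd_def boundary_vertices_def)

lemma inner_not_bd: "inner_vertex x \<Longrightarrow> \<not> bd x y" using bd_boundary by blast

lemma boundary_vertex_bd: assumes "x \<in> boundary_vertices K" shows "\<exists>y. bd x y"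
proof -
  obtain e where e: "e \<in> boundary_edges K" "x \<in> e" using assms by (auto simp: boundary_vertices_def)
  then have "card e = 2" by (simp add: boundary_edges_def)
  then obtain y where "e = {x,y}" using e(2) by (auto simp: card_2_iff)
  then show ?thesis using e(1) by (auto simp: bd_def)
qed

lemma adj_vertices: "adj K x y \<Longrightarrow> x \<in> vertices K" "adj K x y \<Longrightarrow> y \<in> vertices K"
  using sub_K[of "{x,y}" "{x}"] sub_K[of "{x,y}" "{y}"] by (auto simp: adj_def vertices_def)

lemma finite_nbrs: "finite (nbrs x)"
  by (rule finite_subset[OF _ finite_vertices]) (auto dest: adj_vertices)

lemma link_closed:
  assumes "A \<subseteq> nbrs x" "A \<noteq> {}" "\<And>y z. y \<in> A \<Longrightarrow> tri x y z \<Longrightarrow> z \<in> A"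
  shows "nbrs x = A"
  using link_connected[of A x] assms unfolding tri_def by (metis (mono_tags, lifting) distinct_length_2_or_more)

lemma deg: "vdegree K x = card (nbrs x)" by (simp add: vdegree_def)

lemma vertex_nbr: assumes "x \<in> vertices K" shows "\<exists>y. adj K x y"
proof -
  obtain f where f: "f \<in> K" "card f = 3" "{x} \<subseteq> f" using K_face[of "{x}"] assms by (auto simp: vertices_def)
  then have "\<not> f \<subseteq> {x}" using card_mono[of "{x}" f] by auto
  then obtain y where "y \<in> f" "y \<noteq> x" by blast
  then show ?thesis using sub_K[OF f(1), of "{x,y}"] f(3) by (auto simp: adj_def)
qed

lemma link_list:
  assumes xy: "adj K x y" and C: "C \<and> inner_vertex x \<or> \<not> C \<and> bd x y"
  obtains ws where "distinct (x # y # ws)" "nbrs x = set (y # ws)" "ws \<noteq> []"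
    "{f\<in>faces K. x \<in> f} = fan x (y # ws) \<union> (if C then {{x,y,last ws}} else {})"
proof -
  obtain a where a: "tri x y a" using tri_ex[OF xy] by blast
  have 1: "u \<in> nbrs x \<and> v \<in> nbrs x \<and> u \<noteq> v \<and> tri x v u" if "tri x u v" for u v
    using tri_adj[OF that] tri_neq[OF that] tri_perm[OF that] by blast
  have 2: "A = nbrs x" if "A \<subseteq> nbrs x" "A \<noteq> {}" "\<And>u v. u \<in> A \<Longrightarrow> tri x u v \<Longrightarrow> v \<in> A" for A
    using link_closed[OF that] by simp
  have 3: "(\<forall>u\<in>nbrs x. \<forall>b. tri x u b \<longrightarrow> (\<exists>c. tri x u c \<and> c \<noteq> b)) \<and> C \<or> (\<forall>b. tri x y b \<longrightarrow> b = a) \<and> \<not> C"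
    using C tri_other inner_not_bd bd_unique a by (metis mem_Collect_eq)
  obtain ws where ws: "ws \<noteq> []" "distinct (y # ws)" "set (y # ws) = nbrs x"
      "\<And>u v. tri x u v \<longleftrightarrow> (\<exists>i. Suc i < length (y # ws) \<and> {u,v} = {(y # ws) ! i, (y # ws) ! Suc i})
          \<or> (C \<and> {u,v} = {y, last ws})"
    using traverse_graph[of "nbrs x" "tri x" y a C, OF finite_nbrs 1 _ 2 a 3] tri_two by blast
  have "x \<notin> set (y # ws)" using ws(3) adj_irrefl by blast
  then have "distinct (x # y # ws)" using ws(2) by simp
  moreover have "{f\<in>faces K. x \<in> f} = fan x (y # ws) \<union> (if C then {{x,y,last ws}} else {})"
  proof (intro equalityI subsetI)
    fix f assume f: "f \<in> {f\<in>faces K. x \<in> f}"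
    then have "card f = 3" "finite f" using finite_simplex by (auto simp: faces_def)
    then have "card (f - {x}) = 2" using f by simp
    then obtain u v where uv: "f - {x} = {u,v}" "u \<noteq> v" by (auto simp: card_2_iff)
    then have fe: "f = {x,u,v}" using f by blast
    have "x \<noteq> u" "x \<noteq> v" using uv by blast+
    then have "tri x u v" using f uv fe by (auto simp: tri_def faces_def)
    then consider i where "Suc i < length (y # ws)" "{u,v} = {(y # ws) ! i, (y # ws) ! Suc i}"
      | "C" "{u,v} = {y, last ws}" using ws(4) by blast
    then show "f \<in> fan x (y # ws) \<union> (if C then {{x,y,last ws}} else {})"
    proof cases
      case 1
      then have "f = {x, (y # ws) ! i, (y # ws) ! Suc i}" using fe by simp
      then have "f \<in> fan x (y # ws)" using 1(1) unfolding fan_nth by blast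
      then show ?thesis by blast
    qed (use fe in auto)
  next
    fix f assume "f \<in> fan x (y # ws) \<union> (if C then {{x,y,last ws}} else {})"
    then consider i where "Suc i < length (y # ws)" "f = {x, (y # ws) ! i, (y # ws) ! Suc i}"
      | "C" "f = {x, y, last ws}" unfolding fan_nth Un_iff by (metis (full_types) empty_iff singletonD)
    then have "\<exists>u v. f = {x,u,v} \<and> tri x u v"
    proof cases
      case 1
      then show ?thesis using ws(4) by blast
    next
      case 2
      then show ?thesis using ws(4) by blast
    qed
    then show "f \<in> {f\<in>faces K. x \<in> f}" using tri_face by auto
  qed
  ultimately show thesis using that[of ws] ws by simp
qed

lemma contract_nbrs:
  assumes xy: "adj K x y"
  shows "{v. adj (contract y x K) u v} =
    (if u = x then {} else if u = y then nbrs x \<union> nbrs y - {x,y}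
     else nbrs u - {x} \<union> (if adj K u x then {y} else {}))"
proof -
  have ne: "x \<noteq> y" using xy by (auto simp: adj_def)
  let ?g = "id(x := y)"
  have A: "adj (contract y x K) u v \<longleftrightarrow> u \<noteq> v \<and> (\<exists>p q. adj K p q \<and> ?g p = u \<and> ?g q = v)" for u v
  proof
    assume a: "adj (contract y x K) u v"
    then obtain s where s: "s \<in> K" "?g ` s = {u,v}" "u \<noteq> v" by (auto simp: adj_def contract_def)
    then obtain p q where p: "p \<in> s" "?g p = u" and q: "q \<in> s" "?g q = v" by (metis imageE insertI1 insertI2)
    then have "{p,q} \<in> K" "p \<noteq> q" using sub_K[OF s(1), of "{p,q}"] s(3) by auto
    then have "adj K p q" by (simp add: adj_def)
    then show "u \<noteq> v \<and> (\<exists>p q. adj K p q \<and> ?g p = u \<and> ?g q = v)" using p q s by blast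
  next
    assume "u \<noteq> v \<and> (\<exists>p q. adj K p q \<and> ?g p = u \<and> ?g q = v)"
    then obtain p q where p: "u \<noteq> v" "adj K p q" "?g p = u" "?g q = v" by blast
    then have "?g ` {p,q} = {u,v}" by (simp only: image_insert image_empty)
    then have "{u,v} \<in> contract y x K" using p(2) unfolding contract_def adj_def by (metis imageI)
    then show "adj (contract y x K) u v" using p(1) by (simp add: adj_def)
  qed
  have g: "?g p = u \<longleftrightarrow> (p = u \<and> p \<noteq> x) \<or> (p = x \<and> u = y)" for p u by auto
  show ?thesis
    unfolding A g using xy ne adj_irrefl adj_sym by (auto; metis)
qed

lemma contract_vertices: "vertices (contract y x K) \<subseteq> (id(x := y)) ` vertices K"
proof
  fix u assume "u \<in> vertices (contract y x K)"
  then obtain s where s: "s \<in> K" "(id(x := y)) ` s = {u}" by (auto simp: vertices_def contract_def)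
  then obtain p where p: "p \<in> s" "(id(x := y)) p = u" by blast
  then have "{p} \<in> K" using sub_K[OF s(1)] by blast
  then have "p \<in> vertices K" by (simp add: vertices_def)
  then show "u \<in> (id(x := y)) ` vertices K" using p(2) by (metis imageI)
qed

lemma contractible_edge:
  assumes xy: "adj K x y" and C: "inner_vertex x \<or> bd x y"
    and link: "\<And>w. adj K x w \<Longrightarrow> adj K y w \<Longrightarrow> tri x y w"
    and d: "4 \<le> vdegree K x"
  shows "triangulates (cball 0 1 :: complex set) (sphere 0 1) (contract y x K)"
proof -
  define C where "C = inner_vertex x"
  have C': "C \<and> inner_vertex x \<or> \<not> C \<and> bd x y" using C by (auto simp: C_def)
  obtain ws where ws: "distinct (x # y # ws)" "nbrs x = set (y # ws)" "ws \<noteq> []"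
    "{f\<in>faces K. x \<in> f} = fan x (y # ws) \<union> (if C then {{x,y,last ws}} else {})"
    using link_list[OF xy C'] by blast
  have "card (nbrs x) = Suc (length ws)"
    unfolding ws(2) using ws(1) by (simp add: distinct_card)
  then have len: "length ws \<ge> 3" using d by (simp add: deg)
  have tr: "triples (faces K)" by (rule triples_faces[OF pure])
  have K: "complex_of (faces K) = K" by (rule complex_of_faces[OF pure])
  have xw: "adj K x w" if "w \<in> set ws" for w using that ws(2) by auto
  have yw: "adj K y w" if "f \<in> faces K" "{y,w} \<subseteq> f" "y \<noteq> w" for f w
    using that sub_K[of f "{y,w}"] by (auto simp: adj_def faces_def)
  have ynot: "y \<notin> set ws" using ws(1) by auto
  have thd: "tri x y (hd ws)"
  proof -
    have "{x,y,hd ws} \<in> fan x (y # ws)" using ws(3) by (cases ws) auto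
    then have "{x,y,hd ws} \<in> faces K" using ws(4) by blast
    then show ?thesis using ws(1,3) by (intro face_tri) (auto simp: neq_Nil_conv)
  qed
  have eq: "contract y x K = complex_of ({f\<in>faces K. x \<notin> f} \<union> fan y ws)"
    using contract_fan[OF ws(4) _ ws(1)] len by (simp add: K)
  have "pl_equiv (faces K) ({f\<in>faces K. x \<notin> f} \<union> fan y ws)"
  proof (cases C)
    case True
    show ?thesis
    proof (rule pl_equiv_contract_interior[OF tr ws(1)])
      show "2 \<le> length ws" using len by simp
      show "{f\<in>faces K. x \<in> f} = fan x (y # ws) \<union> {{x,y,last ws}}" using ws(4) True by simp
      show "\<not> {y,w} \<subseteq> f" if w: "w \<in> set (butlast (tl ws))" and f: "f \<in> faces K" for w f
      proof
        assume "{y,w} \<subseteq> f"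
        have wt: "w \<in> set (tl ws)" using in_set_butlastD[OF w] .
        then have "w \<in> set ws" by (cases ws) auto
        then have "tri x y w" using link[OF xw yw] f \<open>{y,w} \<subseteq> f\<close> ynot by blast
        moreover have tl: "tri x y (last ws)"
        proof -
          have "{x,y,last ws} \<in> faces K" using ws(4) True by auto
          moreover have "last ws \<in> set ws" using ws(3) by simp
          ultimately show ?thesis using ws(1) by (intro face_tri) auto
        qed
        ultimately have "w = hd ws \<or> w = last ws \<or> hd ws = last ws" using tri_two[OF thd] by blast
        moreover have "distinct (tl ws)" "tl ws \<noteq> []" "ws = hd ws # tl ws" using ws(1,3) len by (cases ws; auto)+
        then have "w \<noteq> last (tl ws)"
          using w by (metis append_butlast_last_id distinct_append disjoint_iff list.set_intros(1))
        then have "w \<noteq> last ws" using \<open>tl ws \<noteq> []\<close> \<open>ws = hd ws # tl ws\<close> by (metis last.simps)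
        moreover have "hd ws \<notin> set (tl ws)" using ws(1,3) by (cases ws) auto
        moreover have "last ws \<in> set (tl ws)" using \<open>tl ws \<noteq> []\<close> \<open>ws = hd ws # tl ws\<close> by (metis last.simps last_in_set)
        ultimately show False using wt by metis
      qed
    qed (use len in simp)
  next
    case False
    show ?thesis
    proof (rule pl_equiv_contract_boundary[OF tr ws(1)])
      show "2 \<le> length ws" using len by simp
      show "{f\<in>faces K. x \<in> f} = fan x (y # ws)" using ws(4) False by simp
      show "\<not> {y,w} \<subseteq> f" if w: "w \<in> set (tl ws)" and f: "f \<in> faces K" for w f
      proof
        assume "{y,w} \<subseteq> f"
        have "w \<in> set ws" using w by (cases ws) auto
        then have "tri x y w" using link[OF xw yw] f \<open>{y,w} \<subseteq> f\<close> ynot by blast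
        then have "w = hd ws" using bd_unique thd C' False by blast
        moreover have "hd ws \<notin> set (tl ws)" using ws(1,3) by (cases ws) auto
        ultimately show False using w by simp
      qed
    qed
  qed
  moreover have "triangulates (cball 0 1 :: complex set) (sphere 0 1) (complex_of (faces K))"
    unfolding K triangulates_def using pure homeo boundary by blast
  ultimately show ?thesis unfolding eq using triangulates_pl_equiv by blast
qed

end

locale minimal_disk = disk_triangulation K h h'
  for K :: "'v set set" and h :: "('v \<Rightarrow> real) \<Rightarrow> complex" and h' :: "complex \<Rightarrow> 'v \<Rightarrow> real" +
  assumes mindeg: "\<And>x y. adj K x y \<Longrightarrow> 4 \<le> vdegree K x"
    and minimal: "four_minimal (cball 0 1 :: complex set) (sphere 0 1) K"
begin

lemma no_R1:
  assumes xy: "adj K x y" and C: "inner_vertex x \<or> bd x y"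
    and link: "\<And>w. adj K x w \<Longrightarrow> adj K y w \<Longrightarrow> tri x y w"
  shows "\<exists>w. tri x y w \<and> vdegree K w = 4"
proof (rule ccontr)
  assume n: "\<not> ?thesis"
  have ne: "x \<noteq> y" using xy by (auto simp: adj_def)
  have "triangulates (cball 0 1 :: complex set) (sphere 0 1) (contract y x K)"
    using contractible_edge[OF xy C link mindeg[OF xy]] .
  moreover have "4 \<le> vdegree (contract y x K) u" if u: "u \<in> vertices (contract y x K)" for u
  proof -
    obtain p where p: "p \<in> vertices K" "(id(x := y)) p = u" using contract_vertices u by blast
    then obtain q where q: "adj K p q" using vertex_nbr by blast
    have ux: "u \<noteq> x" using p(2) ne by (cases "p = x") auto
    show ?thesis
    proof (cases "u = y")
      case True
      have "nbrs x \<inter> nbrs y \<subseteq> {w. tri x y w}" using link by blast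
      moreover have "card {w. tri x y w} \<le> 2"
      proof -
        obtain a where a: "tri x y a" using tri_ex[OF xy] by blast
        show ?thesis
        proof (cases "\<exists>b. tri x y b \<and> b \<noteq> a")
          case True
          then obtain b where b: "tri x y b" "b \<noteq> a" by blast
          then have "{w. tri x y w} \<subseteq> {a,b}" using tri_two[OF a b(1)] by blast
          then have "card {w. tri x y w} \<le> card {a,b}" by (intro card_mono) auto
          then show ?thesis using b(2) by simp
        next
          case False
          then have "{w. tri x y w} = {a}" using a by blast
          then show ?thesis by simp
        qed
      qed
      moreover have "{w. tri x y w} \<subseteq> nbrs x" using tri_adj by blast
      ultimately have i: "card (nbrs x \<inter> nbrs y) \<le> 2"
        using card_mono[OF finite_subset[OF _ finite_nbrs], of "{w. tri x y w}" x "nbrs x \<inter> nbrs y"] by linarith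
      have "card (nbrs x \<union> nbrs y) + card (nbrs x \<inter> nbrs y) = card (nbrs x) + card (nbrs y)"
        using card_Un_Int[OF finite_nbrs finite_nbrs] by simp
      moreover have "4 \<le> card (nbrs x)" "4 \<le> card (nbrs y)"
        using mindeg[OF xy] mindeg[OF adj_sym[OF xy]] by (simp_all add: deg)
      moreover have "{x,y} \<subseteq> nbrs x \<union> nbrs y" using xy adj_sym by blast
      then have "card (nbrs x \<union> nbrs y - {x,y}) = card (nbrs x \<union> nbrs y) - 2"
        using card_Diff_subset[of "{x,y}"] ne by simp
      ultimately have "4 \<le> card (nbrs x \<union> nbrs y - {x,y})" using i by linarith
      then show ?thesis unfolding vdegree_def contract_nbrs[OF xy] using True ne by simp
    next
      case False
      then have pu: "p = u" using p(2) ux by (auto split: if_splits)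
      have d: "4 \<le> card (nbrs u)" using mindeg[OF q] pu by (simp add: deg)
      have e: "vdegree (contract y x K) u = card (nbrs u - {x} \<union> (if adj K u x then {y} else {}))"
        unfolding vdegree_def contract_nbrs[OF xy] using False ux by simp
      show ?thesis
      proof (cases "adj K u x")
        case True
        show ?thesis
        proof (cases "adj K u y")
          case True
          then have "tri x y u" using link adj_sym \<open>adj K u x\<close> by blast
          then have "vdegree K u \<noteq> 4" using n by blast
          then have "5 \<le> card (nbrs u)" using d by (simp add: deg)
          moreover have "nbrs u - {x} \<union> {y} = nbrs u - {x}" using True ne by auto
          ultimately show ?thesis unfolding e using \<open>adj K u x\<close> finite_nbrs by simp
        next
          case False
          have "card (insert y (nbrs u - {x})) = Suc (card (nbrs u - {x}))"
            using False finite_nbrs by simp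
          then show ?thesis unfolding e using \<open>adj K u x\<close> d finite_nbrs by simp
        qed
      next
        case False
        then have "nbrs u - {x} = nbrs u" by auto
        then show ?thesis unfolding e using d False by simp
      qed
    qed
  qed
  ultimately have "F4 (cball 0 1 :: complex set) (sphere 0 1) (contract y x K)" by (simp add: F4_def)
  moreover have "reduction (cball 0 1 :: complex set) (sphere 0 1) K (contract y x K)"
    by (rule R1[OF adj_sym[OF xy]])
  ultimately show False using minimal unfolding four_minimal_def four_reduction_def by blast
qed

end

subsection \<open>Disks without non-facial 3-cycles\<close>

definition sel3 :: "'v \<Rightarrow> 'v \<Rightarrow> 'v \<Rightarrow> nat \<Rightarrow> 'v" where
  "sel3 a b c i = (if i = 1 then a else if i = 2 then b else c)"

lemma sel3_simps [simp]: "sel3 a b c 1 = a" "sel3 a b c (Suc 0) = a" "sel3 a b c 2 = b" "sel3 a b c 3 = c"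
  by (simp_all add: sel3_def)

lemma sel3_image [simp]: "sel3 a b c ` {1,2,3} = {a,b,c}" "sel3 a b c ` {Suc 0,2,3} = {a,b,c}"
  by (auto simp: sel3_def)

lemma inj_on_sel3: "distinct [a,b,c] \<Longrightarrow> inj_on (sel3 a b c) {1,2,3}"
  by (auto simp: inj_on_def sel3_def)

lemma perm3_cases:
  assumes "{i,j,k} = {1,2,3::nat}"
  shows "(i = 1 \<and> j = 2 \<and> k = 3) \<or> (i = 1 \<and> j = 3 \<and> k = 2) \<or> (i = 2 \<and> j = 1 \<and> k = 3) \<or>
    (i = 2 \<and> j = 3 \<and> k = 1) \<or> (i = 3 \<and> j = 1 \<and> k = 2) \<or> (i = 3 \<and> j = 2 \<and> k = 1)"
proof -
  have m: "i \<in> {1,2,3}" "j \<in> {1,2,3}" "k \<in> {1,2,3}" using assms by blast+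
  have "card {i,j,k} = 3" unfolding assms by simp
  then have "i \<noteq> j" "j \<noteq> k" "i \<noteq> k" by (auto simp: card_insert_if split: if_splits)
  then show ?thesis using m by auto
qed

context disk_triangulation
begin

lemma octahedral_frameI:
  assumes d: "distinct [v1,v2,v3,a1,a2,a3]"
    and N: "nbrs v1 = {v2,v3,a2,a3}" "nbrs v2 = {v1,v3,a1,a3}" "nbrs v3 = {v1,v2,a1,a2}"
  shows "octahedral_frame K (sel3 v1 v2 v3) (sel3 a1 a2 a3)"
  unfolding octahedral_frame_def sel3_image
proof (intro conjI allI impI ballI)
  show "inj_on (sel3 a1 a2 a3) {1,2,3}" "inj_on (sel3 v1 v2 v3) {1,2,3}" using d by (auto intro!: inj_on_sel3)
  have "adj K v1 v2" "adj K v2 v3" "adj K v1 v3" using N by blast+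
  then show "cycle3 (sel3 v1 v2 v3 1) (sel3 v1 v2 v3 2) (sel3 v1 v2 v3 3) \<subseteq> K" by (simp add: cycle3_def adj_def)
  fix i :: nat assume "i \<in> {1,2,3}"
  then show "vdegree K (sel3 v1 v2 v3 i) = 4" using d N by (auto simp: deg)
next
  fix i j k :: nat assume "{i,j,k} = {1,2,3}"
  note p = perm3_cases[OF this]
  have A: "adj K w v1 \<longleftrightarrow> w \<in> {v2,v3,a2,a3}" "adj K w v2 \<longleftrightarrow> w \<in> {v1,v3,a1,a3}"
    "adj K w v3 \<longleftrightarrow> w \<in> {v1,v2,a1,a2}" for w
    unfolding N[symmetric] using adj_sym by blast+
  have 1: "{w. w \<notin> {v1,v2,v3} \<and> adj K w v2 \<and> adj K w v3} = {a1}"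
    "{w. w \<notin> {v1,v2,v3} \<and> adj K w v1 \<and> adj K w v3} = {a2}"
    "{w. w \<notin> {v1,v2,v3} \<and> adj K w v1 \<and> adj K w v2} = {a3}"
    unfolding A using d by auto
  have 2: "{w. w \<notin> {v1,v2,v3} \<and> adj K w v3 \<and> adj K w v2} = {a1}"
    "{w. w \<notin> {v1,v2,v3} \<and> adj K w v3 \<and> adj K w v1} = {a2}"
    "{w. w \<notin> {v1,v2,v3} \<and> adj K w v2 \<and> adj K w v1} = {a3}"
    using 1 by (simp_all add: conj_commute)
  show "{w. w \<notin> {v1,v2,v3} \<and> adj K w (sel3 v1 v2 v3 j) \<and> adj K w (sel3 v1 v2 v3 k)} = {sel3 a1 a2 a3 i}"
    using p by (elim disjE conjE; simp only: sel3_simps 1 2)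
qed

lemma edge_count:
  assumes S: "S \<subseteq> faces K" and t: "tri a b u" "tri a b v" "u \<noteq> v"
  shows "odd (card {f\<in>S. {a,b} \<subseteq> f}) \<longleftrightarrow> ({a,b,u} \<in> S) \<noteq> ({a,b,v} \<in> S)"
proof -
  have "tri a b z \<Longrightarrow> z = u \<or> z = v" for z using tri_two[OF t(1,2)] t(3) by blast
  then have "{f\<in>faces K. {a,b} \<subseteq> f} = {{a,b,u},{a,b,v}}"
    using face_star[OF tri_adj(1)[OF t(1)]] t by auto
  moreover have "{f\<in>S. {a,b} \<subseteq> f} = S \<inter> {f\<in>faces K. {a,b} \<subseteq> f}" using S by blast
  ultimately have "{f\<in>S. {a,b} \<subseteq> f} = S \<inter> {{a,b,u},{a,b,v}}" by (simp only:)
  moreover have "{a,b,u} \<noteq> {a,b,v}" using tri_neq[OF t(1)] tri_neq[OF t(2)] t(3) by auto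
  moreover have "odd (card (S \<inter> {p,q})) \<longleftrightarrow> (p \<in> S) \<noteq> (q \<in> S)" if "p \<noteq> q" for p q :: "'v set"
    using that by (cases "p \<in> S"; cases "q \<in> S"; simp)
  ultimately show ?thesis by (simp only:)
qed

lemma edge_count_bd:
  assumes S: "S \<subseteq> faces K" and t: "bd a b" "tri a b u"
  shows "card {f\<in>S. {a,b} \<subseteq> f} = (if {a,b,u} \<in> S then 1 else 0)"
proof -
  have "tri a b z \<longleftrightarrow> z = u" for z using bd_unique[OF t(1) t(2)] t(2) by blast
  then have "{f\<in>faces K. {a,b} \<subseteq> f} = {{a,b,u}}"
    unfolding face_star[OF tri_adj(1)[OF t(2)]] by simp
  moreover have "{f\<in>S. {a,b} \<subseteq> f} = S \<inter> {f\<in>faces K. {a,b} \<subseteq> f}" using S by blast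
  ultimately have e: "{f\<in>S. {a,b} \<subseteq> f} = S \<inter> {{a,b,u}}" by (simp only:)
  show ?thesis unfolding e by simp
qed

lemma count_parity:
  assumes S: "S \<subseteq> faces K"
  shows "even (\<Sum>y\<in>nbrs x. card {f\<in>S. {x,y} \<subseteq> f})"
proof -
  have finS: "finite S" using S finite_K by (auto simp: faces_def intro: finite_subset)
  have "(\<Sum>y\<in>nbrs x. card {f\<in>{f\<in>S. x \<in> f}. y \<in> f}) = 2 * card {f\<in>S. x \<in> f}"
  proof (rule sum_multicount[OF finite_nbrs])
    show "finite {f\<in>S. x \<in> f}" using finS by simp
    show "\<forall>f\<in>{f\<in>S. x \<in> f}. card {y\<in>nbrs x. y \<in> f} = 2"
    proof
      fix f assume f: "f \<in> {f\<in>S. x \<in> f}"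
      then have fK: "f \<in> K" "card f = 3" "x \<in> f" using S by (auto simp: faces_def)
      have "{y\<in>nbrs x. y \<in> f} = f - {x}"
        using fK sub_K[OF fK(1)] by (auto simp: adj_def)
      then show "card {y\<in>nbrs x. y \<in> f} = 2" using fK finite_simplex by simp
    qed
  qed
  moreover have "{f\<in>{f\<in>S. x \<in> f}. y \<in> f} = {f\<in>S. {x,y} \<subseteq> f}" for y by auto
  ultimately show ?thesis by simp
qed

lemma all_faces_in:
  assumes S: "S \<subseteq> faces K" and f: "f \<in> S" "x \<in> f"
    and side: "\<And>y u v. tri x y u \<Longrightarrow> tri x y v \<Longrightarrow> {x,y,u} \<in> S \<Longrightarrow> {x,y,v} \<in> S"
    and t: "tri x y u"
  shows "{x,y,u} \<in> S"
proof -
  let ?A = "{y \<in> nbrs x. \<exists>u. tri x y u \<and> {x,y,u} \<in> S}"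
  have "nbrs x = ?A"
  proof (rule link_closed)
    have "card f = 3" "finite f" using f S finite_simplex by (auto simp: faces_def)
    then have "card (f - {x}) = 2" using f by simp
    then obtain a b where ab: "f - {x} = {a,b}" "a \<noteq> b" by (auto simp: card_2_iff)
    then have fe: "f = {x,a,b}" using f by blast
    then have "tri x a b" using ab f S by (intro face_tri) auto
    then show "?A \<noteq> {}" using tri_adj f(1) fe by blast
    show "z \<in> ?A" if y: "y \<in> ?A" and z: "tri x y z" for y z
    proof -
      have "{x,y,z} \<in> S" using side[OF _ z] y by blast
      then have "{x,z,y} \<in> S" by (simp add: insert_commute)
      then show ?thesis using tri_perm(2)[OF z] tri_adj(3)[OF z] by blast
    qed
  qed blast
  then show ?thesis using side[OF _ t] tri_adj(1)[OF t] by blast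
qed

lemma bd_two:
  assumes "bd x c" shows "\<exists>y. bd x y \<and> y \<noteq> c"
proof (rule ccontr)
  assume n: "\<not> ?thesis"
  have "odd (\<Sum>y\<in>nbrs x. card {f\<in>faces K. {x,y} \<subseteq> f})"
  proof -
    have c: "c \<in> nbrs x" using bd_adj[OF assms] by simp
    obtain u where u: "tri x c u" using tri_ex[OF bd_adj[OF assms]] by blast
    have "card {f\<in>faces K. {x,c} \<subseteq> f} = 1"
      using edge_count_bd[OF order_refl assms u] tri_face[OF u] by simp
    moreover have "even (\<Sum>y\<in>nbrs x - {c}. card {f\<in>faces K. {x,y} \<subseteq> f})"
    proof (rule dvd_sum)
      fix y assume y: "y \<in> nbrs x - {c}"
      then have "\<not> bd x y" using n by blast
      moreover obtain u where u: "tri x y u" using tri_ex y by blast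
      ultimately obtain v where "tri x y v" "v \<noteq> u" using tri_other y by blast
      then show "even (card {f\<in>faces K. {x,y} \<subseteq> f})"
        using edge_count[OF order_refl u] tri_face u by blast
    qed
    ultimately show ?thesis by (simp add: sum.remove[OF finite_nbrs c])
  qed
  then show False using count_parity[OF order_refl] by blast
qed

lemma nbrs_eqI: "A \<subseteq> nbrs x \<Longrightarrow> vdegree K x = card A \<Longrightarrow> nbrs x = A"
  using card_subset_eq[OF finite_nbrs, of A x] by (metis deg)

lemma deg4_inner:
  assumes x: "inner_vertex x" "vdegree K x = 4" and t: "tri x p q"
  obtains r s where "nbrs x = {p,q,r,s}" "distinct [p,q,r,s]" "tri x q r" "tri x r s" "tri x s p"
proof -
  have other: "\<exists>b. tri x y b \<and> b \<noteq> a" if "adj K x y" for y a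
    using tri_other[OF that inner_not_bd[OF x(1)]] .
  obtain r where r: "tri x q r" "r \<noteq> p" using other[of q p] tri_adj[OF t] by blast
  obtain s where s: "tri x r s" "s \<noteq> q" using other[of r q] tri_adj[OF r(1)] by blast
  have sp: "s \<noteq> p"
  proof
    assume sp: "s = p"
    have "nbrs x = {p,q,r}"
    proof (rule link_closed)
      show "{p,q,r} \<subseteq> nbrs x" using tri_adj[OF t] tri_adj[OF r(1)] by blast
      show "w \<in> {p,q,r}" if "y \<in> {p,q,r}" "tri x y w" for y w
        using that tri_two[OF t tri_perm(2)[OF s(1)[unfolded sp]], of w] tri_two[OF tri_perm(2)[OF t] r(1), of w]
          tri_two[OF tri_perm(2)[OF r(1)] s(1)[unfolded sp], of w] r(2) s(2) tri_neq[OF t] tri_neq[OF r(1)] by blast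
    qed simp
    then have "vdegree K x \<le> 3" using card_length[of "[p,q,r]"] by (simp add: deg)
    then show False using x by simp
  qed
  have d: "distinct [p,q,r,s]" using tri_neq[OF t] tri_neq[OF r(1)] tri_neq[OF s(1)] r(2) s(2) sp by auto
  have N: "nbrs x = {p,q,r,s}"
    by (rule nbrs_eqI) (use tri_adj[OF t] tri_adj[OF r(1)] tri_adj[OF s(1)] d x in auto)
  obtain w where w: "tri x s w" "w \<noteq> r" using other[of s r] tri_adj[OF s(1)] by blast
  have "w \<noteq> q"
  proof
    assume "w = q"
    then have "tri x q s" using tri_perm(2)[OF w(1)] by simp
    then show False using tri_two[OF r(1) tri_perm(2)[OF t], of s] d by auto
  qed
  moreover have "w \<in> {p,q,r,s}" using N tri_adj[OF w(1)] by blast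
  ultimately have "w = p" using w(2) tri_neq[OF w(1)] by blast
  then show thesis using that N d r(1) s(1) w(1) by blast
qed

lemma deg4_boundary:
  assumes x: "bd x y" "vdegree K x = 4" and t: "tri x y z" "tri x z v" "v \<noteq> y" and v: "inner_vertex v"
  obtains x' where "nbrs x = {y,z,v,x'}" "distinct [y,z,v,x']" "tri x v x'" "bd x x'"
proof -
  have "\<not> bd x v" using v bd_boundary by blast
  then obtain w where w: "tri x v w" "w \<noteq> z" using tri_other[of x v z] tri_adj[OF t(2)] by blast
  have wy: "w \<noteq> y"
  proof
    assume "w = y"
    then have "tri x y v" using tri_perm(2)[OF w(1)] by simp
    then show False using bd_unique[OF x(1) t(1)] tri_neq[OF t(2)] by blast
  qed
  have d: "distinct [y,z,v,w]" using tri_neq[OF t(1)] tri_neq[OF t(2)] tri_neq[OF w(1)] w(2) wy t(3) by auto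
  have N: "nbrs x = {y,z,v,w}"
    by (rule nbrs_eqI) (use tri_adj[OF t(1)] tri_adj[OF t(2)] tri_adj[OF w(1)] d x in auto)
  have "bd x w"
  proof -
    have "u = v" if u: "tri x w u" for u
    proof -
      have "u \<in> {y,z,v,w}" using N tri_adj[OF u] by blast
      moreover have "u \<noteq> y" using bd_unique[OF x(1) t(1)] tri_perm(2)[OF u] d by auto
      moreover have "u \<noteq> z"
        using tri_two[OF tri_perm(2)[OF t(1)] t(2), of w] tri_perm(2)[OF u] d by auto
      ultimately show ?thesis using tri_neq[OF u] by blast
    qed
    then show ?thesis using tri_adj[OF w(1)] by (auto simp: bd_iff)
  qed
  then show thesis using that N d w(1) by blast
qed

end

locale flag_minimal_disk = minimal_disk K h h'
  for K :: "'v set set" and h :: "('v \<Rightarrow> real) \<Rightarrow> complex" and h' :: "complex \<Rightarrow> 'v \<Rightarrow> real" +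
  assumes flag: "\<And>x y z. adj K x y \<Longrightarrow> adj K y z \<Longrightarrow> adj K x z \<Longrightarrow> tri x y z"
begin

lemma no_R1_flag: "adj K x y \<Longrightarrow> inner_vertex x \<or> bd x y \<Longrightarrow> \<exists>w. tri x y w \<and> vdegree K w = 4"
  using no_R1[of x y] flag[of x y] by blast

definition chord :: "'v \<Rightarrow> 'v \<Rightarrow> bool" where
  "chord c d \<longleftrightarrow> adj K c d \<and> \<not> bd c d \<and> c \<in> boundary_vertices K \<and> d \<in> boundary_vertices K"

definition chord_side :: "'v \<Rightarrow> 'v \<Rightarrow> 'v set set \<Rightarrow> bool" where
  "chord_side c d S \<longleftrightarrow> S \<subseteq> faces K \<and>
    (\<forall>a b u v. tri a b u \<longrightarrow> tri a b v \<longrightarrow> u \<noteq> v \<longrightarrow> (({a,b,u} \<in> S) \<noteq> ({a,b,v} \<in> S) \<longleftrightarrow> {a,b} = {c,d}))"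

lemma chord_side_ex: assumes "chord c d" shows "\<exists>S. chord_side c d S"
proof -
  have cd: "adj K c d" "{c,d} \<notin> boundary_edges K" "c \<in> boundary_vertices K" "d \<in> boundary_vertices K"
    using assms by (simp_all add: chord_def bd_def)
  obtain S where S: "S \<subseteq> faces K"
    "\<And>a b. adj K a b \<Longrightarrow> {a,b} \<notin> boundary_edges K \<Longrightarrow> odd (card {f\<in>S. {a,b} \<subseteq> f}) \<longleftrightarrow> {a,b} = {c,d}"
    by (rule chord_filling[OF cd]) (rule that)
  have "({a,b,u} \<in> S) \<noteq> ({a,b,v} \<in> S) \<longleftrightarrow> {a,b} = {c,d}" if t: "tri a b u" "tri a b v" "u \<noteq> v" for a b u v
  proof -
    have "{a,b} \<notin> boundary_edges K" using t bd_unique[of a b u v] unfolding bd_def by blast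
    then show ?thesis using S(2)[OF tri_adj(1)[OF t(1)]] edge_count[OF S(1) t] by blast
  qed
  then show ?thesis using S(1) unfolding chord_side_def by blast
qed

lemma chord_side_compl: "chord_side c d S \<Longrightarrow> chord_side c d (faces K - S)"
  unfolding chord_side_def using tri_face by (metis Diff_iff Diff_subset)

lemma good_edge: "\<exists>x y. bd x y \<and> (\<forall>w. \<not> chord x w) \<and> (\<forall>w. \<not> chord y w)"
proof (cases "\<exists>c d. chord c d")
  case False
  obtain e where e: "e \<in> boundary_edges K" using boundary_edges_nonempty by blast
  then have "card e = 2" by (simp add: boundary_edges_def)
  then obtain x y where "e = {x,y}" by (auto simp: card_2_iff)
  then have "bd x y" using e by (simp add: bd_def)
  then show ?thesis using False by blast
next
  case True
  define P where "P = (\<lambda>n. \<exists>c d S. chord c d \<and> chord_side c d S \<and> card S = n)"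
  have "\<exists>n. P n" using True chord_side_ex unfolding P_def by blast
  then obtain n where n: "P n" "\<And>m. m < n \<Longrightarrow> \<not> P m" using exists_least_iff[of P] by blast
  then obtain c d S where cd: "chord c d" and S: "chord_side c d S" and cS: "card S = n" unfolding P_def by blast
  have SF: "S \<subseteq> faces K" and side: "\<And>a b u v. tri a b u \<Longrightarrow> tri a b v \<Longrightarrow> u \<noteq> v \<Longrightarrow>
      (({a,b,u} \<in> S) \<noteq> ({a,b,v} \<in> S) \<longleftrightarrow> {a,b} = {c,d})"
    using S unfolding chord_side_def by blast+
  have finS: "finite S" using SF finite_K by (auto simp: faces_def intro: finite_subset)
  have acd: "adj K c d" "\<not> bd c d" using cd by (simp_all add: chord_def)
  obtain t0 where t0: "tri c d t0" using tri_ex[OF acd(1)] by blast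
  obtain t1 where t1: "tri c d t1" "t1 \<noteq> t0" using tri_other[OF acd] by blast
  have "({c,d,t0} \<in> S) \<noteq> ({c,d,t1} \<in> S)" using side[OF t0 t1(1)] t1(2) by blast
  then obtain t t' where t: "tri c d t" "tri c d t'" "t \<noteq> t'" "{c,d,t} \<in> S" "{c,d,t'} \<notin> S" using t0 t1 by metis
  have no_chord: False if ch: "chord c' d'" "{c',d'} \<noteq> {c,d}" and u: "tri c' d' u" "{c',d',u} \<in> S" for c' d' u
  proof -
    obtain S' where S': "chord_side c' d' S'" "{c,d,t} \<notin> S'"
    proof -
      obtain S0 where S0: "chord_side c' d' S0" using chord_side_ex[OF ch(1)] by blast
      then show thesis using that[of S0] that[of "faces K - S0"] chord_side_compl by blast
    qed
    have side': "({a,b,u} \<in> S') \<noteq> ({a,b,v} \<in> S') \<longleftrightarrow> {a,b} = {c',d'}" if "tri a b u" "tri a b v" "u \<noteq> v" for a b u v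
      using that S'(1) unfolding chord_side_def by blast
    have "chord_side c' d' (S \<inter> S')"
      unfolding chord_side_def
    proof (intro conjI allI impI)
      show "S \<inter> S' \<subseteq> faces K" using SF by blast
      fix a b r s assume rs: "tri a b r" "tri a b s" "r \<noteq> s"
      consider (1) "{a,b} = {c,d}" | (2) "{a,b} = {c',d'}" "{a,b} \<noteq> {c,d}" | (3) "{a,b} \<noteq> {c',d'}" "{a,b} \<noteq> {c,d}" by blast
      then show "({a,b,r} \<in> S \<inter> S') \<noteq> ({a,b,s} \<in> S \<inter> S') \<longleftrightarrow> {a,b} = {c',d'}"
      proof cases
        case 1
        have ab: "{a,b,w} = {c,d,w}" for w using 1 by blast
        have "tri c d r" "tri c d s" using rs ab 1 unfolding tri_def by (metis doubleton_eq_iff)+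
        then have "(r = t \<or> r = t') \<and> (s = t \<or> s = t')" using tri_two[OF t(1,2)] t(3) by blast
        then have "{a,b,r} \<notin> S \<inter> S'" "{a,b,s} \<notin> S \<inter> S'" unfolding ab using t(5) S'(2) by blast+
        then show ?thesis using 1 ch(2) by blast
      next
        case 2
        have ab: "{a,b,w} = {c',d',w}" for w using 2(1) by blast
        have "tri c' d' r" "tri c' d' s" using rs ab 2(1) unfolding tri_def by (metis doubleton_eq_iff)+
        then have "u = r \<or> u = s" using tri_two[OF _ _ u(1)] rs(3) by blast
        then have "{a,b,r} \<in> S" "{a,b,s} \<in> S" using u(2) side[OF rs] 2(2) unfolding ab by blast+
        then show ?thesis using side'[OF rs] by blast
      next
        case 3
        then show ?thesis using side[OF rs] side'[OF rs] by blast
      qed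
    qed
    moreover have "card (S \<inter> S') < n"
      using psubset_card_mono[OF finS, of "S \<inter> S'"] t(4) S'(2) cS by blast
    ultimately show False using n(2) ch(1) unfolding P_def by blast
  qed
  have full: "{x,y,u} \<in> S" if x: "x \<notin> {c,d}" "f \<in> S" "x \<in> f" "tri x y u" for x f y u
  proof (rule all_faces_in[OF SF x(2,3) _ x(4)])
    fix y u v assume "tri x y u" "tri x y v" "{x,y,u} \<in> S"
    moreover have "{x,y} \<noteq> {c,d}" using x(1) by blast
    ultimately show "{x,y,v} \<in> S" using side[of x y u v] by (cases "u = v") auto
  qed
  obtain x w where x: "bd c x" "tri c x w" "{c,x,w} \<in> S"
  proof -
    have "\<exists>x\<in>nbrs c. bd c x \<and> odd (card {f\<in>S. {c,x} \<subseteq> f})"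
    proof (rule ccontr)
      assume n: "\<not> ?thesis"
      have "even (\<Sum>y\<in>nbrs c - {d}. card {f\<in>S. {c,y} \<subseteq> f})"
      proof (rule dvd_sum)
        fix y assume y: "y \<in> nbrs c - {d}"
        show "even (card {f\<in>S. {c,y} \<subseteq> f})"
        proof (cases "bd c y")
          case False
          obtain u where u: "tri c y u" using tri_ex y by blast
          obtain v where v: "tri c y v" "v \<noteq> u" using tri_other[OF _ False] y by blast
          have "{c,y} \<noteq> {c,d}" using y by (auto simp: doubleton_eq_iff)
          then show ?thesis using edge_count[OF SF u v(1)] v(2) side[OF u v(1)] by blast
        qed (use n y in blast)
      qed
      moreover have "odd (card {f\<in>S. {c,d} \<subseteq> f})" using edge_count[OF SF t(1-3)] t by blast
      moreover have "d \<in> nbrs c" using acd by simp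
      ultimately have "odd (\<Sum>y\<in>nbrs c. card {f\<in>S. {c,y} \<subseteq> f})" by (simp add: sum.remove[OF finite_nbrs])
      then show False using count_parity[OF SF] by blast
    qed
    then obtain x where x: "bd c x" "odd (card {f\<in>S. {c,x} \<subseteq> f})" by blast
    moreover obtain w where w: "tri c x w" using tri_ex bd_adj x by blast
    ultimately show thesis using that edge_count_bd[OF SF x(1) w] by (metis (full_types) even_zero)
  qed
  have xcd: "x \<notin> {c,d}" using x(1) acd(2) tri_neq[OF x(2)] by blast
  have xS: "{x,y,u} \<in> S" if "tri x y u" for y u by (rule full[OF xcd x(3) _ that]) simp
  obtain y where y: "bd x y" "y \<noteq> c" using bd_two[OF bd_sym[OF x(1)]] by blast
  have "y \<noteq> d"
  proof
    assume yd: "y = d"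
    have t: "tri c x d" using flag[OF bd_adj[OF x(1)]] bd_adj y yd acd by blast
    have "nbrs x = {c,d}"
    proof (rule link_closed)
      show "{c,d} \<subseteq> nbrs x" using bd_adj[OF bd_sym[OF x(1)]] bd_adj y yd by blast
      show "z \<in> {c,d}" if "w \<in> {c,d}" "tri x w z" for w z
        using that bd_unique[OF bd_sym[OF x(1)] tri_perm(4)[OF tri_perm(3)[OF t]]] bd_unique[OF y(1)[unfolded yd]] tri_perm[OF t]
          bd_unique[OF bd_sym[OF x(1)]] by blast
    qed simp
    then have "vdegree K x \<le> 2" using card_length[of "[c,d]"] by (simp add: deg)
    then show False using mindeg[OF bd_adj[OF y(1)]] by simp
  qed
  then have ycd: "y \<notin> {c,d}" using y(2) by blast
  obtain u where u: "tri x y u" using tri_ex[OF bd_adj[OF y(1)]] by blast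
  have yS: "{y,z,r} \<in> S" if "tri y z r" for z r by (rule full[OF ycd xS[OF u] _ that]) simp
  have "\<not> chord x w" for w
  proof
    assume ch: "chord x w"
    then obtain r where "tri x w r" using tri_ex by (auto simp: chord_def)
    moreover have "{x,w} \<noteq> {c,d}" using xcd by blast
    ultimately show False using no_chord[OF ch] xS by blast
  qed
  moreover have "\<not> chord y w" for w
  proof
    assume ch: "chord y w"
    then obtain r where "tri y w r" using tri_ex by (auto simp: chord_def)
    moreover have "{y,w} \<noteq> {c,d}" using ycd by blast
    ultimately show False using no_chord[OF ch] yS by blast
  qed
  ultimately show ?thesis using y(1) by blast
qed

end

context disk_triangulation
begin

lemma face_at: assumes "f \<in> faces K" "z \<in> f" shows "\<exists>a b. f = {z,a,b} \<and> tri z a b"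
proof -
  have "card f = 3" "finite f" using assms finite_simplex by (auto simp: faces_def)
  then have "card (f - {z}) = 2" using assms by simp
  then obtain a b where ab: "f - {z} = {a,b}" "a \<noteq> b" by (auto simp: card_2_iff)
  then have fe: "f = {z,a,b}" using assms by blast
  then have "tri z a b" using ab assms by (intro face_tri) auto
  then show ?thesis using fe by blast
qed

lemma faces_of_4_cycle:
  assumes N: "nbrs z = {a,b,c,d}" and d: "distinct [a,b,c,d]"
    and t: "tri z a b" "tri z b c" "tri z c d" "tri z d a" and f: "f \<in> faces K" "z \<in> f"
  shows "f \<in> {{z,a,b},{z,b,c},{z,c,d},{z,d,a}}"
proof -
  obtain p q where pq: "f = {z,p,q}" "tri z p q" using face_at[OF f] by blast
  have "p \<in> {a,b,c,d}" using tri_adj(1)[OF pq(2)] N by blast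
  moreover have "q = b \<or> q = d" if "p = a" using tri_two[OF t(1) tri_perm(2)[OF t(4)], of q] pq(2) that d by auto
  moreover have "q = a \<or> q = c" if "p = b" using tri_two[OF tri_perm(2)[OF t(1)] t(2), of q] pq(2) that d by auto
  moreover have "q = b \<or> q = d" if "p = c" using tri_two[OF tri_perm(2)[OF t(2)] t(3), of q] pq(2) that d by auto
  moreover have "q = a \<or> q = c" if "p = d" using tri_two[OF t(4) tri_perm(2)[OF t(3)], of q] pq(2) that d by auto
  ultimately show ?thesis unfolding pq(1) by (auto simp: insert_commute)
qed

lemma faces_of_4_path:
  assumes N: "nbrs z = {a,b,c,d}" and d: "distinct [a,b,c,d]"
    and t: "tri z a b" "tri z b c" "tri z c d" and bd: "bd z a" "bd z d" and f: "f \<in> faces K" "z \<in> f"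
  shows "f \<in> {{z,a,b},{z,b,c},{z,c,d}}"
proof -
  obtain p q where pq: "f = {z,p,q}" "tri z p q" using face_at[OF f] by blast
  have "p \<in> {a,b,c,d}" using tri_adj(1)[OF pq(2)] N by blast
  moreover have "q = b" if "p = a" using bd_unique[OF bd(1) t(1), of q] pq(2) that by auto
  moreover have "q = a \<or> q = c" if "p = b" using tri_two[OF tri_perm(2)[OF t(1)] t(2), of q] pq(2) that d by auto
  moreover have "q = b \<or> q = d" if "p = c" using tri_two[OF tri_perm(2)[OF t(2)] t(3), of q] pq(2) that d by auto
  moreover have "q = c" if "p = d" using bd_unique[OF bd(2) tri_perm(2)[OF t(3)], of q] pq(2) that by auto
  ultimately show ?thesis unfolding pq(1) by (auto simp: insert_commute)
qed

lemma triples_K: "triples (faces K)" by (rule triples_faces[OF pure])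

lemma complex_K: "complex_of (faces K) = K" by (rule complex_of_faces[OF pure])

lemma triangulates_K: "triangulates (cball 0 1 :: complex set) (sphere 0 1) (complex_of (faces K))"
  unfolding complex_K triangulates_def using pure homeo boundary by blast

end

context minimal_disk
begin

lemma no_reduction:
  assumes "reduction (cball 0 1 :: complex set) (sphere 0 1) K (complex_of G)" "pl_equiv (faces K) G"
    and "\<And>u w. adj (complex_of G) u w \<Longrightarrow> 4 \<le> card {w. adj (complex_of G) u w}"
  shows False
proof -
  have G: "triples G" using assms(2) by (simp add: pl_equiv_def)
  have "4 \<le> vdegree (complex_of G) u" if u: "u \<in> vertices (complex_of G)" for u
  proof -
    obtain f where f: "f \<in> G" "u \<in> f" using u by (auto simp: vertices_def complex_of_def)
    then have "card f = 3" using G by (simp add: triples_def)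
    then have "\<not> f \<subseteq> {u}" using card_mono[of "{u}" f] by auto
    then obtain w where "w \<in> f" "w \<noteq> u" by blast
    then have "adj (complex_of G) u w" using f by (auto simp: adj_complex_of)
    then show ?thesis using assms(3) by (simp add: vdegree_def)
  qed
  moreover have "triangulates (cball 0 1 :: complex set) (sphere 0 1) (complex_of G)"
    using triangulates_K unfolding triangulates_pl_equiv[OF assms(2)] .
  ultimately have "F4 (cball 0 1 :: complex set) (sphere 0 1) (complex_of G)"
    by (simp add: F4_def)
  then show False using minimal assms(1) unfolding four_minimal_def four_reduction_def by blast
qed

lemma no_R4_contract:
  assumes d: "distinct [x,y,z,v,x',p]"
    and N: "nbrs x = {y,z,v,x'}" "nbrs z = {x,y,p,v}" "nbrs v = {x,z,p,x'}"
    and t: "tri x y z" "tri x z v" "tri x v x'" "tri z y p" "tri z p v" "tri v p x'"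
    and bd: "bd x y" "bd x x'" and yx': "\<not> adj K y x'"
    and flag: "\<And>a b c. {a,b,c} \<subseteq> {x,y,z,v,x',p} \<Longrightarrow> adj K a b \<Longrightarrow> adj K b c \<Longrightarrow> adj K a c \<Longrightarrow> tri a b c"
    and deg: "6 \<le> vdegree K p" "5 \<le> vdegree K y" "5 \<le> vdegree K x'"
  shows False
proof -
  let ?v = "sel3 z v x" and ?a = "sel3 x' y p"
  define F0 where "F0 = {f\<in>faces K. x \<notin> f \<and> z \<notin> f \<and> v \<notin> f}"
  let ?six = "{{x,y,z},{x,z,v},{x,v,x'},{z,y,p},{z,p,v},{v,p,x'}}"
  have fx: "f \<in> {{x,y,z},{x,z,v},{x,v,x'}}" if "f \<in> faces K" "x \<in> f" for f
    by (rule faces_of_4_path[OF N(1) _ t(1-3) bd that]) (use d in auto)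
  have fz: "f \<in> {{z,x,y},{z,y,p},{z,p,v},{z,v,x}}" if "f \<in> faces K" "z \<in> f" for f
    by (rule faces_of_4_cycle[OF N(2) _ _ t(4,5) _ that]) (use d tri_perm[OF t(1)] tri_perm[OF t(2)] in auto)
  have Nv: "nbrs v = {x,z,p,x'}" by (rule N(3))
  have fv: "f \<in> {{v,x,z},{v,z,p},{v,p,x'},{v,x',x}}" if "f \<in> faces K" "v \<in> f" for f
    by (rule faces_of_4_cycle[OF Nv _ _ _ t(6) _ that])
      (use d tri_perm[OF t(2)] tri_perm[OF t(3)] tri_perm[OF t(5)] in auto)
  have six: "?six \<subseteq> faces K" using t tri_face by auto
  have F: "faces K = F0 \<union> ?six"
  proof
    show "F0 \<union> ?six \<subseteq> faces K" using six by (auto simp: F0_def)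
    show "faces K \<subseteq> F0 \<union> ?six"
    proof
      fix f assume f: "f \<in> faces K"
      have e: "{z,x,y} = {x,y,z}" "{z,v,x} = {x,z,v}" "{v,x,z} = {x,z,v}" "{v,z,p} = {z,p,v}" "{v,x',x} = {x,v,x'}"
        by blast+
      consider "x \<in> f" | "z \<in> f" | "v \<in> f" | "f \<in> F0" using f by (auto simp: F0_def)
      then show "f \<in> F0 \<union> ?six"
      proof cases
        case 1
        show ?thesis using fx[OF f 1] by (elim insertE emptyE) simp_all
      next
        case 2
        show ?thesis using fz[OF f 2] unfolding e by (elim insertE emptyE) simp_all
      next
        case 3
        show ?thesis using fv[OF f 3] unfolding e by (elim insertE emptyE) simp_all
      qed simp
    qed
  qed
  have n0: "x \<notin> f" "z \<notin> f" "v \<notin> f" if "f \<in> F0" for f using that by (auto simp: F0_def)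
  let ?T = "{y,p,x'}"
  let ?G = "insert ?T F0"
  have trF: "triples F0" using triples_K by (auto simp: triples_def F0_def)
  have tU: "triples (insert f H)" if "card f = 3" "triples H" for f :: "'v set" and H using that by (simp add: triples_def)
  have T0: "\<not> {y,x'} \<subseteq> f" if "f \<in> F0" for f
    using that yx' sub_K[of f "{y,x'}"] d by (auto simp: F0_def faces_def adj_def)
  have "pl_equiv ?G (F0 \<union> {{x,y,p},{x,x',p}})"
  proof -
    have e: "{y,p,x'} = {y,x',p}" by blast
    show ?thesis unfolding e
      by (rule pl_equiv_subdivide_boundary) (use d trF T0 n0 in \<open>auto intro!: tU\<close>)
  qed
  also have "F0 \<union> {{x,y,p},{x,x',p}} = insert {x,y,p} (F0 \<union> {{x,x',p}})" by simp
  also have "pl_equiv \<dots> ((F0 \<union> {{x,x',p}}) \<union> {{z,y,p},{z,x,p},{z,x,y}})"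
  proof (rule pl_equiv_subdivide_face)
    have "{x,y,p} \<noteq> {x,x',p}" using d by auto
    then show "{x,y,p} \<notin> F0 \<union> {{x,x',p}}" using n0(1)[of "{x,y,p}"] by blast
    show "z \<notin> \<Union>(insert {x,y,p} (F0 \<union> {{x,x',p}}))" using n0(2) d by auto
  qed (use d trF in \<open>auto intro!: tU\<close>)
  also have "\<dots> = insert {x,x',p} (F0 \<union> {{z,y,p},{z,x,p},{z,x,y}})" by (simp add: insert_commute)
  also have "pl_equiv \<dots> ((F0 \<union> {{z,y,p},{z,x,p},{z,x,y}}) \<union> {{v,x',p},{v,x,p},{v,x,x'}})"
  proof (rule pl_equiv_subdivide_face)
    have "z \<notin> {x,x',p}" using d by auto
    then show "{x,x',p} \<notin> F0 \<union> {{z,y,p},{z,x,p},{z,x,y}}" using n0(1)[of "{x,x',p}"] by blast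
    show "v \<notin> \<Union>(insert {x,x',p} (F0 \<union> {{z,y,p},{z,x,p},{z,x,y}}))" using n0(3) d by auto
  qed (use d trF in \<open>auto intro!: tU\<close>)
  also have "\<dots> = (F0 \<union> {{z,y,p},{z,x,y},{v,x',p},{v,x,x'}}) \<union> {{x,p,z},{x,p,v}}" by (simp add: insert_commute)
  also have "pl_equiv \<dots> ((F0 \<union> {{z,y,p},{z,x,y},{v,x',p},{v,x,x'}}) \<union> {{z,v,x},{z,v,p}})"
  proof (rule pl_equiv_flip)
    show "triples (F0 \<union> {{z,y,p},{z,x,y},{v,x',p},{v,x,x'}} \<union> {{x,p,z},{x,p,v}})"
      using d trF by (auto intro!: tU)
  qed (use d n0 in auto)
  also have "\<dots> = faces K" unfolding F by (simp add: insert_commute)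
  finally have eq: "pl_equiv (faces K) ?G" by (rule pl_equiv_sym)
  have fr: "octahedral_frame K ?v ?a"
    by (rule octahedral_frameI) (use d N in auto)
  have xB: "x \<in> boundary_vertices K" using bd_boundary[OF bd(1)] by blast
  have qo: "quasi_octahedron_component K ?v ?a"
    unfolding quasi_octahedron_component_def sel3_image
  proof (intro conjI fr disjI2)
    show "\<exists>i j k. {i,j,k} = {1,2,3} \<and> {?a i, ?a j} \<notin> K \<and> {?a i, ?a k} \<in> K \<and> {?a j, ?a k} \<in> K
        \<and> ?v k \<in> boundary_vertices K"
    proof (intro exI conjI)
      show "{1,2,3} = {1,2,3::nat}" ..
      show "{?a 1, ?a 2} \<notin> K" using yx' d by (auto simp: adj_def insert_commute)
      show "{?a 1, ?a 3} \<in> K" "{?a 2, ?a 3} \<in> K"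
        using tri_adj(3)[OF tri_perm(4)[OF t(6)]] tri_adj(2)[OF t(4)] tri_adj[OF t(6)] by (auto simp: adj_def insert_commute)
      show "?v 3 \<in> boundary_vertices K" using xB by simp
    qed
    show "\<forall>r\<in>{z,v,x} \<union> {x',y,p}. \<forall>s\<in>{z,v,x} \<union> {x',y,p}. \<forall>u\<in>{z,v,x} \<union> {x',y,p}.
       adj K r s \<and> adj K s u \<and> adj K r u \<longrightarrow> {r,s,u} \<in> faces K"
    proof (intro ballI impI)
      fix r s u assume m: "r \<in> {z,v,x} \<union> {x',y,p}" "s \<in> {z,v,x} \<union> {x',y,p}" "u \<in> {z,v,x} \<union> {x',y,p}"
        and a: "adj K r s \<and> adj K s u \<and> adj K r u"
      have sub: "{r,s,u} \<subseteq> {x,y,z,v,x',p}" using m by blast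
      have "tri r s u" by (rule flag[OF sub]) (use a in simp_all)
      then show "{r,s,u} \<in> faces K" by (rule tri_face)
    qed
  qed
  have "reduction (cball 0 1 :: complex set) (sphere 0 1) K
      (contract (?a 2) (?v 3) (delete_vertices {?v 2, ?v 1} K) \<union> {{?a 1, ?a 2, ?a 3}})"
    by (rule R4_contract[OF qo]) (use xB in auto)
  also have "contract (?a 2) (?v 3) (delete_vertices {?v 2, ?v 1} K) \<union> {{?a 1, ?a 2, ?a 3}} = complex_of ?G"
  proof -
    let ?g = "id(x := y)"
    let ?H = "(`) ?g ` (\<lambda>f. f - {v,z}) ` faces K"
    have H0: "?g ` (f - {v,z}) = f" if "f \<in> F0" for f using n0[OF that] by auto
    have six_im: "(`) ?g ` (\<lambda>f. f - {v,z}) ` ?six = {{y},{y,x'},{y,p},{p},{p,x'}}"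
    proof -
      have "{x,y,z} - {v,z} = {x,y}" "{x,z,v} - {v,z} = {x}" "{x,v,x'} - {v,z} = {x,x'}"
        "{z,y,p} - {v,z} = {y,p}" "{z,p,v} - {v,z} = {p}" "{v,p,x'} - {v,z} = {p,x'}" using d by auto
      moreover have "?g x = y" "?g y = y" "?g x' = x'" "?g p = p" using d by auto
      ultimately show ?thesis by (simp only: image_insert image_empty insert_absorb2)
    qed
    have Heq: "?H = F0 \<union> {{y},{y,x'},{y,p},{p},{p,x'}}"
    proof -
      have "(`) ?g ` (\<lambda>f. f - {v,z}) ` F0 = F0" using H0 by (force simp: image_iff)
      then show ?thesis unfolding F image_Un six_im by simp
    qed
    have "contract y x (delete_vertices {v,z} K) = complex_of ?H"
      using contract_complex_of[of y x "(\<lambda>f. f - {v,z}) ` faces K"] delete_vertices_complex_of[of "{v,z}" "faces K"]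
      by (simp add: complex_K)
    moreover have "complex_of ?H \<union> {{x',y,p}} = complex_of ?G"
    proof (intro equalityI subsetI)
      fix s assume "s \<in> complex_of ?H \<union> {{x',y,p}}"
      then consider "s = {x',y,p}" | "s \<noteq> {}" "\<exists>f\<in>?H. s \<subseteq> f" by (auto simp: complex_of_def)
      then show "s \<in> complex_of ?G"
      proof cases
        case 1
        then show ?thesis by (auto intro: complex_ofI[of ?T])
      next
        case 2
        then obtain f where f: "f \<in> F0 \<union> {{y},{y,x'},{y,p},{p},{p,x'}}" "s \<subseteq> f" unfolding Heq by blast
        then have "f \<in> F0 \<or> f \<subseteq> ?T" by auto
        then show ?thesis using f(2) 2(1) by (auto simp: complex_of_def)
      qed
    next
      fix s assume "s \<in> complex_of ?G"
      then have s: "s \<noteq> {}" "s \<subseteq> ?T \<or> (\<exists>f\<in>F0. s \<subseteq> f)" by (auto simp: complex_of_def)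
      show "s \<in> complex_of ?H \<union> {{x',y,p}}"
      proof (cases "s = ?T")
        case False
        have "s \<subseteq> {y,x'} \<or> s \<subseteq> {y,p} \<or> s \<subseteq> {p,x'}" if "s \<subseteq> ?T" using that False by auto
        then have "\<exists>f\<in>?H. s \<subseteq> f" unfolding Heq using s(2) by auto
        then show ?thesis using s(1) by (auto simp: complex_of_def)
      qed auto
    qed
    ultimately show ?thesis by simp
  qed
  finally have red: "reduction (cball 0 1 :: complex set) (sphere 0 1) K (complex_of ?G)" .
  show False
  proof (rule no_reduction[OF red eq])
    fix u w assume "adj (complex_of ?G) u w"
    then obtain f where f: "f \<in> ?G" "u \<in> f" by (auto simp: adj_complex_of)
    then have ux: "u \<notin> {x,z,v}" using n0 d by auto
    let ?N = "{w. adj (complex_of ?G) u w}"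
    have finN: "finite ?N"
    proof (rule finite_subset)
      show "?N \<subseteq> \<Union>?G" by (auto simp: adj_complex_of)
      show "finite (\<Union>?G)" using trF triples_finite[OF trF] by (auto simp: triples_def)
    qed
    have sub: "nbrs u - {x,z,v} \<subseteq> ?N"
    proof
      fix w assume w: "w \<in> nbrs u - {x,z,v}"
      then obtain f where f: "f \<in> faces K" "{u,w} \<subseteq> f" using tri_ex[of u w] tri_face by blast
      have ne: "u \<noteq> w" using w adj_irrefl by blast
      have "f \<in> F0 \<or> {u,w} \<subseteq> ?T"
      proof (rule disjCI)
        assume nT: "\<not> {u,w} \<subseteq> ?T"
        have six_T: "g - {x,z,v} \<subseteq> ?T" if "g \<in> ?six" for g using that by auto
        have uw: "{u,w} \<subseteq> f - {x,z,v}" using f(2) w ux by blast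
        have "f \<notin> ?six" using order_trans[OF uw six_T] nT by blast
        then show "f \<in> F0" using f(1) unfolding F by (simp only: Un_iff simp_thms)
      qed
      then show "w \<in> ?N" using ne f(2) by (auto simp: adj_complex_of)
    qed
    have A: "adj K u x \<longleftrightarrow> u \<in> {y,z,v,x'}" "adj K u z \<longleftrightarrow> u \<in> {x,y,p,v}" "adj K u v \<longleftrightarrow> u \<in> {x,z,p,x'}"
      unfolding N[symmetric] using adj_sym by blast+
    have yx: "adj (complex_of ?G) y x'" "adj (complex_of ?G) x' y" using d by (auto simp: adj_complex_of)
    have fin: "finite (nbrs u)" by (rule finite_nbrs)
    obtain w0 where w0: "adj K u w0"
    proof (cases "f = ?T")
      case True
      then show thesis using that f(2) tri_adj[OF t(4)] tri_adj[OF t(6)] by blast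
    next
      case False
      then have "f \<in> faces K" using f(1) by (auto simp: F0_def)
      then show thesis using that face_at f(2) tri_adj by metis
    qed
    have d4: "4 \<le> card (nbrs u)" using mindeg[OF w0] by (simp add: vdegree_def)
    have cm: "card (insert q (nbrs u - {x,z,v})) \<le> card ?N" if "q \<in> ?N" for q
      using card_mono[OF finN, of "insert q (nbrs u - {x,z,v})"] sub that by blast
    consider "u = p" | "u = y" | "u = x'" | "u \<notin> {p,y,x'}" by blast
    then show "4 \<le> card ?N"
    proof cases
      case 1
      then have "nbrs u - {x,z,v} = nbrs u - {z,v}" using A d by auto
      moreover have "card (nbrs u - {z,v}) = card (nbrs u) - 2"
        using A 1 d card_Diff_subset[of "{z,v}" "nbrs u"] by auto
      ultimately show ?thesis using card_mono[OF finN sub] deg(1) 1 by (simp add: vdegree_def)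
    next
      case 2
      then have "nbrs u - {x,z,v} = nbrs u - {x,z}" using A d by auto
      moreover have "card (nbrs u - {x,z}) = card (nbrs u) - 2"
        using A 2 d card_Diff_subset[of "{x,z}" "nbrs u"] by auto
      moreover have "x' \<notin> nbrs u" using 2 yx' by simp
      ultimately have "card (insert x' (nbrs u - {x,z,v})) = Suc (card (nbrs u) - 2)" using fin by simp
      then show ?thesis using cm[of x'] yx(1) deg(2) 2 by (simp add: vdegree_def)
    next
      case 3
      then have "nbrs u - {x,z,v} = nbrs u - {x,v}" using A d by auto
      moreover have "card (nbrs u - {x,v}) = card (nbrs u) - 2"
        using A 3 d card_Diff_subset[of "{x,v}" "nbrs u"] by auto
      moreover have "y \<notin> nbrs u" using 3 yx' adj_sym by blast
      ultimately have "card (insert y (nbrs u - {x,z,v})) = Suc (card (nbrs u) - 2)" using fin by simp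
      then show ?thesis using cm[of y] yx(2) deg(3) 3 by (simp add: vdegree_def)
    next
      case 4
      then have "nbrs u - {x,z,v} = nbrs u" using A ux by auto
      then show ?thesis using card_mono[OF finN sub] d4 by simp
    qed
  qed
qed

end

context flag_minimal_disk
begin

definition cfg :: "'v \<Rightarrow> 'v \<Rightarrow> 'v \<Rightarrow> 'v \<Rightarrow> 'v \<Rightarrow> bool" where
  "cfg x y z p v \<longleftrightarrow> bd x y \<and> tri x y z \<and> tri z y p \<and> tri z p v \<and> tri z v x \<and> distinct [x,y,p,v] \<and>
    nbrs z = {x,y,p,v} \<and> inner_vertex z \<and> inner_vertex p \<and> inner_vertex v \<and> vdegree K z = 4"

lemma cfg_sym: "cfg x y z p v \<Longrightarrow> cfg y x z v p"
proof -
  assume c: "cfg x y z p v"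
  note c' = c[unfolded cfg_def]
  have t: "tri x y z" "tri z y p" "tri z p v" "tri z v x" and b: "bd x y" using c' by blast+
  have "nbrs z = {y,x,v,p}" "distinct [y,x,v,p]" using c' by auto
  then show "cfg y x z v p"
    unfolding cfg_def
    using bd_sym[OF b] tri_perm(1)[OF t(1)] tri_perm(2)[OF t(2)] tri_perm(2)[OF t(3)] tri_perm(2)[OF t(4)] c' by blast
qed

lemma cfg_ex: "\<exists>x y z p v. cfg x y z p v"
proof -
  obtain x y where xy: "bd x y" and nc: "\<And>w. \<not> chord x w" "\<And>w. \<not> chord y w" using good_edge by blast
  obtain z where z: "tri x y z" "vdegree K z = 4" using no_R1_flag[OF bd_adj[OF xy]] xy by blast
  have xB: "x \<in> boundary_vertices K" "y \<in> boundary_vertices K" using bd_boundary[OF xy] by blast+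
  have bdx: "bd x w" if "adj K x w" "w \<in> boundary_vertices K" for w using nc(1) that xB by (auto simp: chord_def)
  have bdy: "bd y w" if "adj K y w" "w \<in> boundary_vertices K" for w using nc(2) that xB by (auto simp: chord_def)
  have dx: "4 \<le> vdegree K x" "4 \<le> vdegree K y" using mindeg bd_adj[OF xy] bd_adj[OF bd_sym[OF xy]] by blast+
  have deg3: "vdegree K a \<le> 3" if "nbrs a \<subseteq> {b,c,d}" for a b c d
    using card_mono[of "{b,c,d}" "nbrs a"] that card_length[of "[b,c,d]"] by (auto simp: deg intro: order_trans)
  have iz: "inner_vertex z"
  proof (rule ccontr)
    assume "\<not> inner_vertex z"
    then have b: "bd x z" using bdx tri_adj[OF z(1)] by blast
    have "nbrs x = {y,z}"
    proof (rule link_closed)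
      show "{y,z} \<subseteq> nbrs x" using tri_adj[OF z(1)] by blast
      show "w \<in> {y,z}" if "u \<in> {y,z}" "tri x u w" for u w
        using that bd_unique[OF xy z(1)] bd_unique[OF b tri_perm(2)[OF z(1)]] by blast
    qed simp
    then show False using deg3[of x y z z] dx by simp
  qed
  obtain p v where pv: "nbrs z = {x,y,p,v}" "distinct [x,y,p,v]" "tri z y p" "tri z p v" "tri z v x"
    using deg4_inner[OF iz z(2) tri_perm(5)[OF z(1)]] by blast
  have inn: "inner_vertex q" if b: "bd b c" "bd' = b" "tri b c z" "tri b z q" "q \<noteq> c" "\<And>w. adj K b w \<Longrightarrow> w \<in> boundary_vertices K \<Longrightarrow> bd b w"
    "4 \<le> vdegree K b" for b c q bd'
  proof (rule ccontr)
    assume "\<not> inner_vertex q"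
    then have bq: "bd b q" using b(6) tri_adj[OF b(4)] by blast
    have "nbrs b = {c,z,q}"
    proof (rule link_closed)
      show "{c,z,q} \<subseteq> nbrs b" using tri_adj[OF b(3)] tri_adj[OF b(4)] by blast
      show "w \<in> {c,z,q}" if "u \<in> {c,z,q}" "tri b u w" for u w
        using that bd_unique[OF b(1) b(3), of w] bd_unique[OF bq tri_perm(2)[OF b(4)], of w]
          tri_two[OF tri_perm(2)[OF b(3)] b(4), of w] b(5) by blast
    qed simp
    then show False using deg3[of b c z q] b(7) by simp
  qed
  have "inner_vertex p"
    by (rule inn[OF bd_sym[OF xy] refl tri_perm(1)[OF z(1)] tri_perm(1)[OF pv(3)] _ bdy dx(2)]) (use pv(2) in auto)
  moreover have "inner_vertex v"
    by (rule inn[OF xy refl z(1) tri_perm(5)[OF pv(5)] _ bdx dx(1)]) (use pv(2) tri_perm[OF pv(5)] in auto)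
  ultimately show ?thesis unfolding cfg_def using xy z pv iz by blast
qed

lemma cfg_not_pv:
  assumes c: "cfg x y z p v" shows "\<not> (vdegree K p = 4 \<and> vdegree K v = 4)"
proof
  assume d: "vdegree K p = 4 \<and> vdegree K v = 4"
  note c = c[unfolded cfg_def]
  have t: "tri x y z" "tri z y p" "tri z p v" "tri z v x" and dist: "distinct [x,y,p,v]" using c by blast+
  have "tri p y z" using tri_perm(3)[OF tri_perm(2)[OF t(2)]] tri_perm[OF t(2)] by blast
  then obtain r s where r: "nbrs p = {y,z,r,s}" "distinct [y,z,r,s]" "tri p z r" "tri p r s" "tri p s y"
    using deg4_inner[of p y z] c d by blast
  have "r = v" using tri_two[of p z y v r] tri_perm[OF t(2)] tri_perm[OF t(3)] r(2,3) dist by auto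
  have "tri v x z" using tri_perm[OF t(4)] by blast
  then obtain r' s' where r': "nbrs v = {x,z,r',s'}" "distinct [x,z,r',s']" "tri v z r'" "tri v r' s'" "tri v s' x"
    using deg4_inner[of v x z] c d by blast
  have "r' = p" using tri_two[of v z x p r'] tri_perm[OF t(4)] tri_perm[OF t(3)] r'(2,3) dist by auto
  have "s = s'"
    using tri_two[of v p z s s'] tri_perm[OF t(3)] tri_perm[OF r(4)] r(2) r'(2,4) \<open>r = v\<close> \<open>r' = p\<close> by auto
  then have "tri x y s" using flag[of x y s] tri_adj[OF r(5)] tri_adj[OF r'(5)] tri_adj[OF t(1)] by blast
  then show False using bd_unique[of x y z s] c r(2) by auto
qed

lemma cfg_next:
  assumes c: "cfg x y z p v" and dx: "vdegree K x = 4"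
  obtains x' where "nbrs x = {y,z,v,x'}" "distinct [y,z,v,x']" "tri x v x'" "bd x x'" "vdegree K v = 4"
proof -
  note c' = c[unfolded cfg_def]
  have t: "tri x y z" "tri z v x" "v \<noteq> y" using c' by auto
  obtain x' where x': "nbrs x = {y,z,v,x'}" "distinct [y,z,v,x']" "tri x v x'" "bd x x'"
    using deg4_boundary[OF _ dx t(1) _ t(3)] tri_perm[OF t(2)] c' by blast
  obtain w where w: "tri x x' w" "vdegree K w = 4" using no_R1_flag[OF bd_adj[OF x'(4)]] x'(4) by blast
  have "w = v" using bd_unique[OF x'(4) w(1) tri_perm(2)[OF x'(3)]] .
  then show thesis using that x' w by blast
qed

lemma cfg_not_xy:
  assumes c: "cfg x y z p v" shows "\<not> (vdegree K x = 4 \<and> vdegree K y = 4)"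
  using cfg_next[OF c] cfg_next[OF cfg_sym[OF c]] cfg_not_pv[OF c] by metis

lemma cfg_impossible:
  assumes c: "cfg x y z p v" and dx: "vdegree K x = 4" and dy: "vdegree K y \<noteq> 4" and dp: "vdegree K p \<noteq> 4"
  shows False
proof -
  note c' = c[unfolded cfg_def]
  have t: "tri x y z" "tri z y p" "tri z p v" "tri z v x" and dist: "distinct [x,y,p,v]"
    and Nz: "nbrs z = {x,y,p,v}" and inn: "inner_vertex z" "inner_vertex p" "inner_vertex v"
    and bxy: "bd x y" using c' by blast+
  obtain x' where x': "nbrs x = {y,z,v,x'}" "distinct [y,z,v,x']" "tri x v x'" "bd x x'" and dv: "vdegree K v = 4"
    using cfg_next[OF c dx] by blast
  have "tri v x z" using tri_perm[OF t(4)] by blast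
  then obtain r s where r: "nbrs v = {x,z,r,s}" "distinct [x,z,r,s]" "tri v z r" "tri v r s" "tri v s x"
    using deg4_inner[of v x z] inn dv by blast
  have rp: "r = p" using tri_two[of v z x p r] tri_perm[OF t(4)] tri_perm[OF t(3)] r(2,3) dist by auto
  have sx: "s = x'" using tri_two[of v x z x' s] tri_perm[OF t(4)] tri_perm[OF x'(3)] tri_perm[OF r(5)] r(2) x'(2) by auto
  have vpx: "tri v p x'" using r(4) rp sx by simp
  have Nv: "nbrs v = {x,z,p,x'}" using r(1) rp sx by simp
  have dall: "distinct [x,y,z,v,x',p]"
    using dist x'(2) r(2) rp sx tri_neq[OF t(1)] tri_neq[OF x'(3)] tri_neq[OF t(2)] tri_neq[OF t(3)] tri_neq[OF vpx] by auto
  have ge: "4 \<le> vdegree K p" "4 \<le> vdegree K y" "4 \<le> vdegree K x'"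
    using mindeg tri_adj[OF t(2)] tri_adj[OF vpx] by blast+
  have d5: "5 \<le> vdegree K p" "5 \<le> vdegree K y" using ge dp dy by linarith+
  have yx': "\<not> adj K y x'"
  proof
    assume "adj K y x'"
    then have "tri x y x'" using flag[of x y x'] tri_adj[OF t(1)] tri_adj[OF x'(3)] by blast
    then show False using bd_unique[OF bxy t(1)] dall by auto
  qed
  have d5': "5 \<le> vdegree K x'"
  proof (rule ccontr)
    assume "\<not> ?thesis"
    then have d4: "vdegree K x' = 4" using ge by linarith
    obtain x2 where x2: "tri x' p x2" "bd x' x2"
      using deg4_boundary[OF bd_sym[OF x'(4)] d4, of v p] tri_perm[OF x'(3)] tri_perm[OF vpx] inn dall by auto
    obtain w where w: "tri x' x2 w" "vdegree K w = 4" using no_R1_flag[OF bd_adj[OF x2(2)]] x2(2) by blast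
    have "w = p" using bd_unique[OF x2(2) w(1) tri_perm(2)[OF x2(1)]] .
    then show False using w(2) dp by simp
  qed
  show False
  proof (cases "vdegree K p = 5")
    case False
    then have "6 \<le> vdegree K p" using d5 by linarith
    then show False
      using no_R4_contract[OF dall x'(1) Nz Nv t(1) _ x'(3) t(2,3) vpx bxy x'(4) yx' _ _ d5(2) d5']
        tri_perm[OF t(4)] flag by blast
  next
    case True
    have px: "tri p y z" "tri p z v" "tri p v x'" using tri_perm[OF t(2)] tri_perm[OF t(3)] tri_perm[OF vpx] by blast+
    have other: "\<exists>b. tri p q b \<and> b \<noteq> a" if "adj K p q" for q a
      using tri_other[OF that inner_not_bd[OF inn(2)]] .
    obtain w where w: "tri p y w" "w \<noteq> z" using other tri_adj[OF px(1)] by blast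
    have wv: "w \<noteq> v"
    proof
      assume "w = v"
      then have "tri p v y" using tri_perm[OF w(1)] by blast
      then have "y = z \<or> y = x'" using tri_two[OF tri_perm(2)[OF px(2)] px(3), of y] dall by auto
      then show False using dall by auto
    qed
    have wx: "w \<noteq> x'" using yx' tri_adj[OF w(1)] by blast
    have N: "nbrs p = {y,z,v,x',w}"
      by (rule nbrs_eqI) (use tri_adj[OF px(1)] tri_adj[OF px(2)] tri_adj[OF px(3)] tri_adj[OF w(1)] True dall w(2) wv wx tri_neq[OF w(1)] in auto)
    obtain u where u: "tri p w u" "vdegree K u = 4" using no_R1_flag[of p w] inn(2) tri_adj[OF w(1)] by blast
    have "u \<in> {y,z,v,x'}" using N tri_adj[OF u(1)] tri_neq[OF u(1)] by blast
    moreover have "u \<noteq> z"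
      using tri_two[OF tri_perm(2)[OF px(1)] px(2), of w] tri_perm(2)[OF u(1)] w(2) wv tri_neq[OF w(1)] dall by auto
    moreover have "u \<noteq> v"
      using tri_two[OF tri_perm(2)[OF px(2)] px(3), of w] tri_perm(2)[OF u(1)] w(2) wx dall by auto
    ultimately have "u = y \<or> u = x'" by blast
    then show False using u(2) d5(2) d5' by auto
  qed
qed

theorem flag_impossible: False
proof -
  obtain x y z p v where c: "cfg x y z p v" using cfg_ex by blast
  note c' = c[unfolded cfg_def]
  have t: "tri x y z" "tri z y p" "tri z p v" "tri z v x" and dist: "distinct [x,y,p,v]"
    and inn: "inner_vertex z" using c' by blast+
  have 1: "vdegree K y = 4 \<or> vdegree K v = 4"
  proof -
    obtain w where w: "tri z x w" "vdegree K w = 4" using no_R1_flag[of z x] inn tri_adj[OF t(1)] by blast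
    then show ?thesis using tri_two[of z x y v w] tri_perm[OF t(1)] tri_perm[OF t(4)] dist by auto
  qed
  have 2: "vdegree K x = 4 \<or> vdegree K p = 4"
  proof -
    obtain w where w: "tri z y w" "vdegree K w = 4" using no_R1_flag[of z y] inn tri_adj[OF t(1)] by blast
    then show ?thesis using tri_two[of z y x p w] tri_perm[OF t(1)] t(2) dist by auto
  qed
  show False
    using 1 2 cfg_not_pv[OF c] cfg_not_xy[OF c] cfg_impossible[OF c] cfg_impossible[OF cfg_sym[OF c]] by blast
qed

end

subsection \<open>Innermost non-facial 3-cycles\<close>

context disk_triangulation
begin

lemma link_4_cycle:
  assumes t: "tri z a b" "tri z b c" "tri z c d" "tri z d a" and d: "distinct [a,b,c,d]"
  shows "nbrs z = {a,b,c,d}" "inner_vertex z"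
proof -
  have nb: "u = b \<or> u = d" if "tri z a u" for u using tri_two[OF t(1) tri_perm(2)[OF t(4)] that] d by auto
  have nb2: "u = a \<or> u = c" if "tri z b u" for u using tri_two[OF tri_perm(2)[OF t(1)] t(2) that] d by auto
  have nb3: "u = b \<or> u = d" if "tri z c u" for u using tri_two[OF tri_perm(2)[OF t(2)] t(3) that] d by auto
  have nb4: "u = a \<or> u = c" if "tri z d u" for u using tri_two[OF tri_perm(2)[OF t(3)] t(4) that] d by auto
  show N: "nbrs z = {a,b,c,d}"
  proof (rule link_closed)
    show "{a,b,c,d} \<subseteq> nbrs z" using tri_adj(1)[OF t(1)] tri_adj(1)[OF t(2)] tri_adj(1)[OF t(3)] tri_adj(1)[OF t(4)] by blast
    show "w \<in> {a,b,c,d}" if "u \<in> {a,b,c,d}" "tri z u w" for u w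
      using that nb nb2 nb3 nb4 by blast
  qed simp
  show "inner_vertex z"
  proof
    assume "z \<in> boundary_vertices K"
    then obtain u where u: "bd z u" using boundary_vertex_bd by blast
    then consider "u = a" | "u = b" | "u = c" | "u = d" using bd_adj[OF u] N by blast
    then show False
    proof cases
      case 1
      then show ?thesis using bd_unique[OF u[unfolded 1] t(1) tri_perm(2)[OF t(4)]] d by simp
    next
      case 2
      then show ?thesis using bd_unique[OF u[unfolded 2] tri_perm(2)[OF t(1)] t(2)] d by simp
    next
      case 3
      then show ?thesis using bd_unique[OF u[unfolded 3] tri_perm(2)[OF t(2)] t(3)] d by simp
    next
      case 4
      then show ?thesis using bd_unique[OF u[unfolded 4] tri_perm(2)[OF t(3)] t(4)] d by simp
    qed
  qed
qed

lemma even_faces_empty: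
  assumes Z: "Z \<subseteq> faces K" and ev: "\<And>a b. adj K a b \<Longrightarrow> even (card {f\<in>Z. {a,b} \<subseteq> f})"
  shows "Z = {}"
proof (rule ccontr)
  assume "Z \<noteq> {}"
  then obtain f where f: "f \<in> Z" by blast
  have all: "{x,y,u} \<in> Z" if "g \<in> Z" "x \<in> g" "tri x y u" for g x y u
  proof (rule all_faces_in[OF Z that(1,2) _ that(3)])
    fix y u v assume "tri x y u" "tri x y v" "{x,y,u} \<in> Z"
    then show "{x,y,v} \<in> Z"
      using edge_count[OF Z, of x y u v] ev[OF tri_adj(1), of x y u] by (cases "u = v") auto
  qed
  have "\<Union>Z \<subseteq> vertices K"
    using Z sub_K by (fastforce simp: faces_def vertices_def)
  moreover have "f \<noteq> {}" using f Z by (auto simp: faces_def)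
  then have "\<Union>Z \<noteq> {}" using f by blast
  moreover have "y \<in> \<Union>Z" if xy: "x \<in> \<Union>Z" "adj K x y" for x y
  proof -
    obtain g where g: "g \<in> Z" "x \<in> g" using xy(1) by blast
    obtain u where "tri x y u" using tri_ex[OF xy(2)] by blast
    then have "{x,y,u} \<in> Z" using all[OF g] by blast
    then show ?thesis by blast
  qed
  ultimately have V: "\<Union>Z = vertices K" by (rule complex_connected)
  obtain e where e: "e \<in> boundary_edges K" using boundary_edges_nonempty by blast
  then have "card e = 2" by (simp add: boundary_edges_def)
  then obtain a b where "e = {a,b}" by (auto simp: card_2_iff)
  then have ab: "bd a b" using e by (simp add: bd_def)
  then obtain u where u: "tri a b u" using tri_ex bd_adj by blast
  have "a \<in> \<Union>Z" unfolding V using adj_vertices(1)[OF bd_adj[OF ab]] .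
  then have "{a,b,u} \<in> Z" using all u by blast
  then show False using edge_count_bd[OF Z ab u] ev[OF bd_adj[OF ab]] by simp
qed

definition fills :: "'v set set \<Rightarrow> 'v \<Rightarrow> 'v \<Rightarrow> 'v \<Rightarrow> bool" where
  "fills S x y z \<longleftrightarrow> S \<subseteq> faces K \<and>
     (\<forall>a b. adj K a b \<longrightarrow> (odd (card {f\<in>S. {a,b} \<subseteq> f}) \<longleftrightarrow> {a,b} \<in> cycle3 x y z))"

definition nonfacial :: "'v \<Rightarrow> 'v \<Rightarrow> 'v \<Rightarrow> bool" where
  "nonfacial x y z \<longleftrightarrow> adj K x y \<and> adj K y z \<and> adj K x z \<and> \<not> tri x y z"

lemma fills_ex: "nonfacial x y z \<Longrightarrow> \<exists>S. fills S x y z"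
  using triangle_filling[of x y z] unfolding nonfacial_def fills_def by metis

definition oct :: "'v \<Rightarrow> 'v \<Rightarrow> 'v \<Rightarrow> 'v \<Rightarrow> 'v \<Rightarrow> 'v \<Rightarrow> bool" where
  "oct a1 a2 a3 v1 v2 v3 \<longleftrightarrow> distinct [a1,a2,a3,v1,v2,v3] \<and> nonfacial a1 a2 a3 \<and>
     tri v1 v2 v3 \<and> tri v1 v2 a3 \<and> tri v1 v3 a2 \<and> tri v2 v3 a1 \<and> tri v1 a2 a3 \<and> tri v2 a1 a3 \<and> tri v3 a1 a2"

end

locale minimal_filling = minimal_disk K h h'
  for K :: "'v set set" and h :: "('v \<Rightarrow> real) \<Rightarrow> complex" and h' :: "complex \<Rightarrow> 'v \<Rightarrow> real" +
  fixes t1 t2 t3 :: 'v and S :: "'v set set"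
  assumes nonfacial: "nonfacial t1 t2 t3" and fills: "fills S t1 t2 t3"
    and least: "\<And>x y z S'. nonfacial x y z \<Longrightarrow> fills S' x y z \<Longrightarrow> card S \<le> card S'"
begin

lemma SF: "S \<subseteq> faces K" and S_parity: "adj K a b \<Longrightarrow> odd (card {f\<in>S. {a,b} \<subseteq> f}) \<longleftrightarrow> {a,b} \<in> cycle3 t1 t2 t3"
  using fills unfolding fills_def by blast+

lemma finS: "finite S" using SF finite_K by (auto simp: faces_def intro: finite_subset)

lemma tadj: "adj K t1 t2" "adj K t2 t3" "adj K t1 t3" and tneq: "t1 \<noteq> t2" "t2 \<noteq> t3" "t1 \<noteq> t3"
  and ntri: "\<not> tri t1 t2 t3"
  using nonfacial by (auto simp: nonfacial_def adj_def)

lemma perm: "minimal_filling K h h' t2 t1 t3 S" "minimal_filling K h h' t1 t3 t2 S"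
proof -
  have "nonfacial t2 t1 t3" "nonfacial t1 t3 t2"
    using nonfacial adj_sym tri_perm unfolding nonfacial_def by blast+
  moreover have "cycle3 t2 t1 t3 = cycle3 t1 t2 t3" "cycle3 t1 t3 t2 = cycle3 t1 t2 t3"
    by (auto simp: cycle3_def insert_commute)
  then have "fills S t2 t1 t3" "fills S t1 t3 t2" using fills by (simp_all add: fills_def)
  ultimately show "minimal_filling K h h' t2 t1 t3 S" "minimal_filling K h h' t1 t3 t2 S"
    using least by (unfold_locales; blast)+
qed

definition intr :: "'v \<Rightarrow> bool" where
  "intr w \<longleftrightarrow> w \<notin> {t1,t2,t3} \<and> (\<exists>f\<in>S. w \<in> f)"

lemma cycle3_subset: "{a,b} \<in> cycle3 t1 t2 t3 \<Longrightarrow> a \<in> {t1,t2,t3} \<and> b \<in> {t1,t2,t3}"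
  by (auto simp: cycle3_def doubleton_eq_iff)

lemma in_cycle3: "a \<in> {t1,t2,t3} \<Longrightarrow> b \<in> {t1,t2,t3} \<Longrightarrow> a \<noteq> b \<Longrightarrow> {a,b} \<in> cycle3 t1 t2 t3"
  by (auto simp: cycle3_def insert_commute)

lemma side: "tri a b u \<Longrightarrow> tri a b v \<Longrightarrow> {a,b} \<notin> cycle3 t1 t2 t3 \<Longrightarrow> {a,b,u} \<in> S \<Longrightarrow> {a,b,v} \<in> S"
  using edge_count[OF SF, of a b u v] S_parity[OF tri_adj(1), of a b u] by (cases "u = v") auto

lemma intr_all: assumes "intr w" "tri w y u" shows "{w,y,u} \<in> S"
proof -
  obtain f where f: "f \<in> S" "w \<in> f" and wT: "w \<notin> {t1,t2,t3}" using assms(1) by (auto simp: intr_def)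
  show ?thesis
    by (rule all_faces_in[OF SF f _ assms(2)]) (use side wT cycle3_subset in blast)
qed

lemma intr_inner: assumes "intr w" shows "inner_vertex w"
proof
  assume "w \<in> boundary_vertices K"
  then obtain y where y: "bd w y" using boundary_vertex_bd by blast
  obtain u where u: "tri w y u" using tri_ex[OF bd_adj[OF y]] by blast
  have "odd (card {f\<in>S. {w,y} \<subseteq> f})" using edge_count_bd[OF SF y u] intr_all[OF assms u] by simp
  then have "{w,y} \<in> cycle3 t1 t2 t3" using S_parity[OF bd_adj[OF y]] by blast
  then show False using cycle3_subset assms by (auto simp: intr_def)
qed

lemma S_vertex: "f \<in> S \<Longrightarrow> w \<in> f \<Longrightarrow> w \<notin> {t1,t2,t3} \<Longrightarrow> intr w" by (auto simp: intr_def)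

lemma intr_nbr: assumes "intr w" "adj K w y" shows "y \<in> {t1,t2,t3} \<or> intr y"
proof -
  obtain u where "tri w y u" using tri_ex[OF assms(2)] by blast
  then have "{w,y,u} \<in> S" using intr_all assms(1) by blast
  then show ?thesis using S_vertex[of "{w,y,u}" y] by blast
qed

lemma third_vertex: obtains w where "tri t1 t2 w" "intr w"
proof -
  have "odd (card {f\<in>S. {t1,t2} \<subseteq> f})" using S_parity[OF tadj(1)] by (simp add: cycle3_def)
  then have "{f\<in>S. {t1,t2} \<subseteq> f} \<noteq> {}" by (metis card.empty even_zero)
  then obtain f where f: "f \<in> S" "{t1,t2} \<subseteq> f" by blast
  then have "f \<in> {f\<in>faces K. {t1,t2} \<subseteq> f}" using SF by blast
  then obtain w where w: "f = {t1,t2,w}" "tri t1 t2 w" unfolding face_star[OF tadj(1)] by blast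
  have "w \<notin> {t1,t2,t3}" using tri_neq[OF w(2)] w(2) ntri by blast
  then show thesis using that w f S_vertex[of f w] by blast
qed

lemma interior_flag:
  assumes x: "intr x" and a: "adj K x y" "adj K y z" "adj K x z"
  shows "tri x y z"
proof (rule ccontr)
  assume n: "\<not> tri x y z"
  then have nf: "nonfacial x y z" using a by (simp add: nonfacial_def)
  then obtain S' where S': "fills S' x y z" using fills_ex by blast
  have SF': "S' \<subseteq> faces K" and par': "\<And>a b. adj K a b \<Longrightarrow> odd (card {f\<in>S'. {a,b} \<subseteq> f}) \<longleftrightarrow> {a,b} \<in> cycle3 x y z"
    using S' unfolding fills_def by blast+
  define Z where "Z = S' - S"
  have ZF: "Z \<subseteq> faces K" using SF' by (auto simp: Z_def)
  let ?T = "cycle3 t1 t2 t3"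
  have xT: "x \<notin> {t1,t2,t3}" using x by (simp add: intr_def)
  have evZ: "even (card {f\<in>Z. {a,b} \<subseteq> f})" if ab: "adj K a b" and nT: "{a,b} \<notin> ?T" for a b
  proof (cases "\<exists>u. tri a b u \<and> {a,b,u} \<in> S")
    case True
    then obtain u where u: "tri a b u" "{a,b,u} \<in> S" by blast
    have "f \<in> S" if "f \<in> faces K" "{a,b} \<subseteq> f" for f
    proof -
      have "f \<in> {f\<in>faces K. {a,b} \<subseteq> f}" using that by blast
      then obtain v where "f = {a,b,v}" "tri a b v" unfolding face_star[OF ab] by blast
      then show ?thesis using side[OF u(1) _ nT u(2)] by blast
    qed
    then have "{f\<in>Z. {a,b} \<subseteq> f} = {}" using ZF unfolding Z_def by blast
    then show ?thesis by (simp only: card.empty even_zero)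
  next
    case False
    have no: "\<not> intr a" "\<not> intr b"
    proof -
      obtain u where u: "tri a b u" using tri_ex[OF ab] by blast
      show "\<not> intr a" using intr_all[OF _ u] u False by blast
      have "{b,a,u} = {a,b,u}" by blast
      then show "\<not> intr b" using intr_all[OF _ tri_perm(1)[OF u]] u False by auto
    qed
    have "f \<notin> S" if "f \<in> faces K" "{a,b} \<subseteq> f" for f
    proof -
      have "f \<in> {f\<in>faces K. {a,b} \<subseteq> f}" using that by blast
      then obtain v where "f = {a,b,v}" "tri a b v" unfolding face_star[OF ab] by blast
      then show ?thesis using False by blast
    qed
    then have "{f\<in>Z. {a,b} \<subseteq> f} = {f\<in>S'. {a,b} \<subseteq> f}" using SF' unfolding Z_def by blast
    moreover have "{a,b} \<notin> cycle3 x y z"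
    proof
      assume "{a,b} \<in> cycle3 x y z"
      then have "{a,b} = {y,z}" using no x by (auto simp: cycle3_def doubleton_eq_iff)
      then have "\<not> intr y" "\<not> intr z" using no by (auto simp: doubleton_eq_iff)
      then have "y \<in> {t1,t2,t3}" "z \<in> {t1,t2,t3}" using intr_nbr[OF x] a by blast+
      moreover have "y \<noteq> z" using a(2) adj_irrefl by blast
      ultimately show False using in_cycle3 nT \<open>{a,b} = {y,z}\<close> by simp
    qed
    ultimately show ?thesis using par'[OF ab] by (simp only:) blast
  qed
  let ?c = "\<lambda>a b. card {f\<in>Z. {a,b} \<subseteq> f}"
  have two: "even (?c p q + ?c p r)" if pq: "adj K p q" "adj K p r" "q \<noteq> r" and T: "{t1,t2,t3} = {p,q,r}" for p q r
  proof -
    have "even (\<Sum>w\<in>nbrs p. ?c p w)" by (rule count_parity[OF ZF])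
    moreover have "(\<Sum>w\<in>nbrs p. ?c p w) = ?c p q + (\<Sum>w\<in>nbrs p - {q}. ?c p w)"
      by (rule sum.remove) (use pq finite_nbrs in auto)
    moreover have "(\<Sum>w\<in>nbrs p - {q}. ?c p w) = ?c p r + (\<Sum>w\<in>nbrs p - {q} - {r}. ?c p w)"
      by (rule sum.remove) (use pq finite_nbrs in auto)
    moreover have "even (\<Sum>w\<in>nbrs p - {q} - {r}. ?c p w)"
    proof (rule dvd_sum)
      fix w assume w: "w \<in> nbrs p - {q} - {r}"
      then have "{p,w} \<notin> ?T" using cycle3_subset[of p w] adj_irrefl unfolding T by blast
      then show "even (?c p w)" using evZ w by blast
    qed
    ultimately show ?thesis by auto
  qed
  have com: "?c a b = ?c b a" for a b by (simp add: insert_commute)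
  have T3: "even (?c t1 t2 + ?c t1 t3)" "even (?c t2 t1 + ?c t2 t3)"
    by (rule two; use tadj tneq adj_sym in auto)+
  show False
  proof (cases "even (?c t1 t2)")
    case True
    then have e: "even (?c t1 t2)" "even (?c t1 t3)" "even (?c t2 t3)" using T3 com[of t1 t2] by auto
    have "Z = {}"
    proof (rule even_faces_empty[OF ZF])
      fix a b assume ab: "adj K a b"
      show "even (?c a b)"
      proof (cases "{a,b} \<in> ?T")
        case True
        then have "{a,b} = {t1,t2} \<or> {a,b} = {t1,t3} \<or> {a,b} = {t2,t3}" by (auto simp: cycle3_def)
        then show ?thesis using e by (elim disjE) simp_all
      qed (use evZ ab in blast)
    qed
    then have "S' \<subseteq> S" by (auto simp: Z_def)
    moreover have "S' \<noteq> S"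
    proof
      assume "S' = S"
      then have "{x,y} \<in> ?T" using par'[OF a(1)] S_parity[OF a(1)] by (simp add: cycle3_def)
      then show False using cycle3_subset xT by blast
    qed
    ultimately have "card S' < card S" using finS by (simp add: psubset_card_mono psubset_eq)
    then show False using least[OF nf S'] by simp
  next
    case False
    then have o: "odd (?c t1 t2)" "odd (?c t1 t3)" "odd (?c t2 t3)" using T3 com[of t1 t2] by auto
    have "S \<union> Z = {}"
    proof (rule even_faces_empty)
      show "S \<union> Z \<subseteq> faces K" using SF ZF by blast
      fix a b assume ab: "adj K a b"
      have finZ: "finite Z" using ZF finite_K by (auto simp: faces_def intro: finite_subset)
      have "{f\<in>S \<union> Z. {a,b} \<subseteq> f} = {f\<in>S. {a,b} \<subseteq> f} \<union> {f\<in>Z. {a,b} \<subseteq> f}" by blast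
      moreover have "card \<dots> = card {f\<in>S. {a,b} \<subseteq> f} + ?c a b"
        using finS finZ by (intro card_Un_disjoint) (auto simp: Z_def)
      moreover have "even (card {f\<in>S. {a,b} \<subseteq> f} + ?c a b)"
      proof (cases "{a,b} \<in> ?T")
        case True
        then have "{a,b} = {t1,t2} \<or> {a,b} = {t1,t3} \<or> {a,b} = {t2,t3}" by (auto simp: cycle3_def)
        then have "odd (?c a b)" using o by (elim disjE) simp_all
        then show ?thesis using S_parity[OF ab] True by simp
      qed (use evZ S_parity ab in auto)
      ultimately show "even (card {f\<in>S \<union> Z. {a,b} \<subseteq> f})" by (simp only:)
    qed
    moreover obtain w where "tri t1 t2 w" "intr w" using third_vertex .
    then have "S \<noteq> {}" by (auto simp: intr_def)
    ultimately show False by blast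
  qed
qed

lemma interior_R1: "intr w \<Longrightarrow> adj K w y \<Longrightarrow> \<exists>u. tri w y u \<and> vdegree K u = 4"
  using no_R1[of w y] intr_inner interior_flag by blast

lemma not_all_adj: assumes "intr w" "adj K w t1" "adj K w t2" "adj K w t3" shows False
proof -
  have t: "tri w t1 t2" "tri w t2 t3" "tri w t1 t3" using interior_flag assms tadj by blast+
  have "nbrs w = {t1,t2,t3}"
  proof (rule link_closed)
    show "{t1,t2,t3} \<subseteq> nbrs w" using assms by blast
    show "z \<in> {t1,t2,t3}" if "y \<in> {t1,t2,t3}" "tri w y z" for y z
      using that tri_two[OF t(1,3), of z] tri_two[OF tri_perm(2)[OF t(1)] t(2), of z]
        tri_two[OF tri_perm(2)[OF t(3)] tri_perm(2)[OF t(2)], of z] tneq by blast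
  qed simp
  then have "vdegree K w \<le> 3" using card_length[of "[t1,t2,t3]"] by (simp add: deg)
  then show False using mindeg[OF assms(2)] by simp
qed

lemma finish:
  assumes i: "intr z" "intr u" "intr p" and t: "tri t1 t2 z" "tri t1 t3 u" "tri t2 t3 p"
    and a: "adj K z u" "adj K u p" "adj K z p"
  shows "oct t1 t2 t3 p u z"
proof -
  have "tri p u z" using interior_flag[OF i(3)] a adj_sym by blast
  moreover have "tri p u t3" using interior_flag[OF i(3)] a(2) tri_adj[OF t(2)] tri_adj[OF t(3)] adj_sym by blast
  moreover have "tri p z t2" using interior_flag[OF i(3)] a(3) tri_adj[OF t(1)] tri_adj[OF t(3)] adj_sym by blast
  moreover have "tri u z t1" using interior_flag[OF i(2)] a(1) tri_adj[OF t(1)] tri_adj[OF t(2)] adj_sym by blast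
  moreover have "distinct [t1,t2,t3,p,u,z]" using i tneq a adj_irrefl by (auto simp: intr_def)
  ultimately show ?thesis
    unfolding oct_def using nonfacial tri_perm[OF t(1)] tri_perm[OF t(2)] tri_perm[OF t(3)] by blast
qed

lemma deg4_corner:
  assumes d: "vdegree K t1 = 4" and z: "intr z" "tri t1 t2 z" and u: "intr u" "tri t1 t3 u"
  shows "tri t1 z u"
proof -
  have zu: "z \<noteq> u" using not_all_adj[OF z(1)] tri_adj[OF z(2)] tri_adj[OF u(2)] by blast
  have N: "nbrs t1 = {t2,t3,z,u}"
    by (rule nbrs_eqI) (use tri_adj[OF z(2)] tri_adj[OF u(2)] zu z(1) u(1) tneq d in \<open>auto simp: intr_def\<close>)
  have "\<not> bd t1 z" using intr_inner[OF z(1)] bd_boundary by blast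
  then obtain b where b: "tri t1 z b" "b \<noteq> t2" using tri_other tri_adj[OF z(2)] by blast
  have "b \<noteq> t3" using not_all_adj[OF z(1)] tri_adj[OF z(2)] tri_adj[OF b(1)] by blast
  then have "b = u" using N b tri_adj[OF b(1)] tri_neq[OF b(1)] by blast
  then show ?thesis using b by simp
qed

lemma oct_if_deg4:
  assumes d: "vdegree K t1 = 4" shows "\<exists>p u z. oct t1 t2 t3 p u z"
proof -
  interpret m2: minimal_filling K h h' t2 t1 t3 S by (rule perm(1))
  interpret m3: minimal_filling K h h' t1 t3 t2 S by (rule perm(2))
  interpret m23: minimal_filling K h h' t2 t3 t1 S by (rule m2.perm(2))
  interpret m32: minimal_filling K h h' t3 t1 t2 S by (rule m3.perm(1))
  have ie: "m2.intr = intr" "m3.intr = intr" "m23.intr = intr" "m32.intr = intr"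
    unfolding intr_def m2.intr_def m3.intr_def m23.intr_def m32.intr_def by (auto simp: fun_eq_iff)
  obtain z where z: "tri t1 t2 z" "intr z" using third_vertex .
  obtain u where u: "tri t1 t3 u" "intr u" using m3.third_vertex unfolding ie .
  obtain p where p: "tri t2 t3 p" "intr p" using m23.third_vertex unfolding ie .
  have zu: "tri t1 z u" by (rule deg4_corner[OF d z(2,1) u(2,1)])
  have ne: "t2 \<noteq> u" "t3 \<noteq> z" using u z by (auto simp: intr_def)
  have 1: "vdegree K t2 = 4 \<or> vdegree K u = 4"
  proof -
    obtain w where w: "tri z t1 w" "vdegree K w = 4" using interior_R1[OF z(2)] tri_adj[OF z(1)] by blast
    have "tri z t1 t2" "tri z t1 u" using tri_perm[OF z(1)] tri_perm[OF zu] by blast+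
    then have "w = t2 \<or> w = u" using tri_two[OF _ _ w(1)] ne by blast
    then show ?thesis using w by blast
  qed
  have 2: "vdegree K t3 = 4 \<or> vdegree K z = 4"
  proof -
    obtain w where w: "tri u t1 w" "vdegree K w = 4" using interior_R1[OF u(2)] tri_adj[OF u(1)] by blast
    have "tri u t1 t3" "tri u t1 z" using tri_perm[OF u(1)] tri_perm[OF zu] by blast+
    then have "w = t3 \<or> w = z" using tri_two[OF _ _ w(1)] ne by blast
    then show ?thesis using w by blast
  qed
  have c2: "tri t2 z p" if "vdegree K t2 = 4"
    by (rule m2.deg4_corner[OF that]) (use z p ie tri_perm[OF z(1)] in auto)
  have c3: "tri t3 u p" if "vdegree K t3 = 4"
    by (rule m32.deg4_corner[OF that]) (use u p ie tri_perm[OF u(1)] tri_perm[OF p(1)] in auto)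
  have pu: "adj K p u" if d2: "vdegree K t2 = 4" "vdegree K z = 4"
  proof -
    note zp = c2[OF d2(1)]
    have zt: "tri z t1 t2" using tri_perm[OF z(1)] by blast
    obtain r s where r: "nbrs z = {t1,t2,r,s}" "distinct [t1,t2,r,s]" "tri z t2 r" "tri z r s" "tri z s t1"
      using deg4_inner[OF intr_inner[OF z(2)] d2(2) zt] by blast
    have "tri z t2 p" "tri z t2 t1" using tri_perm[OF zp] tri_perm[OF z(1)] by blast+
    then have "r = p" using tri_two[OF _ _ r(3)] r(2) p(2) by (auto simp: intr_def)
    have "tri z t1 u" "tri z t1 t2" "tri z t1 s" using tri_perm[OF zu] zt tri_perm[OF r(5)] by blast+
    then have "s = u" using tri_two[of z t1 u t2 s] r(2) ne by auto
    show ?thesis using tri_adj[OF r(4)] \<open>r = p\<close> \<open>s = u\<close> by simp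
  qed
  have pz: "adj K p z" if d2: "vdegree K t3 = 4" "vdegree K u = 4"
  proof -
    note up = c3[OF d2(1)]
    have ut: "tri u t1 t3" using tri_perm[OF u(1)] by blast
    obtain r s where r: "nbrs u = {t1,t3,r,s}" "distinct [t1,t3,r,s]" "tri u t3 r" "tri u r s" "tri u s t1"
      using deg4_inner[OF intr_inner[OF u(2)] d2(2) ut] by blast
    have "tri u t3 p" "tri u t3 t1" using tri_perm[OF up] tri_perm[OF u(1)] by blast+
    then have "r = p" using tri_two[OF _ _ r(3)] r(2) p(2) by (auto simp: intr_def)
    have "tri u t1 z" "tri u t1 t3" "tri u t1 s" using tri_perm[OF zu] ut tri_perm[OF r(5)] by blast+
    then have "s = z" using tri_two[of u t1 z t3 s] r(2) ne by auto
    show ?thesis using tri_adj[OF r(4)] \<open>r = p\<close> \<open>s = z\<close> by simp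
  qed
  have azu: "adj K z u" using tri_adj[OF zu] by blast
  consider (a) "vdegree K t2 = 4" "vdegree K t3 = 4" | (b) "vdegree K t2 = 4" "vdegree K z = 4"
    | (c) "vdegree K u = 4" "vdegree K t3 = 4" | (d) "vdegree K u = 4" "vdegree K z = 4" using 1 2 by blast
  then show ?thesis
  proof cases
    case a
    have "oct t1 t2 t3 p u z"
      by (rule finish[OF z(2) u(2) p(2) z(1) u(1) p(1) azu]) (use tri_adj[OF c2[OF a(1)]] tri_adj[OF c3[OF a(2)]] in auto)
    then show ?thesis by blast
  next
    case b
    have "oct t1 t2 t3 p u z"
      by (rule finish[OF z(2) u(2) p(2) z(1) u(1) p(1) azu]) (use tri_adj[OF c2[OF b(1)]] adj_sym[OF pu[OF b]] in auto)
    then show ?thesis by blast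
  next
    case c
    have "oct t1 t2 t3 p u z"
      by (rule finish[OF z(2) u(2) p(2) z(1) u(1) p(1) azu]) (use tri_adj[OF c3[OF c(2)]] adj_sym[OF pz[OF c(2,1)]] in auto)
    then show ?thesis by blast
  next
    case d
    have zt: "tri z t2 t1" and ut: "tri u t3 t1" using tri_perm[OF z(1)] tri_perm[OF u(1)] by blast+
    obtain r s where r: "nbrs z = {t2,t1,r,s}" "distinct [t2,t1,r,s]" "tri z t1 r" "tri z r s" "tri z s t2"
      using deg4_inner[OF intr_inner[OF z(2)] d(2) zt] by blast
    have "tri z t1 u" "tri z t1 t2" using tri_perm[OF zu] tri_perm[OF z(1)] by blast+
    then have ru: "r = u" using tri_two[OF _ _ r(3)] r(2) ne by auto
    obtain r' s' where r': "nbrs u = {t3,t1,r',s'}" "distinct [t3,t1,r',s']" "tri u t1 r'" "tri u r' s'" "tri u s' t3"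
      using deg4_inner[OF intr_inner[OF u(2)] d(1) ut] by blast
    have "tri u t1 z" "tri u t1 t3" using tri_perm[OF zu] tri_perm[OF u(1)] by blast+
    then have r'z: "r' = z" using tri_two[OF _ _ r'(3)] r'(2) ne by auto
    have "tri z u s" "tri z u t1" "tri z u s'" using r(4) ru tri_perm[OF zu] tri_perm(1)[OF r'(4)[unfolded r'z]] by simp_all
    then have ss: "s' = s" using tri_two[of z u s t1 s'] r(2) r'(2) by auto
    have "s \<noteq> t3"
      using not_all_adj[OF z(2)] tri_adj[OF z(1)] tri_adj[OF r(4)] by blast
    then have si: "intr s"
      using intr_nbr[OF z(2), of s] tri_adj[OF r(4)] r(2) by auto
    have ts: "tri t2 t3 s"
      using interior_flag[OF si, of t2 t3] tri_adj[OF r(5)] tri_adj[OF r'(5)] ss tadj(2) tri_perm by blast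
    have "oct t1 t2 t3 s u z"
      by (rule finish[OF z(2) u(2) si z(1) u(1) ts azu]) (use tri_adj[OF r(4)] ru in auto)
    then show ?thesis by blast
  qed
qed

lemma oct_interior:
  assumes i: "intr z" "intr x" "intr y" and d: "vdegree K z = 4" "vdegree K x = 4" "vdegree K y = 4"
    and t: "tri z x y" "tri z y p" "tri z p v" "tri z v x" and dist: "distinct [x,y,p,v]"
  shows "\<exists>q. oct p v q x y z"
proof -
  have tx: "tri x y z" and ty: "tri y x z" using tri_perm[OF t(1)] by blast+
  obtain r q where r: "nbrs x = {y,z,r,q}" "distinct [y,z,r,q]" "tri x z r" "tri x r q" "tri x q y"
    using deg4_inner[OF intr_inner[OF i(2)] d(2) tx] by blast
  have "tri x z v" "tri x z y" using tri_perm[OF t(4)] tri_perm[OF t(1)] by blast+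
  then have rv: "r = v" using tri_two[OF _ _ r(3)] r(2) dist by auto
  obtain r' q' where r': "nbrs y = {x,z,r',q'}" "distinct [x,z,r',q']" "tri y z r'" "tri y r' q'" "tri y q' x"
    using deg4_inner[OF intr_inner[OF i(3)] d(3) ty] by blast
  have "tri y z p" "tri y z x" using tri_perm[OF t(2)] tri_perm[OF t(1)] by blast+
  then have rp: "r' = p" using tri_two[OF _ _ r'(3)] r'(2) dist by auto
  have "tri x y q" "tri x y z" "tri x y q'" using tri_perm[OF r(5)] tx tri_perm[OF r'(5)] by blast+
  then have qq: "q' = q" using tri_two[of x y q z q'] r(2) r'(2) by auto
  have xvq: "tri x v q" and ypq: "tri y p q" using r(4) rv r'(4) rp qq by simp_all
  have xqy: "tri x q y" by (rule r(5))
  have apv: "adj K p v" "adj K v q" "adj K p q" using tri_adj[OF t(3)] tri_adj[OF xvq] tri_adj[OF ypq] by blast+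
  have npq: "p \<noteq> q" "v \<noteq> q" using apv adj_irrefl by blast+
  have d6: "distinct [x,y,z,p,v,q]"
    using dist r(2) r'(2) rv rp qq npq tri_neq[OF t(1)] tri_neq[OF t(2)] tri_neq[OF t(3)] tri_neq[OF t(4)] by auto
  have nt: "\<not> tri p v q"
  proof
    assume pvq: "tri p v q"
    have tr: "tri x z v" "tri y z p" "tri y q x" "tri p z y" "tri p y q" "tri p q v" "tri p v z"
      "tri v z x" "tri v x q" "tri v q p" "tri v p z" "tri q x y" "tri q y p" "tri q p v" "tri q v x"
      using tri_perm[OF t(4)] tri_perm[OF t(2)] tri_perm[OF xqy] tri_perm[OF ypq] tri_perm[OF pvq]
        tri_perm[OF t(3)] tri_perm[OF xvq] by blast+
    have ds: "distinct [y,z,v,q]" "distinct [x,z,p,q]" "distinct [z,y,q,v]" "distinct [z,x,q,p]" "distinct [x,y,p,v]"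
      using d6 by auto
    note Nx = link_4_cycle[OF tx tr(1) xvq xqy ds(1)] and Ny = link_4_cycle[OF ty tr(2) ypq tr(3) ds(2)]
      and Nz = link_4_cycle[OF t ds(5)] and Np = link_4_cycle[OF tr(4-7) ds(3)]
      and Nv = link_4_cycle[OF tr(8-11) ds(4)] and Nq = link_4_cycle[OF tr(12-15) ds(5)]
    let ?A = "{x,y,z,p,v,q}"
    have "?A = vertices K"
    proof (rule complex_connected)
      show "?A \<subseteq> vertices K" using adj_vertices tri_adj[OF t(1)] tri_adj[OF t(3)] tri_adj[OF xvq] by blast
      fix a b assume "a \<in> ?A" "adj K a b"
      moreover have "adj K a b \<longleftrightarrow> b \<in> nbrs a" by simp
      ultimately show "b \<in> ?A" using Nx(1) Ny(1) Nz(1) Np(1) Nv(1) Nq(1) by (elim insertE emptyE) auto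
    qed simp
    moreover obtain e where e: "e \<in> boundary_edges K" using boundary_edges_nonempty by blast
    then obtain a b where "e = {a,b}" by (auto simp: boundary_edges_def card_2_iff)
    then have "bd a b" using e by (simp add: bd_def)
    then have "a \<in> boundary_vertices K" "a \<in> vertices K" using bd_boundary adj_vertices bd_adj by blast+
    ultimately show False using Nx(2) Ny(2) Nz(2) Np(2) Nv(2) Nq(2) by auto
  qed
  have "nonfacial p v q" using apv nt by (simp add: nonfacial_def)
  then have "oct p v q x y z"
    unfolding oct_def using d6 tri_perm[OF t(1)] tri_perm[OF t(2)] tri_perm[OF t(3)] tri_perm[OF t(4)] xvq ypq tri_perm[OF xqy] t
      tri_perm[OF xvq] tri_perm[OF ypq] by auto
  then show ?thesis by blast
qed

theorem oct_ex: "\<exists>a1 a2 a3 v1 v2 v3. oct a1 a2 a3 v1 v2 v3"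
proof (cases "\<exists>t\<in>{t1,t2,t3}. vdegree K t = 4")
  case True
  interpret m2: minimal_filling K h h' t2 t1 t3 S by (rule perm(1))
  interpret m3: minimal_filling K h h' t1 t3 t2 S by (rule perm(2))
  interpret m32: minimal_filling K h h' t3 t1 t2 S by (rule m3.perm(1))
  show ?thesis using True oct_if_deg4 m2.oct_if_deg4 m32.oct_if_deg4 by blast
next
  case False
  obtain w where w: "tri t1 t2 w" "intr w" using third_vertex .
  obtain z where z: "tri w t1 z" "vdegree K z = 4" using interior_R1[OF w(2)] tri_adj[OF w(1)] by blast
  have iz: "intr z" using intr_nbr[OF w(2), of z] tri_adj[OF z(1)] z(2) False by blast
  obtain c0 c1 where c: "tri z c0 c1" using tri_perm[OF z(1)] by blast
  obtain c2 c3 where n: "nbrs z = {c0,c1,c2,c3}" "distinct [c0,c1,c2,c3]" "tri z c1 c2" "tri z c2 c3" "tri z c3 c0"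
    using deg4_inner[OF intr_inner[OF iz] z(2) c] by blast
  have e0: "vdegree K c1 = 4 \<or> vdegree K c3 = 4"
  proof -
    obtain u where u: "tri z c0 u" "vdegree K u = 4" using interior_R1[OF iz] tri_adj[OF c] by blast
    then show ?thesis using tri_two[OF c tri_perm(2)[OF n(5)] u(1)] n(2) by auto
  qed
  have e1: "vdegree K c0 = 4 \<or> vdegree K c2 = 4"
  proof -
    obtain u where u: "tri z c1 u" "vdegree K u = 4" using interior_R1[OF iz] tri_adj[OF c] by blast
    then show ?thesis using tri_two[OF tri_perm(2)[OF c] n(3) u(1)] n(2) by auto
  qed
  have i4: "intr u" if "u \<in> nbrs z" "vdegree K u = 4" for u
    using intr_nbr[OF iz, of u] that False by blast
  have m: "c0 \<in> nbrs z" "c1 \<in> nbrs z" "c2 \<in> nbrs z" "c3 \<in> nbrs z" using n(1) by blast+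
  consider "vdegree K c0 = 4" "vdegree K c1 = 4" | "vdegree K c1 = 4" "vdegree K c2 = 4"
    | "vdegree K c2 = 4" "vdegree K c3 = 4" | "vdegree K c3 = 4" "vdegree K c0 = 4" using e0 e1 by blast
  then show ?thesis
  proof cases
    case 1
    show ?thesis using oct_interior[OF iz i4[OF m(1) 1(1)] i4[OF m(2) 1(2)] z(2) 1 c n(3-5) n(2)] by blast
  next
    case 2
    have "distinct [c1,c2,c3,c0]" using n(2) by auto
    from oct_interior[OF iz i4[OF m(2) 2(1)] i4[OF m(3) 2(2)] z(2) 2 n(3-5) c this] show ?thesis by blast
  next
    case 3
    have "distinct [c2,c3,c0,c1]" using n(2) by auto
    from oct_interior[OF iz i4[OF m(3) 3(1)] i4[OF m(4) 3(2)] z(2) 3 n(4,5) c n(3) this] show ?thesis by blast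
  next
    case 4
    have "distinct [c3,c0,c1,c2]" using n(2) by auto
    from oct_interior[OF iz i4[OF m(4) 4(1)] i4[OF m(1) 4(2)] z(2) 4 n(5) c n(3,4) this] show ?thesis by blast
  qed
qed

end

context minimal_disk
begin

lemma oct_component_ex: "\<exists>a1 a2 a3 v1 v2 v3. oct a1 a2 a3 v1 v2 v3"
proof (cases "\<exists>x y z. nonfacial x y z")
  case False
  then interpret flag_minimal_disk K h h'
    by unfold_locales (auto simp: nonfacial_def)
  show ?thesis using flag_impossible by blast
next
  case True
  define P where "P = (\<lambda>n. \<exists>x y z S. nonfacial x y z \<and> fills S x y z \<and> card S = n)"
  have "\<exists>n. P n" using True fills_ex unfolding P_def by blast
  then obtain n where n: "P n" "\<And>m. m < n \<Longrightarrow> \<not> P m" using exists_least_iff[of P] by blast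
  then obtain x y z S where S: "nonfacial x y z" "fills S x y z" "card S = n" unfolding P_def by blast
  have "card S \<le> card S'" if "nonfacial a b c" "fills S' a b c" for a b c S'
  proof (rule ccontr)
    assume "\<not> card S \<le> card S'"
    then have "\<not> P (card S')" using n(2) S(3) by simp
    then show False using that unfolding P_def by blast
  qed
  then interpret minimal_filling K h h' x y z S
    using S by unfold_locales
  show ?thesis by (rule oct_ex)
qed

end

subsection \<open>Octahedron components\<close>

lemma complex_of_insert_face:
  assumes "\<And>s. s \<noteq> {} \<Longrightarrow> s \<subset> T \<Longrightarrow> s \<in> complex_of G" "T \<noteq> {}"
  shows "complex_of G \<union> {T} = complex_of (insert T G)"
  using assms unfolding complex_of_def by blast

lemma octahedron_disk_eq:
  assumes d: "distinct [v 1, v 2, v 3, a 1, a 2, a 3]"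
  shows "octahedron_disk v a = complex_of (octahedron_faces (v 1) (v 2) (v 3) (a 1) (a 2) (a 3))"
proof -
  let ?O = "octahedron_faces (v 1) (v 2) (v 3) (a 1) (a 2) (a 3)" and ?T = "{a 1, a 2, a 3}"
  have 1: "octahedron_disk v a = complex_of (insert ?T ?O) - {?T}"
    unfolding octahedron_disk_def complex_of_def octahedron_faces_def by auto
  have "\<not> ?T \<subseteq> f" if "f \<in> ?O" for f using that d unfolding octahedron_faces_def by auto
  then have "?T \<notin> complex_of ?O" by (auto simp: complex_of_def)
  moreover have "s \<in> complex_of ?O" if "s \<noteq> {}" "s \<subset> ?T" for s
  proof -
    have "s \<subseteq> {a 1, a 2, v 3} \<or> s \<subseteq> {v 1, a 2, a 3} \<or> s \<subseteq> {a 1, v 2, a 3}" using that(2) by auto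
    then show ?thesis using that(1) unfolding complex_of_def octahedron_faces_def by auto
  qed
  then have "complex_of ?O \<union> {?T} = complex_of (insert ?T ?O)" by (intro complex_of_insert_face) auto
  ultimately show ?thesis unfolding 1 by blast
qed

lemma finite_adj_complex_of: assumes "triples G" shows "finite {w. adj (complex_of G) u w}"
proof (rule finite_subset)
  show "{w. adj (complex_of G) u w} \<subseteq> \<Union>G" by (auto simp: adj_complex_of)
  show "finite (\<Union>G)" using assms triples_finite[OF assms] by (auto simp: triples_def)
qed

context disk_triangulation
begin

lemma nbrs_boundary_path:
  assumes b: "bd p q" "bd p r" and t: "tri p q x" "tri p x y" "tri p y r" "distinct [q,x,y,r]"
  shows "nbrs p = {q,x,y,r}"
proof (rule link_closed)
  show "{q,x,y,r} \<subseteq> nbrs p" using tri_adj(1,3)[OF t(1)] tri_adj(1,3)[OF t(3)] by blast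
  show "w \<in> {q,x,y,r}" if "u \<in> {q,x,y,r}" "tri p u w" for u w
    using that bd_unique[OF b(1) t(1), of w] tri_two[OF tri_perm(2)[OF t(1)] t(2), of w]
      tri_two[OF tri_perm(2)[OF t(2)] t(3), of w] bd_unique[OF b(2) tri_perm(2)[OF t(3)], of w] t(4) by auto
qed simp

lemma oct_perm: assumes "oct a1 a2 a3 v1 v2 v3" shows "oct a2 a1 a3 v2 v1 v3" "oct a1 a3 a2 v1 v3 v2"
proof -
  note o = assms[unfolded oct_def]
  have t: "tri v1 v2 v3" "tri v1 v2 a3" "tri v1 v3 a2" "tri v2 v3 a1" "tri v1 a2 a3" "tri v2 a1 a3" "tri v3 a1 a2"
    and d: "distinct [a1,a2,a3,v1,v2,v3]" and n: "nonfacial a1 a2 a3" using o by blast+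
  have n2: "nonfacial a2 a1 a3" "nonfacial a1 a3 a2" using n adj_sym tri_perm unfolding nonfacial_def by blast+
  have d2: "distinct [a2,a1,a3,v2,v1,v3]" "distinct [a1,a3,a2,v1,v3,v2]" using d by auto
  show "oct a2 a1 a3 v2 v1 v3" unfolding oct_def
    using d2(1) n2(1) tri_perm(1)[OF t(1)] tri_perm(1)[OF t(2)] t tri_perm(2)[OF t(7)] by blast
  show "oct a1 a3 a2 v1 v3 v2" unfolding oct_def
    using d2(2) n2(2) tri_perm(2)[OF t(1)] tri_perm(1)[OF t(4)] t tri_perm(2)[OF t(5)] by blast
qed

lemma oct_link:
  assumes "oct a1 a2 a3 v1 v2 v3"
  shows "nbrs v1 = {v2,v3,a2,a3}" "inner_vertex v1"
    "f \<in> faces K \<Longrightarrow> v1 \<in> f \<Longrightarrow> f \<in> {{v1,v2,v3},{v1,v3,a2},{v1,a2,a3},{v1,a3,v2}}"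
proof -
  note o = assms[unfolded oct_def]
  have t: "tri v1 v2 v3" "tri v1 v3 a2" "tri v1 a2 a3" "tri v1 a3 v2" using o tri_perm by blast+
  have d: "distinct [v2,v3,a2,a3]" using o by auto
  show N: "nbrs v1 = {v2,v3,a2,a3}" and "inner_vertex v1" by (rule link_4_cycle[OF t d])+
  show "f \<in> {{v1,v2,v3},{v1,v3,a2},{v1,a2,a3},{v1,a3,v2}}" if "f \<in> faces K" "v1 \<in> f"
    by (rule faces_of_4_cycle[OF N d t that])
qed

end

locale oct_disk = minimal_disk K h h'
  for K :: "'v set set" and h :: "('v \<Rightarrow> real) \<Rightarrow> complex" and h' :: "complex \<Rightarrow> 'v \<Rightarrow> real" +
  fixes a1 a2 a3 v1 v2 v3 :: 'v
  assumes oct: "oct a1 a2 a3 v1 v2 v3"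
begin

lemma perms: "oct_disk K h h' a2 a1 a3 v2 v1 v3" "oct_disk K h h' a1 a3 a2 v1 v3 v2"
  using oct_perm[OF oct] by unfold_locales

lemma d6: "distinct [a1,a2,a3,v1,v2,v3]" and nf: "nonfacial a1 a2 a3" and t: "tri v1 v2 v3" "tri v1 v2 a3" "tri v1 v3 a2" "tri v2 v3 a1"
    "tri v1 a2 a3" "tri v2 a1 a3" "tri v3 a1 a2"
  using oct unfolding oct_def by blast+

lemma aadj: "adj K a1 a2" "adj K a2 a3" "adj K a1 a3" and ntri: "\<not> tri a1 a2 a3"
  using nf by (auto simp: nonfacial_def)

lemma ntris: "\<not> tri a1 a3 a2" "\<not> tri a2 a1 a3" "\<not> tri a2 a3 a1" "\<not> tri a3 a1 a2" "\<not> tri a3 a2 a1"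
  using ntri tri_perm by blast+

lemma Nv: "nbrs v1 = {v2,v3,a2,a3}" "nbrs v2 = {v1,v3,a1,a3}" "nbrs v3 = {v1,v2,a1,a2}"
  and inner: "inner_vertex v1" "inner_vertex v2" "inner_vertex v3"
proof -
  note o2 = oct_perm(1)[OF oct]
  note o3 = oct_perm(1)[OF oct_perm(2)[OF oct]]
  show "nbrs v1 = {v2,v3,a2,a3}" "nbrs v2 = {v1,v3,a1,a3}" "inner_vertex v1" "inner_vertex v2" "inner_vertex v3"
    using oct_link[OF oct] oct_link[OF o2] oct_link[OF o3] by blast+
  show "nbrs v3 = {v1,v2,a1,a2}" using oct_link(1)[OF o3] by blast
qed

lemma Av: "adj K u v1 \<longleftrightarrow> u \<in> {v2,v3,a2,a3}" "adj K u v2 \<longleftrightarrow> u \<in> {v1,v3,a1,a3}" "adj K u v3 \<longleftrightarrow> u \<in> {v1,v2,a1,a2}"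
  unfolding Nv[symmetric] using adj_sym by blast+

abbreviation "V \<equiv> sel3 v1 v2 v3"
abbreviation "A \<equiv> sel3 a1 a2 a3"
abbreviation "T \<equiv> {a1,a2,a3}"

lemma component: "octahedron_component K V A" and v_inner: "V ` {1,2,3} \<inter> boundary_vertices K = {}"
proof -
  show vi: "V ` {1,2,3} \<inter> boundary_vertices K = {}" unfolding sel3_image using inner by blast
  have fr: "octahedral_frame K V A" by (rule octahedral_frameI) (use d6 Nv in auto)
  have cy: "cycle3 (A 1) (A 2) (A 3) \<subseteq> K" using aadj by (simp add: cycle3_def adj_def)
  show "octahedron_component K V A" unfolding octahedron_component_def using fr cy vi by blast
qed

definition F0 :: "'v set set" where "F0 = {f\<in>faces K. v1 \<notin> f \<and> v2 \<notin> f \<and> v3 \<notin> f}"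

lemma n0: "f \<in> F0 \<Longrightarrow> v1 \<notin> f" "f \<in> F0 \<Longrightarrow> v2 \<notin> f" "f \<in> F0 \<Longrightarrow> v3 \<notin> f" by (auto simp: F0_def)

lemma F0_faces: "f \<in> F0 \<Longrightarrow> f \<in> faces K" by (simp add: F0_def)

lemma triples_F0: "triples F0" using triples_K by (auto simp: triples_def F0_def)

lemma triples_insert: "card f = 3 \<Longrightarrow> triples H \<Longrightarrow> triples (insert f H)" by (simp add: triples_def)

lemma faces_eq: "faces K = F0 \<union> octahedron_faces v1 v2 v3 a1 a2 a3"
proof
  show "F0 \<union> octahedron_faces v1 v2 v3 a1 a2 a3 \<subseteq> faces K"
  proof -
    have "{v1,v2,v3} \<in> faces K" "{v1,v2,a3} \<in> faces K" "{v1,a2,v3} \<in> faces K" "{a1,v2,v3} \<in> faces K"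
      "{v1,a2,a3} \<in> faces K" "{a1,v2,a3} \<in> faces K" "{a1,a2,v3} \<in> faces K"
      by (rule tri_face, use t tri_perm in blast)+
    then show ?thesis using F0_faces unfolding octahedron_faces_def by blast
  qed
  show "faces K \<subseteq> F0 \<union> octahedron_faces v1 v2 v3 a1 a2 a3"
  proof
    fix f assume f: "f \<in> faces K"
    have e: "{v1,v3,a2} = {v1,a2,v3}" "{v1,a3,v2} = {v1,v2,a3}" "{v2,v1,v3} = {v1,v2,v3}" "{v2,v3,a1} = {a1,v2,v3}"
      "{v2,a1,a3} = {a1,v2,a3}" "{v2,a3,v1} = {v1,v2,a3}" "{v3,v1,v2} = {v1,v2,v3}" "{v3,v2,a1} = {a1,v2,v3}"
      "{v3,a1,a2} = {a1,a2,v3}" "{v3,a2,v1} = {v1,a2,v3}" "{v3,v2,v1} = {v1,v2,v3}" "{v3,a2,a1} = {a1,a2,v3}" "{v3,a1,v2} = {a1,v2,v3}"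
      "{v3,v1,a2} = {v1,a2,v3}" by blast+
    note o2 = oct_link(3)[OF oct_perm(1)[OF oct] f] and o3 = oct_link(3)[OF oct_perm(1)[OF oct_perm(2)[OF oct]] f]
    consider "v1 \<in> f" | "v2 \<in> f" | "v3 \<in> f" | "f \<in> F0" using f by (auto simp: F0_def)
    then show "f \<in> F0 \<union> octahedron_faces v1 v2 v3 a1 a2 a3"
    proof cases
      case 1
      show ?thesis using oct_link(3)[OF oct f 1] unfolding e octahedron_faces_def by (elim insertE emptyE) simp_all
    next
      case 2
      show ?thesis using o2[OF 2] unfolding e octahedron_faces_def by (elim insertE emptyE) simp_all
    next
      case 3
      show ?thesis using o3[OF 3] unfolding e octahedron_faces_def by (elim insertE emptyE) simp_all
    qed simp
  qed
qed

lemma T_notin: "T \<notin> faces K" using ntri d6 face_tri by auto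

lemma pl_base: "pl_equiv (faces K) (insert T F0)"
proof -
  have "pl_equiv (insert T F0) (F0 \<union> octahedron_faces v1 v2 v3 a1 a2 a3)"
  proof (rule pl_equiv_insert_octahedron)
    show "triples (insert T F0)" using triples_F0 d6 by (auto intro!: triples_insert)
    show "T \<notin> F0" using T_notin F0_faces by blast
    show "{v1,v2,v3} \<inter> \<Union>(insert T F0) = {}" using n0 d6 by auto
  qed (use d6 in simp)
  then show ?thesis unfolding faces_eq by (rule pl_equiv_sym)
qed

lemma delete_image: "(\<lambda>f. f - {v1,v2,v3}) ` faces K = F0 \<union> {{},{a1},{a2},{a3},{a1,a2},{a1,a3},{a2,a3}}"
proof -
  have "(\<lambda>f. f - {v1,v2,v3}) ` F0 = F0"
  proof -
    have "f - {v1,v2,v3} = f" if "f \<in> F0" for f using n0 that by blast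
    then show ?thesis by simp
  qed
  moreover have "(\<lambda>f. f - {v1,v2,v3}) ` octahedron_faces v1 v2 v3 a1 a2 a3 = {{},{a1},{a2},{a3},{a1,a2},{a1,a3},{a2,a3}}"
  proof -
    have "{v1,v2,v3} - {v1,v2,v3} = {}" "{v1,v2,a3} - {v1,v2,v3} = {a3}" "{v1,a2,v3} - {v1,v2,v3} = {a2}"
      "{a1,v2,v3} - {v1,v2,v3} = {a1}" "{v1,a2,a3} - {v1,v2,v3} = {a2,a3}" "{a1,v2,a3} - {v1,v2,v3} = {a1,a3}"
      "{a1,a2,v3} - {v1,v2,v3} = {a1,a2}" using d6 by auto
    then show ?thesis unfolding octahedron_faces_def by (simp only: image_insert image_empty insert_commute)
  qed
  ultimately show ?thesis unfolding faces_eq image_Un by simp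
qed

lemma nbr_F0: assumes "adj K u w" "u \<notin> {v1,v2,v3}" "w \<notin> {v1,v2,v3}" shows "(\<exists>f\<in>F0. {u,w} \<subseteq> f) \<or> {u,w} \<subseteq> T"
proof -
  obtain f where f: "f \<in> faces K" "{u,w} \<subseteq> f" using tri_ex[OF assms(1)] tri_face by blast
  have "g - {v1,v2,v3} \<subseteq> T" if "g \<in> octahedron_faces v1 v2 v3 a1 a2 a3" for g
    using that unfolding octahedron_faces_def by auto
  moreover have "{u,w} \<subseteq> f - {v1,v2,v3}" using f assms by blast
  ultimately show ?thesis using f(1) f(2) unfolding faces_eq by blast
qed

lemma F0_nbr: assumes "f \<in> insert T F0" "u \<in> f" shows "\<exists>w. adj K u w" "u \<notin> {v1,v2,v3}"
proof -
  show "u \<notin> {v1,v2,v3}" using assms n0 d6 by auto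
  show "\<exists>w. adj K u w"
  proof (cases "f = T")
    case True
    then show ?thesis using assms(2) aadj adj_sym by blast
  next
    case False
    then have "f \<in> faces K" using assms(1) F0_faces by blast
    then show ?thesis using face_at[OF _ assms(2)] tri_adj by blast
  qed
qed

lemma no_R2: assumes "6 \<le> vdegree K a1" "6 \<le> vdegree K a2" "6 \<le> vdegree K a3" shows False
proof -
  have "reduction (cball 0 1 :: complex set) (sphere 0 1) K
    (delete_vertices (V ` {1,2,3}) K \<union> (if V ` {1,2,3} \<inter> boundary_vertices K = {} then {{A 1, A 2, A 3}} else {}))"
    by (rule R2[OF component])
  also have "delete_vertices (V ` {1,2,3}) K \<union> (if V ` {1,2,3} \<inter> boundary_vertices K = {} then {{A 1, A 2, A 3}} else {})
     = complex_of ((\<lambda>f. f - {v1,v2,v3}) ` faces K) \<union> {T}"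
    using delete_vertices_complex_of[of "{v1,v2,v3}" "faces K"] v_inner by (simp add: complex_K)
  also have "\<dots> = complex_of (insert T F0)"
  proof -
    have "complex_of ((\<lambda>f. f - {v1,v2,v3}) ` faces K) \<union> {T} = complex_of (insert T ((\<lambda>f. f - {v1,v2,v3}) ` faces K))"
    proof (rule complex_of_insert_face)
      fix s assume s: "s \<noteq> {}" "s \<subset> T"
      then have "s \<subseteq> {a1,a2} \<or> s \<subseteq> {a1,a3} \<or> s \<subseteq> {a2,a3}" by auto
      then show "s \<in> complex_of ((\<lambda>f. f - {v1,v2,v3}) ` faces K)"
        unfolding delete_image using s(1) by (auto simp: complex_of_def)
    qed simp
    also have "\<dots> = complex_of (insert T F0)"
      unfolding delete_image by (rule complex_of_cong) auto
    finally show ?thesis .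
  qed
  finally have red: "reduction (cball 0 1 :: complex set) (sphere 0 1) K (complex_of (insert T F0))" .
  show False
  proof (rule no_reduction[OF red pl_base])
    fix u w assume "adj (complex_of (insert T F0)) u w"
    then obtain f where f: "f \<in> insert T F0" "u \<in> f" by (auto simp: adj_complex_of)
    let ?N = "{w. adj (complex_of (insert T F0)) u w}"
    obtain w0 where w0: "adj K u w0" using F0_nbr(1)[OF f] by blast
    have uV: "u \<notin> {v1,v2,v3}" by (rule F0_nbr(2)[OF f])
    have sub: "nbrs u - {v1,v2,v3} \<subseteq> ?N"
    proof
      fix w assume w: "w \<in> nbrs u - {v1,v2,v3}"
      then have "u \<noteq> w" using adj_irrefl by blast
      then show "w \<in> ?N" using nbr_F0[of u w] w uV by (auto simp: adj_complex_of)
    qed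
    have "triples (insert T F0)" using pl_base by (simp add: pl_equiv_def)
    then have le: "card (nbrs u - {v1,v2,v3}) \<le> card ?N" using sub by (intro card_mono finite_adj_complex_of)
    have d4: "4 \<le> card (nbrs u)" using mindeg[OF w0] by (simp add: deg)
    consider "u = a1" | "u = a2" | "u = a3" | "u \<notin> T" by blast
    then show "4 \<le> card ?N"
    proof cases
      case 1
      then have "nbrs u - {v1,v2,v3} = nbrs u - {v2,v3}" "{v2,v3} \<subseteq> nbrs u" using Av[of u] d6 by auto
      then have "card (nbrs u - {v1,v2,v3}) = card (nbrs u) - 2" using d6 card_Diff_subset[of "{v2,v3}" "nbrs u"] by auto
      then show ?thesis using le assms(1) 1 by (simp add: deg)
    next
      case 2
      then have "nbrs u - {v1,v2,v3} = nbrs u - {v1,v3}" "{v1,v3} \<subseteq> nbrs u" using Av[of u] d6 by auto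
      then have "card (nbrs u - {v1,v2,v3}) = card (nbrs u) - 2" using d6 card_Diff_subset[of "{v1,v3}" "nbrs u"] by auto
      then show ?thesis using le assms(2) 2 by (simp add: deg)
    next
      case 3
      then have "nbrs u - {v1,v2,v3} = nbrs u - {v1,v2}" "{v1,v2} \<subseteq> nbrs u" using Av[of u] d6 by auto
      then have "card (nbrs u - {v1,v2,v3}) = card (nbrs u) - 2" using d6 card_Diff_subset[of "{v1,v2}" "nbrs u"] by auto
      then show ?thesis using le assms(3) 3 by (simp add: deg)
    next
      case 4
      then have "nbrs u - {v1,v2,v3} = nbrs u" using Av[of u] uV by auto
      then show ?thesis using le d4 by simp
    qed
  qed
qed

lemma nbrs_a1: "{a2,a3,v2,v3} \<subseteq> nbrs a1" "v1 \<notin> nbrs a1"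
  using aadj Av[of a1] d6 by auto

lemma oct_disk_all_boundary:
  assumes b: "bd a1 a2" "bd a1 a3" "bd a2 a3" shows "is_octahedron_disk K"
proof -
  have tt: "tri a1 a2 v3" "tri a1 v3 v2" "tri a1 v2 a3" "tri a2 a1 v3" "tri a2 v3 v1" "tri a2 v1 a3"
    "tri a3 a1 v2" "tri a3 v2 v1" "tri a3 v1 a2"
    using tri_perm[OF t(7)] tri_perm[OF t(4)] tri_perm[OF t(6)] tri_perm[OF t(3)] tri_perm[OF t(5)] tri_perm[OF t(2)] by blast+
  have ds: "distinct [a2,v3,v2,a3]" "distinct [a1,v3,v1,a3]" "distinct [a1,v2,v1,a2]" using d6 by auto
  note N1 = nbrs_boundary_path[OF b(1,2) tt(1-3) ds(1)] and N2 = nbrs_boundary_path[OF bd_sym[OF b(1)] b(3) tt(4-6) ds(2)]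
    and N3 = nbrs_boundary_path[OF bd_sym[OF b(2)] bd_sym[OF b(3)] tt(7-9) ds(3)]
  let ?A = "{a1,a2,a3,v1,v2,v3}"
  have "?A = vertices K"
  proof (rule complex_connected)
    show "?A \<subseteq> vertices K" using adj_vertices aadj tri_adj[OF t(1)] by blast
    fix a b assume "a \<in> ?A" "adj K a b"
    moreover have "adj K a b \<longleftrightarrow> b \<in> nbrs a" by simp
    ultimately show "b \<in> ?A" using Nv N1 N2 N3 by (elim insertE emptyE) auto
  qed simp
  moreover have "f \<subseteq> vertices K" if "f \<in> F0" for f
    using F0_faces[OF that] sub_K by (fastforce simp: faces_def vertices_def)
  ultimately have "f \<subseteq> T" if "f \<in> F0" for f using that n0 by blast
  moreover have "card f = 3" if "f \<in> F0" for f using triples_F0 that by (simp add: triples_def)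
  moreover have "card T = 3" using d6 by simp
  ultimately have "f = T" if "f \<in> F0" for f using that card_subset_eq[of T f] by simp
  then have "F0 = {}" using T_notin F0_faces by blast
  then have "K = complex_of (octahedron_faces v1 v2 v3 a1 a2 a3)" using complex_K unfolding faces_eq by simp
  also have "\<dots> = octahedron_disk V A" using octahedron_disk_eq[of V A] d6 by auto
  finally have "K = octahedron_disk V A" .
  moreover have "inj_on V {1,2,3}" "inj_on A {1,2,3}" using d6 by (auto intro!: inj_on_sel3)
  moreover have "V ` {1,2,3} \<inter> A ` {1,2,3} = {}" unfolding sel3_image using d6 by auto
  ultimately show ?thesis unfolding is_octahedron_disk_def by blast
qed

lemma deg_a3_nbrs: "vdegree K a3 = 4 \<Longrightarrow> nbrs a3 = {a1,a2,v1,v2}"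
  by (rule nbrs_eqI) (use aadj adj_sym Av[of a3] d6 in auto)

lemma deg_a3_boundary:
  assumes "vdegree K a3 = 4" shows "bd a3 a1" "bd a3 a2"
proof -
  note N = deg_a3_nbrs[OF assms]
  have "u = v2" if u: "tri a3 a1 u" for u
  proof -
    have "u \<in> {a1,a2,v1,v2}" using tri_adj(3)[OF u] N by blast
    moreover have "u \<noteq> v1" using tri_adj(2)[OF u] Av(1)[of a1] d6 by auto
    moreover have "u \<noteq> a2" using u ntris by blast
    ultimately show ?thesis using tri_neq[OF u] by blast
  qed
  then show "bd a3 a1" using aadj adj_sym unfolding bd_iff by blast
  have "u = v1" if u: "tri a3 a2 u" for u
  proof -
    have "u \<in> {a1,a2,v1,v2}" using tri_adj(3)[OF u] N by blast
    moreover have "u \<noteq> v2" using tri_adj(2)[OF u] Av(2)[of a2] d6 by auto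
    moreover have "u \<noteq> a1" using u ntris by blast
    ultimately show ?thesis using tri_neq[OF u] by blast
  qed
  then show "bd a3 a2" using aadj adj_sym unfolding bd_iff by blast
qed

lemma F0_a3: assumes "vdegree K a3 = 4" "f \<in> F0" shows "a3 \<notin> f"
proof
  assume "a3 \<in> f"
  then obtain p q where pq: "f = {a3,p,q}" "tri a3 p q" using face_at[OF F0_faces[OF assms(2)]] by blast
  then have "p \<in> {a1,a2,v1,v2}" "q \<in> {a1,a2,v1,v2}" using tri_adj(1,3)[OF pq(2)] deg_a3_nbrs[OF assms(1)] by blast+
  then have "p \<in> {a1,a2}" "q \<in> {a1,a2}" using n0(1,2)[OF assms(2)] pq(1) by blast+
  then show False using pq(2) tri_neq[OF pq(2)] ntris by blast
qed

lemma deg_a1_nbr_x: assumes "vdegree K a1 = 5" "adj K a1 x" "x \<notin> {a2,a3,v2,v3}" shows "nbrs a1 = {a2,a3,v2,v3,x}"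
  by (rule nbrs_eqI) (use nbrs_a1 assms d6 in auto)

lemma no_deg5_external:
  assumes d3: "vdegree K a3 = 4" and x: "tri a1 a2 x" "x \<noteq> v3" and d1: "vdegree K a1 = 5" shows False
proof -
  have N3: "nbrs a3 = {a1,a2,v1,v2}" by (rule deg_a3_nbrs[OF d3])
  have xa: "x \<notin> {a2,a3,v2,v3}"
    using x tri_neq[OF x(1)] ntri tri_adj(2)[OF x(1)] Av(2)[of a2] d6 by auto
  have N1: "nbrs a1 = {a2,a3,v2,v3,x}" by (rule deg_a1_nbr_x[OF d1 _ xa]) (use tri_adj[OF x(1)] in blast)
  have xv: "\<not> adj K x a3" "\<not> adj K x v2" "\<not> adj K x v3" "x \<noteq> v1"
  proof -
    have "x \<noteq> v1" using tri_adj(3)[OF x(1)] nbrs_a1(2) by blast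
    moreover have "x \<noteq> a1" using tri_neq[OF x(1)] by blast
    ultimately show "\<not> adj K x a3" "\<not> adj K x v2" "\<not> adj K x v3" "x \<noteq> v1"
      using xa Av[of x] N3 adj_sym[of x a3] by auto
  qed
  have only: "w = a2" if "adj K a1 w" "adj K x w" for w
  proof -
    have "w \<in> {a2,a3,v2,v3,x}" using that(1) N1 by blast
    then show ?thesis using that(2) xv adj_irrefl[of x] by blast
  qed
  have "bd a1 x" unfolding bd_iff using only tri_adj[OF x(1)] by (metis tri_adj(2,3))
  then obtain w where w: "tri a1 x w" "vdegree K w = 4"
    using no_R1[of a1 x] only tri_adj(3)[OF x(1)] tri_perm(2)[OF x(1)] by metis
  have "w = a2" using only tri_adj[OF w(1)] by blast
  moreover have "5 \<le> vdegree K a2"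
  proof -
    have "{a1,a3,v1,v3,x} \<subseteq> nbrs a2"
      using aadj adj_sym Av[of a2] tri_adj(2)[OF x(1)] by blast
    moreover have "card {a1,a3,v1,v3,x} = 5" using d6 xa xv tri_neq[OF x(1)] by auto
    ultimately show ?thesis using card_mono[OF finite_nbrs] by (metis deg)
  qed
  ultimately show False using w(2) by simp
qed

lemma delete3_image:
  assumes d3: "vdegree K a3 = 4"
  shows "(\<lambda>f. f - {a3,v1,v2,v3}) ` faces K = F0 \<union> {{},{a1},{a2},{a1,a2}}"
proof -
  have "(\<lambda>f. f - {a3,v1,v2,v3}) ` F0 = F0"
  proof -
    have "f - {a3,v1,v2,v3} = f" if "f \<in> F0" for f using n0 F0_a3[OF d3] that by blast
    then show ?thesis by simp
  qed
  moreover have "(\<lambda>f. f - {a3,v1,v2,v3}) ` octahedron_faces v1 v2 v3 a1 a2 a3 = {{},{a1},{a2},{a1,a2}}"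
  proof -
    have "{v1,v2,v3} - {a3,v1,v2,v3} = {}" "{v1,v2,a3} - {a3,v1,v2,v3} = {}" "{v1,a2,v3} - {a3,v1,v2,v3} = {a2}"
      "{a1,v2,v3} - {a3,v1,v2,v3} = {a1}" "{v1,a2,a3} - {a3,v1,v2,v3} = {a2}" "{a1,v2,a3} - {a3,v1,v2,v3} = {a1}"
      "{a1,a2,v3} - {a3,v1,v2,v3} = {a1,a2}" using d6 by auto
    then show ?thesis unfolding octahedron_faces_def by (simp only: image_insert image_empty insert_commute insert_absorb2)
  qed
  ultimately show ?thesis unfolding faces_eq image_Un by simp
qed

lemma no_external:
  assumes d3: "vdegree K a3 = 4" and nb: "\<not> bd a1 a2" shows False
proof -
  note N3 = deg_a3_nbrs[OF d3]
  obtain x where x: "tri a1 a2 x" "x \<noteq> v3" using tri_other[OF aadj(1) nb] by blast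
  have x6: "x \<notin> {a1,a2,a3,v1,v2,v3}"
    using x tri_neq[OF x(1)] ntri tri_adj(2,3)[OF x(1)] Av[of a1] Av[of a2] d6 by auto
  have a12: "u = v3 \<or> u = x" if "tri a1 a2 u" for u
    using tri_two[OF tri_perm(4)[OF t(7)] x(1) that] x(2) by blast
  have xF: "{a1,a2,x} \<in> F0" using tri_face[OF x(1)] x6 d6 by (auto simp: F0_def)
  define G where "G = F0 - {{a1,a2,x}}"
  have F0G: "F0 = insert {a1,a2,x} G" using xF by (auto simp: G_def)
  have G12: "\<not> {a1,a2} \<subseteq> f" if "f \<in> G" for f
  proof
    assume s: "{a1,a2} \<subseteq> f"
    have fF: "f \<in> F0" "f \<noteq> {a1,a2,x}" using that by (auto simp: G_def)
    then have "f \<in> {f\<in>faces K. {a1,a2} \<subseteq> f}" using s F0_faces by blast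
    then obtain u where "f = {a1,a2,u}" "tri a1 a2 u" unfolding face_star[OF aadj(1)] by blast
    then show False using a12[of u] fF n0(3)[OF fF(1)] by blast
  qed
  have a3F: "a3 \<notin> f" if "f \<in> F0" for f by (rule F0_a3[OF d3 that])
  have pl3: "pl_equiv (faces K) F0"
  proof -
    have "pl_equiv (insert {a1,a2,x} G) (G \<union> {{a1,a2,x},{a1,a2,a3}})"
    proof (rule pl_equiv_attach_triangle)
      show "triples (insert {a1,a2,x} G)" using triples_F0 F0G by simp
      show "a3 \<notin> \<Union>(insert {a1,a2,x} G)" using a3F unfolding F0G[symmetric] by blast
    qed (rule G12)
    moreover have "G \<union> {{a1,a2,x},{a1,a2,a3}} = insert T F0" unfolding F0G by (simp add: insert_commute)
    ultimately have "pl_equiv F0 (insert T F0)" unfolding F0G[symmetric] by simp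
    then show ?thesis using pl_base pl_equiv_sym pl_equiv_trans by blast
  qed
  have del: "delete_vertices ({a3} \<union> {v1,v2,v3}) K = complex_of F0"
  proof -
    have e: "{a3} \<union> {v1,v2,v3} = {a3,v1,v2,v3}" by blast
    have "delete_vertices ({a3} \<union> {v1,v2,v3}) K = complex_of ((\<lambda>f. f - {a3,v1,v2,v3}) ` faces K)"
      unfolding e using delete_vertices_complex_of[of "{a3,v1,v2,v3}" "faces K"] unfolding complex_K .
    also have "\<dots> = complex_of F0"
      unfolding delete3_image[OF d3]
    proof (rule complex_of_cong)
      fix f assume "f \<in> F0 \<union> {{},{a1},{a2},{a1,a2}}"
      then have "f \<in> F0 \<or> f \<subseteq> {a1,a2,x}" by blast
      then show "\<exists>g\<in>F0. f \<subseteq> g" using xF by blast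
    qed blast
    finally show ?thesis .
  qed
  have Aa3: "adj K u a3 \<longleftrightarrow> u \<in> {a1,a2,v1,v2}" for u using N3 adj_sym by blast
  have bde: "{a1,a3} \<in> boundary_edges K" "{a3,a2} \<in> boundary_edges K"
    using deg_a3_boundary[OF d3] by (simp_all add: bd_def insert_commute)
  have F0n: "\<exists>f\<in>F0. {u,w} \<subseteq> f" if "adj K u w" and un: "u \<notin> {a3,v1,v2,v3}" and wn: "w \<notin> {a3,v1,v2,v3}" for u w
  proof -
    have uw: "u \<notin> {v1,v2,v3}" "w \<notin> {v1,v2,v3}" using that by auto
    have "{u,w} \<subseteq> {a1,a2,x}" if T: "{u,w} \<subseteq> T" using T un wn by auto
    then show ?thesis using nbr_F0[OF that(1) uw] xF by blast
  qed
  have five: "5 \<le> vdegree K a1" "5 \<le> vdegree K a2"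
  proof -
    have "{a2,a3,v2,v3,x} \<subseteq> nbrs a1" "{a1,a3,v1,v3,x} \<subseteq> nbrs a2"
      using aadj adj_sym Av[of a1] Av[of a2] tri_adj(2,3)[OF x(1)] by blast+
    moreover have "card {a2,a3,v2,v3,x} = 5" "card {a1,a3,v1,v3,x} = 5" using d6 x6 by auto
    ultimately show "5 \<le> vdegree K a1" "5 \<le> vdegree K a2" using card_mono[OF finite_nbrs] by (metis deg)+
  qed
  consider (1) "vdegree K a1 = 5" | (2) "vdegree K a2 = 5" | (3) "vdegree K a1 = 6 \<or> vdegree K a2 = 6"
    | (4) "7 \<le> vdegree K a1" "7 \<le> vdegree K a2" using five by linarith
  then show False
  proof cases
    case 1
    show False by (rule no_deg5_external[OF d3 x 1])
  next
    case 2
    interpret m: oct_disk K h h' a2 a1 a3 v2 v1 v3 by (rule perms(1))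
    show False by (rule m.no_deg5_external[OF d3 tri_perm(1)[OF x(1)] x(2) 2])
  next
    case 4
    have "reduction (cball 0 1 :: complex set) (sphere 0 1) K (delete_vertices ({A 3} \<union> V ` {1,2,3}) K)"
      by (rule R2_external[OF component, of 1 3 2]) (use bde in auto)
    then have red: "reduction (cball 0 1 :: complex set) (sphere 0 1) K (complex_of F0)"
      unfolding sel3_image sel3_simps del .
    show False
    proof (rule no_reduction[OF red pl3])
      fix u w assume "adj (complex_of F0) u w"
      then obtain f where f: "f \<in> F0" "u \<in> f" by (auto simp: adj_complex_of)
      let ?N = "{w. adj (complex_of F0) u w}"
      have f': "f \<in> insert T F0" using f by blast
      obtain w0 where w0: "adj K u w0" using F0_nbr(1)[OF f' f(2)] by blast
      have uV: "u \<notin> {a3,v1,v2,v3}" using F0_nbr(2)[OF f' f(2)] a3F[OF f(1)] f(2) by blast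
      have sub: "nbrs u - {a3,v1,v2,v3} \<subseteq> ?N"
      proof
        fix w assume w: "w \<in> nbrs u - {a3,v1,v2,v3}"
        then have "u \<noteq> w" using adj_irrefl by blast
        then show "w \<in> ?N" using F0n[of u w] w uV by (auto simp: adj_complex_of)
      qed
      then have le: "card (nbrs u - {a3,v1,v2,v3}) \<le> card ?N" by (intro card_mono finite_adj_complex_of triples_F0)
      have d4: "4 \<le> card (nbrs u)" using mindeg[OF w0] by (simp add: deg)
      consider "u = a1" | "u = a2" | "u \<notin> {a1,a2}" by blast
      then show "4 \<le> card ?N"
      proof cases
        case 1
        then have "nbrs u - {a3,v1,v2,v3} = nbrs u - {a3,v2,v3}" "{a3,v2,v3} \<subseteq> nbrs u" using Av[of u] Aa3[of u] d6 by auto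
        then have "card (nbrs u - {a3,v1,v2,v3}) = card (nbrs u) - 3" using d6 card_Diff_subset[of "{a3,v2,v3}" "nbrs u"] by auto
        then show ?thesis using le 4 1 by (simp add: deg)
      next
        case 2
        then have "nbrs u - {a3,v1,v2,v3} = nbrs u - {a3,v1,v3}" "{a3,v1,v3} \<subseteq> nbrs u" using Av[of u] Aa3[of u] d6 by auto
        then have "card (nbrs u - {a3,v1,v2,v3}) = card (nbrs u) - 3" using d6 card_Diff_subset[of "{a3,v1,v3}" "nbrs u"] by auto
        then show ?thesis using le 4 2 by (simp add: deg)
      next
        case 3
        then have "nbrs u - {a3,v1,v2,v3} = nbrs u" using Av[of u] Aa3[of u] uV by auto
        then show ?thesis using le d4 by simp
      qed
    qed
  next
    case 3
    let ?O = "octahedron_faces v1 v2 v3 a1 a2 x"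
    let ?G = "G \<union> ?O"
    have vx: "{v1,v2,v3} \<inter> \<Union>(insert {a1,a2,x} G) = {}" using n0 unfolding F0G[symmetric] by blast
    have plG: "pl_equiv (insert {a1,a2,x} G) ?G"
    proof (rule pl_equiv_insert_octahedron)
      show "triples (insert {a1,a2,x} G)" using triples_F0 F0G by simp
      show "{a1,a2,x} \<notin> G" by (simp add: G_def)
    qed (use vx d6 in auto)
    then have pl: "pl_equiv (faces K) ?G" using pl3 pl_equiv_trans unfolding F0G[symmetric] by blast
    have "reduction (cball 0 1 :: complex set) (sphere 0 1) K
      ((delete_vertices ({A 3} \<union> V ` {1,2,3}) K - {{A 1, A 2, x}}) \<union> octahedron_disk V (A(3 := x)))"
    proof (rule R3[OF component])
      show "{A 1, A 3} \<in> boundary_edges K" "{A 3, A 2} \<in> boundary_edges K" using bde by simp_all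
      show "vdegree K (A 3) = 4" "vdegree K (A 1) = 6 \<or> vdegree K (A 2) = 6" using d3 3 by simp_all
      show "{A 1, A 2, x} \<in> faces K" using tri_face[OF x(1)] by simp
      show "x \<notin> {A 3} \<union> V ` {1,2,3}" unfolding sel3_image using x6 by simp
      show "inj_on V {1,2,3}" using d6 by (auto intro!: inj_on_sel3)
      show "V ` {1,2,3} \<inter> (vertices K - ({A 3} \<union> V ` {1,2,3})) = {}" by blast
    qed
    also have "(delete_vertices ({A 3} \<union> V ` {1,2,3}) K - {{A 1, A 2, x}}) \<union> octahedron_disk V (A(3 := x))
      = (complex_of F0 - {{a1,a2,x}}) \<union> complex_of ?O"
    proof -
      have "octahedron_disk V (A(3 := x)) = complex_of ?O"
        using octahedron_disk_eq[of V "A(3 := x)"] d6 x6 by auto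
      then show ?thesis unfolding sel3_image sel3_simps del by simp
    qed
    also have "\<dots> = complex_of ?G"
    proof (intro equalityI subsetI)
      fix s assume "s \<in> complex_of F0 - {{a1,a2,x}} \<union> complex_of ?O"
      then consider "s \<in> complex_of ?O" | "s \<in> complex_of G" | "s \<noteq> {}" "s \<subset> {a1,a2,x}"
        unfolding F0G by (auto simp: complex_of_def)
      then show "s \<in> complex_of ?G"
      proof cases
        case 3
        then have "s \<subseteq> {a1,a2,v3} \<or> s \<subseteq> {v1,a2,x} \<or> s \<subseteq> {a1,v2,x}" by auto
        then show ?thesis using 3(1) by (auto simp: complex_of_def octahedron_faces_def)
      qed (auto simp: complex_of_def)
    next
      fix s assume s: "s \<in> complex_of ?G"
      have "\<not> {a1,a2,x} \<subseteq> f" if "f \<in> ?G" for f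
      proof -
        have "\<not> {a1,a2,x} \<subseteq> f" if "f \<in> ?O" using that d6 x6 unfolding octahedron_faces_def by auto
        then show ?thesis using that G12 by blast
      qed
      then have "s \<noteq> {a1,a2,x}" using s by (auto simp: complex_of_def)
      then show "s \<in> complex_of F0 - {{a1,a2,x}} \<union> complex_of ?O"
        using s unfolding F0G by (auto simp: complex_of_def)
    qed
    finally have red: "reduction (cball 0 1 :: complex set) (sphere 0 1) K (complex_of ?G)" .
    show False
    proof (rule no_reduction[OF red pl])
      fix u w assume "adj (complex_of ?G) u w"
      then obtain f where f: "f \<in> ?G" "u \<in> f" by (auto simp: adj_complex_of)
      let ?N = "{w. adj (complex_of ?G) u w}"
      have "triples ?G" using pl by (simp add: pl_equiv_def)
      then have fin: "finite ?N" by (rule finite_adj_complex_of)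
      have inO: "{p,q} \<subseteq> g \<Longrightarrow> p \<noteq> q \<Longrightarrow> g \<in> ?O \<Longrightarrow> adj (complex_of ?G) p q" for p q g
        by (auto simp: adj_complex_of)
      show "4 \<le> card ?N"
      proof (cases "u \<in> {v1,v2,v3}")
        case True
        have O: "{v1,v2,v3} \<in> ?O" "{v1,a2,x} \<in> ?O" "{a1,v2,x} \<in> ?O" "{a1,a2,v3} \<in> ?O" by (simp_all add: octahedron_faces_def)
        consider "u = v1" | "u = v2" | "u = v3" using True by blast
        then show ?thesis
        proof cases
          case 1
          have "{v2,v3,a2,x} \<subseteq> ?N" unfolding 1
            using O inO[of v1 v2 "{v1,v2,v3}"] inO[of v1 v3 "{v1,v2,v3}"] inO[of v1 a2 "{v1,a2,x}"] inO[of v1 x "{v1,a2,x}"] d6 x6 by auto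
          moreover have "card {v2,v3,a2,x} = 4" using d6 x6 by auto
          ultimately show ?thesis using card_mono[OF fin] by metis
        next
          case 2
          have "{v1,v3,a1,x} \<subseteq> ?N" unfolding 2
            using O inO[of v2 v1 "{v1,v2,v3}"] inO[of v2 v3 "{v1,v2,v3}"] inO[of v2 a1 "{a1,v2,x}"] inO[of v2 x "{a1,v2,x}"] d6 x6 by auto
          moreover have "card {v1,v3,a1,x} = 4" using d6 x6 by auto
          ultimately show ?thesis using card_mono[OF fin] by metis
        next
          case 3
          have "{v1,v2,a1,a2} \<subseteq> ?N" unfolding 3
            using O inO[of v3 v1 "{v1,v2,v3}"] inO[of v3 v2 "{v1,v2,v3}"] inO[of v3 a1 "{a1,a2,v3}"] inO[of v3 a2 "{a1,a2,v3}"] d6 x6 by auto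
          moreover have "card {v1,v2,a1,a2} = 4" using d6 x6 by auto
          ultimately show ?thesis using card_mono[OF fin] by metis
        qed
      next
        case False
        note False' = False
        have fu: "\<exists>g\<in>F0. u \<in> g"
        proof (cases "f \<in> G")
          case False
          then have fO: "f \<in> ?O" using f(1) by blast
          have "g - {v1,v2,v3} \<subseteq> {a1,a2,x}" if "g \<in> ?O" for g using that unfolding octahedron_faces_def by auto
          then have "u \<in> {a1,a2,x}" using fO f(2) False' by (meson DiffI subsetD)
          then show ?thesis by (rule bexI[OF _ xF])
        qed (use f F0G in blast)
        then obtain g where g: "g \<in> insert T F0" "u \<in> g" "g \<in> F0" by blast
        obtain w0 where w0: "adj K u w0" using F0_nbr(1)[OF g(1,2)] by blast
        have uV: "u \<notin> {a3,v1,v2,v3}" using F0_nbr(2)[OF g(1,2)] a3F[OF g(3)] g(2) by blast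
        have edge: "adj (complex_of ?G) u w" if uw: "adj K u w" "w \<noteq> a3" for w
        proof (cases "w \<in> {v1,v2,v3}")
          case True
          have O: "{v1,a2,v3} \<in> ?O" "{a1,v2,v3} \<in> ?O" by (simp_all add: octahedron_faces_def)
          have "w \<in> {v2,v3} \<and> u = a1 \<or> w \<in> {v1,v3} \<and> u = a2"
            using that True Av[of u] uV d6 by auto
          then have "{u,w} \<subseteq> {a1,v2,v3} \<or> {u,w} \<subseteq> {v1,a2,v3}" "u \<noteq> w" using d6 by auto
          then show ?thesis using O inO by blast
        next
          case False
          then obtain k where k: "k \<in> F0" "{u,w} \<subseteq> k" using F0n[OF uw(1) uV] uw(2) by blast
          have ne: "u \<noteq> w" using uw(1) adj_irrefl by blast
          show ?thesis
          proof (cases "k \<in> G")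
            case True
            then show ?thesis using k(2) ne by (auto simp: adj_complex_of)
          next
            case False
            then have "{u,w} \<subseteq> {a1,a2,x}" using k F0G by blast
            then have "{u,w} \<subseteq> {a1,a2,v3} \<or> {u,w} \<subseteq> {v1,a2,x} \<or> {u,w} \<subseteq> {a1,v2,x}" using ne by auto
            moreover have "{a1,a2,v3} \<in> ?O" "{v1,a2,x} \<in> ?O" "{a1,v2,x} \<in> ?O" by (simp_all add: octahedron_faces_def)
            ultimately show ?thesis using inO ne by blast
          qed
        qed
        then have "nbrs u - {a3} \<subseteq> ?N" by blast
        then have le: "card (nbrs u - {a3}) \<le> card ?N" by (rule card_mono[OF fin])
        have d4: "4 \<le> card (nbrs u)" using mindeg[OF w0] by (simp add: deg)
        show ?thesis
        proof (cases "u \<in> {a1,a2}")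
          case True
          then have "5 \<le> card (nbrs u)" using five by (auto simp: deg)
          moreover have "card (nbrs u) - 1 \<le> card (nbrs u - {a3})" using diff_card_le_card_Diff[of "{a3}" "nbrs u"] by simp
          ultimately show ?thesis using le by linarith
        next
          case False
          then have "nbrs u - {a3} = nbrs u" using Aa3[of u] uV by auto
          then show ?thesis using le d4 by simp
        qed
      qed
    qed
  qed
qed

lemma R5_impossible:
  assumes d1: "vdegree K a1 = 5" and d23: "5 \<le> vdegree K a2" "5 \<le> vdegree K a3"
    and u: "tri a1 a3 u" "u \<noteq> v2" and nu: "\<not> tri a1 a2 u"
  shows False
proof -
  have u6: "u \<notin> {a1,a2,a3,v1,v2,v3}"
    using u tri_neq[OF u(1)] ntris tri_adj(2,3)[OF u(1)] Av[of a1] Av[of a3] d6 by auto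
  have N1: "nbrs a1 = {a2,a3,v2,v3,u}"
    by (rule deg_a1_nbr_x[OF d1 tri_adj(3)[OF u(1)]]) (use u6 in auto)
  have t12: "w = v3" if w: "tri a1 a2 w" for w
  proof -
    have "w \<in> {a2,a3,v2,v3,u}" using tri_adj(3)[OF w] N1 by blast
    moreover have "w \<noteq> v2" using tri_adj(2)[OF w] Av(2)[of a2] d6 by auto
    ultimately show ?thesis using w nu ntri tri_neq[OF w] by blast
  qed
  have b12: "bd a1 a2" unfolding bd_iff using aadj t12 by blast
  have nb13: "\<not> bd a1 a3" using bd_unique[OF _ u(1) tri_perm(4)[OF t(6)]] u(2) by blast
  have nb23: "\<not> bd a2 a3"
  proof
    assume b: "bd a2 a3"
    have "nbrs a2 = {a1,v3,v1,a3}"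
      by (rule nbrs_boundary_path[OF bd_sym[OF b12] b]) (use tri_perm[OF t(7)] tri_perm[OF t(3)] tri_perm[OF t(5)] d6 in auto)
    moreover have "card {a1,v3,v1,a3} = 4" using d6 by auto
    ultimately show False using d23(1) by (simp add: deg)
  qed
  define F00 where "F00 = {f\<in>F0. a1 \<notin> f}"
  have n00: "a1 \<notin> f" "v1 \<notin> f" "v2 \<notin> f" "v3 \<notin> f" if "f \<in> F00" for f using that n0 by (auto simp: F00_def)
  have F0e: "F0 = insert {a1,a3,u} F00"
  proof (intro equalityI subsetI)
    fix f assume f: "f \<in> F0"
    show "f \<in> insert {a1,a3,u} F00"
    proof (cases "a1 \<in> f")
      case True
      then obtain p q where pq: "f = {a1,p,q}" "tri a1 p q" using face_at[OF F0_faces[OF f]] by blast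
      then have "p \<in> {a2,a3,v2,v3,u}" "q \<in> {a2,a3,v2,v3,u}" using tri_adj(1,3)[OF pq(2)] N1 by blast+
      then have "p \<in> {a2,a3,u}" "q \<in> {a2,a3,u}" using n0[OF f] pq(1) by blast+
      then have "p = a3 \<and> q = u \<or> p = u \<and> q = a3" using pq(2) tri_neq[OF pq(2)] ntri ntris nu tri_perm(2)[of a1 u a2] by auto
      then show ?thesis unfolding pq(1) by (auto simp: insert_commute)
    qed (use f in \<open>simp add: F00_def\<close>)
  next
    fix f assume "f \<in> insert {a1,a3,u} F00"
    moreover have "{a1,a3,u} \<in> F0" using tri_face[OF u(1)] u6 d6 by (auto simp: F0_def)
    ultimately show "f \<in> F0" by (auto simp: F00_def)
  qed
  let ?R = "{{v1,v2,v3},{v1,v2,a3},{v1,a2,v3},{u,v2,v3},{v1,a2,a3},{u,v2,a3}}"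
  let ?G = "F00 \<union> ?R"
  have d7: "distinct [a1,a2,a3,v1,v2,v3,u]" using d6 u6 by auto
  have pl: "pl_equiv (faces K) ?G"
  proof -
    let ?p = "id(a1 := v3, v3 := a1)"
    have "pl_equiv (insert T F0) ((`) ?p ` insert T F0)"
      by (rule pl_equiv_rename) (use triples_F0 d6 in \<open>auto intro!: triples_insert\<close>)
    also have "(`) ?p ` insert T F0 = insert {u,v3,a3} (F00 \<union> {{v3,a2,a3}})"
    proof -
      have "?p ` f = f" if "f \<in> F00" for f
      proof -
        have "?p z = z" if "z \<in> f" for z using n00(1,4)[OF \<open>f \<in> F00\<close>] that by auto
        then show ?thesis by simp
      qed
      then have "(`) ?p ` F00 = F00" by simp
      moreover have "?p ` {a1,a3,u} = {u,v3,a3}" "?p ` T = {v3,a2,a3}" using d7 by auto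
      ultimately show ?thesis unfolding F0e image_insert by (simp add: insert_commute)
    qed
    finally have 1: "pl_equiv (insert T F0) (insert {u,v3,a3} (F00 \<union> {{v3,a2,a3}}))" .
    have plt: "pl_equiv X Y \<Longrightarrow> triples Y" for X Y :: "'v set set" by (simp add: pl_equiv_def)
    have neqI: "x \<in> X \<Longrightarrow> x \<notin> Y \<Longrightarrow> X \<noteq> Y" for x :: 'v and X Y by blast
    note tr1 = plt[OF 1]
    have 2: "pl_equiv (insert {u,v3,a3} (F00 \<union> {{v3,a2,a3}})) (F00 \<union> {{v3,a2,a3}} \<union> {{v2,v3,a3},{v2,u,a3},{v2,u,v3}})"
    proof (rule pl_equiv_subdivide_face[OF tr1])
      have "{u,v3,a3} \<noteq> {v3,a2,a3}" by (rule neqI[of u]) (use d7 in auto)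
      moreover have "{u,v3,a3} \<notin> F00" by (rule notI, drule n00(4), simp)
      ultimately show "{u,v3,a3} \<notin> F00 \<union> {{v3,a2,a3}}" by simp
      show "v2 \<notin> \<Union> (insert {u,v3,a3} (F00 \<union> {{v3,a2,a3}}))" using n00(3) d7 by auto
    qed
    let ?H = "F00 \<union> {{v3,a2,a3},{v2,u,a3},{v2,u,v3}}"
    have e2: "F00 \<union> {{v3,a2,a3}} \<union> {{v2,v3,a3},{v2,u,a3},{v2,u,v3}} = insert {a3,v3,v2} ?H" by (simp add: insert_commute)
    note 2 = 2[unfolded e2]
    note tr2 = plt[OF 2]
    have 3: "pl_equiv (insert {a3,v3,v2} ?H) (?H \<union> {{v1,v3,v2},{v1,a3,v2},{v1,a3,v3}})"
    proof (rule pl_equiv_subdivide_face[OF tr2])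
      have "{a3,v3,v2} \<noteq> {v3,a2,a3}" by (rule neqI[of v2]) (use d7 in auto)
      moreover have "{a3,v3,v2} \<noteq> {v2,u,a3}" by (rule neqI[of v3]) (use d7 in auto)
      moreover have "{a3,v3,v2} \<noteq> {v2,u,v3}" by (rule neqI[of a3]) (use d7 in auto)
      moreover have "{a3,v3,v2} \<notin> F00" by (rule notI, drule n00(4), simp)
      ultimately show "{a3,v3,v2} \<notin> ?H" by simp
      show "v1 \<notin> \<Union> (insert {a3,v3,v2} ?H)" using n00(2) d7 by auto
    qed
    let ?J = "F00 \<union> {{v2,u,a3},{v2,u,v3},{v1,v3,v2},{v1,a3,v2}}"
    have e3: "?H \<union> {{v1,v3,v2},{v1,a3,v2},{v1,a3,v3}} = ?J \<union> {{a3,v3,v1},{a3,v3,a2}}" by (simp add: insert_commute)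
    note 3 = 3[unfolded e3]
    note tr3 = plt[OF 3]
    have 4: "pl_equiv (?J \<union> {{a3,v3,v1},{a3,v3,a2}}) (?J \<union> {{v1,a2,a3},{v1,a2,v3}})"
    proof (rule pl_equiv_flip[OF tr3])
      show "distinct [a3,v3,v1,a2]" using d7 by auto
      show "\<not> {a3,v3} \<subseteq> f" "\<not> {v1,a2} \<subseteq> f" if "f \<in> ?J" for f
        using that n00(4)[of f] n00(2)[of f] d7 by auto
    qed
    have e4: "?J \<union> {{v1,a2,a3},{v1,a2,v3}} = ?G" by (simp add: insert_commute)
    show ?thesis using pl_equiv_trans[OF pl_equiv_trans[OF pl_equiv_trans[OF pl_equiv_trans[OF pl_base 1] 2] 3] 4] unfolding e4 .
  qed
  define H where "H = F00 \<union> {{a1,a3,u},{v1,v2,v3},{v1,v2,a3},{v1,a2,v3},{a1,v2,v3},{v1,a2,a3},{a1,v2,a3}}"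
  have fK: "faces K = insert {a1,a2,v3} H"
    unfolding faces_eq F0e octahedron_faces_def H_def by auto
  have Hf: "{a1,v2,v3} \<in> H" "{v1,a2,v3} \<in> H" by (simp_all add: H_def)
  have H12: "\<not> {a2,a1} \<subseteq> f" if "f \<in> H" for f using that n00(1)[of f] d7 unfolding H_def by auto
  have del: "{s\<in>K. \<not> {a2,a1} \<subseteq> s} = complex_of H"
  proof (intro equalityI subsetI)
    fix s assume s: "s \<in> {s\<in>K. \<not> {a2,a1} \<subseteq> s}"
    then have "s \<in> complex_of (faces K)" unfolding complex_K by blast
    then obtain f where f: "s \<noteq> {}" "f \<in> faces K" "s \<subseteq> f" by (auto simp: complex_of_def)
    have "\<exists>g\<in>H. s \<subseteq> g"
    proof (cases "f \<in> H")
      case False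
      then have "f = {a1,a2,v3}" using f(2) unfolding fK by simp
      then have "s \<subseteq> {a1,v2,v3} \<or> s \<subseteq> {v1,a2,v3}" using s f(3) by auto
      then show ?thesis using Hf by blast
    qed (use f in blast)
    then show "s \<in> complex_of H" using f(1) by (simp add: complex_of_def)
  next
    fix s assume "s \<in> complex_of H"
    then obtain f where f: "s \<noteq> {}" "f \<in> H" "s \<subseteq> f" by (auto simp: complex_of_def)
    then have "s \<in> complex_of (faces K)" unfolding fK by (auto simp: complex_of_def)
    moreover note H12[OF f(2)]
    ultimately show "s \<in> {s\<in>K. \<not> {a2,a1} \<subseteq> s}" using f(3) unfolding complex_K by blast
  qed
  have con: "contract u a1 {s\<in>K. \<not> {a2,a1} \<subseteq> s} = complex_of ?G"
  proof -
    let ?p = "id(a1 := u)"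
    have "?p ` f = f" if "f \<in> F00" for f
    proof -
      have "?p z = z" if "z \<in> f" for z using n00(1)[OF \<open>f \<in> F00\<close>] that by auto
      then show ?thesis by simp
    qed
    then have "(`) ?p ` F00 = F00" by simp
    moreover have "?p ` {a1,a3,u} = {u,a3}" "?p ` {v1,v2,v3} = {v1,v2,v3}" "?p ` {v1,v2,a3} = {v1,v2,a3}"
      "?p ` {v1,a2,v3} = {v1,a2,v3}" "?p ` {a1,v2,v3} = {u,v2,v3}" "?p ` {v1,a2,a3} = {v1,a2,a3}" "?p ` {a1,v2,a3} = {u,v2,a3}"
      using d7 by auto
    ultimately have "(`) ?p ` H = F00 \<union> {{u,a3},{v1,v2,v3},{v1,v2,a3},{v1,a2,v3},{u,v2,v3},{v1,a2,a3},{u,v2,a3}}"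
      unfolding H_def by (simp only: image_Un image_insert image_empty)
    then have "contract u a1 {s\<in>K. \<not> {a2,a1} \<subseteq> s} = complex_of (F00 \<union> {{u,a3},{v1,v2,v3},{v1,v2,a3},{v1,a2,v3},{u,v2,v3},{v1,a2,a3},{u,v2,a3}})"
      unfolding del contract_complex_of by simp
    also have "\<dots> = complex_of ?G"
    proof (rule complex_of_cong)
      fix f assume "f \<in> F00 \<union> {{u,a3},{v1,v2,v3},{v1,v2,a3},{v1,a2,v3},{u,v2,v3},{v1,a2,a3},{u,v2,a3}}"
      then have "f \<in> ?G \<or> f \<subseteq> {u,v2,a3}" by (elim UnE insertE emptyE) simp_all
      moreover have "{u,v2,a3} \<in> ?G" by simp
      ultimately show "\<exists>g\<in>?G. f \<subseteq> g" by (meson order_refl)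
    next
      fix f assume "f \<in> ?G"
      then have "f \<in> F00 \<union> {{u,a3},{v1,v2,v3},{v1,v2,a3},{v1,a2,v3},{u,v2,v3},{v1,a2,a3},{u,v2,a3}}"
        by (elim UnE insertE emptyE) simp_all
      then show "\<exists>g\<in>F00 \<union> {{u,a3},{v1,v2,v3},{v1,v2,a3},{v1,a2,v3},{u,v2,v3},{v1,a2,a3},{u,v2,a3}}. f \<subseteq> g"
        by (meson order_refl)
    qed
    finally show ?thesis .
  qed
  let ?V = "sel3 v2 v1 v3" and ?A = "sel3 a2 a1 a3"
  interpret m: oct_disk K h h' a2 a1 a3 v2 v1 v3 by (rule perms(1))
  have red: "reduction (cball 0 1 :: complex set) (sphere 0 1) K (complex_of ?G)"
  proof -
    have VA: "?V ` {1,2,3} \<union> ?A ` {1,2,3} = {a1,a2,a3,v1,v2,v3}" unfolding sel3_image by blast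
    have be: "{e \<in> boundary_edges K. e \<subseteq> ?V ` {1,2,3} \<union> ?A ` {1,2,3}} = {{a2,a1}}"
    proof (intro equalityI subsetI)
      fix e assume "e \<in> {e \<in> boundary_edges K. e \<subseteq> ?V ` {1,2,3} \<union> ?A ` {1,2,3}}"
      then have e: "e \<in> boundary_edges K" "e \<subseteq> {a1,a2,a3,v1,v2,v3}" unfolding VA by blast+
      then have "e \<inter> {v1,v2,v3} = {}" using inner by (auto simp: boundary_vertices_def)
      then have eT: "e \<subseteq> T" using e(2) by blast
      have "card e = 2" using e(1) by (simp add: boundary_edges_def)
      then obtain p q where pq: "e = {p,q}" "p \<noteq> q" by (auto simp: card_2_iff)
      then have "bd p q" using e(1) by (simp add: bd_def)
      then show "e \<in> {{a2,a1}}" using eT pq nb13 nb23 bd_sym by auto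
    qed (use b12 bd_sym in \<open>auto simp: VA bd_def\<close>)
    have "{y. adj K (?A 2) y} - (?V ` {1,2,3} \<union> ?A ` {1,2,3}) = {u}" unfolding VA using N1 u6 by auto
    then have "reduction (cball 0 1 :: complex set) (sphere 0 1) K (contract u (?A 2) {s\<in>K. \<not> {?A 1, ?A 2} \<subseteq> s})"
      by (intro R5[OF m.component]) (use be d1 in simp_all)
    then show ?thesis unfolding sel3_simps con .
  qed
  show False
  proof (rule no_reduction[OF red pl])
    fix w w' assume "adj (complex_of ?G) w w'"
    then obtain f where f: "f \<in> ?G" "w \<in> f" by (auto simp: adj_complex_of)
    let ?N = "{z. adj (complex_of ?G) w z}"
    have trG: "triples ?G" using pl by (simp add: pl_equiv_def)
    have fin: "finite ?N" by (rule finite_adj_complex_of[OF trG])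
    have wa1: "w \<noteq> a1" using f(1,2) n00(1)[of f] d7 by (elim UnE insertE emptyE) auto
    have sub: "nbrs w - {a1} \<subseteq> ?N"
    proof
      fix z assume z: "z \<in> nbrs w - {a1}"
      then have wz: "w \<noteq> z" using adj_irrefl by blast
      obtain g where g: "g \<in> faces K" "{w,z} \<subseteq> g" using tri_ex[of w z] tri_face z by blast
      have "\<exists>k\<in>?G. g - {a1} \<subseteq> k"
      proof (cases "g \<in> ?G")
        case False
        then have "g \<in> {{a1,a2,v3},{a1,a3,u},{a1,v2,v3},{a1,v2,a3}}"
          using g(1) unfolding fK H_def by (elim UnE insertE emptyE) simp_all
        then have "g - {a1} \<subseteq> {v1,a2,v3} \<or> g - {a1} \<subseteq> {u,v2,a3} \<or> g - {a1} \<subseteq> {v1,v2,v3}"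
          by (elim insertE emptyE) auto
        moreover have "{v1,a2,v3} \<in> ?G" "{u,v2,a3} \<in> ?G" "{v1,v2,v3} \<in> ?G" by simp_all
        ultimately show ?thesis by meson
      qed (meson Diff_subset)
      moreover have "{w,z} \<subseteq> g - {a1}" using g(2) wa1 z by blast
      ultimately show "z \<in> ?N" unfolding mem_Collect_eq adj_complex_of using wz by (meson subset_trans)
    qed
    then have le: "card (nbrs w - {a1}) \<le> card ?N" by (intro card_mono fin)
    have "\<exists>k\<in>faces K. w \<in> k"
    proof (cases "f \<in> faces K")
      case False
      then have "f \<in> {{u,v2,v3},{u,v2,a3}}" using f(1) unfolding fK H_def by (elim UnE insertE emptyE) simp_all
      then have "w \<in> {a1,a3,u} \<or> w \<in> {v1,v2,v3}" using f(2) by auto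
      moreover have "{a1,a3,u} \<in> faces K" "{v1,v2,v3} \<in> faces K" by (simp_all add: fK H_def)
      ultimately show ?thesis by meson
    qed (use f(2) in blast)
    then obtain k where k: "k \<in> faces K" "w \<in> k" by blast
    obtain w0 where w0: "adj K w w0" using face_at[OF k] tri_adj(1) by blast
    have d4: "4 \<le> card (nbrs w)" using mindeg[OF w0] by (simp add: deg)
    have inG: "adj (complex_of ?G) p q" if "g \<in> ?G" "{p,q} \<subseteq> g" "p \<noteq> q" for p q g
      using that unfolding adj_complex_of by meson
    have Rm: "{v1,v2,v3} \<in> ?G" "{u,v2,a3} \<in> ?G" "{v1,a2,v3} \<in> ?G" "{u,v2,v3} \<in> ?G" by simp_all
    have N2: "adj (complex_of ?G) v2 v1" "adj (complex_of ?G) v2 v3" "adj (complex_of ?G) v2 a3" "adj (complex_of ?G) v2 u"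
      using inG[OF Rm(1), of v2 v1] inG[OF Rm(1), of v2 v3] inG[OF Rm(2), of v2 a3] inG[OF Rm(2), of v2 u] d7 by auto
    have N3: "adj (complex_of ?G) v3 v1" "adj (complex_of ?G) v3 v2" "adj (complex_of ?G) v3 a2" "adj (complex_of ?G) v3 u"
      using inG[OF Rm(1), of v3 v1] inG[OF Rm(1), of v3 v2] inG[OF Rm(3), of v3 a2] inG[OF Rm(4), of v3 u] d7 by auto
    have Nu: "adj (complex_of ?G) u v2" using inG[OF Rm(4), of u v2] d7 by auto
    consider "w = v2" | "w = v3" | "w = u" | "w \<in> {a2,a3}" | "w \<notin> {a2,a3,v2,v3,u}" by blast
    then show "4 \<le> card ?N"
    proof cases
      case 1
      have "{v1,v3,a3,u} \<subseteq> ?N" unfolding 1 using N2 by (simp only: insert_subset mem_Collect_eq empty_subsetI simp_thms)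
      moreover have "card {v1,v3,a3,u} = 4" using d7 by auto
      ultimately show ?thesis using card_mono[OF fin] by metis
    next
      case 2
      have "{v1,v2,a2,u} \<subseteq> ?N" unfolding 2 using N3 by (simp only: insert_subset mem_Collect_eq empty_subsetI simp_thms)
      moreover have "card {v1,v2,a2,u} = 4" using d7 by auto
      ultimately show ?thesis using card_mono[OF fin] by metis
    next
      case 3
      have "insert v2 (nbrs w - {a1}) \<subseteq> ?N" using sub unfolding 3 using Nu by (simp only: insert_subset mem_Collect_eq)
      moreover have "v2 \<notin> nbrs w - {a1}" using Av(2)[of w] 3 d7 by auto
      moreover have "finite (nbrs w - {a1})" using finite_nbrs by blast
      ultimately have "card (nbrs w - {a1}) + 1 \<le> card ?N" using card_mono[OF fin, of "insert v2 (nbrs w - {a1})"] by simp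
      moreover have "card (nbrs w) - 1 \<le> card (nbrs w - {a1})" using diff_card_le_card_Diff[of "{a1}" "nbrs w"] by simp
      ultimately show ?thesis using d4 by linarith
    next
      case 4
      then have "5 \<le> card (nbrs w)" using d23 by (auto simp: deg)
      moreover have "card (nbrs w) - 1 \<le> card (nbrs w - {a1})" using diff_card_le_card_Diff[of "{a1}" "nbrs w"] by simp
      ultimately show ?thesis using le by linarith
    next
      case 5
      then have "\<not> adj K w a1" using N1 adj_sym by blast
      then have "nbrs w - {a1} = nbrs w" by blast
      then show ?thesis using le d4 by simp
    qed
  qed
qed

lemma deg5_impossible:
  assumes d1: "vdegree K a1 = 5" and d23: "5 \<le> vdegree K a2" "5 \<le> vdegree K a3" shows False
proof -
  interpret m: oct_disk K h h' a1 a3 a2 v1 v3 v2 by (rule perms(2))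
  have "card {a2,a3,v2,v3} = 4" using d6 by auto
  then have "\<not> nbrs a1 \<subseteq> {a2,a3,v2,v3}" using d1 card_mono[of "{a2,a3,v2,v3}" "nbrs a1"] by (auto simp: deg)
  then obtain u where u: "adj K a1 u" "u \<notin> {a2,a3,v2,v3}" by blast
  note N1 = deg_a1_nbr_x[OF d1 u]
  have u2: "u \<noteq> v2" "u \<noteq> v3" "u \<noteq> a1" using u adj_irrefl by blast+
  have nv: "\<not> adj K u v2" "\<not> adj K u v3" using Av(2,3)[of u] u u2 nbrs_a1(2) by auto
  have only: "w = a2 \<or> w = a3" if "adj K a1 w" "adj K u w" for w
    using that N1 nv adj_irrefl[of u] by blast
  show False
  proof (cases "tri a1 a3 u \<and> tri a1 a2 u")
    case True
    have "inner_vertex a1"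
    proof
      assume "a1 \<in> boundary_vertices K"
      then obtain y where y: "bd a1 y" using boundary_vertex_bd by blast
      then have "y \<in> {a2,a3,v2,v3,u}" using bd_adj N1 by blast
      moreover have "\<not> bd a1 a2" using bd_unique[of a1 a2 u v3] True tri_perm[OF t(7)] u2 by blast
      moreover have "\<not> bd a1 a3" using bd_unique[of a1 a3 u v2] True tri_perm[OF t(6)] u2 by blast
      moreover have "\<not> bd a1 u" using bd_unique[of a1 u a2 a3] True tri_perm(2) d6 by auto
      moreover have "\<not> bd a1 v2" "\<not> bd a1 v3" using y inner bd_boundary by blast+
      ultimately show False using y by blast
    qed
    moreover have "tri a1 u w" if "adj K a1 w" "adj K u w" for w
      using only[OF that] True tri_perm(2) by blast
    ultimately obtain w where w: "tri a1 u w" "vdegree K w = 4" using no_R1[OF u(1)] by blast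
    then have "w = a2 \<or> w = a3" using only tri_adj[OF w(1)] by blast
    then show False using w(2) d23 by auto
  next
    case False
    obtain w where w: "tri a1 u w" using tri_ex[OF u(1)] by blast
    then have "w = a2 \<or> w = a3" using only tri_adj[OF w(1)] by blast
    then consider "tri a1 a3 u" "\<not> tri a1 a2 u" | "tri a1 a2 u" "\<not> tri a1 a3 u" using False w tri_perm(2) by blast
    then show False
    proof cases
      case 1
      show False by (rule R5_impossible[OF d1 d23 1(1) u2(1) 1(2)])
    next
      case 2
      show False by (rule m.R5_impossible[OF d1 d23(2,1) 2(1) u2(2) 2(2)])
    qed
  qed
qed

end

context minimal_disk
begin

lemma is_octahedron: "is_octahedron_disk K"
proof -
  have external: "is_octahedron_disk K" if o: "oct_disk K h h' a1 a2 a3 v1 v2 v3" and d: "vdegree K a3 = 4" for a1 a2 a3 v1 v2 v3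
  proof -
    interpret m: oct_disk K h h' a1 a2 a3 v1 v2 v3 by (rule o)
    have "bd a1 a2" using m.no_external[OF d] by blast
    then show ?thesis using m.oct_disk_all_boundary bd_sym m.deg_a3_boundary[OF d] by blast
  qed
  obtain a1 a2 a3 v1 v2 v3 where "oct a1 a2 a3 v1 v2 v3" using oct_component_ex by blast
  then interpret m1: oct_disk K h h' a1 a2 a3 v1 v2 v3 by unfold_locales
  interpret m2: oct_disk K h h' a2 a1 a3 v2 v1 v3 by (rule m1.perms(1))
  interpret m3: oct_disk K h h' a1 a3 a2 v1 v3 v2 by (rule m1.perms(2))
  interpret m4: oct_disk K h h' a3 a1 a2 v3 v1 v2 by (rule m3.perms(1))
  interpret m5: oct_disk K h h' a2 a3 a1 v2 v3 v1 by (rule m2.perms(2))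
  have "4 \<le> vdegree K a1" "4 \<le> vdegree K a2" "4 \<le> vdegree K a3" using mindeg m1.aadj adj_sym by blast+
  then consider "vdegree K a1 = 4" | "vdegree K a2 = 4" | "vdegree K a3 = 4"
    | "5 \<le> vdegree K a1" "5 \<le> vdegree K a2" "5 \<le> vdegree K a3" by linarith
  then show ?thesis
  proof cases
    case 1
    show ?thesis by (rule external[OF m5.oct_disk_axioms 1])
  next
    case 2
    show ?thesis by (rule external[OF m3.oct_disk_axioms 2])
  next
    case 3
    show ?thesis by (rule external[OF m1.oct_disk_axioms 3])
  next
    case 4
    have "vdegree K a1 \<noteq> 5" "vdegree K a2 \<noteq> 5" "vdegree K a3 \<noteq> 5"
      using m1.deg5_impossible m2.deg5_impossible m4.deg5_impossible 4 by blast+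
    then have "6 \<le> vdegree K a1" "6 \<le> vdegree K a2" "6 \<le> vdegree K a3" using 4 by linarith+
    then show ?thesis using m1.no_R2 by blast
  qed
qed

end

subsection \<open>The octahedron is minimal\<close>

lemma homeomorphism_interior_image:
  fixes S :: "'a::euclidean_space set"
  assumes h: "homeomorphism S T h h'" and d: "DIM('a) = DIM('b)"
  shows "h ` interior S = interior (T :: 'b::euclidean_space set)"
proof -
  have *: "f ` interior X \<subseteq> interior Y" if "homeomorphism X Y f g" "DIM('x) \<ge> DIM('y)"
    for X :: "'x::euclidean_space set" and Y :: "'y::euclidean_space set" and f g
  proof (rule interior_maximal)
    have i: "inj_on f X" using that(1) by (metis homeomorphism_def inj_on_inverseI)
    show "f ` interior X \<subseteq> Y" using that(1) interior_subset by (fastforce simp: homeomorphism_def)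
    show "open (f ` interior X)"
      by (rule invariance_of_domain_gen)
        (use that i interior_subset in \<open>auto simp: homeomorphism_def intro: continuous_on_subset inj_on_subset\<close>)
  qed
  have 1: "h ` interior S \<subseteq> interior T" using *[OF h] d by simp
  have 2: "h' ` interior T \<subseteq> interior S" using *[OF homeomorphism_symD[OF h]] d by simp
  have "y \<in> h ` interior S" if y: "y \<in> interior T" for y
  proof -
    have "h (h' y) = y" using homeomorphism_apply2[OF h] y interior_subset by (meson subsetD)
    then show ?thesis using 2 y by (metis image_eqI image_subset_iff)
  qed
  then show ?thesis using 1 by blast
qed

lemma triangulates_triangle:
  assumes d: "distinct [p,q,r]"
  shows "triangulates (cball 0 1 :: complex set) (sphere 0 1) (complex_of {{p,q,r}})"
proof -
  let ?K = "complex_of {{p,q,r}}"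
  have tr: "triples {{p,q,r}}" using d by (auto simp: triples_def)
  have sum3: "(\<Sum>v | x v \<noteq> 0. x v) = x p + x q + x r" if "\<And>v. v \<notin> {p,q,r} \<Longrightarrow> x v = 0" for x :: "'a \<Rightarrow> real"
  proof -
    have "(\<Sum>v | x v \<noteq> 0. x v) = (\<Sum>v\<in>{p,q,r}. x v)" by (rule sum.mono_neutral_left) (use that in auto)
    then show ?thesis using d by simp
  qed
  have R: "x \<in> realization ?K \<longleftrightarrow> (\<forall>v. 0 \<le> x v) \<and> (\<forall>v. v \<notin> {p,q,r} \<longrightarrow> x v = 0) \<and> x p + x q + x r = 1" (is "?l \<longleftrightarrow> ?r")
    for x :: "'a \<Rightarrow> real"
  proof
    assume l: ?l
    then have z: "\<forall>v. v \<notin> {p,q,r} \<longrightarrow> x v = 0" by (auto simp: realization_def complex_of_def)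
    then show ?r using l sum3[of x] by (auto simp: realization_def)
  next
    assume r: ?r
    then have "x p \<noteq> 0 \<or> x q \<noteq> 0 \<or> x r \<noteq> 0" by linarith
    then have "{v. x v \<noteq> 0} \<noteq> {}" by blast
    moreover have "{v. x v \<noteq> 0} \<subseteq> {p,q,r}" using r by blast
    ultimately show ?l using r sum3[of x] by (auto simp: realization_def complex_of_def)
  qed
  have be: "boundary_edges ?K = {e. card e = 2 \<and> e \<subseteq> {p,q,r}}"
  proof -
    have "card {f\<in>{{p,q,r}}. e \<subseteq> f} = 1 \<longleftrightarrow> e \<subseteq> {p,q,r}" for e by (simp add: Collect_conv_if)
    then show ?thesis unfolding boundary_edges_complex_of[OF tr] by simp
  qed
  have bc: "s \<in> boundary_complex ?K \<longleftrightarrow> s \<in> ?K \<and> s \<noteq> {p,q,r}" for s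
  proof
    assume "s \<in> boundary_complex ?K"
    then obtain e where e: "s \<noteq> {}" "card e = 2" "e \<subseteq> {p,q,r}" "s \<subseteq> e" unfolding boundary_complex_def be by auto
    then have "finite e" using card.infinite by force
    then have "card s \<le> 2" using e card_mono by metis
    then have "s \<noteq> {p,q,r}" using d by auto
    then show "s \<in> ?K \<and> s \<noteq> {p,q,r}" using e by (auto simp: complex_of_def)
  next
    assume s: "s \<in> ?K \<and> s \<noteq> {p,q,r}"
    then have "s \<subseteq> {p,q} \<or> s \<subseteq> {q,r} \<or> s \<subseteq> {p,r}" by (auto simp: complex_of_def)
    moreover have "{p,q} \<in> boundary_edges ?K" "{q,r} \<in> boundary_edges ?K" "{p,r} \<in> boundary_edges ?K"
      unfolding be using d by auto
    ultimately show "s \<in> boundary_complex ?K" using s unfolding boundary_complex_def by (auto simp: complex_of_def)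
  qed
  have B: "x \<in> realization (boundary_complex ?K) \<longleftrightarrow> x \<in> realization ?K \<and> (x p = 0 \<or> x q = 0 \<or> x r = 0)" for x :: "'a \<Rightarrow> real"
  proof -
    have "x \<in> realization (boundary_complex ?K) \<longleftrightarrow> x \<in> realization ?K \<and> {v. x v \<noteq> 0} \<noteq> {p,q,r}"
      unfolding realization_def using bc by auto
    moreover have "{v. x v \<noteq> 0} \<noteq> {p,q,r} \<longleftrightarrow> (x p = 0 \<or> x q = 0 \<or> x r = 0)" if "x \<in> realization ?K"
      using that unfolding R by auto
    ultimately show ?thesis by blast
  qed
  define S where "S = {z::complex. (-1) \<bullet> z \<le> 0} \<inter> {z. (-\<i>) \<bullet> z \<le> 0} \<inter> {z. (1+\<i>) \<bullet> z \<le> 1}"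
  have S: "z \<in> S \<longleftrightarrow> 0 \<le> Re z \<and> 0 \<le> Im z \<and> Re z + Im z \<le> 1" for z by (auto simp: S_def inner_complex_def)
  have nz: "(-1::complex) \<noteq> 0" "-\<i> \<noteq> 0" "1+\<i> \<noteq> 0" by (auto simp: complex_eq_iff)
  have iS: "z \<in> interior S \<longleftrightarrow> 0 < Re z \<and> 0 < Im z \<and> Re z + Im z < 1" for z
    unfolding S_def interior_Int interior_halfspace_le[OF nz(1)] interior_halfspace_le[OF nz(2)] interior_halfspace_le[OF nz(3)]
    by (auto simp: inner_complex_def)
  define g where "g x = Complex (x q) (x r)" for x :: "'a \<Rightarrow> real"
  define g' where "g' z = (\<lambda>v. if v = p then 1 - Re z - Im z else if v = q then Re z else if v = r then Im z else 0)"
    for z :: complex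
  have hom: "homeomorphism (realization ?K) S g g'"
  proof (rule homeomorphismI)
    show "continuous_on (realization ?K) g" unfolding g_def
      by (intro continuous_intros continuous_on_subset[OF continuous_on_product_coordinates]) auto
    show "continuous_on S g'" unfolding g'_def
      by (intro continuous_on_coordinatewise_then_product continuous_on_const_if continuous_intros)
    show "g ` realization ?K \<subseteq> S"
    proof
      fix z assume "z \<in> g ` realization ?K"
      then obtain x where x: "x \<in> realization ?K" "z = g x" by blast
      then have "0 \<le> x p" "0 \<le> x q" "0 \<le> x r" "x p + x q + x r = 1" unfolding R by auto
      then show "z \<in> S" unfolding S x(2) g_def by simp
    qed
    show "g' ` S \<subseteq> realization ?K"
    proof
      fix x assume "x \<in> g' ` S"
      then obtain z where z: "z \<in> S" "x = g' z" by blast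
      then show "x \<in> realization ?K" using d unfolding R S g'_def by auto
    qed
    show "g' (g x) = x" if "x \<in> realization ?K" for x
    proof
      fix v
      have "x p = 1 - x q - x r" using that unfolding R by auto
      then show "g' (g x) v = x v" using that d unfolding R g'_def g_def by auto
    qed
    show "g (g' z) = z" if "z \<in> S" for z using d by (auto simp: g_def g'_def)
  qed
  have gB: "g ` realization (boundary_complex ?K) = S - interior S"
  proof (intro equalityI subsetI)
    fix z assume "z \<in> g ` realization (boundary_complex ?K)"
    then obtain x where x: "x \<in> realization ?K" "x p = 0 \<or> x q = 0 \<or> x r = 0" "z = g x" using B by blast
    then have "z \<in> S" using hom by (auto simp: homeomorphism_def)
    moreover have "x p + x q + x r = 1" using x(1) unfolding R by blast
    ultimately show "z \<in> S - interior S" using x(2) unfolding Diff_iff iS x(3) g_def by auto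
  next
    fix z assume z: "z \<in> S - interior S"
    then have "g' z \<in> realization ?K" "g (g' z) = z" using hom by (auto simp: homeomorphism_def)
    moreover have "g' z p = 0 \<or> g' z q = 0 \<or> g' z r = 0" using z d unfolding Diff_iff iS S g'_def by auto
    ultimately show "z \<in> g ` realization (boundary_complex ?K)" using B by (metis imageI)
  qed
  have "S homeomorphic (cball 0 1 :: complex set)"
  proof (rule homeomorphic_convex_compact_cball)
    show "convex S" unfolding S_def by (intro convex_Int convex_halfspace_le)
    have "bounded S"
    proof (rule boundedI)
      fix z assume "z \<in> S"
      then have "\<bar>Re z\<bar> + \<bar>Im z\<bar> \<le> 1" unfolding S by auto
      then show "norm z \<le> 1" using cmod_le[of z] by linarith
    qed
    moreover have "closed S" unfolding S_def by (intro closed_Int closed_halfspace_le)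
    ultimately show "compact S" by (simp add: compact_eq_bounded_closed)
    have "Complex (1/4) (1/4) \<in> interior S" unfolding iS by simp
    then show "interior S \<noteq> {}" by blast
  qed simp
  then obtain k k' where k: "homeomorphism S (cball 0 1 :: complex set) k k'" unfolding homeomorphic_def by blast
  have "k ` (S - interior S) = cball 0 1 - ball 0 1"
  proof -
    have "inj_on k S" by (rule inj_on_inverseI[of _ k']) (use k in \<open>simp add: homeomorphism_def\<close>)
    then have "k ` (S - interior S) = k ` S - k ` interior S"
      by (rule inj_on_image_set_diff) (use interior_subset in auto)
    then have "k ` (S - interior S) = cball 0 1 - k ` interior S" using homeomorphism_image1[OF k] by simp
    then show ?thesis using homeomorphism_interior_image[OF k] by simp
  qed
  also have "cball 0 1 - ball 0 1 = (sphere 0 1 :: complex set)" by (rule cball_diff_eq_sphere)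
  finally have "(k \<circ> g) ` realization (boundary_complex ?K) = sphere 0 1" unfolding image_comp[symmetric] gB .
  moreover have "homeomorphism (realization ?K) (cball 0 1) (k \<circ> g) (g' \<circ> k')"
    by (rule homeomorphism_compose[OF hom k])
  ultimately show ?thesis unfolding triangulates_def using pure_complex_of[OF tr] by blast
qed

lemma F4_many_vertices:
  assumes "F4 (cball 0 1 :: complex set) (sphere 0 1) K" shows "5 \<le> card (vertices K)"
proof -
  obtain h h' where p: "pure_2_complex K" "homeomorphism (realization K) (cball 0 1 :: complex set) h h'"
    and d: "\<And>x. x \<in> vertices K \<Longrightarrow> 4 \<le> vdegree K x"
    using assms unfolding F4_def triangulates_def by blast
  have "0 \<in> cball (0::complex) 1" by simp
  then have "realization K \<noteq> {}" using p(2) unfolding homeomorphism_def by blast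
  then obtain s where s: "s \<in> K" unfolding realization_def by blast
  have sub: "t \<in> K" if "s \<in> K" "t \<subseteq> s" "t \<noteq> {}" for s t using p(1) that unfolding pure_2_complex_def by blast
  have "s \<noteq> {}" using s p(1) unfolding pure_2_complex_def by blast
  then obtain x where "x \<in> s" by blast
  then have x: "x \<in> vertices K" using sub[OF s, of "{x}"] by (simp add: vertices_def)
  have fin: "finite (vertices K)"
  proof -
    have "finite K" using p(1) unfolding pure_2_complex_def by blast
    moreover have "(\<lambda>x. {x}) ` vertices K \<subseteq> K" by (auto simp: vertices_def)
    ultimately have "finite ((\<lambda>x. {x}) ` vertices K)" using finite_subset by blast
    then show ?thesis by (rule finite_imageD) (auto intro: inj_onI)
  qed
  have "{y. adj K x y} \<subseteq> vertices K - {x}"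
  proof
    fix y assume y: "y \<in> {y. adj K x y}"
    then show "y \<in> vertices K - {x}" using sub[of "{x,y}" "{y}"] by (auto simp: adj_def vertices_def)
  qed
  then have "card {y. adj K x y} \<le> card (vertices K - {x})" by (rule card_mono[rotated]) (use fin in simp)
  then have "4 \<le> card (vertices K - {x})" using d[OF x] unfolding vdegree_def by linarith
  then show ?thesis using x fin by simp
qed

lemma octahedral_frame_vertices:
  assumes fr: "octahedral_frame K v a" and sub: "\<And>s t. s \<in> K \<Longrightarrow> t \<subseteq> s \<Longrightarrow> t \<noteq> {} \<Longrightarrow> t \<in> K"
  shows "v ` {1,2,3} \<subseteq> vertices K" "card (v ` {1,2,3}) = 3"
    "a ` {1,2,3} \<subseteq> vertices K" "card (v ` {1,2,3} \<union> a ` {1,2,3}) = 6"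
proof -
  have inj: "inj_on a {1,2,3::nat}" "inj_on v {1,2,3::nat}" and cy: "cycle3 (v 1) (v 2) (v 3) \<subseteq> K"
    using fr unfolding octahedral_frame_def by simp_all
  have ai: "a i \<notin> v ` {1,2,3} \<and> adj K (a i) (v j)" if "{i,j,k} = {1,2,3}" for i j k
  proof -
    have "{w. w \<notin> v ` {1,2,3} \<and> adj K w (v j) \<and> adj K w (v k)} = {a i}"
      using fr that unfolding octahedral_frame_def by meson
    then show ?thesis by blast
  qed
  have e: "{v 1, v 2} \<in> K" "{v 2, v 3} \<in> K" using cy by (simp_all add: cycle3_def)
  show "v ` {1,2,3} \<subseteq> vertices K" using sub[OF e(1)] sub[OF e(2)] by (simp add: vertices_def)
  show 3: "card (v ` {1,2,3}) = 3" using card_image[OF inj(2)] by simp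
  have "a 1 \<notin> v ` {1,2,3} \<and> adj K (a 1) (v 2)" by (rule ai[of 1 2 3]) simp
  moreover have "a 2 \<notin> v ` {1,2,3} \<and> adj K (a 2) (v 1)" by (rule ai[of 2 1 3]) auto
  moreover have "a 3 \<notin> v ` {1,2,3} \<and> adj K (a 3) (v 1)" by (rule ai[of 3 1 2]) auto
  ultimately have a: "a i \<notin> v ` {1,2,3} \<and> (\<exists>w. adj K (a i) w)" if "i \<in> {1,2,3}" for i using that by blast
  have "adj K x w \<Longrightarrow> x \<in> vertices K" for x w using sub[of "{x,w}" "{x}"] by (auto simp: adj_def vertices_def)
  then show "a ` {1,2,3} \<subseteq> vertices K" using a by blast
  have "v ` {1,2,3} \<inter> a ` {1,2,3} = {}"
  proof (rule equals0I, elim IntE, elim imageE)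
    fix x i j assume "x = v i" "i \<in> {1,2,3}" "x = a j" "j \<in> {1,2,3::nat}"
    then show False using a[of j] by (metis imageI)
  qed
  moreover have "card (a ` {1,2,3}) = 3" using card_image[OF inj(1)] by simp
  ultimately show "card (v ` {1,2,3} \<union> a ` {1,2,3}) = 6" using 3 by (subst card_Un_disjoint) auto
qed

lemma vertices_contract:
  assumes "x \<noteq> y" "x \<in> vertices K" shows "vertices (contract x y K) \<subseteq> vertices K - {y}"
proof
  fix u assume "u \<in> vertices (contract x y K)"
  then obtain s where s: "s \<in> K" "(id(y := x)) ` s = {u}" by (auto simp: vertices_def contract_def)
  show "u \<in> vertices K - {y}"
  proof (cases "u = x")
    case False
    have eq: "w = u \<and> w \<noteq> y" if "w \<in> s" for w
    proof -
      have "(id(y := x)) w = u" using that s(2) by blast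
      then show ?thesis using False by (auto split: if_splits)
    qed
    moreover have "s \<noteq> {}" using s(2) by blast
    ultimately have "s = {u}" "u \<noteq> y" by blast+
    then show ?thesis using s(1) by (simp add: vertices_def)
  qed (use assms in simp)
qed

lemma octahedron_adj:
  assumes d: "distinct [v1,v2,v3,a1,a2,a3]"
  shows "adj (complex_of (octahedron_faces v1 v2 v3 a1 a2 a3)) x y \<longleftrightarrow> x \<noteq> y \<and>
    x \<in> {v1,v2,v3,a1,a2,a3} \<and> y \<in> {v1,v2,v3,a1,a2,a3} \<and>
    \<not> (x \<in> {v1,a1} \<and> y \<in> {v1,a1}) \<and> \<not> (x \<in> {v2,a2} \<and> y \<in> {v2,a2}) \<and> \<not> (x \<in> {v3,a3} \<and> y \<in> {v3,a3})"
  using d unfolding adj_complex_of octahedron_faces_def by auto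

lemma octahedron_vertices: "vertices (complex_of (octahedron_faces v1 v2 v3 a1 a2 a3)) = {v1,v2,v3,a1,a2,a3}"
  by (auto simp: vertices_def complex_of_def octahedron_faces_def)

lemma octahedron_F4:
  assumes d: "distinct [v1,v2,v3,a1,a2,a3]"
  shows "F4 (cball 0 1 :: complex set) (sphere 0 1) (complex_of (octahedron_faces v1 v2 v3 a1 a2 a3))"
proof -
  let ?O = "octahedron_faces v1 v2 v3 a1 a2 a3"
  have "pl_equiv {{a1,a2,a3}} ({} \<union> ?O)"
    by (rule pl_equiv_insert_octahedron) (use d in \<open>auto simp: triples_def\<close>)
  then have pl: "pl_equiv {{a1,a2,a3}} ?O" by simp
  then have tr: "triples ?O" by (simp add: pl_equiv_def)
  have "triangulates (cball 0 1 :: complex set) (sphere 0 1) (complex_of ?O)"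
    using triangulates_triangle[of a1 a2 a3] triangulates_pl_equiv[OF pl] d by auto
  moreover have "4 \<le> vdegree (complex_of ?O) x" if x: "x \<in> {v1,v2,v3,a1,a2,a3}" for x
  proof -
    have fin: "finite {y. adj (complex_of ?O) x y}" by (rule finite_adj_complex_of[OF tr])
    have four: "4 \<le> vdegree (complex_of ?O) x" if "A \<subseteq> {y. adj (complex_of ?O) x y}" "card A = 4" for A
      using card_mono[OF fin that(1)] that(2) by (simp add: vdegree_def)
    consider "x \<in> {v1,a1}" | "x \<in> {v2,a2}" | "x \<in> {v3,a3}" using x by blast
    then show ?thesis
    proof cases
      case 1
      show ?thesis by (rule four[of "{v2,v3,a2,a3}"]) (use 1 d in \<open>auto simp: octahedron_adj[OF d]\<close>)
    next
      case 2
      show ?thesis by (rule four[of "{v1,v3,a1,a3}"]) (use 2 d in \<open>auto simp: octahedron_adj[OF d]\<close>)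
    next
      case 3
      show ?thesis by (rule four[of "{v1,v2,a1,a2}"]) (use 3 d in \<open>auto simp: octahedron_adj[OF d]\<close>)
    qed
  qed
  ultimately show ?thesis unfolding F4_def octahedron_vertices by blast
qed

lemma octahedron_four_minimal:
  assumes d: "distinct [v1,v2,v3,a1,a2,a3]"
  shows "four_minimal (cball 0 1 :: complex set) (sphere 0 1) (complex_of (octahedron_faces v1 v2 v3 a1 a2 a3))"
  unfolding four_minimal_def four_reduction_def
proof (intro notI, elim exE conjE)
  define K where "K = complex_of (octahedron_faces v1 v2 v3 a1 a2 a3)"
  define X where "X = {v1,v2,v3,a1,a2,a3}"
  fix K' assume red: "reduction (cball 0 1 :: complex set) (sphere 0 1) (complex_of (octahedron_faces v1 v2 v3 a1 a2 a3)) K'"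
    and F4: "F4 (cball 0 1 :: complex set) (sphere 0 1) K'"
  have X: "card X = 6" "finite X" "vertices K = X" using d by (auto simp: X_def K_def octahedron_vertices)
  have sub: "t \<in> K" if "s \<in> K" "t \<subseteq> s" "t \<noteq> {}" for s t using that unfolding K_def complex_of_def by blast
  have small: False if "vertices K' \<subseteq> W" "card W \<le> 4" "W \<subseteq> X" for W
    using F4_many_vertices[OF F4] card_mono[OF finite_subset[OF that(3) X(2)] that(1)] that(2) by linarith
  have frame: "card (X - v ` {1,2,3}) = 3" "v ` {1,2,3} \<subseteq> X" "a ` {1,2,3} \<subseteq> X" "v ` {1,2,3} \<union> a ` {1,2,3} = X"
    if "octahedral_frame K v a" for v a :: "nat \<Rightarrow> 'a"
  proof -
    have f: "v ` {1,2,3} \<subseteq> X" "card (v ` {1,2,3}) = 3" "a ` {1,2,3} \<subseteq> X" "card (v ` {1,2,3} \<union> a ` {1,2,3}) = 6"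
      unfolding X(3)[symmetric] using octahedral_frame_vertices[OF that] sub by (simp_all del: image_insert)
    show "v ` {1,2,3} \<subseteq> X" "a ` {1,2,3} \<subseteq> X" by (fact f(1), fact f(3))
    have "card (X - v ` {1,2,3}) = card X - card (v ` {1,2,3})" by (rule card_Diff_subset) (use f(1) in auto)
    then show "card (X - v ` {1,2,3}) = 3" unfolding f(2) X(1) by simp
    show "v ` {1,2,3} \<union> a ` {1,2,3} = X"
      by (rule card_subset_eq[OF X(2)]) (use f X(1) in auto)
  qed
  have del: "vertices (delete_vertices Y K) = X - Y" for Y by (auto simp: vertices_def delete_vertices_def X(3)[symmetric])
  from red[folded K_def] show False
  proof cases
    case (R1 x y)
    have xy: "x \<in> X" "y \<in> X" "x \<noteq> y" using R1(2) unfolding K_def X_def octahedron_adj[OF d] by blast+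
    have "\<exists>z z'. z \<noteq> z' \<and> {z,z'} \<subseteq> X - {x,y} \<and> \<not> adj K z z'"
    proof -
      have "{x,y} \<inter> {v1,a1} = {} \<or> {x,y} \<inter> {v2,a2} = {} \<or> {x,y} \<inter> {v3,a3} = {}"
        using R1(2) d unfolding K_def octahedron_adj[OF d] by auto
      moreover have "\<not> adj K v1 a1" "\<not> adj K v2 a2" "\<not> adj K v3 a3" unfolding K_def octahedron_adj[OF d] by auto
      moreover have "v1 \<noteq> a1" "v2 \<noteq> a2" "v3 \<noteq> a3" using d by auto
      moreover have "{v1,a1} \<subseteq> X" "{v2,a2} \<subseteq> X" "{v3,a3} \<subseteq> X" by (auto simp: X_def)
      moreover have ?thesis if "{x,y} \<inter> {p,q} = {}" "\<not> adj K p q" "p \<noteq> q" "{p,q} \<subseteq> X" for p q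
        by (intro exI[of _ p] exI[of _ q]) (use that in auto)
      ultimately show ?thesis by (elim disjE)
    qed
    then obtain z z' where z: "z \<noteq> z'" "{z,z'} \<subseteq> X - {x,y}" "\<not> adj K z z'" by blast
    have vs: "vertices K' \<subseteq> X - {y}" unfolding R1(1) using vertices_contract[of x y K] xy X(3) by blast
    have z': "z \<in> vertices K'"
    proof -
      have "{z} \<in> K" using z(2) X(3) by (auto simp: vertices_def)
      moreover have "(id(y := x)) ` {z} = {z}" using z(2) by auto
      ultimately show ?thesis unfolding R1(1) vertices_def contract_def by (metis image_eqI mem_Collect_eq)
    qed
    have "{u. adj K' z u} \<subseteq> X - {y,z,z'}"
    proof
      fix u assume u: "u \<in> {u. adj K' z u}"
      then obtain s where s: "s \<in> K" "(id(y := x)) ` s = {z,u}" "z \<noteq> u" by (auto simp: adj_def R1(1) contract_def)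
      have "pure_2_complex K'" using F4 by (simp add: F4_def triangulates_def)
      then have "s \<in> K' \<Longrightarrow> t \<noteq> {} \<Longrightarrow> t \<subseteq> s \<Longrightarrow> t \<in> K'" for s t unfolding pure_2_complex_def by simp
      from this[of "{z,u}" "{u}"] have "{u} \<in> K'" using u unfolding adj_def by simp
      then have "u \<in> X - {y}" using vs by (auto simp: vertices_def)
      moreover have "u \<noteq> z'"
      proof
        assume "u = z'"
        then have "z \<in> (id(y := x)) ` s" "z' \<in> (id(y := x)) ` s" using s(2) by blast+
        then have "{z,z'} \<subseteq> s" using z(2) by (auto split: if_splits)
        then show False using z(1,3) sub[OF s(1)] by (simp add: adj_def)
      qed
      ultimately show "u \<in> X - {y,z,z'}" using s(3) by blast
    qed
    then have "vdegree K' z \<le> card (X - {y,z,z'})" unfolding vdegree_def by (rule card_mono[rotated]) (use X in simp)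
    also have "\<dots> = card X - card {y,z,z'}" using xy z(2) by (intro card_Diff_subset) auto
    also have "\<dots> = 3" using X(1) z(1,2) by auto
    finally show False using F4 z' unfolding F4_def by fastforce
  next
    case (R2 v a)
    have fr: "octahedral_frame K v a" using R2(2) by (simp add: octahedron_component_def)
    then have "inj_on a {1,2,3}" by (simp add: octahedral_frame_def)
    then have "a 1 \<noteq> a 2" by (auto simp: inj_on_def)
    then have "vertices K' \<subseteq> vertices (delete_vertices (v ` {1,2,3}) K)"
      unfolding R2(1) by (auto simp: vertices_def split: if_splits)
    then show False using small[of "X - v ` {1,2,3}"] frame(1)[OF fr] unfolding del by auto
  next
    case (R2_external v a i j k)
    have fr: "octahedral_frame K v a" using R2_external(2) by (simp add: octahedron_component_def)
    have "vertices K' \<subseteq> X - v ` {1,2,3}" unfolding R2_external(1) del by blast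
    then show False using small[of "X - v ` {1,2,3}"] frame(1)[OF fr] by auto
  next
    case (R3 v a x w)
    have fr: "octahedral_frame K v a" using R3(2) by (simp add: octahedron_component_def)
    have f: "{a 1, a 2, x} \<in> K" "card {a 1, a 2, x} = 3" using R3(7) by (simp_all add: faces_def)
    then have "{x} \<in> K" using sub by blast
    then have "x \<in> X" using X(3) by (auto simp: vertices_def)
    then have "x \<in> {a 1, a 2, a 3} \<union> v ` {1,2,3}" using frame(4)[OF fr] by auto
    moreover have "x \<noteq> a 1" "x \<noteq> a 2" using f(2) by (auto simp: card_insert_if split: if_splits)
    ultimately show False using R3(8) by blast
  next
    case (R4_delete v a)
    have fr: "octahedral_frame K v a" using R4_delete(2) by (simp add: quasi_octahedron_component_def)
    have "vertices K' \<subseteq> X - v ` {1,2,3}" unfolding R4_delete(1) del by blast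
    then show False using small[of "X - v ` {1,2,3}"] frame(1)[OF fr] by auto
  next
    case (R4_contract v a i j k)
    have fr: "octahedral_frame K v a" using R4_contract(2) by (simp add: quasi_octahedron_component_def)
    then have "inj_on a {1,2,3}" by (simp add: octahedral_frame_def)
    then have ne: "a 1 \<noteq> a 2" by (auto simp: inj_on_def)
    have "i \<in> {1,2,3}" "j \<in> {1,2,3}" "k \<in> {1,2,3}" using R4_contract(3) by auto
    let ?W = "insert (a i) (X - v ` {1,2,3})"
    have V: "v ` {1,2,3} = {v i, v j, v k}" using R4_contract(3) by (metis image_insert image_empty)
    have "vertices K' \<subseteq> ?W"
    proof
      fix u assume "u \<in> vertices K'"
      then have "{u} \<in> contract (a i) (v k) (delete_vertices {v i, v j} K)"
        unfolding R4_contract(1) vertices_def using ne by auto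
      then obtain s where s: "s \<in> K" "s \<inter> {v i, v j} = {}" "{u} = (id(v k := a i)) ` s"
        by (auto simp: contract_def delete_vertices_def)
      show "u \<in> ?W"
      proof (cases "u = a i")
        case False
        have "x = u \<and> x \<noteq> v k" if "x \<in> s" for x
        proof -
          have "(id(v k := a i)) x = u" using that s(3) by blast
          then show ?thesis using False by (auto split: if_splits)
        qed
        moreover have "s \<noteq> {}" using s(3) by blast
        ultimately have "s = {u}" "u \<noteq> v k" by blast+
        then show ?thesis using s(1,2) X(3) unfolding V by (auto simp: vertices_def)
      qed simp
    qed
    moreover have "card ?W \<le> 4" using frame(1)[OF fr] card_insert_le_m1[of 4 "X - v ` {1,2,3}" "a i"] by simp
    moreover have "?W \<subseteq> X" using frame(3)[OF fr] \<open>i \<in> {1,2,3}\<close> by blast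
    ultimately show False by (rule small)
  next
    case (R5 v a x)
    have fr: "octahedral_frame K v a" using R5(2) by (simp add: octahedron_component_def)
    have "adj K (a 2) x" "x \<notin> v ` {1,2,3} \<union> a ` {1,2,3}" using R5(5) by blast+
    moreover have "x \<in> X" if "adj K y x" for y using that unfolding K_def X_def octahedron_adj[OF d] by blast
    ultimately show False using frame(4)[OF fr] by blast
  next
    case (R6 x z y u)
    have f: "{x,z,y} \<in> K" "card {x,z,y} = 3" "{x,z,u} \<in> K" "card {x,z,u} = 3" using R6(2,3) by (simp_all add: faces_def)
    have ne: "x \<noteq> y" "x \<noteq> u" "z \<noteq> u" "y \<noteq> u" using f(2,4) R6(4) by (auto simp: card_insert_if split: if_splits)
    have "{x} \<in> K" "{y} \<in> K" "{z} \<in> K" "{u} \<in> K" using sub[OF f(1)] sub[OF f(3)] by simp_all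
    then have in_X: "x \<in> X" "y \<in> X" "z \<in> X" "u \<in> X" using X(3) by (auto simp: vertices_def)
    have 1: "vertices (contract z u K) \<subseteq> X - {u}" using vertices_contract[of z u K] ne in_X X(3) by blast
    have "{x} \<in> contract z u K"
    proof -
      have "(id(u := z)) ` {x} = {x}" using ne by simp
      then show ?thesis unfolding contract_def using \<open>{x} \<in> K\<close> by (metis image_eqI)
    qed
    then have "vertices (contract x y (contract z u K)) \<subseteq> vertices (contract z u K) - {y}"
      by (intro vertices_contract ne) (simp add: vertices_def)
    then have "vertices K' \<subseteq> X - {u,y}" unfolding R6(1) using 1 by blast
    moreover have "card (X - {u,y}) \<le> 4" using in_X X(1) ne by (simp add: card_Diff_subset)
    ultimately show False using small[of "X - {u,y}"] by blast
  qed
qed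

theorem theorem5:
  fixes K :: "'v set set"
  shows "(F4 (cball 0 1 :: complex set) (sphere 0 1) K \<and>
          four_minimal (cball 0 1 :: complex set) (sphere 0 1) K)
         \<longleftrightarrow> is_octahedron_disk K"
proof
  assume m: "F4 (cball 0 1 :: complex set) (sphere 0 1) K \<and> four_minimal (cball 0 1 :: complex set) (sphere 0 1) K"
  then obtain h h' where h: "pure_2_complex K" "homeomorphism (realization K) (cball 0 1 :: complex set) h h'"
      "h ` realization (boundary_complex K) = sphere 0 1"
    and deg4: "\<And>x. x \<in> vertices K \<Longrightarrow> 4 \<le> vdegree K x"
    unfolding F4_def triangulates_def by blast
  interpret disk_triangulation K h h' by unfold_locales (fact h)+
  interpret minimal_disk K h h' by unfold_locales (use m deg4 adj_vertices(1) in blast)+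
  show "is_octahedron_disk K" by (rule is_octahedron)
next
  assume "is_octahedron_disk K"
  then obtain v a :: "nat \<Rightarrow> 'v" where va: "inj_on v {1,2,3}" "inj_on a {1,2,3}" "v ` {1,2,3} \<inter> a ` {1,2,3} = {}"
    and K: "K = octahedron_disk v a" unfolding is_octahedron_disk_def by blast
  have d: "distinct [v 1, v 2, v 3, a 1, a 2, a 3]" using va by (auto simp: inj_on_def)
  show "F4 (cball 0 1 :: complex set) (sphere 0 1) K \<and> four_minimal (cball 0 1 :: complex set) (sphere 0 1) K"
    unfolding K octahedron_disk_eq[OF d] using octahedron_F4[OF d] octahedron_four_minimal[OF d] by blast
qed

end
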